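(* Let $X$ be a simplicial complex on $[n]$ with Stanley-Reisner ring $A_X$, and let $\mathbf c=\mathbf a-\mathbf b$ with $\mathbf a,\mathbf b\in\mathbb N^{n+1}$ having disjoint supports $a$ and $b$. The homogeneous pieces $T^i_{\mathbf c}(X)$ ($i=1,2$) of the cotangent cohomology of $A_X$ vanish unless $a\in X$, $\mathbf b\in\{0,1\}^{n+1}$ (i.e. $\mathbf b=b$) and $b\neq\emptyset$. If these conditions are satisfied, there are isomorphisms $$T^i_{\mathbf c}(X)\;\simeq\;H^{i-1}\big(\langle U_b(\mathrm{lk}(a,X))\rangle,\ \langle\widetilde U_b(\mathrm{lk}(a,X))\rangle,\ \mathbb C\big)\quad\text{for } i=1,2,$$ unless $b$ consists of a single vertex. If $b$ consists of only one vertex, then these formulae become true if reduced cohomology is used instead.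
   Context: Let $[n]=\{0,\dots,n\}$ and $P=\mathbb C[x_0,\dots,x_n]$. A simplicial complex $X$ on $[n]$ is a family of subsets of $[n]$ closed under taking subsets, with $\emptyset\in X$ (elements of $[n]$ need not be vertices of $X$). A subset $p\subseteq[n]$ is identified with its characteristic vector in $\{0,1\}^{n+1}$; the support of $\mathbf p\in\mathbb N^{n+1}$ is $\{i:\mathbf p_i\neq0\}$. Put $I_X=\langle \mathbf x^p : p\subseteq[n],\,p\notin X\rangle$ and $A_X=P/I_X$. For $A=P/I$: $T^1_A$ is the cokernel of the natural map $\mathrm{Der}_{\mathbb C}(P,P)\to\mathrm{Hom}_P(I,A)$. If $0\to R\to P^m\xrightarrow{j}P\to A\to0$ is exact and $R_0=\langle j(f)e-j(e)f : e,f\in P^m\rangle\subseteq R$, then $T^2_A$ is the cokernel of the induced map $\mathrm{Hom}_P(P^m,A)\to\mathrm{Hom}_A(R/R_0,A)$. For $A=A_X$ these modules are $\mathbb Z^{n+1}$-graded ($\deg x_i$ is the $i$-th unit vector), and $T^i_{\mathbf c}(X)$ is the degree $\mathbf c$ part of $T^i_{A_X}$. Link: $\mathrm{lk}(a,X)=\{g\in X : g\cap a=\emptyset,\ g\cup a\in X\}$ for $a\in X$. For a complex $Y$ on $[n]$ and $b\subseteq[n]$: $U_b(Y)=\{f\in Y : f\cup b\notin Y\}$, and $\widetilde U_b(Y)=\{f\in Y : (f\cup b)\setminus\{v\}\notin Y\text{ for some }v\in b\}$. Geometric realization: $|Y|=\{\alpha:[n]\to[0,1] : \{i:\alpha(i)\ne0\}\in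 Y,\ \sum_i\alpha(i)=1\}$; for $\emptyset\neq f\in Y$, $\langle f\rangle=\{\alpha\in|Y| : \alpha(i)\neq0\Leftrightarrow i\in f\}$. For any subset $Z\subseteq Y$, $\langle Z\rangle=\bigcup_{f\in Z}\langle f\rangle$ if $\emptyset\notin Z$, and $\langle Z\rangle=\mathrm{cone}\big(\bigcup_{\emptyset\ne f\in Z}\langle f\rangle\big)$ if $\emptyset\in Z$, regarded as a subspace of the geometric cone over $|Y|$ (the cone over the empty set is the one-point space). $H^\bullet(\cdot,\cdot,\mathbb C)$ is singular cohomology of pairs; if $b$ is a single vertex then $\widetilde U_b=\emptyset$ and reduced cohomology refers to that of the first space, the reduced cohomology of the empty space being taken as $0$ in degrees $\geq 0$. *)

theory Defs
  imports "HOL-Analysis.Analysis" "HOL-Homology.Homology" "HOL-Algebra.Module" "HOL-Algebra.QuotRing"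
begin

section \<open>Modules over commutative rings\<close>

text \<open>The fields \<open>mult\<close> and \<open>one\<close> of a module record carry no information and are left
  unspecified. Functions with a given domain are represented extensionally, so that equality of
  homomorphisms is equality of functions.\<close>

definition regular_module :: "'a ring \<Rightarrow> ('a, 'a) module" where
  "regular_module R = \<lparr>carrier = carrier R, mult = undefined, one = undefined,
     zero = \<zero>\<^bsub>R\<^esub>, add = add R, smult = mult R\<rparr>"

definition restrict_scalars :: "('r \<Rightarrow> 's) \<Rightarrow> ('s, 'm) module \<Rightarrow> ('r, 'm) module" where
  "restrict_scalars h M = \<lparr>carrier = carrier M, mult = undefined, one = undefined,
     zero = \<zero>\<^bsub>M\<^esub>, add = add M, smult = (\<lambda>r x. h r \<odot>\<^bsub>M\<^esub> x)\<rparr>"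

text \<open>For a module over \<open>R\<close> annihilated by an ideal \<open>I\<close>: the induced structure over \<open>R Quot I\<close>.
  The set under \<open>the_elem\<close> is then a singleton, for every coset \<open>a\<close>.\<close>

definition factor_scalars :: "('r, 'm) module \<Rightarrow> ('r set, 'm) module" where
  "factor_scalars M = \<lparr>carrier = carrier M, mult = undefined, one = undefined,
     zero = \<zero>\<^bsub>M\<^esub>, add = add M, smult = (\<lambda>a x. the_elem ((\<lambda>r. r \<odot>\<^bsub>M\<^esub> x) ` a))\<rparr>"

definition quot_module :: "('r, 'm) module \<Rightarrow> 'm set \<Rightarrow> ('r, 'm set) module" where
  "quot_module M N = \<lparr>carrier = a_rcosets\<^bsub>M\<^esub> N, mult = undefined, one = undefined,
     zero = N, add = set_add M, smult = (\<lambda>r x. \<Union>y\<in>x. N +>\<^bsub>M\<^esub> (r \<odot>\<^bsub>M\<^esub> y))\<rparr>"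

definition mod_hom :: "'r ring \<Rightarrow> ('r, 'm) module \<Rightarrow> ('r, 'k) module \<Rightarrow> ('m \<Rightarrow> 'k) set" where
  "mod_hom R M N = {h \<in> carrier M \<rightarrow>\<^sub>E carrier N.
     (\<forall>x\<in>carrier M. \<forall>y\<in>carrier M. h (x \<oplus>\<^bsub>M\<^esub> y) = h x \<oplus>\<^bsub>N\<^esub> h y) \<and>
     (\<forall>r\<in>carrier R. \<forall>x\<in>carrier M. h (r \<odot>\<^bsub>M\<^esub> x) = r \<odot>\<^bsub>N\<^esub> h x)}"

definition hom_module ::
    "'r ring \<Rightarrow> ('r, 'm) module \<Rightarrow> ('r, 'k) module \<Rightarrow> ('r, 'm \<Rightarrow> 'k) module" where
  "hom_module R M N = \<lparr>carrier = mod_hom R M N, mult = undefined, one = undefined,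
     zero = (\<lambda>x\<in>carrier M. \<zero>\<^bsub>N\<^esub>),
     add = (\<lambda>g h. \<lambda>x\<in>carrier M. g x \<oplus>\<^bsub>N\<^esub> h x),
     smult = (\<lambda>r h. \<lambda>x\<in>carrier M. r \<odot>\<^bsub>N\<^esub> h x)\<rparr>"

definition free_module :: "'r ring \<Rightarrow> nat \<Rightarrow> ('r, nat \<Rightarrow> 'r) module" where
  "free_module R m = \<lparr>carrier = {..<m} \<rightarrow>\<^sub>E carrier R, mult = undefined, one = undefined,
     zero = (\<lambda>k\<in>{..<m}. \<zero>\<^bsub>R\<^esub>),
     add = (\<lambda>x y. \<lambda>k\<in>{..<m}. x k \<oplus>\<^bsub>R\<^esub> y k),
     smult = (\<lambda>r x. \<lambda>k\<in>{..<m}. r \<otimes>\<^bsub>R\<^esub> x k)\<rparr>"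

definition span_module :: "'r ring \<Rightarrow> ('r, 'm) module \<Rightarrow> 'm set \<Rightarrow> 'm set" where
  "span_module R M S = \<Inter>{N. submodule N R M \<and> S \<subseteq> N}"

definition mod_isomorphic :: "'r ring \<Rightarrow> ('r, 'm) module \<Rightarrow> ('r, 'k) module \<Rightarrow> bool" where
  "mod_isomorphic R M N \<longleftrightarrow> (\<exists>h\<in>mod_hom R M N. bij_betw h (carrier M) (carrier N))"

definition complex_field :: "complex ring" where
  "complex_field = \<lparr>carrier = UNIV, mult = (*), one = 1, zero = 0, add = (+)\<rparr>"


section \<open>Gradings\<close>

text \<open>The graded pieces of a module are given by a family of subsets of its carrier.
  Multidegrees in \<open>\<int>\<^sup>n\<^sup>+\<^sup>1\<close> are functions \<open>nat \<Rightarrow> int\<close> of which only the values on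
  \<open>{0..n}\<close> matter.\<close>

type_synonym mdeg = "nat \<Rightarrow> int"

definition quot_grading ::
    "('r, 'm) module \<Rightarrow> 'm set \<Rightarrow> (mdeg \<Rightarrow> 'm set) \<Rightarrow> mdeg \<Rightarrow> 'm set set" where
  "quot_grading M N G d = (\<lambda>x. N +>\<^bsub>M\<^esub> x) ` G d"

definition hom_grading :: "'r ring \<Rightarrow> ('r, 'm) module \<Rightarrow> (mdeg \<Rightarrow> 'm set) \<Rightarrow>
    ('r, 'k) module \<Rightarrow> (mdeg \<Rightarrow> 'k set) \<Rightarrow> mdeg \<Rightarrow> ('m \<Rightarrow> 'k) set" where
  "hom_grading R M G N H c = {h \<in> mod_hom R M N. \<forall>d. \<forall>x\<in>G d. h x \<in> H (\<lambda>i. d i + c i)}"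


section \<open>The polynomial ring and its quotients\<close>

type_synonym mpoly = "(nat \<Rightarrow>\<^sub>0 nat) \<Rightarrow>\<^sub>0 complex"

definition poly_ring :: "nat \<Rightarrow> mpoly ring" where
  "poly_ring n = \<lparr>carrier = {p. \<forall>t\<in>Poly_Mapping.keys p. Poly_Mapping.keys t \<subseteq> {0..n}},
     mult = (*), one = 1, zero = 0, add = (+)\<rparr>"

definition poly_const :: "complex \<Rightarrow> mpoly" where
  "poly_const z = Poly_Mapping.single 0 z"

definition poly_var :: "nat \<Rightarrow> mpoly" where
  "poly_var i = Poly_Mapping.single (Poly_Mapping.single i 1) 1"

definition poly_grading :: "nat \<Rightarrow> mdeg \<Rightarrow> mpoly set" where
  "poly_grading n d = {p \<in> carrier (poly_ring n).
     \<forall>t\<in>Poly_Mapping.keys p. \<forall>i\<le>n. int (Poly_Mapping.lookup t i) = d i}"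

definition quot_ring_module :: "nat \<Rightarrow> mpoly set \<Rightarrow> (mpoly, mpoly set) module" where
  "quot_ring_module n I = restrict_scalars (\<lambda>p. I +>\<^bsub>poly_ring n\<^esub> p)
     (regular_module (poly_ring n Quot I))"

definition quot_ring_grading :: "nat \<Rightarrow> mpoly set \<Rightarrow> mdeg \<Rightarrow> mpoly set set" where
  "quot_ring_grading n I =
     quot_grading (regular_module (poly_ring n)) I (poly_grading n)"


section \<open>Cotangent cohomology of \<open>P/I\<close>\<close>

definition poly_derivations :: "nat \<Rightarrow> (mpoly \<Rightarrow> mpoly) set" where
  "poly_derivations n = {D \<in> carrier (poly_ring n) \<rightarrow>\<^sub>E carrier (poly_ring n).
     (\<forall>p\<in>carrier (poly_ring n). \<forall>q\<in>carrier (poly_ring n).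
        D (p + q) = D p + D q \<and> D (p * q) = p * D q + q * D p) \<and>
     (\<forall>z. \<forall>p\<in>carrier (poly_ring n). D (poly_const z * p) = poly_const z * D p)}"

definition ideal_module :: "nat \<Rightarrow> mpoly set \<Rightarrow> (mpoly, mpoly) module" where
  "ideal_module n I = (regular_module (poly_ring n))\<lparr>carrier := I\<rparr>"

definition T1 :: "nat \<Rightarrow> mpoly set \<Rightarrow> (mpoly, (mpoly \<Rightarrow> mpoly set) set) module" where
  "T1 n I = quot_module (hom_module (poly_ring n) (ideal_module n I) (quot_ring_module n I))
     ((\<lambda>D. \<lambda>f\<in>I. I +>\<^bsub>poly_ring n\<^esub> D f) ` poly_derivations n)"

definition T1_piece ::
    "nat \<Rightarrow> mpoly set \<Rightarrow> mdeg \<Rightarrow> (complex, (mpoly \<Rightarrow> mpoly set) set) module" where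
  "T1_piece n I c = (restrict_scalars poly_const (T1 n I))\<lparr>carrier :=
     quot_grading (hom_module (poly_ring n) (ideal_module n I) (quot_ring_module n I))
       ((\<lambda>D. \<lambda>f\<in>I. I +>\<^bsub>poly_ring n\<^esub> D f) ` poly_derivations n)
       (hom_grading (poly_ring n) (ideal_module n I) (\<lambda>d. I \<inter> poly_grading n d)
          (quot_ring_module n I) (quot_ring_grading n I)) c\<rparr>"

text \<open>\<open>Deg k\<close> is the degree of the \<open>k\<close>-th basis vector of \<open>P\<^sup>m\<close>.\<close>

definition free_grading :: "nat \<Rightarrow> nat \<Rightarrow> (nat \<Rightarrow> mdeg) \<Rightarrow> mdeg \<Rightarrow> (nat \<Rightarrow> mpoly) set" where
  "free_grading n m Deg d = {e \<in> carrier (free_module (poly_ring n) m).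
     \<forall>k<m. e k \<in> poly_grading n (\<lambda>i. d i - Deg k i)}"

text \<open>Exactness of \<open>P\<^sup>m \<rightarrow> P \<rightarrow> P/I \<rightarrow> 0\<close>, with \<open>j\<close> homogeneous of degree \<open>0\<close>.\<close>

definition graded_presentation ::
    "nat \<Rightarrow> mpoly set \<Rightarrow> nat \<Rightarrow> (nat \<Rightarrow> mdeg) \<Rightarrow> ((nat \<Rightarrow> mpoly) \<Rightarrow> mpoly) \<Rightarrow> bool" where
  "graded_presentation n I m Deg j \<longleftrightarrow>
     j \<in> mod_hom (poly_ring n) (free_module (poly_ring n) m) (regular_module (poly_ring n)) \<and>
     j ` carrier (free_module (poly_ring n) m) = I \<and>
     (\<forall>d. \<forall>e\<in>free_grading n m Deg d. j e \<in> poly_grading n d)"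

definition rel_carrier :: "nat \<Rightarrow> nat \<Rightarrow> ((nat \<Rightarrow> mpoly) \<Rightarrow> mpoly) \<Rightarrow> (nat \<Rightarrow> mpoly) set" where
  "rel_carrier n m j = {e \<in> carrier (free_module (poly_ring n) m). j e = 0}"

definition rel_module ::
    "nat \<Rightarrow> nat \<Rightarrow> ((nat \<Rightarrow> mpoly) \<Rightarrow> mpoly) \<Rightarrow> (mpoly, nat \<Rightarrow> mpoly) module" where
  "rel_module n m j = (free_module (poly_ring n) m)\<lparr>carrier := rel_carrier n m j\<rparr>"

definition koszul_rels :: "nat \<Rightarrow> nat \<Rightarrow> ((nat \<Rightarrow> mpoly) \<Rightarrow> mpoly) \<Rightarrow> (nat \<Rightarrow> mpoly) set" where
  "koszul_rels n m j = (let F = free_module (poly_ring n) m in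
     span_module (poly_ring n) F
       {(j f \<odot>\<^bsub>F\<^esub> e) \<ominus>\<^bsub>F\<^esub> (j e \<odot>\<^bsub>F\<^esub> f) | e f. e \<in> carrier F \<and> f \<in> carrier F})"

definition rel_quot ::
    "nat \<Rightarrow> nat \<Rightarrow> ((nat \<Rightarrow> mpoly) \<Rightarrow> mpoly) \<Rightarrow> (mpoly set, (nat \<Rightarrow> mpoly) set) module" where
  "rel_quot n m j = factor_scalars (quot_module (rel_module n m j) (koszul_rels n m j))"

definition rel_hom_module :: "nat \<Rightarrow> mpoly set \<Rightarrow> nat \<Rightarrow> ((nat \<Rightarrow> mpoly) \<Rightarrow> mpoly) \<Rightarrow>
    (mpoly set, (nat \<Rightarrow> mpoly) set \<Rightarrow> mpoly set) module" where
  "rel_hom_module n I m j = hom_module (poly_ring n Quot I) (rel_quot n m j)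
     (regular_module (poly_ring n Quot I))"

text \<open>The image of \<open>Hom(P\<^sup>m, A)\<close> in \<open>Hom(R/R\<^sub>0, A)\<close>. A homomorphism on \<open>P\<^sup>m\<close> with values in \<open>A\<close>
  vanishes on \<open>R\<^sub>0\<close>, so it is constant on each coset of \<open>R\<^sub>0\<close>.\<close>

definition rel_hom_image :: "nat \<Rightarrow> mpoly set \<Rightarrow> nat \<Rightarrow> ((nat \<Rightarrow> mpoly) \<Rightarrow> mpoly) \<Rightarrow>
    ((nat \<Rightarrow> mpoly) set \<Rightarrow> mpoly set) set" where
  "rel_hom_image n I m j = (\<lambda>h. \<lambda>x\<in>carrier (rel_quot n m j). the_elem (h ` x)) `
     mod_hom (poly_ring n) (free_module (poly_ring n) m) (quot_ring_module n I)"

definition T2 :: "nat \<Rightarrow> mpoly set \<Rightarrow> nat \<Rightarrow> ((nat \<Rightarrow> mpoly) \<Rightarrow> mpoly) \<Rightarrow>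
    (mpoly set, ((nat \<Rightarrow> mpoly) set \<Rightarrow> mpoly set) set) module" where
  "T2 n I m j = quot_module (rel_hom_module n I m j) (rel_hom_image n I m j)"

definition T2_piece :: "nat \<Rightarrow> mpoly set \<Rightarrow> nat \<Rightarrow> (nat \<Rightarrow> mdeg) \<Rightarrow> ((nat \<Rightarrow> mpoly) \<Rightarrow> mpoly) \<Rightarrow>
    mdeg \<Rightarrow> (complex, ((nat \<Rightarrow> mpoly) set \<Rightarrow> mpoly set) set) module" where
  "T2_piece n I m Deg j c =
     (restrict_scalars (\<lambda>z. I +>\<^bsub>poly_ring n\<^esub> poly_const z) (T2 n I m j))\<lparr>carrier :=
       quot_grading (rel_hom_module n I m j) (rel_hom_image n I m j)
         (hom_grading (poly_ring n Quot I) (rel_quot n m j)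
            (quot_grading (rel_module n m j) (koszul_rels n m j)
               (\<lambda>d. rel_carrier n m j \<inter> free_grading n m Deg d))
            (regular_module (poly_ring n Quot I)) (quot_ring_grading n I)) c\<rparr>"


section \<open>Simplicial complexes and Stanley-Reisner ideals\<close>

definition simplicial_complex_on :: "nat \<Rightarrow> nat set set \<Rightarrow> bool" where
  "simplicial_complex_on n X \<longleftrightarrow> X \<subseteq> Pow {0..n} \<and> {} \<in> X \<and> (\<forall>f\<in>X. \<forall>g. g \<subseteq> f \<longrightarrow> g \<in> X)"

definition stanley_reisner_ideal :: "nat \<Rightarrow> nat set set \<Rightarrow> mpoly set" where
  "stanley_reisner_ideal n X =
     Idl\<^bsub>poly_ring n\<^esub> {(\<Prod>i\<in>p. poly_var i) | p. p \<subseteq> {0..n} \<and> p \<notin> X}"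

definition vec_support :: "nat \<Rightarrow> (nat \<Rightarrow> nat) \<Rightarrow> nat set" where
  "vec_support n v = {i. i \<le> n \<and> v i \<noteq> 0}"

definition link :: "nat set \<Rightarrow> nat set set \<Rightarrow> nat set set" where
  "link a X = {g \<in> X. g \<inter> a = {} \<and> g \<union> a \<in> X}"

definition U_faces :: "nat set \<Rightarrow> nat set set \<Rightarrow> nat set set" where
  "U_faces b Y = {f \<in> Y. f \<union> b \<notin> Y}"

definition U_tilde_faces :: "nat set \<Rightarrow> nat set set \<Rightarrow> nat set set" where
  "U_tilde_faces b Y = {f \<in> Y. \<exists>v\<in>b. (f \<union> b) - {v} \<notin> Y}"


section \<open>Geometric realization\<close>

definition geom_realization :: "nat \<Rightarrow> nat set set \<Rightarrow> (nat \<Rightarrow> real) set" where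
  "geom_realization n Y = {\<alpha>. (\<forall>i. 0 \<le> \<alpha> i \<and> \<alpha> i \<le> 1) \<and> (\<forall>i>n. \<alpha> i = 0) \<and>
     {i. i \<le> n \<and> \<alpha> i \<noteq> 0} \<in> Y \<and> (\<Sum>i\<le>n. \<alpha> i) = 1}"

definition open_cell :: "nat \<Rightarrow> nat set set \<Rightarrow> nat set \<Rightarrow> (nat \<Rightarrow> real) set" where
  "open_cell n Y f = {\<alpha> \<in> geom_realization n Y. \<forall>i\<le>n. \<alpha> i \<noteq> 0 \<longleftrightarrow> i \<in> f}"

text \<open>The geometric cone over \<open>|Y|\<close> lives in \<open>(nat \<Rightarrow> real) \<times> real\<close>: the base is at height \<open>0\<close> and the
  apex is \<open>(0, 1)\<close>. The apex is inserted explicitly so that the cone over the empty set is a point.\<close>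

definition geom_cone :: "(nat \<Rightarrow> real) set \<Rightarrow> ((nat \<Rightarrow> real) \<times> real) set" where
  "geom_cone Z = insert (\<lambda>_. 0, 1)
     {(\<lambda>i. (1 - t) * \<alpha> i, t) | \<alpha> t. \<alpha> \<in> Z \<and> 0 \<le> t \<and> t \<le> 1}"

definition geom_subset :: "nat \<Rightarrow> nat set set \<Rightarrow> nat set set \<Rightarrow> ((nat \<Rightarrow> real) \<times> real) set" where
  "geom_subset n Y Z =
     (if {} \<in> Z then geom_cone (\<Union>f\<in>Z - {{}}. open_cell n Y f)
      else (\<Union>f\<in>Z. open_cell n Y f) \<times> {0})"


section \<open>Singular cohomology with complex coefficients\<close>

text \<open>A cochain is given by its values on singular simplices; it is relative to \<open>S\<close> if it vanishes on
  the simplices lying in \<open>S\<close>. Off the singular simplices it is \<open>0\<close> by convention.\<close>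

definition cochains ::
    "nat \<Rightarrow> 'a topology \<Rightarrow> 'a set \<Rightarrow> (complex, ((nat \<Rightarrow> real) \<Rightarrow> 'a) \<Rightarrow> complex) module" where
  "cochains p X S = \<lparr>carrier = {\<phi>. \<forall>\<sigma>. \<phi> \<sigma> \<noteq> 0 \<longrightarrow>
       singular_simplex p X \<sigma> \<and> \<not> singular_simplex p (subtopology X S) \<sigma>},
     mult = undefined, one = undefined, zero = (\<lambda>\<sigma>. 0),
     add = (\<lambda>\<phi> \<psi> \<sigma>. \<phi> \<sigma> + \<psi> \<sigma>), smult = (\<lambda>z \<phi> \<sigma>. z * \<phi> \<sigma>)\<rparr>"

definition cochain_eval :: "(((nat \<Rightarrow> real) \<Rightarrow> 'a) \<Rightarrow> complex) \<Rightarrow> 'a chain \<Rightarrow> complex" where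
  "cochain_eval \<phi> c = (\<Sum>\<sigma>\<in>Poly_Mapping.keys c. of_int (Poly_Mapping.lookup c \<sigma>) * \<phi> \<sigma>)"

definition coboundary :: "nat \<Rightarrow> 'a topology \<Rightarrow> (((nat \<Rightarrow> real) \<Rightarrow> 'a) \<Rightarrow> complex) \<Rightarrow>
    ((nat \<Rightarrow> real) \<Rightarrow> 'a) \<Rightarrow> complex" where
  "coboundary p X \<phi> = (\<lambda>\<sigma>. if singular_simplex (Suc p) X \<sigma>
     then cochain_eval \<phi> (chain_boundary (Suc p) (frag_of \<sigma>)) else 0)"

definition cocycles ::
    "nat \<Rightarrow> 'a topology \<Rightarrow> 'a set \<Rightarrow> (complex, ((nat \<Rightarrow> real) \<Rightarrow> 'a) \<Rightarrow> complex) module" where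
  "cocycles p X S = (cochains p X S)\<lparr>carrier :=
     {\<phi> \<in> carrier (cochains p X S). coboundary p X \<phi> = (\<lambda>\<sigma>. 0)}\<rparr>"

definition coboundaries ::
    "nat \<Rightarrow> 'a topology \<Rightarrow> 'a set \<Rightarrow> (((nat \<Rightarrow> real) \<Rightarrow> 'a) \<Rightarrow> complex) set" where
  "coboundaries p X S = (case p of 0 \<Rightarrow> {\<lambda>\<sigma>. 0}
     | Suc q \<Rightarrow> coboundary q X ` carrier (cochains q X S))"

definition rel_cohomology ::
    "nat \<Rightarrow> 'a topology \<Rightarrow> 'a set \<Rightarrow> (complex, (((nat \<Rightarrow> real) \<Rightarrow> 'a) \<Rightarrow> complex) set) module" where
  "rel_cohomology p X S = quot_module (cocycles p X S) (coboundaries p X S)"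

text \<open>Reduced cohomology in degrees \<open>\<ge> 0\<close> is that of the augmented cochain complex, with \<open>\<complex>\<close> in degree
  \<open>-1\<close>, mapped to the constant \<open>0\<close>-cochains. For the empty space it vanishes in all degrees \<open>\<ge> 0\<close>.\<close>

definition reduced_coboundaries ::
    "nat \<Rightarrow> 'a topology \<Rightarrow> (((nat \<Rightarrow> real) \<Rightarrow> 'a) \<Rightarrow> complex) set" where
  "reduced_coboundaries p X = (case p of
       0 \<Rightarrow> range (\<lambda>z \<sigma>. if singular_simplex 0 X \<sigma> then z else 0)
     | Suc q \<Rightarrow> coboundaries p X {})"

definition reduced_cohomology ::
    "nat \<Rightarrow> 'a topology \<Rightarrow> (complex, (((nat \<Rightarrow> real) \<Rightarrow> 'a) \<Rightarrow> complex) set) module" where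
  "reduced_cohomology p X = quot_module (cocycles p X {}) (reduced_coboundaries p X)"

end

theory Submission
  imports Defs
begin

text \<open>Both sides are computed by the same finite object. Let \<open>Y\<close> be the link of \<open>a\<close>, let \<open>U\<close> be the set of the
faces \<open>f\<close> of \<open>Y\<close> with \<open>f \<union> b \<notin> Y\<close>, ordered by inclusion, and let \<open>U1\<close> be the up-closed subset of those
\<open>f \<in> U\<close> for which \<open>(f \<union> b) - {v} \<notin> Y\<close> or \<open>2 \<le> b v\<close> for some \<open>v\<close> in \<open>b\<close>. The cohomology of the poset
\<open>U\<close> relative to \<open>U1\<close> in degrees 0 and 1 consists of functions on \<open>U\<close>, or on the pairs \<open>f \<subseteq> g\<close> in \<open>U\<close>:
0-cocycles are constant along inclusions and vanish on \<open>U1\<close>, 1-cocycles are additive on chains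
\<open>f \<subseteq> g \<subseteq> h\<close> and vanish when \<open>f \<in> U1\<close>, and coboundaries are differences of functions that vanish
on \<open>U1\<close>.

On the topological side, the points of \<open>\<langle>U\<rangle>\<close> are stratified by the faces that carry them. The star of
\<open>f\<close>, consisting of the points whose face contains \<open>f\<close>, is star-shaped about the barycentre of \<open>f\<close>, hence
contractible, and the space is covered by open stars. So a singular 0-cocycle is determined by its values
at barycentres, a singular 1-cocycle is determined up to coboundaries by its values on paths between
barycentres inside a star, and every poset 1-cocycle is realised by subdividing paths until the pieces
lie in stars (\<open>rel_cohomology_0\<close>, \<open>reduced_cohomology_0\<close>, \<open>rel_cohomology_1\<close>).

On the algebraic side, a homomorphism of degree \<open>c\<close> on the ideal sends a monomial \<open>x\<^sup>s\<close> to a multiple of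
\<open>x\<^sup>s\<^sup>+\<^sup>c\<close>. Multiplication by monomials identifies the coefficients that belong to the same face of the
link, which gives a function on \<open>U\<close>. It vanishes on \<open>U1\<close>, because over a face of \<open>U1\<close> the ideal contains a
monomial in which \<open>x\<^sub>v\<close> occurs to a lower power than \<open>b v\<close>, so that its image has no place to go. A derivation
contributes in degree \<open>c\<close> only if \<open>b\<close> is a unit vector, and then a constant function; this is where
reduced cohomology comes from (\<open>T1_piece_vector_quotient\<close>).

For the second cotangent module, the relations are generated, apart from the basis vectors of zero
generators, by the differences of two ways of writing a monomial \<open>x\<^sup>d\<close> as a multiple of a generator of the ideal. A representative generator is chosen for every face
\<open>f\<close> of \<open>U\<close>, and the value of a homomorphism on the relation between the representatives of \<open>f\<close> and \<open>g\<close>, in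
a degree that belongs to \<open>g\<close>, is a 1-cocycle at \<open>(f, g)\<close>. Over \<open>U1\<close> the representative lacks part of some
\<open>x\<^sub>v\<close> with \<open>v\<close> in \<open>b\<close>; that two such generators are not separated is the place where the Koszul relations
enter (\<open>sg_special\<close>). The homomorphism extends to the free module iff the cocycle is a coboundary, and
every cocycle arises (\<open>T2_piece_vector_quotient\<close>).

If the degree is not admissible then \<open>U \<subseteq> U1\<close>, so all cocycles vanish. Otherwise \<open>U1\<close> is the set that
defines the second space, and the two computations agree.\<close>

section \<open>Quotients of function spaces\<close>

text \<open>A linear map from the function space \<open>V\<close> onto \<open>M\<close> with kernel \<open>N\<close>. All the cohomology modules are compared
  through such presentations, because they live in different types.\<close>

definition linear_presentation ::
    "(('x \<Rightarrow> complex) \<Rightarrow> 'm) \<Rightarrow> (complex, 'm) module \<Rightarrow> ('x \<Rightarrow> complex) set \<Rightarrow> ('x \<Rightarrow> complex) set \<Rightarrow> bool" where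
  "linear_presentation \<pi> M V N \<longleftrightarrow> \<pi> ` V = carrier M \<and>
     (\<forall>v\<in>V. \<forall>w\<in>V. (\<lambda>x. v x + w x) \<in> V \<and> \<pi> (\<lambda>x. v x + w x) = \<pi> v \<oplus>\<^bsub>M\<^esub> \<pi> w) \<and>
     (\<forall>z. \<forall>v\<in>V. (\<lambda>x. z * v x) \<in> V \<and> \<pi> (\<lambda>x. z * v x) = z \<odot>\<^bsub>M\<^esub> \<pi> v) \<and>
     (\<forall>v\<in>V. \<forall>w\<in>V. \<pi> v = \<pi> w \<longleftrightarrow> (\<lambda>x. v x - w x) \<in> N)"

definition vector_quotient ::
    "(complex, 'm) module \<Rightarrow> ('x \<Rightarrow> complex) set \<Rightarrow> ('x \<Rightarrow> complex) set \<Rightarrow> bool" where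
  "vector_quotient M V N \<longleftrightarrow> (\<exists>\<pi>. linear_presentation \<pi> M V N)"

text \<open>Both modules are copies of \<open>V/N\<close>; the isomorphism matches the classes of the same element of \<open>V\<close>.\<close>

lemma vector_quotient_isomorphic:
  assumes "vector_quotient M V N" and "vector_quotient M' V N"
  shows "mod_isomorphic complex_field M M'"
proof -
  obtain p q where pp: "linear_presentation p M V N" and qq: "linear_presentation q M' V N"
    using assms unfolding vector_quotient_def by blast
  have p: "p ` V = carrier M"
     "\<And>v w. v \<in> V \<Longrightarrow> w \<in> V \<Longrightarrow> (\<lambda>x. v x + w x) \<in> V \<and> p (\<lambda>x. v x + w x) = p v \<oplus>\<^bsub>M\<^esub> p w"
     "\<And>z v. v \<in> V \<Longrightarrow> (\<lambda>x. z * v x) \<in> V \<and> p (\<lambda>x. z * v x) = z \<odot>\<^bsub>M\<^esub> p v"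
     "\<And>v w. v \<in> V \<Longrightarrow> w \<in> V \<Longrightarrow> p v = p w \<longleftrightarrow> (\<lambda>x. v x - w x) \<in> N"
    using pp unfolding linear_presentation_def by simp_all
  have q: "q ` V = carrier M'"
     "\<And>v w. v \<in> V \<Longrightarrow> w \<in> V \<Longrightarrow> q (\<lambda>x. v x + w x) = q v \<oplus>\<^bsub>M'\<^esub> q w"
     "\<And>z v. v \<in> V \<Longrightarrow> q (\<lambda>x. z * v x) = z \<odot>\<^bsub>M'\<^esub> q v"
     "\<And>v w. v \<in> V \<Longrightarrow> w \<in> V \<Longrightarrow> q v = q w \<longleftrightarrow> (\<lambda>x. v x - w x) \<in> N"
    using qq unfolding linear_presentation_def by simp_all
  have pq: "p v = p w \<longleftrightarrow> q v = q w" if "v \<in> V" "w \<in> V" for v w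
    using p(4) q(4) that by blast
  define h where "h = (\<lambda>x\<in>carrier M. q (inv_into V p x))"
  have hp: "h (p v) = q v" if "v \<in> V" for v
  proof -
    have "p v \<in> p ` V" using that by blast
    then have "inv_into V p (p v) \<in> V" "p (inv_into V p (p v)) = p v"
      by (rule inv_into_into, rule f_inv_into_f)
    then show ?thesis using pq that p(1) unfolding h_def by auto
  qed
  have "h \<in> mod_hom complex_field M M'"
    unfolding mod_hom_def
  proof (intro CollectI conjI ballI)
    show "h \<in> carrier M \<rightarrow>\<^sub>E carrier M'"
      using p(1) q(1) inv_into_into[of _ p V] unfolding h_def by auto
  next
    fix x y assume "x \<in> carrier M" "y \<in> carrier M"
    then obtain v w where v: "v \<in> V" "w \<in> V" "x = p v" "y = p w" using p(1) by blast
    then show "h (x \<oplus>\<^bsub>M\<^esub> y) = h x \<oplus>\<^bsub>M'\<^esub> h y"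
      using p(2)[OF v(1,2)] q(2)[OF v(1,2)] hp[of "\<lambda>x. v x + w x"] hp by simp
  next
    fix z x assume "x \<in> carrier M"
    then obtain v where v: "v \<in> V" "x = p v" using p(1) by blast
    then show "h (z \<odot>\<^bsub>M\<^esub> x) = z \<odot>\<^bsub>M'\<^esub> h x"
      using p(3)[OF v(1)] q(3)[OF v(1)] hp[of "\<lambda>x. z * v x"] hp by simp
  qed
  moreover have "bij_betw h (carrier M) (carrier M')"
  proof (rule bij_betw_imageI)
    show "inj_on h (carrier M)"
      unfolding inj_on_def p(1)[symmetric] using hp pq by auto
    show "h ` carrier M = carrier M'"
      unfolding p(1)[symmetric] q(1)[symmetric] image_image using hp by simp
  qed
  ultimately show ?thesis unfolding mod_isomorphic_def by blast
qed

text \<open>The union over a coset that defines the scalar multiplication of a quotient module is a single coset,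
  because the scalar maps \<open>N\<close> into itself.\<close>

lemma coset_smult:
  assumes M: "abelian_group M" and N: "additive_subgroup N M" and x: "x \<in> carrier M"
    and s: "\<And>x y. x \<in> carrier M \<Longrightarrow> y \<in> carrier M \<Longrightarrow> s (x \<oplus>\<^bsub>M\<^esub> y) = s x \<oplus>\<^bsub>M\<^esub> s y"
      "\<And>x. x \<in> carrier M \<Longrightarrow> s x \<in> carrier M" "\<And>x. x \<in> N \<Longrightarrow> s x \<in> N"
  shows "(\<Union>y\<in>N +>\<^bsub>M\<^esub> x. N +>\<^bsub>M\<^esub> s y) = N +>\<^bsub>M\<^esub> s x"
proof -
  interpret abelian_group M by fact
  interpret abelian_subgroup N M using M N by (meson abelian_subgroupI3)
  have "N +>\<^bsub>M\<^esub> s y = N +>\<^bsub>M\<^esub> s x" if "y \<in> N +>\<^bsub>M\<^esub> x" for y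
  proof -
    obtain k where k: "k \<in> N" "y = k \<oplus>\<^bsub>M\<^esub> x" using \<open>y \<in> N +>\<^bsub>M\<^esub> x\<close> by (auto simp: a_r_coset_def')
    then have "s y = s k \<oplus>\<^bsub>M\<^esub> s x" using s(1) x by (simp add: a_Hcarr)
    moreover have "s k \<in> N" using s(3) k by blast
    ultimately have "s y \<in> N +>\<^bsub>M\<^esub> s x" by (auto simp: a_r_coset_def')
    then show ?thesis using a_repr_independence' s(2) x by metis
  qed
  moreover have "x \<in> N +>\<^bsub>M\<^esub> x" using x a_rcos_self by blast
  ultimately show ?thesis by blast
qed

text \<open>The homomorphism theorem in the form in which it is applied to each quotient: \<open>F\<close> identifies the classes
  of \<open>G\<close> modulo \<open>N\<close> with \<open>V/N'\<close>. It is enough that \<open>F\<close> is onto modulo \<open>N'\<close>. The map \<open>s\<close> accounts for scalars that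
  act through another ring.\<close>

lemma vector_quotient_quot:
  fixes M :: "('r, 'm) module" and Q :: "(complex, 'm set) module" and F :: "'m \<Rightarrow> 'x \<Rightarrow> complex"
  assumes M: "abelian_group M" and N: "additive_subgroup N M"
    and G: "G \<subseteq> carrier M" "\<And>x y. x \<in> G \<Longrightarrow> y \<in> G \<Longrightarrow> x \<oplus>\<^bsub>M\<^esub> y \<in> G"
       "\<And>z x. x \<in> G \<Longrightarrow> s z \<odot>\<^bsub>M\<^esub> x \<in> G"
    and s: "\<And>z x y. x \<in> carrier M \<Longrightarrow> y \<in> carrier M \<Longrightarrow>
         s z \<odot>\<^bsub>M\<^esub> (x \<oplus>\<^bsub>M\<^esub> y) = s z \<odot>\<^bsub>M\<^esub> x \<oplus>\<^bsub>M\<^esub> s z \<odot>\<^bsub>M\<^esub> y"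
       "\<And>z x. x \<in> carrier M \<Longrightarrow> s z \<odot>\<^bsub>M\<^esub> x \<in> carrier M" "\<And>z x. x \<in> N \<Longrightarrow> s z \<odot>\<^bsub>M\<^esub> x \<in> N"
    and Q: "carrier Q = (\<lambda>x. N +>\<^bsub>M\<^esub> x) ` G" "add Q = set_add M"
       "\<And>z x. z \<odot>\<^bsub>Q\<^esub> x = (\<Union>y\<in>x. N +>\<^bsub>M\<^esub> (s z \<odot>\<^bsub>M\<^esub> y))"
    and V: "\<And>v w. v \<in> V \<Longrightarrow> w \<in> V \<Longrightarrow> (\<lambda>x. v x + w x) \<in> V"
       "\<And>z v. v \<in> V \<Longrightarrow> (\<lambda>x. z * v x) \<in> V"
    and N': "(\<lambda>x. 0) \<in> N'" "\<And>v w. v \<in> N' \<Longrightarrow> w \<in> N' \<Longrightarrow> (\<lambda>x. v x + w x) \<in> N'"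
       "\<And>z v. v \<in> N' \<Longrightarrow> (\<lambda>x. z * v x) \<in> N'"
    and F: "\<And>x. x \<in> G \<Longrightarrow> F x \<in> V" "\<And>x y. x \<in> G \<Longrightarrow> y \<in> G \<Longrightarrow> F (x \<oplus>\<^bsub>M\<^esub> y) = (\<lambda>i. F x i + F y i)"
       "\<And>z x. x \<in> G \<Longrightarrow> F (s z \<odot>\<^bsub>M\<^esub> x) = (\<lambda>i. z * F x i)"
    and ker: "\<And>x. x \<in> G \<Longrightarrow> F x \<in> N' \<longleftrightarrow> x \<in> N"
    and sur: "\<And>v. v \<in> V \<Longrightarrow> \<exists>x\<in>G. (\<lambda>i. v i - F x i) \<in> N'"
    and neg: "\<And>x. x \<in> G \<Longrightarrow> \<ominus>\<^bsub>M\<^esub> x = s (-1) \<odot>\<^bsub>M\<^esub> x"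
  shows "vector_quotient Q V N'"
proof -
  interpret abelian_group M by fact
  interpret abelian_subgroup N M using M N
    by (meson abelian_subgroupI3)
  define g where "g v = (SOME x. x \<in> G \<and> (\<lambda>i. v i - F x i) \<in> N')" for v
  have g: "g v \<in> G" "(\<lambda>i. v i - F (g v) i) \<in> N'" if "v \<in> V" for v
    using sur[OF that] someI_ex[of "\<lambda>x. x \<in> G \<and> (\<lambda>i. v i - F x i) \<in> N'"]
    unfolding g_def by blast+
  have coset: "N +>\<^bsub>M\<^esub> x = N +>\<^bsub>M\<^esub> y \<longleftrightarrow> (\<lambda>i. F x i - F y i) \<in> N'" if "x \<in> G" "y \<in> G" for x y
  proof -
    have c: "x \<in> carrier M" "y \<in> carrier M" using that G by auto
    have "N +>\<^bsub>M\<^esub> x = N +>\<^bsub>M\<^esub> y \<longleftrightarrow> x \<in> N +>\<^bsub>M\<^esub> y"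
      using c a_repr_independence' a_rcos_self by metis
    also have "\<dots> \<longleftrightarrow> x \<oplus>\<^bsub>M\<^esub> \<ominus>\<^bsub>M\<^esub> y \<in> N" by (rule a_rcos_module) (use c M in auto)
    also have "\<dots> \<longleftrightarrow> F (x \<oplus>\<^bsub>M\<^esub> \<ominus>\<^bsub>M\<^esub> y) \<in> N'"
      using ker[of "x \<oplus>\<^bsub>M\<^esub> \<ominus>\<^bsub>M\<^esub> y"] that G neg by auto
    also have "F (x \<oplus>\<^bsub>M\<^esub> \<ominus>\<^bsub>M\<^esub> y) = (\<lambda>i. F x i - F y i)"
      using that G neg F(2)[of x "s (-1) \<odot>\<^bsub>M\<^esub> y"] F(3)[of y "-1"] by auto
    finally show ?thesis .
  qed
  have rep: "N +>\<^bsub>M\<^esub> g v = N +>\<^bsub>M\<^esub> x" if "v \<in> V" "x \<in> G" "(\<lambda>i. v i - F x i) \<in> N'" for v x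
  proof -
    have "(\<lambda>i. (v i - F x i) + (-1) * (v i - F (g v) i)) \<in> N'"
      using N' g(2) that by blast
    then show ?thesis using coset g(1) that by simp
  qed
  define p where "p v = N +>\<^bsub>M\<^esub> g v" for v
  have smul: "z \<odot>\<^bsub>Q\<^esub> (N +>\<^bsub>M\<^esub> x) = N +>\<^bsub>M\<^esub> (s z \<odot>\<^bsub>M\<^esub> x)" if "x \<in> G" for z x
    unfolding Q(3)
    by (rule coset_smult[OF M N, where s = "\<lambda>y. s z \<odot>\<^bsub>M\<^esub> y"]) (use that G(1) s in auto)
  show ?thesis unfolding vector_quotient_def linear_presentation_def
  proof (intro exI[of _ p] conjI ballI allI)
    show "p ` V = carrier Q"
    proof
      show "p ` V \<subseteq> carrier Q" using g Q(1) unfolding p_def by auto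
      show "carrier Q \<subseteq> p ` V"
      proof
        fix c assume "c \<in> carrier Q"
        then obtain x where x: "x \<in> G" "c = N +>\<^bsub>M\<^esub> x" using Q(1) by auto
        then have "c = p (F x)" using rep[of "F x" x] F(1) N'(1) unfolding p_def by auto
        then show "c \<in> p ` V" using F(1) x by blast
      qed
    qed
  next
    fix v w assume vw: "v \<in> V" "w \<in> V"
    then show "(\<lambda>x. v x + w x) \<in> V" using V by blast
    have "(\<lambda>i. (v i - F (g v) i) + (w i - F (g w) i)) \<in> N'" using N'(2) g vw by blast
    moreover have "g v \<oplus>\<^bsub>M\<^esub> g w \<in> G" using g vw G by blast
    ultimately have "p (\<lambda>x. v x + w x) = N +>\<^bsub>M\<^esub> (g v \<oplus>\<^bsub>M\<^esub> g w)"
      unfolding p_def using vw V F(2) g by (intro rep) (auto simp: algebra_simps)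
    then show "p (\<lambda>x. v x + w x) = p v \<oplus>\<^bsub>Q\<^esub> p w"
      unfolding p_def Q(2) using a_rcos_sum g(1) vw G(1) by (metis subsetD)
  next
    fix z v assume v: "v \<in> V"
    then show "(\<lambda>x. z * v x) \<in> V" using V by blast
    have "(\<lambda>i. z * (v i - F (g v) i)) \<in> N'" using N'(3) g v by blast
    moreover have "s z \<odot>\<^bsub>M\<^esub> g v \<in> G" using g v G by blast
    ultimately have "p (\<lambda>x. z * v x) = N +>\<^bsub>M\<^esub> (s z \<odot>\<^bsub>M\<^esub> g v)"
      unfolding p_def using v V F(3) g by (intro rep) (auto simp: algebra_simps)
    then show "p (\<lambda>x. z * v x) = z \<odot>\<^bsub>Q\<^esub> p v"
      unfolding p_def using smul g(1) v by simp
  next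
    fix v w assume vw: "v \<in> V" "w \<in> V"
    have "p v = p w \<longleftrightarrow> (\<lambda>i. F (g v) i - F (g w) i) \<in> N'"
      unfolding p_def using coset g vw by blast
    also have "\<dots> \<longleftrightarrow> (\<lambda>x. v x - w x) \<in> N'"
    proof
      assume "(\<lambda>i. F (g v) i - F (g w) i) \<in> N'"
      then have "(\<lambda>i. (v i - F (g v) i) + ((-1) * (w i - F (g w) i) + (F (g v) i - F (g w) i))) \<in> N'"
        by (rule N'(2)[OF g(2)[OF vw(1)] N'(2)[OF N'(3)[OF g(2)[OF vw(2)]]]])
      then show "(\<lambda>x. v x - w x) \<in> N'" by (simp add: algebra_simps)
    next
      assume "(\<lambda>i. v i - w i) \<in> N'"
      then have "(\<lambda>i. (v i - w i) + ((-1) * (v i - F (g v) i) + (w i - F (g w) i))) \<in> N'"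
        by (intro N'(2)[OF _ N'(2)[OF N'(3)[OF g(2)[OF vw(1)]] g(2)[OF vw(2)]]])
      then show "(\<lambda>i. F (g v) i - F (g w) i) \<in> N'" by (simp add: algebra_simps)
    qed
    finally show "p v = p w \<longleftrightarrow> (\<lambda>x. v x - w x) \<in> N'" .
  qed
qed

section \<open>Singular cochains\<close>

lemma cochain_eval_superset:
  assumes "finite K" "Poly_Mapping.keys c \<subseteq> K"
  shows "cochain_eval \<phi> c = (\<Sum>\<sigma>\<in>K. of_int (Poly_Mapping.lookup c \<sigma>) * \<phi> \<sigma>)"
  unfolding cochain_eval_def using assms
  by (intro sum.mono_neutral_left) (auto simp: in_keys_iff)

lemma cochain_eval_diff: "cochain_eval \<phi> (c - d) = cochain_eval \<phi> c - cochain_eval \<phi> d"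
proof -
  let ?K = "Poly_Mapping.keys c \<union> Poly_Mapping.keys d"
  have "Poly_Mapping.keys (c - d) \<subseteq> ?K" by (rule keys_diff)
  then show ?thesis
    by (simp add: cochain_eval_superset[of ?K] lookup_minus algebra_simps sum_subtractf)
qed

lemma cochain_eval_0 [simp]: "cochain_eval \<phi> 0 = 0"
  by (simp add: cochain_eval_def)

lemma cochain_eval_of [simp]: "cochain_eval \<phi> (frag_of \<sigma>) = \<phi> \<sigma>"
  by (simp add: cochain_eval_def)

lemma cochain_eval_add: "cochain_eval \<phi> (c + d) = cochain_eval \<phi> c + cochain_eval \<phi> d"
  using cochain_eval_diff[of \<phi> "c + d" d] by simp

lemma cochain_eval_add_cochain:
  "cochain_eval (\<lambda>\<sigma>. \<phi> \<sigma> + \<psi> \<sigma>) c = cochain_eval \<phi> c + cochain_eval \<psi> c"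
  by (simp add: cochain_eval_def algebra_simps sum.distrib)

lemma cochain_eval_scale: "cochain_eval (\<lambda>\<sigma>. z * \<phi> \<sigma>) c = z * cochain_eval \<phi> c"
  by (simp add: cochain_eval_def sum_distrib_left mult_ac)

lemma coboundary_add:
  "coboundary p X (\<lambda>\<sigma>. \<phi> \<sigma> + \<psi> \<sigma>) = (\<lambda>\<sigma>. coboundary p X \<phi> \<sigma> + coboundary p X \<psi> \<sigma>)"
  by (auto simp: coboundary_def cochain_eval_add_cochain)

lemma coboundary_scale: "coboundary p X (\<lambda>\<sigma>. z * \<phi> \<sigma>) = (\<lambda>\<sigma>. z * coboundary p X \<phi> \<sigma>)"
  by (auto simp: coboundary_def cochain_eval_scale)

lemma coboundary_zero_imp_eval:
  assumes "coboundary p X \<phi> = (\<lambda>\<sigma>. 0)" "singular_chain (Suc p) X d"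
  shows "cochain_eval \<phi> (chain_boundary (Suc p) d) = 0"
  using assms(2) unfolding singular_chain_def
proof (induction rule: frag_induction)
  case (one \<sigma>)
  then show ?case using fun_cong[OF assms(1), of \<sigma>] by (simp add: coboundary_def)
qed (auto simp: chain_boundary_diff cochain_eval_diff)

lemma coboundary_zeroI:
  assumes "\<And>d. singular_chain (Suc p) X d \<Longrightarrow> cochain_eval \<phi> (chain_boundary (Suc p) d) = 0"
  shows "coboundary p X \<phi> = (\<lambda>\<sigma>. 0)"
  unfolding coboundary_def using assms by (auto simp: singular_chain_of)

lemma cochains_simps:
  "\<zero>\<^bsub>cochains p X S\<^esub> = (\<lambda>\<sigma>. 0)" "\<phi> \<oplus>\<^bsub>cochains p X S\<^esub> \<psi> = (\<lambda>\<sigma>. \<phi> \<sigma> + \<psi> \<sigma>)"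
  "z \<odot>\<^bsub>cochains p X S\<^esub> \<phi> = (\<lambda>\<sigma>. z * \<phi> \<sigma>)"
  "\<phi> \<in> carrier (cochains p X S) \<longleftrightarrow> (\<forall>\<sigma>. \<phi> \<sigma> \<noteq> 0 \<longrightarrow>
       singular_simplex p X \<sigma> \<and> \<not> singular_simplex p (subtopology X S) \<sigma>)"
  by (auto simp: cochains_def)

lemma cocycles_simps:
  "\<zero>\<^bsub>cocycles p X S\<^esub> = (\<lambda>\<sigma>. 0)" "\<phi> \<oplus>\<^bsub>cocycles p X S\<^esub> \<psi> = (\<lambda>\<sigma>. \<phi> \<sigma> + \<psi> \<sigma>)"
  "z \<odot>\<^bsub>cocycles p X S\<^esub> \<phi> = (\<lambda>\<sigma>. z * \<phi> \<sigma>)"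
  "\<phi> \<in> carrier (cocycles p X S) \<longleftrightarrow>
     \<phi> \<in> carrier (cochains p X S) \<and> coboundary p X \<phi> = (\<lambda>\<sigma>. 0)"
  by (auto simp: cocycles_def cochains_simps)

lemma cocycles_closed:
  assumes "\<phi> \<in> carrier (cocycles p X S)"
  shows "\<psi> \<in> carrier (cocycles p X S) \<Longrightarrow> (\<lambda>\<sigma>. \<phi> \<sigma> + \<psi> \<sigma>) \<in> carrier (cocycles p X S)"
    and "(\<lambda>\<sigma>. z * \<phi> \<sigma>) \<in> carrier (cocycles p X S)"
proof -
  show "(\<lambda>\<sigma>. z * \<phi> \<sigma>) \<in> carrier (cocycles p X S)"
    using assms unfolding cocycles_simps by (auto simp: cochains_simps coboundary_scale)
  show "(\<lambda>\<sigma>. \<phi> \<sigma> + \<psi> \<sigma>) \<in> carrier (cocycles p X S)" if "\<psi> \<in> carrier (cocycles p X S)"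
    using assms that unfolding cocycles_simps
    by (auto simp: cochains_simps coboundary_add) (metis add.left_neutral)+
qed

lemma cocycles_zero: "(\<lambda>\<sigma>. 0) \<in> carrier (cocycles p X S)"
  by (auto simp: cocycles_simps cochains_simps coboundary_def cochain_eval_def)

lemma abelian_group_cocycles: "abelian_group (cocycles p X S)"
proof (rule abelian_groupI)
  fix \<phi> assume "\<phi> \<in> carrier (cocycles p X S)"
  then show "\<exists>\<psi>\<in>carrier (cocycles p X S). \<psi> \<oplus>\<^bsub>cocycles p X S\<^esub> \<phi> = \<zero>\<^bsub>cocycles p X S\<^esub>"
    by (intro bexI[of _ "\<lambda>\<sigma>. (-1) * \<phi> \<sigma>"] cocycles_closed(2)) (simp_all add: cocycles_simps(1,2))
qed (use cocycles_closed(1) cocycles_zero in \<open>auto simp: cocycles_simps(1-3) algebra_simps\<close>)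

lemma cocycles_neg:
  assumes "\<phi> \<in> carrier (cocycles p X S)"
  shows "\<ominus>\<^bsub>cocycles p X S\<^esub> \<phi> = -1 \<odot>\<^bsub>cocycles p X S\<^esub> \<phi>"
proof -
  interpret abelian_group "cocycles p X S" by (rule abelian_group_cocycles)
  show ?thesis
    by (rule minus_equality)
       (use assms cocycles_closed(2)[OF assms, of "-1"] in \<open>auto simp: cocycles_simps(1-3)\<close>)
qed

text \<open>The case of \<open>vector_quotient_quot\<close> in which the numerator consists of all cocycles.\<close>

lemma vector_quotient_cocycles:
  assumes N: "N \<subseteq> carrier (cocycles p X S)" "(\<lambda>\<sigma>. 0) \<in> N"
      "\<And>\<phi> \<psi>. \<phi> \<in> N \<Longrightarrow> \<psi> \<in> N \<Longrightarrow> (\<lambda>\<sigma>. \<phi> \<sigma> + \<psi> \<sigma>) \<in> N"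
      "\<And>z \<phi>. \<phi> \<in> N \<Longrightarrow> (\<lambda>\<sigma>. z * \<phi> \<sigma>) \<in> N"
    and V: "\<And>v w. v \<in> V \<Longrightarrow> w \<in> V \<Longrightarrow> (\<lambda>x. v x + w x) \<in> V" "\<And>z v. v \<in> V \<Longrightarrow> (\<lambda>x. z * v x) \<in> V"
    and N': "(\<lambda>x. 0) \<in> N'" "\<And>v w. v \<in> N' \<Longrightarrow> w \<in> N' \<Longrightarrow> (\<lambda>x. v x + w x) \<in> N'"
       "\<And>z v. v \<in> N' \<Longrightarrow> (\<lambda>x. z * v x) \<in> N'"
    and F: "\<And>\<phi>. \<phi> \<in> carrier (cocycles p X S) \<Longrightarrow> F \<phi> \<in> V"
       "\<And>\<phi> \<psi>. F (\<lambda>\<sigma>. \<phi> \<sigma> + \<psi> \<sigma>) = (\<lambda>i. F \<phi> i + F \<psi> i)"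
       "\<And>z \<phi>. F (\<lambda>\<sigma>. z * \<phi> \<sigma>) = (\<lambda>i. z * F \<phi> i)"
    and ker: "\<And>\<phi>. \<phi> \<in> carrier (cocycles p X S) \<Longrightarrow> F \<phi> \<in> N' \<longleftrightarrow> \<phi> \<in> N"
    and sur: "\<And>v. v \<in> V \<Longrightarrow> \<exists>\<phi>\<in>carrier (cocycles p X S). (\<lambda>i. v i - F \<phi> i) \<in> N'"
  shows "vector_quotient (quot_module (cocycles p X S) N) V N'"
proof -
  interpret abelian_group "cocycles p X S" by (rule abelian_group_cocycles)
  show ?thesis
  proof (rule vector_quotient_quot[where s = "\<lambda>z. z" and F = F and M = "cocycles p X S"
        and G = "carrier (cocycles p X S)", OF abelian_group_cocycles])
    show "additive_subgroup N (cocycles p X S)"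
    proof (intro additive_subgroup.intro subgroup.intro)
      fix \<phi> assume "\<phi> \<in> N"
      then have "inv\<^bsub>add_monoid (cocycles p X S)\<^esub> \<phi> = (\<lambda>\<sigma>. (-1) * \<phi> \<sigma>)"
        using cocycles_neg[of \<phi> p X S] N(1) unfolding a_inv_def cocycles_simps(3) by blast
      then show "inv\<^bsub>add_monoid (cocycles p X S)\<^esub> \<phi> \<in> N"
        using N(4)[OF \<open>\<phi> \<in> N\<close>, of "-1"] by simp
    qed (use N in \<open>auto simp: cocycles_simps(1,2)\<close>)
    show "carrier (quot_module (cocycles p X S) N) =
      (\<lambda>x. N +>\<^bsub>cocycles p X S\<^esub> x) ` carrier (cocycles p X S)"
      by (auto simp: quot_module_def A_RCOSETS_def')
    show "(\<oplus>\<^bsub>quot_module (cocycles p X S) N\<^esub>) = set_add (cocycles p X S)"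
      by (simp add: quot_module_def)
    show "z \<odot>\<^bsub>quot_module (cocycles p X S) N\<^esub> x =
       (\<Union>y\<in>x. N +>\<^bsub>cocycles p X S\<^esub> (z \<odot>\<^bsub>cocycles p X S\<^esub> y))" for z x
      by (simp add: quot_module_def)
    show "\<exists>\<phi>\<in>carrier (cocycles p X S). (\<lambda>i. v i - F \<phi> i) \<in> N'" if "v \<in> V" for v
      by (rule sur[OF that])
    show "F \<phi> \<in> N' \<longleftrightarrow> \<phi> \<in> N" if "\<phi> \<in> carrier (cocycles p X S)" for \<phi>
      by (rule ker[OF that])
  qed (use cocycles_closed N V N' F cocycles_neg in \<open>auto simp: cocycles_simps(1-3) algebra_simps\<close>)
qed

section \<open>Chains in contractible spaces\<close>

definition point_simplex :: "'a \<Rightarrow> (nat \<Rightarrow> real) \<Rightarrow> 'a" where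
  "point_simplex x = (\<lambda>_\<in>standard_simplex 0. x)"

lemma singular_simplex_0_iff:
  "singular_simplex 0 X \<sigma> \<longleftrightarrow> (\<exists>x\<in>topspace X. \<sigma> = point_simplex x)"
proof
  assume s: "singular_simplex 0 X \<sigma>"
  let ?e = "\<lambda>j::nat. if j = 0 then 1 else 0 :: real"
  have "\<sigma> ?e \<in> topspace X"
    using s unfolding singular_simplex_def by (auto simp: continuous_map_def topspace_standard_simplex standard_simplex_0)
  moreover have "\<sigma> = point_simplex (\<sigma> ?e)"
    using s unfolding singular_simplex_def point_simplex_def
    by (intro ext) (auto simp: standard_simplex_0 extensional_def)
  ultimately show "\<exists>x\<in>topspace X. \<sigma> = point_simplex x" by blast
qed (auto simp: singular_simplex_def point_simplex_def)

lemma point_simplex_inject [simp]: "point_simplex x = point_simplex y \<longleftrightarrow> x = y"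
  unfolding point_simplex_def using nonempty_standard_simplex[of 0]
  by (auto simp: fun_eq_iff restrict_def split: if_splits)

text \<open>A contraction makes the cycle homologous to one in a single point, where cycles of odd degree bound.\<close>

lemma contractible_odd_cycle_boundary:
  assumes "contractible_space X" "singular_chain p X c" "chain_boundary p c = 0" "odd p"
  shows "\<exists>d. singular_chain (Suc p) X d \<and> chain_boundary (Suc p) d = c"
proof (cases "topspace X = {}")
  case True
  then show ?thesis using assms(2) by (intro exI[of _ 0]) (simp add: singular_chain_empty)
next
  case False
  obtain a where a: "a \<in> topspace X" "homotopic_with (\<lambda>x. True) X X id (\<lambda>x. a)"
    using assms(1) False unfolding contractible_space_def
    using homotopic_with_imp_continuous_maps continuous_map_const by fastforce
  have cyc: "singular_relcycle p X {} c" using assms by (simp add: singular_cycle)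
  have "homologous_rel p X {} (chain_map p id c) (chain_map p (\<lambda>x. a) c)"
    by (rule homotopic_imp_homologous_rel_chain_maps[OF _ cyc]) (use a in simp)
  then have hom: "homologous_rel p X {} c (chain_map p (\<lambda>x. a) c)"
    using chain_map_id_gen[OF assms(2), of id] by simp
  have top: "topspace (subtopology X {a}) = {a}" using a by auto
  have "singular_relcycle p (subtopology X {a}) {} (chain_map p (\<lambda>x. a) c)"
    by (rule singular_relcycle_chain_map[OF cyc]) (use a in \<open>auto simp: continuous_map_in_subtopology\<close>)
  then have "singular_relboundary p (subtopology X {a}) {} (chain_map p (\<lambda>x. a) c)"
    using singular_boundary_eq_cycle_singleton[OF top, of p] \<open>odd p\<close> odd_pos by fastforce
  then have "singular_relboundary p X {} (chain_map p (\<lambda>x. a) c)"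
    using singular_boundary_mono[of "{a}" "topspace X" p X] a by (simp add: subtopology_topspace)
  then have "singular_relboundary p X {} c"
    using hom singular_relboundary_add unfolding homologous_rel_def by fastforce
  then show ?thesis by (simp add: singular_boundary)
qed

text \<open>A contraction makes every point homologous to one fixed point.\<close>

lemma contractible_points_joined:
  assumes "contractible_space X" "x \<in> topspace X" "y \<in> topspace X"
  shows "\<exists>d. singular_chain 1 X d \<and>
    chain_boundary 1 d = frag_of (point_simplex y) - frag_of (point_simplex x)"
proof -
  obtain a where a: "a \<in> topspace X" "homotopic_with (\<lambda>x. True) X X id (\<lambda>x. a)"
    using assms unfolding contractible_space_def
    using homotopic_with_imp_continuous_maps continuous_map_const by fastforce
  have *: "homologous_rel 0 X {} (frag_of (point_simplex z)) (frag_of (point_simplex a))"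
    if "z \<in> topspace X" for z
  proof -
    have s: "singular_simplex 0 X (point_simplex z)" using that singular_simplex_0_iff by blast
    then have cyc: "singular_relcycle 0 X {} (frag_of (point_simplex z))"
      by (simp add: singular_cycle singular_chain_of chain_boundary_def)
    have "homologous_rel 0 X {} (chain_map 0 id (frag_of (point_simplex z)))
        (chain_map 0 (\<lambda>x. a) (frag_of (point_simplex z)))"
      by (rule homotopic_imp_homologous_rel_chain_maps[OF _ cyc]) (use a in simp)
    moreover have "simplex_map 0 id (point_simplex z) = point_simplex z"
      "simplex_map 0 (\<lambda>x. a) (point_simplex z) = point_simplex a"
      unfolding simplex_map_def point_simplex_def by (auto simp: restrict_def)
    ultimately show ?thesis by simp
  qed
  have "homologous_rel 0 X {} (frag_of (point_simplex y)) (frag_of (point_simplex x))"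
    using *[OF assms(3)] *[OF assms(2)] homologous_rel_sym homologous_rel_trans by metis
  then show ?thesis by (simp add: homologous_rel_def singular_boundary)
qed

section \<open>Cohomology of posets in degrees 0 and 1\<close>

text \<open>Cocycles and coboundaries of the order complex of \<open>U\<close> relative to that of an up-closed subset \<open>U'\<close>. A
  1-cochain is a function on the pairs \<open>f \<subseteq> g\<close>, extended by 0. Reduced cohomology in degree 0 divides by
  \<open>poset_const\<close>.\<close>

definition poset_Z0 :: "nat set set \<Rightarrow> nat set set \<Rightarrow> (nat set \<Rightarrow> complex) set" where
  "poset_Z0 U U' = {l. (\<forall>f. f \<notin> U - U' \<longrightarrow> l f = 0) \<and> (\<forall>f\<in>U. \<forall>g\<in>U. f \<subseteq> g \<longrightarrow> l f = l g)}"

definition poset_const :: "nat set set \<Rightarrow> (nat set \<Rightarrow> complex) set" where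
  "poset_const U = range (\<lambda>z f. if f \<in> U then z else 0)"

definition poset_Z1 :: "nat set set \<Rightarrow> nat set set \<Rightarrow> (nat set \<times> nat set \<Rightarrow> complex) set" where
  "poset_Z1 U U' = {c. (\<forall>f g. \<not> (f \<in> U - U' \<and> g \<in> U \<and> f \<subseteq> g) \<longrightarrow> c (f, g) = 0) \<and>
     (\<forall>f\<in>U. \<forall>g\<in>U. \<forall>h\<in>U. f \<subseteq> g \<longrightarrow> g \<subseteq> h \<longrightarrow> c (f, h) = c (f, g) + c (g, h))}"

definition poset_delta :: "nat set set \<Rightarrow> (nat set \<Rightarrow> complex) \<Rightarrow> nat set \<times> nat set \<Rightarrow> complex" where
  "poset_delta U u = (\<lambda>(f, g). if f \<in> U \<and> g \<in> U \<and> f \<subseteq> g then u g - u f else 0)"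

definition poset_B1 :: "nat set set \<Rightarrow> nat set set \<Rightarrow> (nat set \<times> nat set \<Rightarrow> complex) set" where
  "poset_B1 U U' = poset_delta U ` {u. \<forall>f\<in>U'. u f = 0}"

lemma poset_Z0D:
  assumes "l \<in> poset_Z0 U U'"
  shows "f \<notin> U - U' \<Longrightarrow> l f = 0" "f \<in> U \<Longrightarrow> g \<in> U \<Longrightarrow> f \<subseteq> g \<Longrightarrow> l g = l f"
proof -
  note l = assms[unfolded poset_Z0_def mem_Collect_eq]
  show "l f = 0" if "f \<notin> U - U'" using l[THEN conjunct1] that by (elim allE impE)
  show "l g = l f" if "f \<in> U" "g \<in> U" "f \<subseteq> g"
    by (rule sym, rule l[THEN conjunct2, THEN bspec, THEN bspec, THEN mp]) (fact that)+
qed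

lemma poset_Z0I:
  assumes "\<And>f. f \<notin> U - U' \<Longrightarrow> l f = 0" "\<And>f g. f \<in> U \<Longrightarrow> g \<in> U \<Longrightarrow> f \<subseteq> g \<Longrightarrow> l g = l f"
  shows "l \<in> poset_Z0 U U'"
  unfolding poset_Z0_def mem_Collect_eq
  by (intro conjI allI ballI impI, erule assms(1), rule sym, rule assms(2))

lemma poset_Z1D:
  assumes "c \<in> poset_Z1 U U'"
  shows "\<not> (f \<in> U - U' \<and> g \<in> U \<and> f \<subseteq> g) \<Longrightarrow> c (f, g) = 0"
    "f \<in> U \<Longrightarrow> g \<in> U \<Longrightarrow> h \<in> U \<Longrightarrow> f \<subseteq> g \<Longrightarrow> g \<subseteq> h \<Longrightarrow> c (f, h) = c (f, g) + c (g, h)"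
proof -
  note c = assms[unfolded poset_Z1_def mem_Collect_eq]
  show "c (f, g) = 0" if "\<not> (f \<in> U - U' \<and> g \<in> U \<and> f \<subseteq> g)"
    by (rule c[THEN conjunct1, THEN spec, THEN spec, THEN mp]) (fact that)
  show "c (f, h) = c (f, g) + c (g, h)" if "f \<in> U" "g \<in> U" "h \<in> U" "f \<subseteq> g" "g \<subseteq> h"
    by (rule c[THEN conjunct2, THEN bspec, THEN bspec, THEN bspec, THEN mp, THEN mp]) (fact that)+
qed

lemma poset_Z1I:
  assumes "\<And>f g. \<not> (f \<in> U - U' \<and> g \<in> U \<and> f \<subseteq> g) \<Longrightarrow> c (f, g) = 0"
    "\<And>f g h. f \<in> U \<Longrightarrow> g \<in> U \<Longrightarrow> h \<in> U \<Longrightarrow> f \<subseteq> g \<Longrightarrow> g \<subseteq> h \<Longrightarrow> c (f, h) = c (f, g) + c (g, h)"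
  shows "c \<in> poset_Z1 U U'"
  unfolding poset_Z1_def mem_Collect_eq
  by (intro conjI allI ballI impI, erule assms(1), rule assms(2))

lemma poset_Z0_closed:
  assumes v: "v \<in> poset_Z0 U U'"
  shows "w \<in> poset_Z0 U U' \<Longrightarrow> (\<lambda>x. v x + w x) \<in> poset_Z0 U U'"
    "(\<lambda>x. z * v x) \<in> poset_Z0 U U'"
proof -
  show "(\<lambda>x. v x + w x) \<in> poset_Z0 U U'" if w: "w \<in> poset_Z0 U U'"
  proof (rule poset_Z0I)
    fix f g assume h: "f \<in> U" "g \<in> U" "f \<subseteq> g"
    show "v g + w g = v f + w f" unfolding poset_Z0D(2)[OF v h] poset_Z0D(2)[OF w h] ..
  qed (simp add: poset_Z0D(1)[OF v] poset_Z0D(1)[OF w])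
  show "(\<lambda>x. z * v x) \<in> poset_Z0 U U'"
  proof (rule poset_Z0I)
    fix f g assume h: "f \<in> U" "g \<in> U" "f \<subseteq> g"
    show "z * v g = z * v f" unfolding poset_Z0D(2)[OF v h] ..
  qed (simp add: poset_Z0D(1)[OF v])
qed

lemma poset_const_closed:
  "(\<lambda>x. 0) \<in> poset_const U"
  "v \<in> poset_const U \<Longrightarrow> w \<in> poset_const U \<Longrightarrow> (\<lambda>x. v x + w x) \<in> poset_const U"
  "v \<in> poset_const U \<Longrightarrow> (\<lambda>x. z * v x) \<in> poset_const U"
proof -
  show "(\<lambda>x. 0) \<in> poset_const U" unfolding poset_const_def by (intro range_eqI[of _ _ 0]) auto
  show "(\<lambda>x. v x + w x) \<in> poset_const U" if vw: "v \<in> poset_const U" "w \<in> poset_const U"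
  proof -
    obtain a b where "v = (\<lambda>f. if f \<in> U then a else 0)" "w = (\<lambda>f. if f \<in> U then b else 0)"
      using vw unfolding poset_const_def by auto
    then show ?thesis unfolding poset_const_def by (intro range_eqI[of _ _ "a + b"]) auto
  qed
  show "(\<lambda>x. z * v x) \<in> poset_const U" if v: "v \<in> poset_const U"
  proof -
    obtain a where "v = (\<lambda>f. if f \<in> U then a else 0)" using v unfolding poset_const_def by auto
    then show ?thesis unfolding poset_const_def by (intro range_eqI[of _ _ "z * a"]) auto
  qed
qed

lemma poset_Z1_closed:
  assumes v: "v \<in> poset_Z1 U U'"
  shows "w \<in> poset_Z1 U U' \<Longrightarrow> (\<lambda>x. v x + w x) \<in> poset_Z1 U U'"
    "(\<lambda>x. z * v x) \<in> poset_Z1 U U'"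
proof -
  show "(\<lambda>x. v x + w x) \<in> poset_Z1 U U'" if w: "w \<in> poset_Z1 U U'"
  proof (rule poset_Z1I)
    fix f g h assume h: "f \<in> U" "g \<in> U" "h \<in> U" "f \<subseteq> g" "g \<subseteq> h"
    show "v (f, h) + w (f, h) = v (f, g) + w (f, g) + (v (g, h) + w (g, h))"
      unfolding poset_Z1D(2)[OF v h] poset_Z1D(2)[OF w h] by simp
  qed (simp add: poset_Z1D(1)[OF v] poset_Z1D(1)[OF w])
  show "(\<lambda>x. z * v x) \<in> poset_Z1 U U'"
  proof (rule poset_Z1I)
    fix f g h assume h: "f \<in> U" "g \<in> U" "h \<in> U" "f \<subseteq> g" "g \<subseteq> h"
    show "z * v (f, h) = z * v (f, g) + z * v (g, h)"
      unfolding poset_Z1D(2)[OF v h] by (simp add: algebra_simps)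
  qed (simp add: poset_Z1D(1)[OF v])
qed

lemma poset_B1_closed:
  "(\<lambda>x. 0) \<in> poset_B1 U U'"
  "v \<in> poset_B1 U U' \<Longrightarrow> w \<in> poset_B1 U U' \<Longrightarrow> (\<lambda>x. v x + w x) \<in> poset_B1 U U'"
  "v \<in> poset_B1 U U' \<Longrightarrow> (\<lambda>x. z * v x) \<in> poset_B1 U U'"
proof -
  show "(\<lambda>x. 0) \<in> poset_B1 U U'"
    unfolding poset_B1_def by (intro image_eqI[of _ _ "\<lambda>f. 0"]) (auto simp: poset_delta_def)
  show "(\<lambda>x. v x + w x) \<in> poset_B1 U U'" if vw: "v \<in> poset_B1 U U'" "w \<in> poset_B1 U U'"
  proof -
    obtain a b where "v = poset_delta U a" "w = poset_delta U b" "\<forall>f\<in>U'. a f = 0" "\<forall>f\<in>U'. b f = 0"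
      using vw unfolding poset_B1_def by auto
    then show ?thesis unfolding poset_B1_def
      by (intro image_eqI[of _ _ "\<lambda>f. a f + b f"]) (auto simp: poset_delta_def)
  qed
  show "(\<lambda>x. z * v x) \<in> poset_B1 U U'" if v: "v \<in> poset_B1 U U'"
  proof -
    obtain a where "v = poset_delta U a" "\<forall>f\<in>U'. a f = 0"
      using v unfolding poset_B1_def by auto
    then show ?thesis unfolding poset_B1_def
      by (intro image_eqI[of _ _ "\<lambda>f. z * a f"]) (auto simp: poset_delta_def algebra_simps)
  qed
qed

section \<open>Spaces stratified by a poset of faces\<close>

definition star :: "'a topology \<Rightarrow> ('a \<Rightarrow> nat set) \<Rightarrow> nat set \<Rightarrow> 'a set" where
  "star T car f = {x \<in> topspace T. f \<subseteq> car x}"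

text \<open>The function \<open>car\<close> sends a point to the face whose stratum contains it, and \<open>pt f\<close> is a base point of the
  stratum of \<open>f\<close>. The assumption \<open>join\<close> makes the intersection of two stars either empty or a star. Only the stars
  of a cover have to be open: when the empty face is present its star is the whole space and covers alone,
  whereas the stars of the other faces are difficult to control near the apex.\<close>

locale stratified_space =
  fixes T :: "'a topology" and car :: "'a \<Rightarrow> nat set" and pt :: "nat set \<Rightarrow> 'a"
    and U U' :: "nat set set"
  assumes car_in: "x \<in> topspace T \<Longrightarrow> car x \<in> U"
    and pt: "f \<in> U \<Longrightarrow> pt f \<in> topspace T" "f \<in> U \<Longrightarrow> car (pt f) = f"
    and sub: "U' \<subseteq> U"
    and up: "f \<in> U' \<Longrightarrow> g \<in> U \<Longrightarrow> f \<subseteq> g \<Longrightarrow> g \<in> U'"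
    and join: "f \<in> U \<Longrightarrow> g \<in> U \<Longrightarrow> h \<in> U \<Longrightarrow> f \<subseteq> h \<Longrightarrow> g \<subseteq> h \<Longrightarrow> f \<union> g \<in> U"
    and star_contractible: "f \<in> U \<Longrightarrow> contractible_space (subtopology T (star T car f))"
    and cover: "\<exists>G\<subseteq>U. (\<forall>g\<in>G. openin T (star T car g)) \<and> topspace T \<subseteq> (\<Union>g\<in>G. star T car g)"
    and cover': "\<exists>G\<subseteq>U'. (\<forall>g\<in>G. openin (subtopology T {x \<in> topspace T. car x \<in> U'}) (star T car g)) \<and>
        {x \<in> topspace T. car x \<in> U'} \<subseteq> (\<Union>g\<in>G. star T car g)"
begin

abbreviation St :: "nat set \<Rightarrow> 'a set" where "St \<equiv> star T car"

abbreviation S :: "'a set" where "S \<equiv> {x \<in> topspace T. car x \<in> U'}"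

abbreviation small :: "((nat \<Rightarrow> real) \<Rightarrow> 'a) \<Rightarrow> nat \<Rightarrow> bool" where
  "small \<sigma> p \<equiv> \<exists>g\<in>U. singular_simplex p (subtopology T (St g)) \<sigma>"

lemma star_mono: "f \<subseteq> g \<Longrightarrow> St g \<subseteq> St f"
  by (auto simp: star_def)

lemma star_subset: "St f \<subseteq> topspace T"
  by (auto simp: star_def)

lemma star_sub_S: "f \<in> U' \<Longrightarrow> St f \<subseteq> S"
  using up car_in by (auto simp: star_def)

lemma singular_chain_star:
  "singular_chain p (subtopology T (St g)) c \<Longrightarrow> singular_chain p T c"
  by (simp add: singular_chain_subtopology)

lemma star_cycle_boundary:
  assumes "g \<in> U" "singular_chain 1 (subtopology T (St g)) c" "chain_boundary 1 c = 0"
  shows "\<exists>d. singular_chain 2 T d \<and> chain_boundary 2 d = c"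
  using contractible_odd_cycle_boundary[OF star_contractible[OF assms(1)] assms(2,3)]
    singular_chain_star by (auto simp: numeral_2_eq_2)

text \<open>The Lebesgue number argument, applied to the cover by open stars.\<close>

lemma eventually_small:
  assumes "singular_chain p T c"
  obtains N where "\<And>M \<sigma>. N \<le> M \<Longrightarrow> \<sigma> \<in> Poly_Mapping.keys ((singular_subdivision p ^^ M) c) \<Longrightarrow> small \<sigma> p"
proof -
  obtain G where G: "G \<subseteq> U" "\<forall>g\<in>G. openin T (St g)" "topspace T \<subseteq> (\<Union>g\<in>G. St g)"
    using cover by blast
  obtain N where N: "\<And>M \<sigma>. N \<le> M \<Longrightarrow> \<sigma> \<in> Poly_Mapping.keys ((singular_subdivision p ^^ M) c)
      \<Longrightarrow> \<exists>V\<in>St ` G. \<sigma> \<in> standard_simplex p \<rightarrow> V"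
    by (rule sufficient_iterated_singular_subdivision_exists[of "St ` G" T p c])
      (use G assms in auto)
  have "singular_chain p T ((singular_subdivision p ^^ M) c)" for M
    by (induction M) (auto simp: singular_chain_singular_subdivision assms)
  then have T: "singular_simplex p T \<sigma>" if "\<sigma> \<in> Poly_Mapping.keys ((singular_subdivision p ^^ M) c)" for M \<sigma>
    using that unfolding singular_chain_def by auto
  show ?thesis
  proof (rule that)
    fix M \<sigma> assume *: "N \<le> M" "\<sigma> \<in> Poly_Mapping.keys ((singular_subdivision p ^^ M) c)"
    then obtain g where "g \<in> G" "\<sigma> \<in> standard_simplex p \<rightarrow> St g" using N by blast
    then show "small \<sigma> p"
      using T[OF *(2)] G(1) by (intro bexI[of _ g]) (auto simp: singular_simplex_subtopology)
  qed
qed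

lemma subdivision_points [simp]:
  "singular_chain 0 T c \<Longrightarrow> (singular_subdivision 0 ^^ M) c = c"
  by (induction M) (auto simp: singular_subdivision_zero)

lemma subdivision_chain:
  "singular_chain p X c \<Longrightarrow> singular_chain p X ((singular_subdivision p ^^ M) c)"
  by (induction M) (auto simp: singular_chain_singular_subdivision)

lemma boundary_subdivision:
  "singular_chain (Suc p) X c \<Longrightarrow> chain_boundary (Suc p) ((singular_subdivision (Suc p) ^^ M) c)
     = (singular_subdivision p ^^ M) (chain_boundary (Suc p) c)"
proof (induction M)
  case (Suc M)
  then show ?case
    using chain_boundary_singular_subdivision[of "Suc p" X "(singular_subdivision (Suc p) ^^ M) c"]
      subdivision_chain[of "Suc p" X c M] by simp
qed simp

text \<open>Subdivision changes a 1-chain by a boundary and by 1-chains that lie in stars; a sufficiently fine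
  subdivision is itself a sum of simplices that lie in stars.\<close>

lemma chain_functional_zero:
  fixes E :: "'a chain \<Rightarrow> complex"
  assumes diff: "\<And>a b. E (a - b) = E a - E b"
    and bd: "\<And>d. singular_chain 2 T d \<Longrightarrow> E (chain_boundary 2 d) = 0"
    and local: "\<And>g c. g \<in> U \<Longrightarrow> singular_chain 1 (subtopology T (St g)) c \<Longrightarrow> E c = 0"
    and c: "singular_chain 1 T c"
  shows "E c = 0"
proof -
  have E0: "E 0 = 0" using diff[of 0 0] by simp
  have E_add: "E (a + b) = E a + E b" for a b using diff[of "a + b" b] by simp
  obtain N where N: "\<And>M \<sigma>. N \<le> M \<Longrightarrow> \<sigma> \<in> Poly_Mapping.keys ((singular_subdivision 1 ^^ M) c) \<Longrightarrow> small \<sigma> 1"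
    using eventually_small[OF c] by blast
  have "E ((singular_subdivision 1 ^^ N) c) = 0"
  proof -
    have "Poly_Mapping.keys ((singular_subdivision 1 ^^ N) c) \<subseteq> {\<sigma>. small \<sigma> 1}" using N by blast
    then show ?thesis
    proof (induction rule: frag_induction)
      case (one \<sigma>)
      then show ?case using local by (auto simp: singular_chain_of)
    qed (auto simp: E0 diff)
  qed
  moreover obtain h where h: "\<And>p. h p 0 = (0 :: 'a chain)"
        "\<And>p c1 c2. h p (c1 - c2) = h p c1 - h p c2"
        "\<And>p X c. singular_chain p X c \<Longrightarrow> singular_chain (Suc p) X (h p c)"
        "\<And>p X c. singular_chain p X c
            \<Longrightarrow> chain_boundary (Suc p) (h p c) + h (p - Suc 0) (chain_boundary p c)
                   = (singular_subdivision p ^^ N) c - c"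
    using chain_homotopic_iterated_singular_subdivision[of N] by blast
  have h0: "E (h 0 d) = 0" if "singular_chain 0 T d" for d
    using that unfolding singular_chain_def
  proof (induction rule: frag_induction)
    case (one \<sigma>)
    then obtain x where x: "x \<in> topspace T" "\<sigma> = point_simplex x"
      by (auto simp: singular_simplex_0_iff)
    then have "singular_chain 0 (subtopology T (St (car x))) (frag_of \<sigma>)"
      unfolding singular_chain_of singular_simplex_0_iff by (auto simp: star_def)
    then have "singular_chain 1 (subtopology T (St (car x))) (h 0 (frag_of \<sigma>))"
      using h(3) One_nat_def by metis
    then show ?case using local car_in[OF x(1)] by blast
  qed (auto simp: h E0 diff)
  have "chain_boundary 2 (h 1 c) + h 0 (chain_boundary 1 c) = (singular_subdivision 1 ^^ N) c - c"
    using h(4)[OF c] by (simp add: numeral_2_eq_2)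
  then have "E ((singular_subdivision 1 ^^ N) c) - E c = E (chain_boundary 2 (h 1 c)) + E (h 0 (chain_boundary 1 c))"
    using diff E_add by metis
  moreover have "E (chain_boundary 2 (h 1 c)) = 0"
    using bd h(3)[OF c] by (simp add: numeral_2_eq_2)
  moreover have "E (h 0 (chain_boundary 1 c)) = 0"
    using h0 singular_chain_boundary[OF c] by simp
  ultimately show ?thesis by simp
qed

definition arc :: "nat set \<Rightarrow> 'a \<Rightarrow> 'a chain" where
  "arc f x = (SOME d. singular_chain 1 (subtopology T (St f)) d \<and>
     chain_boundary 1 d = frag_of (point_simplex x) - frag_of (point_simplex (pt f)))"

lemma arc:
  assumes "f \<in> U" "x \<in> St f"
  shows "singular_chain 1 (subtopology T (St f)) (arc f x)"
    and "chain_boundary 1 (arc f x) = frag_of (point_simplex x) - frag_of (point_simplex (pt f))"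
proof -
  have "pt f \<in> St f" using pt assms by (auto simp: star_def)
  then have "\<exists>d. singular_chain 1 (subtopology T (St f)) d \<and>
     chain_boundary 1 d = frag_of (point_simplex x) - frag_of (point_simplex (pt f))"
    using assms star_subset by (intro contractible_points_joined star_contractible) auto
  from someI_ex[OF this] show "singular_chain 1 (subtopology T (St f)) (arc f x)"
    and "chain_boundary 1 (arc f x) = frag_of (point_simplex x) - frag_of (point_simplex (pt f))"
    unfolding arc_def by blast+
qed

lemma pt_in_star: "f \<subseteq> g \<Longrightarrow> g \<in> U \<Longrightarrow> pt g \<in> St f"
  using pt by (auto simp: star_def)

lemma chain_in_larger_star:
  assumes "f \<subseteq> g" "singular_chain p (subtopology T (St g)) c"
  shows "singular_chain p (subtopology T (St f)) c"
  by (rule singular_chain_mono[OF assms(2) star_mono[OF assms(1)]])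

lemma vanish_on_S:
  assumes "\<phi> \<in> carrier (cochains p T S)" "f \<in> U'" "singular_chain p (subtopology T (St f)) c"
  shows "cochain_eval \<phi> c = 0"
proof -
  have "\<phi> \<sigma> = 0" if "\<sigma> \<in> Poly_Mapping.keys c" for \<sigma>
  proof -
    have "singular_simplex p (subtopology T (St f)) \<sigma>"
      using assms(3) that by (auto simp: singular_chain_def)
    then have "singular_simplex p (subtopology T S) \<sigma>"
      by (rule singular_simplex_mono[OF _ star_sub_S[OF assms(2)]])
    then show ?thesis using assms(1)[unfolded cochains_simps, THEN spec, of \<sigma>] by argo
  qed
  then show ?thesis by (simp add: cochain_eval_def)
qed

subsection \<open>Degree 0\<close>

definition face_values :: "(((nat \<Rightarrow> real) \<Rightarrow> 'a) \<Rightarrow> complex) \<Rightarrow> nat set \<Rightarrow> complex" where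
  "face_values \<phi> = (\<lambda>f. if f \<in> U then \<phi> (point_simplex (pt f)) else 0)"

text \<open>The two points are joined by a chain in the star of \<open>f\<close>.\<close>

lemma cocycle0_constant:
  assumes "\<phi> \<in> carrier (cocycles 0 T S')" "f \<in> U" "x \<in> St f"
  shows "\<phi> (point_simplex x) = \<phi> (point_simplex (pt f))"
proof -
  have "cochain_eval \<phi> (chain_boundary 1 (arc f x)) = 0"
    using coboundary_zero_imp_eval[of 0 T \<phi> "arc f x"] assms arc(1)[OF assms(2,3)] singular_chain_star
    by (simp add: cocycles_simps)
  then have "cochain_eval \<phi> (frag_of (point_simplex x) - frag_of (point_simplex (pt f))) = 0"
    unfolding arc(2)[OF assms(2,3)] .
  then show ?thesis by (simp add: cochain_eval_diff)
qed

lemma cocycle0_eqI: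
  assumes "\<phi> \<in> carrier (cocycles 0 T S')" "\<psi> \<in> carrier (cocycles 0 T S')"
    "\<And>f. f \<in> U \<Longrightarrow> face_values \<phi> f = face_values \<psi> f"
  shows "\<phi> = \<psi>"
proof
  fix \<sigma>
  show "\<phi> \<sigma> = \<psi> \<sigma>"
  proof (cases "singular_simplex 0 T \<sigma>")
    case True
    then obtain x where x: "x \<in> topspace T" "\<sigma> = point_simplex x" by (auto simp: singular_simplex_0_iff)
    then have "x \<in> St (car x)" "car x \<in> U" using car_in by (auto simp: star_def)
    then show ?thesis
      using cocycle0_constant[OF assms(1)] cocycle0_constant[OF assms(2)] assms(3)[of "car x"] x(2)
      by (simp add: face_values_def)
  next
    case False
    then have "\<phi> \<sigma> = 0" "\<psi> \<sigma> = 0"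
      using assms(1,2)[unfolded cocycles_simps cochains_simps, THEN conjunct1, THEN spec, of \<sigma>] by argo+
    then show ?thesis by simp
  qed
qed

text \<open>A singular 0-simplex is evaluated at the only point of the standard 0-simplex.\<close>

definition spread_values :: "(nat set \<Rightarrow> complex) \<Rightarrow> ((nat \<Rightarrow> real) \<Rightarrow> 'a) \<Rightarrow> complex" where
  "spread_values l \<sigma> = (if singular_simplex 0 T \<sigma> then l (car (\<sigma> (\<lambda>j. if j = 0 then 1 else 0))) else 0)"

lemma spread_values_point [simp]:
  "x \<in> topspace T \<Longrightarrow> spread_values l (point_simplex x) = l (car x)"
  using singular_simplex_0_iff[of T "point_simplex x"]
  by (auto simp: spread_values_def) (simp add: point_simplex_def standard_simplex_0)

lemma eval_zero_on_starI:
  assumes "singular_chain 0 (subtopology T (St g)) d" "\<And>x. x \<in> St g \<Longrightarrow> E (frag_of (point_simplex x)) = 0"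
    "\<And>a b. E (a - b) = E a - E b"
  shows "E d = (0::complex)"
  using assms(1) unfolding singular_chain_def
proof (induction rule: frag_induction)
  case zero
  then show ?case using assms(3)[of 0 0] by simp
next
  case (one \<sigma>)
  then show ?case using assms(2) singular_simplex_0_iff[of "subtopology T (St g)" \<sigma>] by auto
qed (simp add: assms(3))

lemma spread_const_boundary:
  assumes "singular_chain 1 T c"
  shows "cochain_eval (spread_values (\<lambda>_. z)) (chain_boundary 1 c) = 0"
  using assms unfolding singular_chain_def
proof (induction rule: frag_induction)
  case (one \<sigma>)
  then have "singular_simplex 0 T (singular_face 1 k \<sigma>)" if "k \<le> 1" for k
    using singular_simplex_singular_face[of 1 T \<sigma> k] that by auto
  then show ?case
    by (simp add: chain_boundary_of cochain_eval_diff cochain_eval_add spread_values_def flip: diff_conv_add_uminus)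
qed (auto simp: chain_boundary_diff cochain_eval_diff)

text \<open>On the star of \<open>g\<close> the cochain has the constant value \<open>l g\<close>, so it is closed there; being closed is a
  local condition by \<open>chain_functional_zero\<close>.\<close>

lemma spread_values_cocycle:
  assumes l: "l \<in> poset_Z0 U U'"
  shows "spread_values l \<in> carrier (cocycles 0 T S)" "face_values (spread_values l) = l"
proof -
  have c: "spread_values l \<in> carrier (cochains 0 T S)"
    unfolding cochains_simps
  proof (intro allI impI conjI notI)
    fix \<sigma> assume n: "spread_values l \<sigma> \<noteq> 0"
    then show s: "singular_simplex 0 T \<sigma>" by (auto simp: spread_values_def split: if_splits)
    assume "singular_simplex 0 (subtopology T S) \<sigma>"
    then obtain x where "x \<in> S" "\<sigma> = point_simplex x" by (auto simp: singular_simplex_0_iff)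
    then show False using n poset_Z0D(1)[OF l, of "car x"] by auto
  qed
  have E: "cochain_eval (spread_values l) (chain_boundary 1 d) = 0" if "singular_chain 1 T d" for d
  proof (rule chain_functional_zero[where E = "\<lambda>c. cochain_eval (spread_values l) (chain_boundary 1 c)"])
    fix d :: "'a chain" assume "singular_chain 2 T d"
    then show "cochain_eval (spread_values l) (chain_boundary 1 (chain_boundary 2 d)) = 0"
      using chain_boundary_boundary[of 2 T d] by simp
  next
    fix g c assume g: "g \<in> U" "singular_chain 1 (subtopology T (St g)) c"
    have "cochain_eval (\<lambda>\<sigma>. spread_values l \<sigma> + (-1) * spread_values (\<lambda>_. l g) \<sigma>) (chain_boundary 1 c) = 0"
    proof (rule eval_zero_on_starI[where E = "cochain_eval (\<lambda>\<sigma>. spread_values l \<sigma> + (-1) * spread_values (\<lambda>_. l g) \<sigma>)"])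
      show "singular_chain 0 (subtopology T (St g)) (chain_boundary 1 c)"
        using singular_chain_boundary[OF g(2)] by simp
      fix x assume x: "x \<in> St g"
      then have "x \<in> topspace T" "l (car x) = l g"
        using poset_Z0D(2)[OF l, of g "car x"] g car_in unfolding star_def by auto
      then show "cochain_eval (\<lambda>\<sigma>. spread_values l \<sigma> + (-1) * spread_values (\<lambda>_. l g) \<sigma>) (frag_of (point_simplex x)) = 0"
        by simp
    qed (simp add: cochain_eval_diff)
    moreover have "cochain_eval (spread_values (\<lambda>_. l g)) (chain_boundary 1 c) = 0"
      by (rule spread_const_boundary[OF singular_chain_star[OF g(2)]])
    ultimately show "cochain_eval (spread_values l) (chain_boundary 1 c) = 0"
      unfolding cochain_eval_add_cochain cochain_eval_scale by simp
  qed (use that in \<open>auto simp: chain_boundary_diff cochain_eval_diff\<close>)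
  show "spread_values l \<in> carrier (cocycles 0 T S)"
    using c E by (auto simp: cocycles_simps intro: coboundary_zeroI)
  show "face_values (spread_values l) = l"
  proof
    fix f show "face_values (spread_values l) f = l f"
      using poset_Z0D(1)[OF l, of f] pt[of f] by (simp add: face_values_def)
  qed
qed

lemma face_values_Z0:
  assumes "\<phi> \<in> carrier (cocycles 0 T S)"
  shows "face_values \<phi> \<in> poset_Z0 U U'"
proof (rule poset_Z0I)
  fix f assume f: "f \<notin> U - U'"
  show "face_values \<phi> f = 0"
  proof (cases "f \<in> U")
    case True
    then have "pt f \<in> S" using f pt by auto
    then have "singular_simplex 0 (subtopology T S) (point_simplex (pt f))"
      by (auto simp: singular_simplex_0_iff)
    then show ?thesis using assms unfolding cocycles_simps cochains_simps face_values_def by auto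
  qed (simp add: face_values_def)
next
  fix f g assume "f \<in> U" "g \<in> U" "f \<subseteq> g"
  then show "face_values \<phi> g = face_values \<phi> f"
    using cocycle0_constant[OF assms, of f "pt g"] pt_in_star by (auto simp: face_values_def)
qed

lemma face_values_linear:
  "face_values (\<lambda>\<sigma>. \<phi> \<sigma> + \<psi> \<sigma>) = (\<lambda>f. face_values \<phi> f + face_values \<psi> f)"
  "face_values (\<lambda>\<sigma>. z * \<phi> \<sigma>) = (\<lambda>f. z * face_values \<phi> f)"
  by (auto simp: face_values_def)

lemma rel_cohomology_0:
  "vector_quotient (rel_cohomology 0 T S) (poset_Z0 U U') {\<lambda>_. 0}"
  unfolding rel_cohomology_def
proof (rule vector_quotient_cocycles[where F = face_values])
  show "coboundaries 0 T S \<subseteq> carrier (cocycles 0 T S)"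
    by (simp add: coboundaries_def cocycles_zero)
  show "face_values \<phi> \<in> {\<lambda>_. 0} \<longleftrightarrow> \<phi> \<in> coboundaries 0 T S" if \<phi>: "\<phi> \<in> carrier (cocycles 0 T S)" for \<phi>
  proof
    assume "face_values \<phi> \<in> {\<lambda>_. 0}"
    then have "\<phi> = (\<lambda>\<sigma>. 0)" using cocycle0_eqI[OF \<phi> cocycles_zero] by (simp add: face_values_def)
    then show "\<phi> \<in> coboundaries 0 T S" by (simp add: coboundaries_def)
  qed (auto simp: coboundaries_def face_values_def)
  show "\<exists>\<phi>\<in>carrier (cocycles 0 T S). (\<lambda>i. v i - face_values \<phi> i) \<in> {\<lambda>_. 0}" if "v \<in> poset_Z0 U U'" for v
    using spread_values_cocycle[OF that] by (intro bexI[of _ "spread_values v"]) auto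
qed (auto simp: coboundaries_def poset_Z0_closed face_values_Z0 face_values_linear)

text \<open>The constants that are divided out are the spread constant functions on \<open>U\<close>.\<close>

lemma reduced_cohomology_0:
  assumes "U' = {}"
  shows "vector_quotient (reduced_cohomology 0 T) (poset_Z0 U U') (poset_const U)"
proof -
  have S: "S = {}" using assms by simp
  define K where "K z = (\<lambda>\<sigma>. if singular_simplex 0 T \<sigma> then z else 0 :: complex)" for z
  have red: "reduced_coboundaries 0 T = range K"
    unfolding reduced_coboundaries_def K_def by simp
  have Z: "(\<lambda>f. if f \<in> U then z else 0) \<in> poset_Z0 U U'" for z
    using assms by (intro poset_Z0I) auto
  have Kspread: "K z = spread_values (\<lambda>f. if f \<in> U then z else 0)" for z
  proof
    fix \<sigma>
    show "K z \<sigma> = spread_values (\<lambda>f. if f \<in> U then z else 0) \<sigma>"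
    proof (cases "singular_simplex 0 T \<sigma>")
      case True
      then obtain x where "x \<in> topspace T" "\<sigma> = point_simplex x" by (auto simp: singular_simplex_0_iff)
      then show ?thesis using True car_in by (simp add: K_def)
    qed (simp add: K_def spread_values_def)
  qed
  have K: "K z \<in> carrier (cocycles 0 T {})" "face_values (K z) = (\<lambda>f. if f \<in> U then z else 0)" for z
    using spread_values_cocycle[OF Z[of z]] unfolding Kspread S by auto
  have "vector_quotient (quot_module (cocycles 0 T {}) (range K)) (poset_Z0 U U') (poset_const U)"
  proof (rule vector_quotient_cocycles[where F = face_values])
    show "range K \<subseteq> carrier (cocycles 0 T {})" using K by auto
    show "(\<lambda>\<sigma>. 0) \<in> range K" by (rule range_eqI[of _ _ 0]) (simp add: K_def)
    show "(\<lambda>\<sigma>. \<phi> \<sigma> + \<psi> \<sigma>) \<in> range K" if pq: "\<phi> \<in> range K" "\<psi> \<in> range K" for \<phi> \<psi>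
    proof -
      obtain a b where "\<phi> = K a" "\<psi> = K b" using pq by auto
      then show ?thesis by (intro range_eqI[of _ _ "a + b"]) (auto simp: K_def)
    qed
    show "(\<lambda>\<sigma>. z * \<phi> \<sigma>) \<in> range K" if p: "\<phi> \<in> range K" for z \<phi>
    proof -
      obtain a where "\<phi> = K a" using p by auto
      then show ?thesis by (intro range_eqI[of _ _ "z * a"]) (auto simp: K_def)
    qed
    show "face_values \<phi> \<in> poset_const U \<longleftrightarrow> \<phi> \<in> range K" if \<phi>: "\<phi> \<in> carrier (cocycles 0 T {})" for \<phi>
    proof
      assume "face_values \<phi> \<in> poset_const U"
      then obtain z where "face_values \<phi> = (\<lambda>f. if f \<in> U then z else 0)" unfolding poset_const_def by auto
      then have "\<phi> = K z" using cocycle0_eqI[OF \<phi> K(1)[of z]] K(2)[of z] by simp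
      then show "\<phi> \<in> range K" by simp
    next
      assume "\<phi> \<in> range K"
      then show "face_values \<phi> \<in> poset_const U" using K(2) unfolding poset_const_def by auto
    qed
    show "\<exists>\<phi>\<in>carrier (cocycles 0 T {}). (\<lambda>i. v i - face_values \<phi> i) \<in> poset_const U" if "v \<in> poset_Z0 U U'" for v
      using spread_values_cocycle[OF that] poset_const_closed(1) S
      by (intro bexI[of _ "spread_values v"]) auto
    show "face_values \<phi> \<in> poset_Z0 U U'" if "\<phi> \<in> carrier (cocycles 0 T {})" for \<phi>
      using face_values_Z0[of \<phi>] that S by simp
  qed (auto simp: poset_Z0_closed face_values_linear poset_const_closed)
  then show ?thesis unfolding reduced_cohomology_def red .
qed

subsection \<open>Degree 1\<close>

definition arc_values :: "(((nat \<Rightarrow> real) \<Rightarrow> 'a) \<Rightarrow> complex) \<Rightarrow> nat set \<times> nat set \<Rightarrow> complex" where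
  "arc_values \<phi> = (\<lambda>(f, g). if f \<in> U - U' \<and> g \<in> U \<and> f \<subseteq> g then cochain_eval \<phi> (arc f (pt g)) else 0)"

text \<open>A 1-cycle in a star bounds, as the star is contractible.\<close>

lemma cocycle1_zero_on_cycle:
  assumes "\<phi> \<in> carrier (cocycles 1 T S)" "g \<in> U" "singular_chain 1 (subtopology T (St g)) c" "chain_boundary 1 c = 0"
  shows "cochain_eval \<phi> c = 0"
proof -
  obtain d where d: "singular_chain 2 T d" "chain_boundary 2 d = c"
    using star_cycle_boundary[OF assms(2-4)] by blast
  have "coboundary 1 T \<phi> = (\<lambda>\<sigma>. 0)" using assms(1) by (simp add: cocycles_simps)
  from coboundary_zero_imp_eval[OF this, of d] d show ?thesis by (simp add: numeral_2_eq_2)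
qed

text \<open>The two paths from \<open>pt f\<close> to \<open>x\<close> form a cycle in the star of \<open>f\<close>.\<close>

lemma arc_concat:
  assumes "\<phi> \<in> carrier (cocycles 1 T S)" "f \<in> U" "g \<in> U" "f \<subseteq> g" "x \<in> St g"
  shows "cochain_eval \<phi> (arc f x) = cochain_eval \<phi> (arc f (pt g)) + cochain_eval \<phi> (arc g x)"
proof -
  have x: "x \<in> St f" using assms(4,5) star_mono by blast
  have p: "pt g \<in> St f" using pt_in_star assms by blast
  let ?c = "arc f x - (arc f (pt g) + arc g x)"
  have "singular_chain 1 (subtopology T (St f)) ?c"
    by (intro singular_chain_diff singular_chain_add arc(1)[OF assms(2) x] arc(1)[OF assms(2) p]
        chain_in_larger_star[OF assms(4) arc(1)[OF assms(3,5)]])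
  moreover have "chain_boundary 1 ?c = 0"
    unfolding chain_boundary_diff chain_boundary_add arc(2)[OF assms(2) x] arc(2)[OF assms(2) p] arc(2)[OF assms(3,5)]
    by simp
  ultimately have "cochain_eval \<phi> ?c = 0" by (rule cocycle1_zero_on_cycle[OF assms(1,2)])
  then show ?thesis by (simp add: cochain_eval_diff cochain_eval_add)
qed

lemma arc_values_eq:
  assumes "\<phi> \<in> carrier (cocycles 1 T S)" "f \<in> U" "g \<in> U" "f \<subseteq> g"
  shows "arc_values \<phi> (f, g) = cochain_eval \<phi> (arc f (pt g))"
proof (cases "f \<in> U'")
  case True
  have "\<phi> \<in> carrier (cochains 1 T S)" using assms(1) by (simp add: cocycles_simps)
  from vanish_on_S[OF this True arc(1)[OF assms(2) pt_in_star[OF assms(4,3)]]] show ?thesis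
    using True by (simp add: arc_values_def)
qed (use assms in \<open>simp add: arc_values_def\<close>)

lemma arc_values_Z1:
  assumes \<phi>: "\<phi> \<in> carrier (cocycles 1 T S)"
  shows "arc_values \<phi> \<in> poset_Z1 U U'"
proof (rule poset_Z1I)
  fix f g h assume *: "f \<in> U" "g \<in> U" "h \<in> U" "f \<subseteq> g" "g \<subseteq> h"
  then show "arc_values \<phi> (f, h) = arc_values \<phi> (f, g) + arc_values \<phi> (g, h)"
    using arc_concat[OF \<phi> *(1,2,4) pt_in_star[OF *(5,3)]] by (simp add: arc_values_eq[OF \<phi>])
qed (auto simp: arc_values_def)

lemma arc_values_linear:
  "arc_values (\<lambda>\<sigma>. \<phi> \<sigma> + \<psi> \<sigma>) = (\<lambda>p. arc_values \<phi> p + arc_values \<psi> p)"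
  "arc_values (\<lambda>\<sigma>. z * \<phi> \<sigma>) = (\<lambda>p. z * arc_values \<phi> p)"
  by (auto simp: arc_values_def cochain_eval_add_cochain cochain_eval_scale)

lemma coboundary_eval:
  assumes "singular_chain (Suc p) T c"
  shows "cochain_eval (coboundary p T \<psi>) c = cochain_eval \<psi> (chain_boundary (Suc p) c)"
  using assms unfolding singular_chain_def
proof (induction rule: frag_induction)
  case (one \<sigma>)
  then show ?case by (simp add: coboundary_def)
qed (auto simp: chain_boundary_diff cochain_eval_diff)

lemma coboundary_cocycle:
  assumes "\<psi> \<in> carrier (cochains p T S)"
  shows "coboundary p T \<psi> \<in> carrier (cocycles (Suc p) T S)"
  unfolding cocycles_simps
proof
  show "coboundary p T \<psi> \<in> carrier (cochains (Suc p) T S)"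
    unfolding cochains_simps
  proof (intro allI impI conjI notI)
    fix \<sigma> assume n: "coboundary p T \<psi> \<sigma> \<noteq> 0"
    then show "singular_simplex (Suc p) T \<sigma>" by (auto simp: coboundary_def split: if_splits)
    assume "singular_simplex (Suc p) (subtopology T S) \<sigma>"
    then have "singular_chain p (subtopology T S) (chain_boundary (Suc p) (frag_of \<sigma>))"
      using singular_chain_boundary_alt singular_chain_of by metis
    then have "\<psi> \<tau> = 0" if "\<tau> \<in> Poly_Mapping.keys (chain_boundary (Suc p) (frag_of \<sigma>))" for \<tau>
      using assms[unfolded cochains_simps, THEN spec, of \<tau>] that unfolding singular_chain_def by auto
    then have "cochain_eval \<psi> (chain_boundary (Suc p) (frag_of \<sigma>)) = 0" by (simp add: cochain_eval_def)
    then show False using n by (simp add: coboundary_def split: if_splits)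
  qed
  show "coboundary (Suc p) T (coboundary p T \<psi>) = (\<lambda>\<sigma>. 0)"
  proof (rule coboundary_zeroI)
    fix d :: "'a chain" assume d: "singular_chain (Suc (Suc p)) T d"
    have "cochain_eval (coboundary p T \<psi>) (chain_boundary (Suc (Suc p)) d)
        = cochain_eval \<psi> (chain_boundary (Suc p) (chain_boundary (Suc (Suc p)) d))"
      by (rule coboundary_eval[OF singular_chain_boundary_alt[OF d]])
    then show "cochain_eval (coboundary p T \<psi>) (chain_boundary (Suc (Suc p)) d) = 0"
      using chain_boundary_boundary[OF d] by simp
  qed
qed

lemma arc_values_coboundary:
  assumes "\<psi> \<in> carrier (cochains 0 T S)"
  shows "arc_values (coboundary 0 T \<psi>) = poset_delta U (\<lambda>f. \<psi> (point_simplex (pt f)))"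
proof
  fix p :: "nat set \<times> nat set"
  obtain f g where p: "p = (f, g)" by fastforce
  have c: "coboundary 0 T \<psi> \<in> carrier (cocycles 1 T S)"
    using coboundary_cocycle[OF assms] by simp
  show "arc_values (coboundary 0 T \<psi>) p = poset_delta U (\<lambda>f. \<psi> (point_simplex (pt f))) p"
  proof (cases "f \<in> U \<and> g \<in> U \<and> f \<subseteq> g")
    case True
    then have fg: "f \<in> U" "g \<in> U" "f \<subseteq> g" by auto
    note a = arc[OF fg(1) pt_in_star[OF fg(3,2)]]
    have "cochain_eval (coboundary 0 T \<psi>) (arc f (pt g)) = cochain_eval \<psi> (chain_boundary 1 (arc f (pt g)))"
      using coboundary_eval[of 0 "arc f (pt g)" \<psi>] singular_chain_star[OF a(1)] by simp
    then show ?thesis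
      unfolding p arc_values_eq[OF c fg] a(2) by (simp add: poset_delta_def fg cochain_eval_diff)
  qed (auto simp: p arc_values_def poset_delta_def)
qed

lemma point_value_zero_on_S:
  assumes "\<psi> \<in> carrier (cochains 0 T S)" "x \<in> S"
  shows "\<psi> (point_simplex x) = 0"
proof -
  have "singular_simplex 0 (subtopology T S) (point_simplex x)"
    using assms(2) by (auto simp: singular_simplex_0_iff)
  then show ?thesis using assms(1)[unfolded cochains_simps, THEN spec, of "point_simplex x"] by argo
qed

text \<open>A 1-cocycle with trivial arc values is integrated along the arcs; that the resulting
  0-cochain is a primitive has to be tested on paths inside one star only.\<close>

lemma arc_values_B1_imp_coboundary:
  assumes \<phi>: "\<phi> \<in> carrier (cocycles 1 T S)" and u: "arc_values \<phi> = poset_delta U u" "\<forall>f\<in>U'. u f = 0"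
  shows "\<phi> \<in> coboundaries 1 T S"
proof -
  define F where "F x = u (car x) + cochain_eval \<phi> (arc (car x) x)" for x
  define \<psi> where "\<psi> \<sigma> = (if singular_simplex 0 T \<sigma> then F (\<sigma> (\<lambda>j. if j = 0 then 1 else 0)) else 0)" for \<sigma>
  have chn: "\<phi> \<in> carrier (cochains 1 T S)" using \<phi> by (simp add: cocycles_simps)
  have in_star: "x \<in> St (car x)" if "x \<in> topspace T" for x using that by (simp add: star_def)
  have \<psi>_pt: "\<psi> (point_simplex x) = F x" if "x \<in> topspace T" for x
  proof -
    have "singular_simplex 0 T (point_simplex x)" using that by (auto simp: singular_simplex_0_iff)
    then show ?thesis by (simp add: \<psi>_def) (simp add: point_simplex_def standard_simplex_0)
  qed
  have \<psi>: "\<psi> \<in> carrier (cochains 0 T S)"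
    unfolding cochains_simps
  proof (intro allI impI conjI notI)
    fix \<sigma> assume n: "\<psi> \<sigma> \<noteq> 0"
    then show "singular_simplex 0 T \<sigma>" by (auto simp: \<psi>_def split: if_splits)
    assume "singular_simplex 0 (subtopology T S) \<sigma>"
    then obtain x where x: "x \<in> topspace T" "car x \<in> U'" "\<sigma> = point_simplex x"
      by (auto simp: singular_simplex_0_iff)
    have "F x = 0"
      unfolding F_def
      using u(2) x vanish_on_S[OF chn x(2) arc(1)[OF car_in[OF x(1)] in_star[OF x(1)]]] by simp
    then show False using n x \<psi>_pt by simp
  qed
  define E where "E c = cochain_eval \<phi> c - cochain_eval \<psi> (chain_boundary 1 c)" for c
  have E: "E c = 0" if "singular_chain 1 T c" for c
  proof (rule chain_functional_zero[where E = E])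
    show "E (a - b) = E a - E b" for a b
      by (simp add: E_def chain_boundary_diff cochain_eval_diff)
    show "E (chain_boundary 2 d) = 0" if d: "singular_chain 2 T d" for d
    proof -
      have "coboundary 1 T \<phi> = (\<lambda>\<sigma>. 0)" using \<phi> by (simp add: cocycles_simps)
      from coboundary_zero_imp_eval[OF this, of d] d have "cochain_eval \<phi> (chain_boundary 2 d) = 0"
        by (simp add: numeral_2_eq_2)
      then show ?thesis using chain_boundary_boundary[OF d] by (simp add: E_def)
    qed
    show "E c = 0" if g: "g \<in> U" and c: "singular_chain 1 (subtopology T (St g)) c" for g c
    proof -
      \<comment> \<open>On the star of \<open>g\<close> both summands of \<open>E\<close> factor through the end points.\<close>
      define H where "H d = cochain_eval \<phi> (frag_extend (\<lambda>\<sigma>. arc g (\<sigma> (\<lambda>j. if j = 0 then 1 else 0))) d)" for d :: "'a chain"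
      have pt_eval: "point_simplex x (\<lambda>j. if j = 0 then 1 else 0) = x" for x :: 'a
        by (simp add: point_simplex_def standard_simplex_0)
      have diffH: "H (a - b) = H a - H b" for a b
        by (simp add: H_def frag_extend_diff cochain_eval_diff)
      have bnd0: "singular_chain 0 (subtopology T (St g)) (chain_boundary 1 c)"
        using singular_chain_boundary[OF c] by simp
      define K where "K c = frag_extend (\<lambda>\<sigma>. arc g (\<sigma> (\<lambda>j. if j = 0 then 1 else 0))) (chain_boundary 1 c)" for c
      have diffK: "K (a - b) = K a - K b" for a b
        by (simp add: K_def chain_boundary_diff frag_extend_diff)
      have HK: "H (chain_boundary 1 c) = cochain_eval \<phi> (K c)" for c by (simp add: H_def K_def)
      have k: "singular_chain 1 (subtopology T (St g)) (c - K c) \<and> chain_boundary 1 (c - K c) = 0"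
      proof -
        have "Poly_Mapping.keys c \<subseteq> {\<sigma>. singular_simplex 1 (subtopology T (St g)) \<sigma>}"
          using c by (simp add: singular_chain_def)
        then show ?thesis
        proof (induction rule: frag_induction)
          case (one \<sigma>)
          then have s: "singular_simplex 1 (subtopology T (St g)) \<sigma>" by simp
          define x where "x k = singular_face 1 k \<sigma> (\<lambda>j. if j = 0 then 1 else 0)" for k
          have x: "x k \<in> St g" "singular_face 1 k \<sigma> = point_simplex (x k)" if "k \<le> 1" for k
          proof -
            have "singular_simplex 0 (subtopology T (St g)) (singular_face 1 k \<sigma>)"
              using singular_simplex_singular_face[OF s _ that] by simp
            then obtain y where "y \<in> St g" "singular_face 1 k \<sigma> = point_simplex y"
              by (auto simp: singular_simplex_0_iff)
            then show "x k \<in> St g" "singular_face 1 k \<sigma> = point_simplex (x k)"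
              by (simp_all add: x_def pt_eval)
          qed
          have x0: "x 0 \<in> St g" and x1: "x 1 \<in> St g" using x(1) by auto
          have b: "chain_boundary 1 (frag_of \<sigma>) = frag_of (point_simplex (x 0)) - frag_of (point_simplex (x 1))"
            using x[of 0] x[of 1] by (simp add: chain_boundary_of)
          have "K (frag_of \<sigma>) = arc g (x 0) - arc g (x 1)"
            unfolding K_def b frag_extend_diff by (simp add: pt_eval)
          moreover have "singular_chain 1 (subtopology T (St g)) (frag_of \<sigma> - (arc g (x 0) - arc g (x 1)))"
            by (intro singular_chain_diff arc(1)[OF g x0] arc(1)[OF g x1]) (simp only: singular_chain_of s)
          moreover have "chain_boundary 1 (frag_of \<sigma> - (arc g (x 0) - arc g (x 1))) = 0"
            unfolding chain_boundary_diff b arc(2)[OF g x0] arc(2)[OF g x1] by simp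
          ultimately show ?case by simp
        next
          case (diff a b)
          have eq: "a - b - K (a - b) = (a - K a) - (b - K b)" by (simp add: diffK)
          show ?case
            unfolding eq chain_boundary_diff
            using diff singular_chain_diff[of 1 "subtopology T (St g)" "a - K a" "b - K b"]
            by (simp add: chain_boundary_diff)
        qed (simp add: K_def)
      qed
      then have "cochain_eval \<phi> (c - K c) = 0" using cocycle1_zero_on_cycle[OF \<phi> g] by blast
      then have "cochain_eval \<phi> c = H (chain_boundary 1 c)" using HK[of c] by (simp add: cochain_eval_diff)
      moreover have "H (chain_boundary 1 c) - cochain_eval (\<lambda>\<sigma>. \<psi> \<sigma> + (-1) * spread_values (\<lambda>_. u g) \<sigma>) (chain_boundary 1 c) = 0"
      proof (rule eval_zero_on_starI[OF bnd0, where E = "\<lambda>d. H d - cochain_eval (\<lambda>\<sigma>. \<psi> \<sigma> + (-1) * spread_values (\<lambda>_. u g) \<sigma>) d"])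
        fix x assume x: "x \<in> St g"
        then have xt: "x \<in> topspace T" "g \<subseteq> car x" by (auto simp: star_def)
        have "cochain_eval \<phi> (arc g x) = arc_values \<phi> (g, car x) + cochain_eval \<phi> (arc (car x) x)"
          using arc_concat[OF \<phi> g car_in[OF xt(1)] xt(2) in_star[OF xt(1)]]
            arc_values_eq[OF \<phi> g car_in[OF xt(1)] xt(2)] by simp
        also have "arc_values \<phi> (g, car x) = u (car x) - u g"
          using u(1) g car_in[OF xt(1)] xt(2) by (simp add: poset_delta_def)
        finally show "H (frag_of (point_simplex x)) - cochain_eval (\<lambda>\<sigma>. \<psi> \<sigma> + (-1) * spread_values (\<lambda>_. u g) \<sigma>) (frag_of (point_simplex x)) = 0"
          using xt(1) by (simp add: H_def pt_eval \<psi>_pt F_def)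
      qed (simp add: diffH cochain_eval_diff)
      moreover have "cochain_eval (spread_values (\<lambda>_. u g)) (chain_boundary 1 c) = 0"
        by (rule spread_const_boundary[OF singular_chain_star[OF c]])
      ultimately show "E c = 0" unfolding E_def cochain_eval_add_cochain cochain_eval_scale by simp
    qed
  qed (rule that)
  have "\<phi> = coboundary 0 T \<psi>"
  proof
    fix \<sigma>
    show "\<phi> \<sigma> = coboundary 0 T \<psi> \<sigma>"
    proof (cases "singular_simplex 1 T \<sigma>")
      case True
      then show ?thesis using E[of "frag_of \<sigma>"] by (simp add: E_def singular_chain_of coboundary_def)
    next
      case False
      then show ?thesis using chn[unfolded cochains_simps, THEN spec, of \<sigma>] by (simp add: coboundary_def)
    qed
  qed
  then show ?thesis using \<psi> by (simp add: coboundaries_def)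
qed

text \<open>The primitive, on the star of \<open>g\<close>, of the 1-cocycle that is to be built from \<open>c\<close>.\<close>

definition germ :: "(nat set \<times> nat set \<Rightarrow> complex) \<Rightarrow> nat set \<Rightarrow> ((nat \<Rightarrow> real) \<Rightarrow> 'a) \<Rightarrow> complex" where
  "germ c g = spread_values (\<lambda>f. c (g, f))"

text \<open>On a simplex that lies in the star of some \<open>g\<close>, the difference of the values of the germ at the end points.\<close>

definition small_value :: "(nat set \<times> nat set \<Rightarrow> complex) \<Rightarrow> ((nat \<Rightarrow> real) \<Rightarrow> 'a) \<Rightarrow> complex" where
  "small_value c \<sigma> = cochain_eval (germ c (SOME g. g \<in> U \<and> singular_simplex 1 (subtopology T (St g)) \<sigma>))
     (chain_boundary 1 (frag_of \<sigma>))"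

text \<open>If the simplex lies in the stars of \<open>g\<close> and \<open>h\<close>, it lies in the star of \<open>g \<union> h\<close>, and by the cocycle condition
  the two germs differ there by a constant.\<close>

lemma small_value_eq:
  assumes c: "c \<in> poset_Z1 U U'" and g: "g \<in> U" and \<sigma>: "singular_simplex 1 (subtopology T (St g)) \<sigma>"
  shows "small_value c \<sigma> = cochain_eval (germ c g) (chain_boundary 1 (frag_of \<sigma>))"
proof -
  define g' where "g' = (SOME g. g \<in> U \<and> singular_simplex 1 (subtopology T (St g)) \<sigma>)"
  have "\<exists>g. g \<in> U \<and> singular_simplex 1 (subtopology T (St g)) \<sigma>" using g \<sigma> by blast
  from someI_ex[OF this] have g': "g' \<in> U" "singular_simplex 1 (subtopology T (St g')) \<sigma>"
    unfolding g'_def by blast+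
  obtain z where z: "z \<in> standard_simplex 1" using nonempty_standard_simplex[of 1] by blast
  then have "\<sigma> z \<in> St g" "\<sigma> z \<in> St g'"
    using \<sigma> g'(2) by (auto simp: singular_simplex_subtopology)
  then have z: "\<sigma> z \<in> topspace T" "g \<subseteq> car (\<sigma> z)" "g' \<subseteq> car (\<sigma> z)" by (auto simp: star_def)
  let ?h = "g \<union> g'"
  have h: "?h \<in> U" using join[OF g g'(1) car_in[OF z(1)] z(2,3)] .
  have "singular_simplex 1 (subtopology T (St ?h)) \<sigma>"
    using \<sigma> g'(2) unfolding singular_simplex_subtopology by (auto simp: star_def)
  then have ch: "singular_chain 1 (subtopology T (St ?h)) (frag_of \<sigma>)" by (simp only: singular_chain_of)
  then have bd: "singular_chain 0 (subtopology T (St ?h)) (chain_boundary 1 (frag_of \<sigma>))"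
    using singular_chain_boundary by fastforce
  define k where "k = c (g', ?h) - c (g, ?h)"
  let ?\<psi> = "\<lambda>\<tau>. (germ c g' \<tau> + (-1) * germ c g \<tau>) + (-1) * spread_values (\<lambda>_. k) \<tau>"
  have "cochain_eval ?\<psi> (chain_boundary 1 (frag_of \<sigma>)) = 0"
  proof (rule eval_zero_on_starI[OF bd, where E = "cochain_eval ?\<psi>"])
    fix x assume "x \<in> St ?h"
    then have x: "x \<in> topspace T" "?h \<subseteq> car x" by (auto simp: star_def)
    have "c (g', car x) = c (g', ?h) + c (?h, car x)" "c (g, car x) = c (g, ?h) + c (?h, car x)"
      using poset_Z1D(2)[OF c _ h car_in[OF x(1)] _ x(2)] g g'(1) by blast+
    then show "cochain_eval ?\<psi> (frag_of (point_simplex x)) = 0"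
      using x(1) by (simp add: germ_def k_def)
  qed (simp add: cochain_eval_diff)
  then show ?thesis
    unfolding small_value_def g'_def[symmetric] cochain_eval_add_cochain cochain_eval_scale
    using spread_const_boundary[OF singular_chain_star[OF ch], of k] by simp
qed

lemma small_value_chain:
  assumes c: "c \<in> poset_Z1 U U'" and g: "g \<in> U" and d: "singular_chain 1 (subtopology T (St g)) d"
  shows "cochain_eval (small_value c) d = cochain_eval (germ c g) (chain_boundary 1 d)"
  using d unfolding singular_chain_def
proof (induction rule: frag_induction)
  case (one \<sigma>)
  then show ?case using small_value_eq[OF c g, of \<sigma>] by simp
qed (auto simp: cochain_eval_diff chain_boundary_diff)

lemma small_value_subdivision:
  assumes c: "c \<in> poset_Z1 U U'" and g: "g \<in> U" and d: "singular_chain 1 (subtopology T (St g)) d"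
  shows "cochain_eval (small_value c) ((singular_subdivision 1 ^^ M) d) = cochain_eval (germ c g) (chain_boundary 1 d)"
proof -
  have "singular_chain 0 T (chain_boundary 1 d)"
    using singular_chain_boundary[OF singular_chain_star[OF d]] by simp
  then have "chain_boundary 1 ((singular_subdivision 1 ^^ M) d) = chain_boundary 1 d"
    using boundary_subdivision[of 0 _ d M] d by fastforce
  then show ?thesis
    using small_value_chain[OF c g subdivision_chain[OF d, of M]] by simp
qed

text \<open>Once all simplices lie in stars, further subdivision cuts them inside their stars, where the values are
  differences at end points and add up.\<close>

lemma small_value_stable:
  assumes c: "c \<in> poset_Z1 U U'"
    and N: "\<And>M \<sigma>. N \<le> M \<Longrightarrow> \<sigma> \<in> Poly_Mapping.keys ((singular_subdivision 1 ^^ M) d) \<Longrightarrow> small \<sigma> 1"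
    and M: "N \<le> M"
  shows "cochain_eval (small_value c) ((singular_subdivision 1 ^^ M) d) =
    cochain_eval (small_value c) ((singular_subdivision 1 ^^ N) d)"
  using M
proof (induction M rule: dec_induct)
  case (step M)
  have "cochain_eval (small_value c) (singular_subdivision 1 e) = cochain_eval (small_value c) e"
    if "Poly_Mapping.keys e \<subseteq> {\<sigma>. small \<sigma> 1}" for e
    using that
  proof (induction rule: frag_induction)
    case (one \<sigma>)
    then obtain g where g: "g \<in> U" "singular_simplex 1 (subtopology T (St g)) \<sigma>" by auto
    then have ch: "singular_chain 1 (subtopology T (St g)) (frag_of \<sigma>)" by (simp only: singular_chain_of)
    show ?case
      using small_value_subdivision[OF c g(1) ch, of 1] small_value_chain[OF c g(1) ch] by simp
  qed (auto simp: cochain_eval_diff singular_subdivision_diff)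
  from this[of "(singular_subdivision 1 ^^ M) d"] show ?case using N[OF step.hyps(1)] step.IH by auto
qed simp

text \<open>A path is subdivided until all its pieces lie in stars; by \<open>small_value_stable\<close> the number of subdivisions
  does not matter.\<close>

definition path_value :: "(nat set \<times> nat set \<Rightarrow> complex) \<Rightarrow> ((nat \<Rightarrow> real) \<Rightarrow> 'a) \<Rightarrow> complex" where
  "path_value c \<sigma> = (if singular_simplex 1 T \<sigma> then
     cochain_eval (small_value c) ((singular_subdivision 1 ^^
       (SOME N. \<forall>M\<ge>N. \<forall>\<tau>\<in>Poly_Mapping.keys ((singular_subdivision 1 ^^ M) (frag_of \<sigma>)). small \<tau> 1)) (frag_of \<sigma>)) else 0)"

lemma path_value_eventually:
  assumes c: "c \<in> poset_Z1 U U'" and d: "singular_chain 1 T d"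
  shows "\<exists>N. \<forall>M\<ge>N. cochain_eval (path_value c) d = cochain_eval (small_value c) ((singular_subdivision 1 ^^ M) d)"
  using d unfolding singular_chain_def
proof (induction rule: frag_induction)
  case (one \<sigma>)
  then have \<sigma>: "singular_simplex 1 T \<sigma>" by simp
  then have ch: "singular_chain 1 T (frag_of \<sigma>)" by (simp only: singular_chain_of)
  define N where "N = (SOME N. \<forall>M\<ge>N. \<forall>\<tau>\<in>Poly_Mapping.keys ((singular_subdivision 1 ^^ M) (frag_of \<sigma>)). small \<tau> 1)"
  obtain N0 where "\<And>M \<tau>. N0 \<le> M \<Longrightarrow> \<tau> \<in> Poly_Mapping.keys ((singular_subdivision 1 ^^ M) (frag_of \<sigma>)) \<Longrightarrow> small \<tau> 1"
    using eventually_small[OF ch] by blast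
  then have "\<exists>N. \<forall>M\<ge>N. \<forall>\<tau>\<in>Poly_Mapping.keys ((singular_subdivision 1 ^^ M) (frag_of \<sigma>)). small \<tau> 1" by blast
  from someI_ex[OF this] have N: "\<And>M \<tau>. N \<le> M \<Longrightarrow> \<tau> \<in> Poly_Mapping.keys ((singular_subdivision 1 ^^ M) (frag_of \<sigma>)) \<Longrightarrow> small \<tau> 1"
    unfolding N_def[symmetric] by blast
  have "path_value c \<sigma> = cochain_eval (small_value c) ((singular_subdivision 1 ^^ N) (frag_of \<sigma>))"
    using \<sigma> by (simp add: path_value_def N_def)
  moreover have "cochain_eval (small_value c) ((singular_subdivision 1 ^^ M) (frag_of \<sigma>)) =
      cochain_eval (small_value c) ((singular_subdivision 1 ^^ N) (frag_of \<sigma>))" if "N \<le> M" for M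
    by (rule small_value_stable[OF c N that])
  ultimately have "\<forall>M\<ge>N. cochain_eval (path_value c) (frag_of \<sigma>) =
      cochain_eval (small_value c) ((singular_subdivision 1 ^^ M) (frag_of \<sigma>))"
    unfolding cochain_eval_of by metis
  then show ?case by (rule exI)
next
  case (diff a b)
  then obtain N1 N2 where
    "\<forall>M\<ge>N1. cochain_eval (path_value c) a = cochain_eval (small_value c) ((singular_subdivision 1 ^^ M) a)"
    "\<forall>M\<ge>N2. cochain_eval (path_value c) b = cochain_eval (small_value c) ((singular_subdivision 1 ^^ M) b)"
    by blast
  then have "\<forall>M\<ge>max N1 N2. cochain_eval (path_value c) (a - b) =
      cochain_eval (small_value c) ((singular_subdivision 1 ^^ M) (a - b))"
    unfolding cochain_eval_diff singular_subdivision_power_diff by (metis max.bounded_iff)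
  then show ?case by (rule exI)
qed simp

lemma path_value_in_star:
  assumes c: "c \<in> poset_Z1 U U'" and g: "g \<in> U" and d: "singular_chain 1 (subtopology T (St g)) d"
  shows "cochain_eval (path_value c) d = cochain_eval (germ c g) (chain_boundary 1 d)"
proof -
  obtain N where "\<forall>M\<ge>N. cochain_eval (path_value c) d = cochain_eval (small_value c) ((singular_subdivision 1 ^^ M) d)"
    using path_value_eventually[OF c singular_chain_star[OF d]] by (elim exE)
  then have "cochain_eval (path_value c) d = cochain_eval (small_value c) ((singular_subdivision 1 ^^ N) d)"
    by (elim allE[of _ N] impE) simp_all
  then show ?thesis using small_value_subdivision[OF c g d, of N] by (rule trans)
qed

text \<open>The boundary of a 2-simplex is subdivided until the 2-simplices of the subdivision lie in stars. There the
  cochain has a primitive, so it vanishes on boundaries.\<close>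

lemma path_value_cocycle:
  assumes c: "c \<in> poset_Z1 U U'"
  shows "path_value c \<in> carrier (cocycles 1 T S)"
  unfolding cocycles_simps
proof
  show "path_value c \<in> carrier (cochains 1 T S)"
    unfolding cochains_simps
  proof (intro allI impI conjI notI)
    fix \<sigma> assume n: "path_value c \<sigma> \<noteq> 0"
    then show \<sigma>: "singular_simplex 1 T \<sigma>" by (auto simp: path_value_def split: if_splits)
    assume s: "singular_simplex 1 (subtopology T S) \<sigma>"
    obtain G where G: "G \<subseteq> U'" "\<forall>g\<in>G. openin (subtopology T S) (St g)" "S \<subseteq> (\<Union>g\<in>G. St g)"
      using cover' by blast
    have ch: "singular_chain 1 (subtopology T S) (frag_of \<sigma>)" using s by (simp only: singular_chain_of)
    obtain N where N: "\<And>M \<tau>. N \<le> M \<Longrightarrow> \<tau> \<in> Poly_Mapping.keys ((singular_subdivision 1 ^^ M) (frag_of \<sigma>))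
        \<Longrightarrow> \<exists>V\<in>St ` G. \<tau> \<in> standard_simplex 1 \<rightarrow> V"
      by (rule sufficient_iterated_singular_subdivision_exists[of "St ` G" "subtopology T S" 1 "frag_of \<sigma>"])
        (use G ch in auto)
    have zero: "small_value c \<tau> = 0"
      if \<tau>: "\<tau> \<in> Poly_Mapping.keys ((singular_subdivision 1 ^^ M) (frag_of \<sigma>))" "N \<le> M" for M \<tau>
    proof -
      obtain g where g: "g \<in> G" "\<tau> \<in> standard_simplex 1 \<rightarrow> St g" using N[OF \<tau>(2,1)] by blast
      have "singular_simplex 1 (subtopology T S) \<tau>"
        using subdivision_chain[OF ch, of M] \<tau>(1) unfolding singular_chain_def by auto
      then have t: "singular_simplex 1 (subtopology T (St g)) \<tau>"
        using g(2) by (auto simp: singular_simplex_subtopology)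
      have g': "g \<in> U'" "g \<in> U" using g(1) G(1) sub by auto
      have "(\<lambda>f. c (g, f)) = (\<lambda>f. 0)" using poset_Z1D(1)[OF c, of g] g'(1) by auto
      then have "germ c g \<rho> = 0" for \<rho> by (simp add: germ_def spread_values_def)
      then show ?thesis using small_value_eq[OF c g'(2) t] by (simp add: cochain_eval_def)
    qed
    have chT: "singular_chain 1 T (frag_of \<sigma>)" using \<sigma> by (simp only: singular_chain_of)
    obtain N' where "\<forall>M\<ge>N'. cochain_eval (path_value c) (frag_of \<sigma>) =
        cochain_eval (small_value c) ((singular_subdivision 1 ^^ M) (frag_of \<sigma>))"
      using path_value_eventually[OF c chT] by blast
    then have "path_value c \<sigma> = cochain_eval (small_value c) ((singular_subdivision 1 ^^ max N N') (frag_of \<sigma>))"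
      by simp
    also have "\<dots> = 0" unfolding cochain_eval_def using zero by (intro sum.neutral) auto
    finally show False using n by simp
  qed
  show "coboundary 1 T (path_value c) = (\<lambda>\<sigma>. 0)"
  proof (rule coboundary_zeroI)
    fix d :: "'a chain" assume d: "singular_chain (Suc 1) T d"
    have bd: "singular_chain 1 T (chain_boundary (Suc 1) d)" by (rule singular_chain_boundary_alt[OF d])
    obtain N1 where N1: "\<forall>M\<ge>N1. cochain_eval (path_value c) (chain_boundary (Suc 1) d) =
        cochain_eval (small_value c) ((singular_subdivision 1 ^^ M) (chain_boundary (Suc 1) d))"
      using path_value_eventually[OF c bd] by blast
    obtain N2 where N2: "\<And>M \<sigma>. N2 \<le> M \<Longrightarrow> \<sigma> \<in> Poly_Mapping.keys ((singular_subdivision (Suc 1) ^^ M) d)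
        \<Longrightarrow> small \<sigma> (Suc 1)"
      using eventually_small[OF d] by blast
    let ?e = "(singular_subdivision (Suc 1) ^^ max N1 N2) d"
    have "Poly_Mapping.keys ?e \<subseteq> {\<sigma>. small \<sigma> (Suc 1)}" using N2[of "max N1 N2"] by auto
    then have "cochain_eval (small_value c) (chain_boundary (Suc 1) ?e) = 0"
    proof (induction rule: frag_induction)
      case (one \<sigma>)
      then obtain g where g: "g \<in> U" "singular_simplex (Suc 1) (subtopology T (St g)) \<sigma>" by auto
      then have ch: "singular_chain (Suc 1) (subtopology T (St g)) (frag_of \<sigma>)" by (simp only: singular_chain_of)
      have "cochain_eval (small_value c) (chain_boundary (Suc 1) (frag_of \<sigma>))
         = cochain_eval (germ c g) (chain_boundary 1 (chain_boundary (Suc 1) (frag_of \<sigma>)))"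
        by (rule small_value_chain[OF c g(1) singular_chain_boundary_alt[OF ch]])
      then show ?case using chain_boundary_boundary[OF ch] by simp
    qed (auto simp: cochain_eval_diff chain_boundary_diff)
    then show "cochain_eval (path_value c) (chain_boundary (Suc 1) d) = 0"
      unfolding boundary_subdivision[OF d, of "max N1 N2"]
      using N1[THEN spec, of "max N1 N2"] by simp
  qed
qed

lemma arc_values_path_value:
  assumes c: "c \<in> poset_Z1 U U'"
  shows "arc_values (path_value c) = c"
proof
  fix p :: "nat set \<times> nat set"
  obtain f g where p: "p = (f, g)" by fastforce
  show "arc_values (path_value c) p = c p"
  proof (cases "f \<in> U \<and> g \<in> U \<and> f \<subseteq> g")
    case True
    then have fg: "f \<in> U" "g \<in> U" "f \<subseteq> g" by auto
    note a = arc[OF fg(1) pt_in_star[OF fg(3,2)]]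
    have "c (f, f) = 0" using poset_Z1D(2)[OF c fg(1) fg(1) fg(1)] by simp
    then have "cochain_eval (germ c f) (chain_boundary 1 (arc f (pt g))) = c (f, g)"
      unfolding a(2) using pt fg by (simp add: cochain_eval_diff germ_def)
    then show ?thesis
      using arc_values_eq[OF path_value_cocycle[OF c] fg] path_value_in_star[OF c fg(1) a(1)] p by simp
  next
    case False
    then show ?thesis using poset_Z1D(1)[OF c, of f g] by (auto simp: p arc_values_def)
  qed
qed

lemma rel_cohomology_1:
  "vector_quotient (rel_cohomology 1 T S) (poset_Z1 U U') (poset_B1 U U')"
  unfolding rel_cohomology_def
proof (rule vector_quotient_cocycles[where F = arc_values])
  have B: "coboundaries 1 T S = coboundary 0 T ` carrier (cochains 0 T S)"
    by (simp add: coboundaries_def)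
  show "coboundaries 1 T S \<subseteq> carrier (cocycles 1 T S)"
    unfolding B using coboundary_cocycle[of _ 0] by auto
  show "(\<lambda>\<sigma>. 0) \<in> coboundaries 1 T S"
    unfolding B by (intro image_eqI[of _ _ "\<lambda>\<sigma>. 0"]) (auto simp: coboundary_def cochain_eval_def cochains_simps)
  show "(\<lambda>\<sigma>. \<phi> \<sigma> + \<psi> \<sigma>) \<in> coboundaries 1 T S" if p: "\<phi> \<in> coboundaries 1 T S" "\<psi> \<in> coboundaries 1 T S" for \<phi> \<psi>
  proof -
    obtain a b where ab: "\<phi> = coboundary 0 T a" "\<psi> = coboundary 0 T b" "a \<in> carrier (cochains 0 T S)" "b \<in> carrier (cochains 0 T S)"
      using p unfolding B by auto
    have "(\<lambda>\<sigma>. a \<sigma> + b \<sigma>) \<in> carrier (cochains 0 T S)"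
      unfolding cochains_simps
    proof (rule allI)
      fix \<sigma> show "a \<sigma> + b \<sigma> \<noteq> 0 \<longrightarrow> singular_simplex 0 T \<sigma> \<and> \<not> singular_simplex 0 (subtopology T S) \<sigma>"
        using ab(3,4)[unfolded cochains_simps, THEN spec, of \<sigma>] by (cases "a \<sigma> = 0") auto
    qed
    then show ?thesis unfolding B ab coboundary_add[symmetric] by (rule imageI)
  qed
  show "(\<lambda>\<sigma>. z * \<phi> \<sigma>) \<in> coboundaries 1 T S" if p: "\<phi> \<in> coboundaries 1 T S" for z \<phi>
  proof -
    obtain a where a: "\<phi> = coboundary 0 T a" "a \<in> carrier (cochains 0 T S)" using p unfolding B by auto
    then have "(\<lambda>\<sigma>. z * a \<sigma>) \<in> carrier (cochains 0 T S)" by (simp add: cochains_simps)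
    then show ?thesis unfolding B a coboundary_scale[symmetric] by (rule imageI)
  qed
  show "arc_values \<phi> \<in> poset_B1 U U' \<longleftrightarrow> \<phi> \<in> coboundaries 1 T S" if \<phi>: "\<phi> \<in> carrier (cocycles 1 T S)" for \<phi>
  proof
    assume "arc_values \<phi> \<in> poset_B1 U U'"
    then show "\<phi> \<in> coboundaries 1 T S"
      using arc_values_B1_imp_coboundary[OF \<phi>] unfolding poset_B1_def by blast
  next
    assume "\<phi> \<in> coboundaries 1 T S"
    then obtain \<psi> where \<psi>: "\<psi> \<in> carrier (cochains 0 T S)" "\<phi> = coboundary 0 T \<psi>" unfolding B by auto
    have "\<forall>f\<in>U'. \<psi> (point_simplex (pt f)) = 0"
    proof
      fix f assume "f \<in> U'"
      then have "pt f \<in> S" using pt sub by auto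
      then show "\<psi> (point_simplex (pt f)) = 0" by (rule point_value_zero_on_S[OF \<psi>(1)])
    qed
    then show "arc_values \<phi> \<in> poset_B1 U U'"
      unfolding \<psi>(2) arc_values_coboundary[OF \<psi>(1)] poset_B1_def by blast
  qed
  show "\<exists>\<phi>\<in>carrier (cocycles 1 T S). (\<lambda>i. v i - arc_values \<phi> i) \<in> poset_B1 U U'" if "v \<in> poset_Z1 U U'" for v
    using arc_values_path_value[OF that] path_value_cocycle[OF that] poset_B1_closed(1)
    by (intro bexI[of _ "path_value v"]) auto
qed (auto simp: poset_Z1_closed poset_B1_closed arc_values_Z1 arc_values_linear)

end

section \<open>The geometric realization\<close>

definition segment_point :: "real \<Rightarrow> (nat \<Rightarrow> real) \<times> real \<Rightarrow> (nat \<Rightarrow> real) \<times> real \<Rightarrow> (nat \<Rightarrow> real) \<times> real" where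
  "segment_point s x p = (\<lambda>i. (1 - s) * fst x i + s * fst p i, (1 - s) * snd x + s * snd p)"

text \<open>The straight-line homotopy to \<open>p\<close> stays in \<open>S\<close>.\<close>

lemma starlike_contractible:
  assumes p: "p \<in> S" and seg: "\<And>s x. x \<in> S \<Longrightarrow> 0 \<le> s \<Longrightarrow> s \<le> 1 \<Longrightarrow> segment_point s x p \<in> S"
  shows "contractible_space (top_of_set S)"
proof -
  have "continuous_on ({0..1::real} \<times> S) (\<lambda>y. segment_point (fst y) (snd y) p)"
    unfolding segment_point_def
    by (intro continuous_intros continuous_on_product_then_coordinatewise)
  then have "continuous_map (prod_topology (top_of_set {0..1::real}) (top_of_set S)) (top_of_set S)
      (\<lambda>y. segment_point (fst y) (snd y) p)"
    using seg by (auto simp: continuous_map_in_subtopology)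
  then have "homotopic_with (\<lambda>x. True) (top_of_set S) (top_of_set S) id (\<lambda>x. p)"
    unfolding homotopic_with_def
    by (intro exI[of _ "\<lambda>y. segment_point (fst y) (snd y) p"]) (auto simp: segment_point_def)
  then show ?thesis unfolding contractible_space_def by blast
qed

text \<open>Everything above height 0 belongs to the stratum of the empty face, whose base point is the apex. The base
  points of the other strata are barycentres.\<close>

definition carrier_face :: "nat \<Rightarrow> (nat \<Rightarrow> real) \<times> real \<Rightarrow> nat set" where
  "carrier_face n x = (if snd x \<noteq> 0 then {} else {i. i \<le> n \<and> fst x i \<noteq> 0})"

definition face_point :: "nat set \<Rightarrow> (nat \<Rightarrow> real) \<times> real" where
  "face_point f = (if f = {} then (\<lambda>_. 0, 1) else (\<lambda>i. if i \<in> f then 1 / card f else 0, 0))"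

lemma open_cells_iff:
  assumes "Z \<subseteq> Pow {0..n}"
  shows "\<alpha> \<in> (\<Union>f\<in>Z. open_cell n Y f) \<longleftrightarrow> \<alpha> \<in> geom_realization n Y \<and> {i. i \<le> n \<and> \<alpha> i \<noteq> 0} \<in> Z"
proof -
  have "\<alpha> \<in> open_cell n Y f \<longleftrightarrow> \<alpha> \<in> geom_realization n Y \<and> {i. i \<le> n \<and> \<alpha> i \<noteq> 0} = f" if "f \<in> Z" for f
  proof -
    have "f \<subseteq> {0..n}" using assms that by auto
    then have "i \<le> n" if "i \<in> f" for i using that by auto
    then show ?thesis unfolding open_cell_def by auto
  qed
  then show ?thesis by auto
qed

lemma geom_realization_nonempty_support:
  assumes "\<alpha> \<in> geom_realization n Y"
  shows "{i. i \<le> n \<and> \<alpha> i \<noteq> 0} \<noteq> {}"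
proof
  assume "{i. i \<le> n \<and> \<alpha> i \<noteq> 0} = {}"
  then have "(\<Sum>i\<le>n. \<alpha> i) = 0" by (intro sum.neutral) auto
  then show False using assms by (simp add: geom_realization_def)
qed

lemma geom_subset_base_iff:
  assumes "Z \<subseteq> Pow {0..n}"
  shows "(\<alpha>, 0) \<in> geom_subset n Y Z \<longleftrightarrow> \<alpha> \<in> geom_realization n Y \<and> {i. i \<le> n \<and> \<alpha> i \<noteq> 0} \<in> Z"
proof -
  have Z: "Z - {{}} \<subseteq> Pow {0..n}" using assms by auto
  have "(\<alpha>, 0) \<in> geom_cone C \<longleftrightarrow> \<alpha> \<in> C" for C by (auto simp: geom_cone_def)
  then show ?thesis
    unfolding geom_subset_def
    using open_cells_iff[OF Z, of \<alpha> Y] open_cells_iff[OF assms, of \<alpha> Y] geom_realization_nonempty_support[of \<alpha> n Y]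
    by auto
qed

lemma geom_subset_height:
  assumes "x \<in> geom_subset n Y Z" "snd x \<noteq> 0"
  shows "{} \<in> Z"
  using assms unfolding geom_subset_def by (auto split: if_splits)

lemma geom_subset_cone_iff:
  assumes "Y \<subseteq> Pow {0..n}" "{} \<in> Y"
  shows "x \<in> geom_subset n Y Y \<longleftrightarrow> x = (\<lambda>_. 0, 1) \<or>
    (\<exists>\<alpha> t. \<alpha> \<in> geom_realization n Y \<and> 0 \<le> t \<and> t \<le> 1 \<and> x = (\<lambda>i. (1 - t) * \<alpha> i, t))"
proof -
  have "Y - {{}} \<subseteq> Pow {0..n}" using assms by auto
  then have "\<alpha> \<in> (\<Union>f\<in>Y - {{}}. open_cell n Y f) \<longleftrightarrow> \<alpha> \<in> geom_realization n Y" for \<alpha>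
    using open_cells_iff[of "Y - {{}}" n \<alpha> Y] geom_realization_nonempty_support[of \<alpha> n Y]
    by (auto simp: geom_realization_def)
  then have "(\<Union>f\<in>Y - {{}}. open_cell n Y f) = geom_realization n Y" by blast
  then show ?thesis using assms(2) unfolding geom_subset_def geom_cone_def by auto
qed

lemma geom_realization_segment:
  assumes Y: "\<And>f g. f \<in> Y \<Longrightarrow> g \<subseteq> f \<Longrightarrow> g \<in> Y"
    and a: "\<alpha> \<in> geom_realization n Y" and b: "\<beta> \<in> geom_realization n Y"
    and supp: "{i. i \<le> n \<and> \<beta> i \<noteq> 0} \<subseteq> {i. i \<le> n \<and> \<alpha> i \<noteq> 0}" and s: "0 \<le> s" "s \<le> 1"
  shows "(\<lambda>i. (1 - s) * \<alpha> i + s * \<beta> i) \<in> geom_realization n Y"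
proof -
  have "(1 - s) * \<alpha> i + s * \<beta> i \<le> 1" "0 \<le> (1 - s) * \<alpha> i + s * \<beta> i" for i
    using a b s convex_bound_le[of "\<alpha> i" 1 "\<beta> i" "1 - s" s] by (auto simp: geom_realization_def)
  moreover have "{i. i \<le> n \<and> (1 - s) * \<alpha> i + s * \<beta> i \<noteq> 0} \<in> Y"
    by (rule Y[of "{i. i \<le> n \<and> \<alpha> i \<noteq> 0}"]) (use a supp in \<open>auto simp: geom_realization_def\<close>)
  moreover have "(\<Sum>i\<le>n. (1 - s) * \<alpha> i + s * \<beta> i) = 1"
    using a b by (simp add: sum.distrib sum_distrib_left[symmetric] geom_realization_def)
  ultimately show ?thesis using a b by (simp add: geom_realization_def)
qed

text \<open>Moving towards the barycentre of \<open>f\<close> from a point whose face contains \<open>f\<close> keeps the face, so the star of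
  \<open>f\<close> is star-shaped; for the empty face one moves towards the apex. If the empty face belongs to the set of
  faces at hand, its star is the whole space and a cover by itself; otherwise all points have height 0, and
  stars are open because they are given by the nonvanishing of finitely many coordinates.\<close>

lemma geom_stratified:
  assumes Y: "Y \<subseteq> Pow {0..n}" "\<And>f g. f \<in> Y \<Longrightarrow> g \<subseteq> f \<Longrightarrow> g \<in> Y"
    and U: "U \<subseteq> Y" "\<And>f g. f \<in> U \<Longrightarrow> f \<subseteq> g \<Longrightarrow> g \<in> Y \<Longrightarrow> g \<in> U"
    and U': "U' \<subseteq> U" "\<And>f g. f \<in> U' \<Longrightarrow> f \<subseteq> g \<Longrightarrow> g \<in> Y \<Longrightarrow> g \<in> U'"
  shows "stratified_space (top_of_set (geom_subset n Y U)) (carrier_face n) face_point U U'"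
    and "{x \<in> topspace (top_of_set (geom_subset n Y U)). carrier_face n x \<in> U'} = geom_subset n Y U'"
proof -
  let ?W = "geom_subset n Y U" and ?car = "carrier_face n"
  let ?T = "top_of_set ?W"
  have Un: "U \<subseteq> Pow {0..n}" and Un': "U' \<subseteq> Pow {0..n}" using U U' Y by auto
  have base: "(\<alpha>, 0) \<in> ?W \<longleftrightarrow> \<alpha> \<in> geom_realization n Y \<and> {i. i \<le> n \<and> \<alpha> i \<noteq> 0} \<in> U" for \<alpha>
    by (rule geom_subset_base_iff[OF Un])
  have full: "U = Y" if "{} \<in> U" using that U by blast
  have full': "U' = U" "U = Y" if "{} \<in> U'" using that U U' by blast+
  have car_in: "?car x \<in> U" if "x \<in> ?W" for x
  proof (cases "snd x = 0")
    case True
    then show ?thesis using that base[of "fst x"] by (cases x) (auto simp: carrier_face_def)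
  qed (use geom_subset_height[OF that] in \<open>simp add: carrier_face_def\<close>)
  have star_base: "x \<in> ?W \<and> f \<subseteq> ?car x \<longleftrightarrow> snd x = 0 \<and> fst x \<in> geom_realization n Y \<and>
      {i. i \<le> n \<and> fst x i \<noteq> 0} \<in> U \<and> f \<subseteq> {i. i \<le> n \<and> fst x i \<noteq> 0}" if "f \<noteq> {}" for f x
  proof (cases "snd x = 0")
    case True
    then show ?thesis using base[of "fst x"] by (cases x) (auto simp: carrier_face_def)
  qed (use that in \<open>auto simp: carrier_face_def\<close>)
  have apex: "(\<lambda>_. 0, 1) \<in> ?W" if "{} \<in> U" using that by (simp add: geom_subset_def geom_cone_def)
  have pt_base: "fst (face_point f) \<in> geom_realization n Y" "{i. i \<le> n \<and> fst (face_point f) i \<noteq> 0} = f"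
    if "f \<in> U" "f \<noteq> {}" for f
  proof -
    have fn: "f \<subseteq> {0..n}" using that(1) Un by blast
    then have f: "finite f" "f \<subseteq> {..n}" using finite_subset[of f "{0..n}"] by auto
    then have c: "card f > 0" using that by (simp add: card_gt_0_iff)
    show supp: "{i. i \<le> n \<and> fst (face_point f) i \<noteq> 0} = f" using f that c by (auto simp: face_point_def)
    have "(\<Sum>i\<le>n. fst (face_point f) i) = (\<Sum>i\<in>f. 1 / card f)"
      using f that by (simp add: face_point_def sum.If_cases Int_absorb1 flip: Collect_mem_eq)
    then have "(\<Sum>i\<le>n. fst (face_point f) i) = 1" using c by simp
    then show "fst (face_point f) \<in> geom_realization n Y"
      using supp that U f c by (auto simp: geom_realization_def) (auto simp: face_point_def)
  qed
  have pt: "face_point f \<in> ?W \<and> ?car (face_point f) = f" if "f \<in> U" for f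
  proof (cases "f = {}")
    case True
    then show ?thesis using apex that by (simp add: face_point_def carrier_face_def)
  next
    case False
    have "snd (face_point f) = 0" using False by (simp add: face_point_def)
    then show ?thesis using pt_base[OF that False] star_base[OF False, of "face_point f"] that
      by (auto simp: carrier_face_def)
  qed
  have star: "star ?T ?car f = {x \<in> ?W. f \<subseteq> ?car x}" for f by (simp add: star_def)
  have contr: "contractible_space (subtopology ?T (star ?T ?car f))" if f: "f \<in> U" for f
  proof -
    have "subtopology ?T (star ?T ?car f) = top_of_set {x \<in> ?W. f \<subseteq> ?car x}"
      unfolding star subtopology_subtopology by (intro arg_cong[where f = top_of_set]) auto
    moreover have "contractible_space (top_of_set {x \<in> ?W. f \<subseteq> ?car x})"
    proof (rule starlike_contractible)
      show "face_point f \<in> {x \<in> ?W. f \<subseteq> ?car x}" using pt[OF f] by simp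
      fix s :: real and x assume x: "x \<in> {x \<in> ?W. f \<subseteq> ?car x}" and s: "0 \<le> s" "s \<le> 1"
      show "segment_point s x (face_point f) \<in> {x \<in> ?W. f \<subseteq> ?car x}"
      proof (cases "f = {}")
        case True
        have Y0: "U = Y" "{} \<in> Y" using full f True by auto
        have "segment_point s x (\<lambda>_. 0, 1) \<in> geom_subset n Y Y"
        proof -
          have "x = (\<lambda>_. 0, 1) \<or> (\<exists>\<alpha> t. \<alpha> \<in> geom_realization n Y \<and> 0 \<le> t \<and> t \<le> 1 \<and> x = (\<lambda>i. (1 - t) * \<alpha> i, t))"
            using x Y0 geom_subset_cone_iff[OF Y(1)] by auto
          then show ?thesis
          proof
            assume "x = (\<lambda>_. 0, 1)"
            then have "segment_point s x (\<lambda>_. 0, 1) = x" by (simp add: segment_point_def)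
            then show ?thesis using x Y0 by auto
          next
            assume "\<exists>\<alpha> t. \<alpha> \<in> geom_realization n Y \<and> 0 \<le> t \<and> t \<le> 1 \<and> x = (\<lambda>i. (1 - t) * \<alpha> i, t)"
            then obtain \<alpha> t where a: "\<alpha> \<in> geom_realization n Y" "0 \<le> t" "t \<le> 1" "x = (\<lambda>i. (1 - t) * \<alpha> i, t)" by blast
            let ?t = "(1 - s) * t + s"
            have "1 - ?t = (1 - s) * (1 - t)" by (simp add: algebra_simps)
            moreover have "0 \<le> (1 - s) * (1 - t)" "0 \<le> (1 - s) * t" using s a by auto
            ultimately have "0 \<le> ?t" "?t \<le> 1" "segment_point s x (\<lambda>_. 0, 1) = (\<lambda>i. (1 - ?t) * \<alpha> i, ?t)"
              using s a(4) by (auto simp: segment_point_def mult.assoc)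
            then show ?thesis unfolding geom_subset_cone_iff[OF Y(1) Y0(2)] using a(1) by blast
          qed
        qed
        then show ?thesis using True Y0 by (simp add: face_point_def)
      next
        case False
        have x': "snd x = 0" "fst x \<in> geom_realization n Y" "f \<subseteq> {i. i \<le> n \<and> fst x i \<noteq> 0}"
          using x star_base[OF False, of x] by auto
        let ?\<gamma> = "\<lambda>i. (1 - s) * fst x i + s * fst (face_point f) i"
        have g: "?\<gamma> \<in> geom_realization n Y"
          using geom_realization_segment[OF Y(2) x'(2) pt_base(1)[OF f False] _ s] pt_base(2)[OF f False] x'(3) by simp
        have "f \<subseteq> {i. i \<le> n \<and> ?\<gamma> i \<noteq> 0}"
        proof
          fix i assume i: "i \<in> f"
          then have i': "i \<le> n" "fst x i > 0" "fst (face_point f) i > 0"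
            using x'(2,3) pt_base[OF f False] by (auto simp: geom_realization_def less_le)
          have "?\<gamma> i > 0"
          proof (cases "s = 0")
            case False
            then have "s * fst (face_point f) i > 0" "(1 - s) * fst x i \<ge> 0" using s i' by auto
            then show ?thesis by linarith
          qed (use i' in simp)
          then show "i \<in> {i. i \<le> n \<and> ?\<gamma> i \<noteq> 0}" using i' by simp
        qed
        moreover from this have "{i. i \<le> n \<and> ?\<gamma> i \<noteq> 0} \<in> U"
          using U(2)[OF f] g by (simp add: geom_realization_def)
        moreover have "snd (segment_point s x (face_point f)) = 0" "fst (segment_point s x (face_point f)) = ?\<gamma>"
          using x'(1) False by (auto simp: segment_point_def face_point_def)
        ultimately show ?thesis using star_base[OF False, of "segment_point s x (face_point f)"] g by auto
      qed
    qed
    ultimately show ?thesis by simp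
  qed
  have open_star: "openin (top_of_set Z) {x \<in> ?W. f \<subseteq> ?car x}"
    if "Z \<subseteq> ?W" "{x \<in> ?W. f \<subseteq> ?car x} \<subseteq> Z" "\<And>x. x \<in> Z \<Longrightarrow> snd x = 0" "f \<in> U" for Z f
  proof -
    have fn: "f \<subseteq> {0..n}" using that(4) Un by blast
    then have f: "finite f" "f \<subseteq> {0..n}" using finite_subset[of f "{0..n}"] by auto
    have eq: "{x \<in> ?W. f \<subseteq> ?car x} = Z \<inter> (\<Inter>i\<in>f. {x. fst x i \<noteq> 0})"
    proof (intro Set.set_eqI iffI)
      fix x assume x: "x \<in> {x \<in> ?W. f \<subseteq> ?car x}"
      then have "x \<in> Z" using that(2) by blast
      moreover have "f \<subseteq> {i. i \<le> n \<and> fst x i \<noteq> 0}"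
        using x that(3)[OF \<open>x \<in> Z\<close>] by (simp add: carrier_face_def)
      ultimately show "x \<in> Z \<inter> (\<Inter>i\<in>f. {x. fst x i \<noteq> 0})" by blast
    next
      fix x assume x: "x \<in> Z \<inter> (\<Inter>i\<in>f. {x. fst x i \<noteq> 0})"
      then have "x \<in> Z" by simp
      moreover have "f \<subseteq> {i. i \<le> n \<and> fst x i \<noteq> 0}" using x f(2) by fastforce
      ultimately show "x \<in> {x \<in> ?W. f \<subseteq> ?car x}"
        using that(1) that(3)[OF \<open>x \<in> Z\<close>] by (auto simp: carrier_face_def)
    qed
    have "open (\<Inter>i\<in>f. {x :: (nat \<Rightarrow> real) \<times> real. fst x i \<noteq> 0})"
      by (intro open_INT f(1) ballI open_Collect_neq continuous_intros continuous_on_product_then_coordinatewise)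
    then show ?thesis unfolding eq by blast
  qed
  show S: "{x \<in> topspace ?T. ?car x \<in> U'} = geom_subset n Y U'"
  proof (cases "{} \<in> U'")
    case True
    then show ?thesis using full'[OF True] car_in by auto
  next
    case False
    show ?thesis
    proof (intro Set.set_eqI iffI)
      fix x assume x: "x \<in> {x \<in> topspace ?T. ?car x \<in> U'}"
      then have "snd x = 0" using False by (auto simp: carrier_face_def split: if_splits)
      then show "x \<in> geom_subset n Y U'"
        using x base[of "fst x"] geom_subset_base_iff[OF Un', of "fst x" Y] by (cases x) (auto simp: carrier_face_def)
    next
      fix x assume x: "x \<in> geom_subset n Y U'"
      then have "snd x = 0" using geom_subset_height False by blast
      then show "x \<in> {x \<in> topspace ?T. ?car x \<in> U'}"
        using x base[of "fst x"] geom_subset_base_iff[OF Un', of "fst x" Y] U' by (cases x) (auto simp: carrier_face_def)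
    qed
  qed
  have cover_gen: "\<exists>G\<subseteq>U0. (\<forall>g\<in>G. openin (top_of_set Z) (star ?T ?car g)) \<and> Z \<subseteq> (\<Union>g\<in>G. star ?T ?car g)"
    if Z: "Z = {x \<in> ?W. ?car x \<in> U0}" "U0 \<subseteq> U" "\<And>f g. f \<in> U0 \<Longrightarrow> f \<subseteq> g \<Longrightarrow> g \<in> U \<Longrightarrow> g \<in> U0" for Z U0
  proof (cases "{} \<in> U0")
    case True
    then have "Z = ?W" using Z car_in by auto
    then show ?thesis using True by (intro exI[of _ "{{}}"]) (auto simp: star)
  next
    case False
    have h: "snd x = 0" if "x \<in> Z" for x using that False Z(1) by (auto simp: carrier_face_def split: if_splits)
    have "openin (top_of_set Z) (star ?T ?car g)" if g: "g \<in> U0" for g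
      unfolding star
    proof (rule open_star[of Z g])
      show "Z \<subseteq> ?W" unfolding Z(1) by (rule Collect_subset)
      show "{x \<in> ?W. g \<subseteq> ?car x} \<subseteq> Z"
      proof
        fix x assume "x \<in> {x \<in> ?W. g \<subseteq> ?car x}"
        then have x: "x \<in> ?W" "g \<subseteq> ?car x" by simp_all
        then have "?car x \<in> U0" using Z(3)[OF g x(2) car_in[OF x(1)]] by simp
        then show "x \<in> Z" using x unfolding Z(1) by simp
      qed
      show "snd x = 0" if "x \<in> Z" for x by (rule h[OF that])
      show "g \<in> U" using g Z(2) by (rule rev_subsetD)
    qed
    then show ?thesis using Z(1) by (intro exI[of _ U0]) (auto simp: star)
  qed
  show "stratified_space ?T ?car face_point U U'"
  proof
    show "\<exists>G\<subseteq>U. (\<forall>g\<in>G. openin ?T (star ?T ?car g)) \<and> topspace ?T \<subseteq> (\<Union>g\<in>G. star ?T ?car g)"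
    proof -
      have W: "?W = {x \<in> ?W. ?car x \<in> U}" using car_in by blast
      have "g \<in> U" if "f \<in> U" "f \<subseteq> g" "g \<in> U" for f g using that(3) .
      from cover_gen[OF W order_refl this] show ?thesis by (simp only: topspace_euclidean_subtopology)
    qed
    have sub: "subtopology ?T {x \<in> topspace ?T. ?car x \<in> U'} = top_of_set {x \<in> ?W. ?car x \<in> U'}"
      unfolding subtopology_subtopology by (intro arg_cong[where f = top_of_set]) auto
    show "\<exists>G\<subseteq>U'. (\<forall>g\<in>G. openin (subtopology ?T {x \<in> topspace ?T. ?car x \<in> U'}) (star ?T ?car g)) \<and>
        {x \<in> topspace ?T. ?car x \<in> U'} \<subseteq> (\<Union>g\<in>G. star ?T ?car g)"
    proof -
      have "g \<in> U'" if "f \<in> U'" "f \<subseteq> g" "g \<in> U" for f g using U'(2)[OF that(1,2)] U(1) that(3) by blast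
      from cover_gen[OF refl U'(1) this] show ?thesis unfolding sub by (simp only: topspace_euclidean_subtopology)
    qed
    show "f \<union> g \<in> U" if "f \<in> U" "g \<in> U" "h \<in> U" "f \<subseteq> h" "g \<subseteq> h" for f g h
      using U(2)[OF that(1), of "f \<union> g"] Y(2)[of h "f \<union> g"] U(1) that by auto
    show "g \<in> U'" if "f \<in> U'" "g \<in> U" "f \<subseteq> g" for f g using U'(2)[OF that(1,3)] U(1) that(2) by auto
  qed (use car_in pt contr U'(1) in auto)
qed

section \<open>Monomials and polynomials\<close>

declare One_nat_def [simp del]

abbreviation keys where "keys \<equiv> Poly_Mapping.keys"
abbreviation lookup where "lookup \<equiv> Poly_Mapping.lookup"
abbreviation single where "single \<equiv> Poly_Mapping.single"

type_synonym expo = "nat \<Rightarrow>\<^sub>0 nat"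

text \<open>Divisibility of monomials.\<close>

definition below :: "expo \<Rightarrow> expo \<Rightarrow> bool" where
  "below s t \<longleftrightarrow> (\<forall>i. lookup s i \<le> lookup t i)"

lemma below_add [simp]: "below s (s + t)" "below s (t + s)"
  by (auto simp: below_def lookup_add)

lemma below_refl [simp]: "below s s" by (simp add: below_def)

lemma below_trans: "below s t \<Longrightarrow> below t u \<Longrightarrow> below s u"
  unfolding below_def using le_trans by blast

lemma below_diff: "below s t \<Longrightarrow> s + (t - s) = t"
  by (intro poly_mapping_eqI) (simp add: below_def lookup_add lookup_minus)

lemma below_iff: "below s t \<longleftrightarrow> (\<exists>e. t = s + e)"
  using below_diff below_add by metis

lemma keys_add_nat: "keys (s + t) = keys s \<union> keys (t :: expo)"
  by (auto simp: in_keys_iff lookup_add)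

lemma below_keys: "below s t \<Longrightarrow> keys s \<subseteq> keys t"
proof
  fix i assume s: "below s t" "i \<in> keys s"
  then have "lookup s i \<le> lookup t i" "lookup s i \<noteq> 0" by (simp_all add: below_def in_keys_iff)
  then show "i \<in> keys t" by (simp add: in_keys_iff)
qed

lemma poly_eq_sum_single: "p = (\<Sum>t\<in>keys p. single t (lookup p t))"
  by (intro poly_mapping_eqI) (simp add: lookup_sum lookup_single when_def in_keys_iff)

lemma additive_sum:
  fixes F :: "'a::comm_monoid_add \<Rightarrow> 'b::comm_monoid_add"
  assumes "F 0 = 0" "\<And>x y. F (x + y) = F x + F y"
  shows "F (\<Sum>i\<in>K. g i) = (\<Sum>i\<in>K. F (g i))"
  using assms by (induction K rule: infinite_finite_induct) auto

lemma lookup_single_mult: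
  fixes p :: mpoly
  shows "lookup (single e z * p) u = (if below e u then z * lookup p (u - e) else 0)"
proof -
  have "single e z * p = (\<Sum>t\<in>keys p. single (e + t) (z * lookup p t))"
  proof -
    have "single e z * p = single e z * (\<Sum>t\<in>keys p. single t (lookup p t))"
      using poly_eq_sum_single[of p] by simp
    also have "\<dots> = (\<Sum>t\<in>keys p. single (e + t) (z * lookup p t))"
      by (simp add: sum_distrib_left mult_single)
    finally show ?thesis .
  qed
  then have *: "lookup (single e z * p) u = (\<Sum>t\<in>keys p. if e + t = u then z * lookup p t else 0)"
    by (simp add: lookup_sum lookup_single when_def)
  show ?thesis
  proof (cases "below e u")
    case True
    then have "e + t = u \<longleftrightarrow> t = u - e" for t using below_diff[OF True] by (metis add_diff_cancel_left')
    then show ?thesis using True by (simp add: * in_keys_iff)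
  next
    case False
    then have "e + t \<noteq> u" for t by (auto simp: below_iff)
    then show ?thesis using False by (simp add: *)
  qed
qed

lemma lookup_mult_sum:
  fixes p r :: mpoly
  shows "lookup (r * p) u = (\<Sum>e\<in>keys r. if below e u then lookup r e * lookup p (u - e) else 0)"
proof -
  have "r * p = (\<Sum>e\<in>keys r. single e (lookup r e) * p)"
    unfolding sum_distrib_right[symmetric] by (rule arg_cong[OF poly_eq_sum_single, of "\<lambda>q. q * p"])
  then have "lookup (r * p) u = lookup (\<Sum>e\<in>keys r. single e (lookup r e) * p) u" by (rule arg_cong)
  also have "\<dots> = (\<Sum>e\<in>keys r. lookup (single e (lookup r e) * p) u)" by (rule lookup_sum)
  finally show ?thesis by (simp add: lookup_single_mult cong: sum.cong)
qed

definition block :: "nat \<Rightarrow> nat set \<Rightarrow> expo" where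
  "block k S = (\<Sum>i\<in>S. single i k)"

lemma lookup_block: "finite S \<Longrightarrow> lookup (block k S) i = (if i \<in> S then k else 0)"
  by (simp add: block_def lookup_sum lookup_single when_def)

lemma keys_block: "finite S \<Longrightarrow> keys (block k S) = (if k = 0 then {} else S)"
  by (rule Set.set_eqI) (simp add: in_keys_iff lookup_block del: keys_eq_empty)

lemma prod_poly_var: "finite S \<Longrightarrow> (\<Prod>i\<in>S. poly_var i) = single (block 1 S) 1"
proof (induction S rule: finite_induct)
  case (insert i S)
  then show ?case by (simp add: poly_var_def mult_single block_def)
qed (simp add: block_def)

lemma keys_diff_subset: "keys (p - q) \<subseteq> keys p \<union> keys (q :: 'a \<Rightarrow>\<^sub>0 'b::ab_group_add)"
  by (auto simp: in_keys_iff lookup_minus)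

section \<open>The polynomial ring\<close>

lemma poly_ring_simps [simp]:
  "mult (poly_ring n) = (*)" "one (poly_ring n) = 1" "zero (poly_ring n) = 0" "add (poly_ring n) = (+)"
  by (simp_all add: poly_ring_def)

lemma poly_ring_carrier: "p \<in> carrier (poly_ring n) \<longleftrightarrow> (\<forall>t\<in>keys p. keys t \<subseteq> {0..n})"
  by (simp add: poly_ring_def)

lemma poly_ring_closed [simp]:
  "0 \<in> carrier (poly_ring n)" "1 \<in> carrier (poly_ring n)"
  "p \<in> carrier (poly_ring n) \<Longrightarrow> q \<in> carrier (poly_ring n) \<Longrightarrow> p + q \<in> carrier (poly_ring n)"
  "p \<in> carrier (poly_ring n) \<Longrightarrow> q \<in> carrier (poly_ring n) \<Longrightarrow> p - q \<in> carrier (poly_ring n)"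
  "p \<in> carrier (poly_ring n) \<Longrightarrow> q \<in> carrier (poly_ring n) \<Longrightarrow> p * q \<in> carrier (poly_ring n)"
  "p \<in> carrier (poly_ring n) \<Longrightarrow> - p \<in> carrier (poly_ring n)"
proof -
  show "p + q \<in> carrier (poly_ring n)" if "p \<in> carrier (poly_ring n)" "q \<in> carrier (poly_ring n)"
    using that keys_add[of p q] unfolding poly_ring_carrier by blast
  show "p - q \<in> carrier (poly_ring n)" if "p \<in> carrier (poly_ring n)" "q \<in> carrier (poly_ring n)"
    using that keys_diff_subset[of p q] unfolding poly_ring_carrier by blast
  show "p * q \<in> carrier (poly_ring n)" if pq: "p \<in> carrier (poly_ring n)" "q \<in> carrier (poly_ring n)"
    unfolding poly_ring_carrier
  proof
    fix t assume "t \<in> keys (p * q)"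
    then obtain a b where "t = a + b" "a \<in> keys p" "b \<in> keys q" using keys_mult[of p q] by blast
    then show "keys t \<subseteq> {0..n}" using pq unfolding poly_ring_carrier by (simp add: keys_add_nat)
  qed
  show "- p \<in> carrier (poly_ring n)" if "p \<in> carrier (poly_ring n)"
    using that unfolding poly_ring_carrier by (simp add: in_keys_iff)
qed (auto simp: poly_ring_carrier)

lemma single_closed [simp]: "keys t \<subseteq> {0..n} \<Longrightarrow> single t z \<in> carrier (poly_ring n)"
  by (simp add: poly_ring_carrier)

lemma poly_const_closed [simp]: "poly_const z \<in> carrier (poly_ring n)"
  by (simp add: poly_const_def)

lemma lookup_poly_const_mult: "lookup (poly_const z * p) t = z * lookup p t"
proof -
  have "below 0 t" by (simp add: below_def)
  then show ?thesis by (simp add: poly_const_def lookup_single_mult)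
qed

lemma sum_closed: "(\<And>i. i \<in> K \<Longrightarrow> p i \<in> carrier (poly_ring n)) \<Longrightarrow> (\<Sum>i\<in>K. p i) \<in> carrier (poly_ring n)"
  by (induction K rule: infinite_finite_induct) auto

lemma poly_ring_cring: "cring (poly_ring n)"
proof (rule cringI)
  show "abelian_group (poly_ring n)"
  proof (rule abelian_groupI)
    fix p assume "p \<in> carrier (poly_ring n)"
    then show "\<exists>q\<in>carrier (poly_ring n). q \<oplus>\<^bsub>poly_ring n\<^esub> p = \<zero>\<^bsub>poly_ring n\<^esub>"
      by (intro bexI[of _ "- p"]) auto
  qed (auto simp: algebra_simps)
  show "comm_monoid (poly_ring n)" by (rule comm_monoidI) (auto simp: algebra_simps)
qed (auto simp: algebra_simps)

interpretation PR: cring "poly_ring n" for n by (rule poly_ring_cring)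

lemma poly_ring_neg: "p \<in> carrier (poly_ring n) \<Longrightarrow> \<ominus>\<^bsub>poly_ring n\<^esub> p = - p"
  by (rule PR.minus_equality) auto

section \<open>Stanley-Reisner ideals\<close>

locale stanley_reisner =
  fixes n :: nat and X :: "nat set set"
  assumes complex: "simplicial_complex_on n X"
begin

abbreviation P where "P \<equiv> poly_ring n"
abbreviation I where "I \<equiv> stanley_reisner_ideal n X"
abbreviation A where "A \<equiv> P Quot I"

lemma face_subset: "f \<in> X \<Longrightarrow> f \<subseteq> {0..n}" and face_down: "f \<in> X \<Longrightarrow> g \<subseteq> f \<Longrightarrow> g \<in> X"
  using complex unfolding simplicial_complex_on_def by blast+

lemma ideal_nonface_polys: "ideal {p \<in> carrier P. \<forall>t\<in>keys p. keys t \<notin> X} P"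
proof (rule idealI[OF PR.ring_axioms])
  show "subgroup {p \<in> carrier P. \<forall>t\<in>keys p. keys t \<notin> X} (add_monoid P)"
  proof
    fix p q assume "p \<in> {p \<in> carrier P. \<forall>t\<in>keys p. keys t \<notin> X}" "q \<in> {p \<in> carrier P. \<forall>t\<in>keys p. keys t \<notin> X}"
    then show "p \<otimes>\<^bsub>add_monoid P\<^esub> q \<in> {p \<in> carrier P. \<forall>t\<in>keys p. keys t \<notin> X}"
      using keys_add[of p q] by auto
  next
    fix p assume p: "p \<in> {p \<in> carrier P. \<forall>t\<in>keys p. keys t \<notin> X}"
    then have "inv\<^bsub>add_monoid P\<^esub> p = - p" using poly_ring_neg[of p n] by (simp add: a_inv_def)
    then show "inv\<^bsub>add_monoid P\<^esub> p \<in> {p \<in> carrier P. \<forall>t\<in>keys p. keys t \<notin> X}"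
      using p by (auto simp: in_keys_iff)
  qed auto
  fix p x assume p: "p \<in> {p \<in> carrier P. \<forall>t\<in>keys p. keys t \<notin> X}" and x: "x \<in> carrier P"
  have *: "keys t \<notin> X" if t: "t \<in> keys (x * p)" for t
  proof -
    obtain a b where "t = a + b" "a \<in> keys x" "b \<in> keys p" using keys_mult[of x p] t by blast
    then show ?thesis using p face_down[of "keys t" "keys b"] by (auto simp: keys_add_nat)
  qed
  then show "x \<otimes>\<^bsub>P\<^esub> p \<in> {p \<in> carrier P. \<forall>t\<in>keys p. keys t \<notin> X}"
    "p \<otimes>\<^bsub>P\<^esub> x \<in> {p \<in> carrier P. \<forall>t\<in>keys p. keys t \<notin> X}"
    using p x by (auto simp: mult.commute)
qed

text \<open>A monomial whose support is a nonface is a multiple of the squarefree generator on its support, and the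
  polynomials with such monomials only form an ideal.\<close>

lemma I_eq: "I = {p \<in> carrier P. \<forall>t\<in>keys p. keys t \<notin> X}"
proof
  let ?G = "{(\<Prod>i\<in>p. poly_var i) | p. p \<subseteq> {0..n} \<and> p \<notin> X}"
  have G: "?G \<subseteq> {p \<in> carrier P. \<forall>t\<in>keys p. keys t \<notin> X}"
  proof
    fix q assume "q \<in> ?G"
    then obtain p where p: "q = (\<Prod>i\<in>p. poly_var i)" "p \<subseteq> {0..n}" "p \<notin> X" by blast
    then have "finite p" using finite_subset by blast
    then show "q \<in> {p \<in> carrier P. \<forall>t\<in>keys p. keys t \<notin> X}"
      using p by (simp add: prod_poly_var keys_block)
  qed
  show "I \<subseteq> {p \<in> carrier P. \<forall>t\<in>keys p. keys t \<notin> X}"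
    unfolding stanley_reisner_ideal_def genideal_def using ideal_nonface_polys G by blast
  have "?G \<subseteq> carrier P" using G by blast
  then have I: "ideal I P" and GI: "?G \<subseteq> I"
    unfolding stanley_reisner_ideal_def by (rule PR.genideal_ideal, rule PR.genideal_self)
  interpret ideal I P by (rule I)
  show "{p \<in> carrier P. \<forall>t\<in>keys p. keys t \<notin> X} \<subseteq> I"
  proof
    fix p assume p: "p \<in> {p \<in> carrier P. \<forall>t\<in>keys p. keys t \<notin> X}"
    have "single t (lookup p t) \<in> I" if t: "t \<in> keys p" for t
    proof -
      have tn: "keys t \<subseteq> {0..n}" "keys t \<notin> X" using p t by (auto simp: poly_ring_carrier)
      from tn have "(\<Prod>i\<in>keys t. poly_var i) \<in> ?G" by blast
      then have "(\<Prod>i\<in>keys t. poly_var i) \<in> I" by (rule subsetD[OF GI])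
      then have gen: "single (block 1 (keys t)) 1 \<in> I" by (simp only: prod_poly_var[OF finite_keys])
      have b: "below (block 1 (keys t)) t"
        unfolding below_def by (auto simp: lookup_block in_keys_iff)
      have "keys (t - block 1 (keys t)) \<subseteq> keys t"
        by (auto simp: in_keys_iff lookup_minus)
      then have "single (t - block 1 (keys t)) (lookup p t) \<in> carrier P"
        using tn(1) by (intro single_closed) (rule order_trans)
      from I_r_closed[OF gen this] show ?thesis
        by (simp add: mult_single below_diff[OF b])
    qed
    then have mem: "\<forall>t\<in>keys p. single t (lookup p t) \<in> I" by blast
    have "K \<subseteq> keys p \<longrightarrow> (\<Sum>t\<in>K. single t (lookup p t)) \<in> I" for K
    proof (induction K rule: infinite_finite_induct)
      case (insert t K)
      then show ?case
        using mem a_closed[of "single t (lookup p t)" "\<Sum>t\<in>K. single t (lookup p t)"] by simp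
    qed (use zero_closed in simp_all)
    from this[THEN mp, OF order_refl] show "p \<in> I" unfolding poly_eq_sum_single[symmetric] .
  qed
qed

lemma ideal_I: "ideal I P"
  unfolding I_eq by (rule ideal_nonface_polys)

sublocale II: ideal I P by (rule ideal_I)

lemma I_iff: "p \<in> I \<longleftrightarrow> p \<in> carrier P \<and> (\<forall>t. keys t \<in> X \<longrightarrow> lookup p t = 0)"
  unfolding I_eq by (auto simp: in_keys_iff)

lemma I_carrier: "p \<in> I \<Longrightarrow> p \<in> carrier P"
  by (simp add: I_iff)

lemma single_in_I: "keys t \<subseteq> {0..n} \<Longrightarrow> keys t \<notin> X \<Longrightarrow> single t z \<in> I"
  unfolding I_eq by simp

section \<open>Coefficients in the Stanley-Reisner ring\<close>

abbreviation cl :: "mpoly \<Rightarrow> mpoly set" where "cl p \<equiv> I +>\<^bsub>P\<^esub> p"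

lemma cl_eq_iff:
  assumes "p \<in> carrier P" "q \<in> carrier P"
  shows "cl p = cl q \<longleftrightarrow> (\<forall>t. keys t \<in> X \<longrightarrow> lookup p t = lookup q t)"
proof -
  have "cl p = cl q \<longleftrightarrow> p - q \<in> I"
    using PR.quotient_eq_iff_same_a_r_cos[OF ideal_I assms] poly_ring_neg[OF assms(2)]
    by (simp add: a_minus_def)
  also have "\<dots> \<longleftrightarrow> (\<forall>t. keys t \<in> X \<longrightarrow> lookup p t = lookup q t)"
    using assms by (simp add: I_iff lookup_minus)
  finally show ?thesis .
qed

text \<open>Independent of the representative when the support of \<open>t\<close> is a face, by \<open>cl_eq_iff\<close>; these
  coefficients determine an element of \<open>A\<close>.\<close>

definition coef :: "mpoly set \<Rightarrow> expo \<Rightarrow> complex" where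
  "coef C t = lookup (SOME p. p \<in> carrier P \<and> C = cl p) t"

lemma coef_cl: "p \<in> carrier P \<Longrightarrow> keys t \<in> X \<Longrightarrow> coef (cl p) t = lookup p t"
proof -
  assume p: "p \<in> carrier P" and t: "keys t \<in> X"
  let ?q = "SOME q. q \<in> carrier P \<and> cl p = cl q"
  have "?q \<in> carrier P \<and> cl p = cl ?q" by (rule someI[of _ p]) (use p in simp)
  then have "\<forall>t. keys t \<in> X \<longrightarrow> lookup p t = lookup ?q t"
    using cl_eq_iff[OF p, of ?q] by blast
  then show ?thesis using t by (simp add: coef_def)
qed

lemma A_carrier: "C \<in> carrier A \<longleftrightarrow> (\<exists>p\<in>carrier P. C = cl p)"
  by (auto simp: FactRing_def A_RCOSETS_def')

lemma cl_in_A [simp]: "p \<in> carrier P \<Longrightarrow> cl p \<in> carrier A"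
  by (auto simp: A_carrier)

lemma A_eqI:
  assumes "C \<in> carrier A" "D \<in> carrier A" "\<And>t. keys t \<in> X \<Longrightarrow> coef C t = coef D t"
  shows "C = D"
proof -
  obtain p q where "p \<in> carrier P" "q \<in> carrier P" "C = cl p" "D = cl q"
    using assms(1,2) by (auto simp: A_carrier)
  then show ?thesis using assms(3) cl_eq_iff coef_cl by metis
qed

lemma A_add: "p \<in> carrier P \<Longrightarrow> q \<in> carrier P \<Longrightarrow> cl p \<oplus>\<^bsub>A\<^esub> cl q = cl (p + q)"
  using II.a_rcos_sum[of p q] by (simp add: FactRing_def)

lemma A_mult: "p \<in> carrier P \<Longrightarrow> q \<in> carrier P \<Longrightarrow> cl p \<otimes>\<^bsub>A\<^esub> cl q = cl (p * q)"
  using II.rcoset_mult_add[of p q] by (simp add: FactRing_def)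

lemma A_zero: "\<zero>\<^bsub>A\<^esub> = I" and A_zero': "I = cl 0"
  using II.a_rcos_const[of 0] II.zero_closed by (simp_all add: FactRing_def)

lemma A_cring: "cring A"
  by (rule II.quotient_is_cring[OF poly_ring_cring])

sublocale AA: cring A by (rule A_cring)

lemma coef_zero: "keys t \<in> X \<Longrightarrow> coef I t = 0"
  using coef_cl[of 0 t] A_zero' by simp

lemma coef_add:
  assumes "C \<in> carrier A" "D \<in> carrier A" "keys t \<in> X"
  shows "coef (C \<oplus>\<^bsub>A\<^esub> D) t = coef C t + coef D t"
  using assms by (auto simp: A_carrier A_add coef_cl lookup_add)

lemma coef_single_mult:
  assumes "keys e \<subseteq> {0..n}" "C \<in> carrier A" "keys t \<in> X"
  shows "coef (cl (single e z) \<otimes>\<^bsub>A\<^esub> C) t = (if below e t then z * coef C (t - e) else 0)"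
proof -
  obtain p where p: "p \<in> carrier P" "C = cl p" using assms(2) by (auto simp: A_carrier)
  have "keys (t - e) \<in> X"
  proof -
    have "keys (t - e) \<subseteq> keys t" by (auto simp: in_keys_iff lookup_minus)
    then show ?thesis using face_down[OF assms(3)] by blast
  qed
  then show ?thesis using assms p by (auto simp: A_mult coef_cl lookup_single_mult)
qed

lemma coef_const_mult:
  assumes "C \<in> carrier A" "keys t \<in> X"
  shows "coef (cl (poly_const z) \<otimes>\<^bsub>A\<^esub> C) t = z * coef C t"
proof -
  have "below 0 t" by (simp add: below_def)
  then show ?thesis using coef_single_mult[of 0 C t z] assms by (simp add: poly_const_def)
qed

lemma quot_ring_gradingD:
  assumes "C \<in> quot_ring_grading n I d"
  shows "C \<in> carrier A" "keys t \<in> X \<Longrightarrow> coef C t \<noteq> 0 \<Longrightarrow> i \<le> n \<Longrightarrow> int (lookup t i) = d i"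
proof -
  obtain p where p: "p \<in> poly_grading n d" "C = cl p"
    using assms by (auto simp: quot_ring_grading_def quot_grading_def regular_module_def a_r_coset_def')
  then have c: "p \<in> carrier P" by (simp add: poly_grading_def)
  then show "C \<in> carrier A" using p by simp
  show "int (lookup t i) = d i" if "keys t \<in> X" "coef C t \<noteq> 0" "i \<le> n"
    using that p c by (auto simp: coef_cl poly_grading_def in_keys_iff)
qed

lemma quot_ring_gradingI: "p \<in> poly_grading n d \<Longrightarrow> cl p \<in> quot_ring_grading n I d"
  by (auto simp: quot_ring_grading_def quot_grading_def regular_module_def a_r_coset_def')

end

section \<open>Modules of homomorphisms\<close>

lemma hom_module_simps:
  "carrier (hom_module R M N) = mod_hom R M N"
  "\<zero>\<^bsub>hom_module R M N\<^esub> = (\<lambda>x\<in>carrier M. \<zero>\<^bsub>N\<^esub>)"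
  "g \<oplus>\<^bsub>hom_module R M N\<^esub> h = (\<lambda>x\<in>carrier M. g x \<oplus>\<^bsub>N\<^esub> h x)"
  "r \<odot>\<^bsub>hom_module R M N\<^esub> h = (\<lambda>x\<in>carrier M. r \<odot>\<^bsub>N\<^esub> h x)"
  by (simp_all add: hom_module_def)

lemma mod_homI:
  assumes "\<And>x. x \<in> carrier M \<Longrightarrow> h x \<in> carrier N" "h \<in> extensional (carrier M)"
    "\<And>x y. x \<in> carrier M \<Longrightarrow> y \<in> carrier M \<Longrightarrow> h (x \<oplus>\<^bsub>M\<^esub> y) = h x \<oplus>\<^bsub>N\<^esub> h y"
    "\<And>r x. r \<in> carrier R \<Longrightarrow> x \<in> carrier M \<Longrightarrow> h (r \<odot>\<^bsub>M\<^esub> x) = r \<odot>\<^bsub>N\<^esub> h x"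
  shows "h \<in> mod_hom R M N"
  using assms unfolding mod_hom_def PiE_def by auto

lemma mod_homD:
  assumes "h \<in> mod_hom R M N"
  shows "x \<in> carrier M \<Longrightarrow> h x \<in> carrier N" "h \<in> extensional (carrier M)"
    "x \<in> carrier M \<Longrightarrow> y \<in> carrier M \<Longrightarrow> h (x \<oplus>\<^bsub>M\<^esub> y) = h x \<oplus>\<^bsub>N\<^esub> h y"
    "r \<in> carrier R \<Longrightarrow> x \<in> carrier M \<Longrightarrow> h (r \<odot>\<^bsub>M\<^esub> x) = r \<odot>\<^bsub>N\<^esub> h x"
  using assms unfolding mod_hom_def PiE_def by auto

text \<open>The closure properties of source and target that make the homomorphisms an additive group with
  scalar multiplication.\<close>

locale hom_target =
  fixes R :: "'r ring" and M :: "('r, 'm) module" and N :: "('r, 'k) module"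
  assumes N: "abelian_group N"
    and M_add: "x \<in> carrier M \<Longrightarrow> y \<in> carrier M \<Longrightarrow> x \<oplus>\<^bsub>M\<^esub> y \<in> carrier M"
    and M_smult: "r \<in> carrier R \<Longrightarrow> x \<in> carrier M \<Longrightarrow> r \<odot>\<^bsub>M\<^esub> x \<in> carrier M"
    and N_smult: "r \<in> carrier R \<Longrightarrow> p \<in> carrier N \<Longrightarrow> r \<odot>\<^bsub>N\<^esub> p \<in> carrier N"
    and N_distr: "r \<in> carrier R \<Longrightarrow> p \<in> carrier N \<Longrightarrow> q \<in> carrier N \<Longrightarrow>
        r \<odot>\<^bsub>N\<^esub> (p \<oplus>\<^bsub>N\<^esub> q) = r \<odot>\<^bsub>N\<^esub> p \<oplus>\<^bsub>N\<^esub> r \<odot>\<^bsub>N\<^esub> q"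
    and N_comm: "r \<in> carrier R \<Longrightarrow> s \<in> carrier R \<Longrightarrow> p \<in> carrier N \<Longrightarrow>
        r \<odot>\<^bsub>N\<^esub> (s \<odot>\<^bsub>N\<^esub> p) = s \<odot>\<^bsub>N\<^esub> (r \<odot>\<^bsub>N\<^esub> p)"
begin

interpretation N: abelian_group N by (rule N)

lemma smult_zero: "r \<in> carrier R \<Longrightarrow> r \<odot>\<^bsub>N\<^esub> \<zero>\<^bsub>N\<^esub> = \<zero>\<^bsub>N\<^esub>"
proof -
  assume r: "r \<in> carrier R"
  have c: "r \<odot>\<^bsub>N\<^esub> \<zero>\<^bsub>N\<^esub> \<in> carrier N" using N_smult[OF r] by simp
  have "r \<odot>\<^bsub>N\<^esub> \<zero>\<^bsub>N\<^esub> \<oplus>\<^bsub>N\<^esub> r \<odot>\<^bsub>N\<^esub> \<zero>\<^bsub>N\<^esub> = r \<odot>\<^bsub>N\<^esub> \<zero>\<^bsub>N\<^esub>"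
    using N_distr[OF r, of "\<zero>\<^bsub>N\<^esub>" "\<zero>\<^bsub>N\<^esub>"] by simp
  then show ?thesis using c N.add.l_cancel_one by blast
qed

lemma smult_neg: "r \<in> carrier R \<Longrightarrow> y \<in> carrier N \<Longrightarrow> r \<odot>\<^bsub>N\<^esub> (\<ominus>\<^bsub>N\<^esub> y) = \<ominus>\<^bsub>N\<^esub> (r \<odot>\<^bsub>N\<^esub> y)"
  using N_distr[of r "\<ominus>\<^bsub>N\<^esub> y" y] smult_zero[of r] N_smult
  by (intro N.minus_equality[symmetric]) (auto simp: N.l_neg)

lemma hom_zero: "(\<lambda>x\<in>carrier M. \<zero>\<^bsub>N\<^esub>) \<in> mod_hom R M N"
  by (rule mod_homI) (auto simp: M_add M_smult smult_zero)

lemma hom_add: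
  assumes "g \<in> mod_hom R M N" "h \<in> mod_hom R M N"
  shows "(\<lambda>x\<in>carrier M. g x \<oplus>\<^bsub>N\<^esub> h x) \<in> mod_hom R M N"
  using mod_homD[OF assms(1)] mod_homD[OF assms(2)]
  by (intro mod_homI) (auto simp: M_add M_smult N_distr N.a_ac)

lemma hom_neg:
  assumes "h \<in> mod_hom R M N"
  shows "(\<lambda>x\<in>carrier M. \<ominus>\<^bsub>N\<^esub> h x) \<in> mod_hom R M N"
  using mod_homD[OF assms]
  by (intro mod_homI) (auto simp: M_add M_smult N.minus_add smult_neg)

lemma hom_smult:
  assumes "h \<in> mod_hom R M N" "s \<in> carrier R"
  shows "(\<lambda>x\<in>carrier M. s \<odot>\<^bsub>N\<^esub> h x) \<in> mod_hom R M N"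
  using mod_homD[OF assms(1)] assms(2)
  by (intro mod_homI) (auto simp: M_add M_smult N_smult N_distr N_comm)

lemma hom_abelian_group: "abelian_group (hom_module R M N)"
proof (rule abelian_groupI)
  fix h assume h: "h \<in> carrier (hom_module R M N)"
  then have h': "h \<in> mod_hom R M N" by (simp add: hom_module_simps)
  note D = mod_homD[OF h']
  show "\<zero>\<^bsub>hom_module R M N\<^esub> \<oplus>\<^bsub>hom_module R M N\<^esub> h = h"
    using D(1,2) by (intro ext) (auto simp: hom_module_simps extensional_def)
  show "\<exists>g\<in>carrier (hom_module R M N). g \<oplus>\<^bsub>hom_module R M N\<^esub> h = \<zero>\<^bsub>hom_module R M N\<^esub>"
    using hom_neg[OF h'] D(1)
    by (intro bexI[of _ "\<lambda>x\<in>carrier M. \<ominus>\<^bsub>N\<^esub> h x"]) (auto simp: hom_module_simps N.l_neg intro!: restrict_ext)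
qed (auto simp: hom_module_simps hom_add hom_zero
    intro!: restrict_ext N.a_assoc N.a_comm mod_homD(1)[where R = R and M = M and N = N])

lemma hom_neg_eq:
  assumes "h \<in> mod_hom R M N"
  shows "\<ominus>\<^bsub>hom_module R M N\<^esub> h = (\<lambda>x\<in>carrier M. \<ominus>\<^bsub>N\<^esub> h x)"
proof -
  interpret H: abelian_group "hom_module R M N" by (rule hom_abelian_group)
  show ?thesis
    using hom_neg[OF assms] assms mod_homD(1)[OF assms]
    by (intro H.minus_equality) (auto simp: hom_module_simps N.l_neg intro!: restrict_ext)
qed

lemma hom_smult_distr:
  assumes "g \<in> mod_hom R M N" "h \<in> mod_hom R M N" "s \<in> carrier R"
  shows "s \<odot>\<^bsub>hom_module R M N\<^esub> (g \<oplus>\<^bsub>hom_module R M N\<^esub> h) =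
    s \<odot>\<^bsub>hom_module R M N\<^esub> g \<oplus>\<^bsub>hom_module R M N\<^esub> s \<odot>\<^bsub>hom_module R M N\<^esub> h"
  using mod_homD(1)[OF assms(1)] mod_homD(1)[OF assms(2)] assms(3)
  by (auto simp: hom_module_simps N_distr intro!: restrict_ext)

end

section \<open>A fixed multidegree\<close>

locale multidegree = stanley_reisner +
  fixes a b :: "nat \<Rightarrow> nat"
  assumes disj: "vec_support n a \<inter> vec_support n b = {}"
begin

definition As where "As = vec_support n a"
definition Bs where "Bs = vec_support n b"
definition ea :: expo where "ea = (\<Sum>i\<le>n. single i (a i))"
definition eb :: expo where "eb = (\<Sum>i\<le>n. single i (b i))"
abbreviation cdeg :: mdeg where "cdeg \<equiv> (\<lambda>i. int (a i) - int (b i))"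
definition Y where "Y = link As X"
definition U where "U = U_faces Bs Y"
text \<open>The faces on which homomorphisms of degree \<open>c\<close> vanish. If the values of \<open>b\<close> are 0 and 1, the second
  alternative never occurs.\<close>

definition U1 where "U1 = {f \<in> U. \<exists>v\<in>Bs. (f \<union> Bs) - {v} \<notin> Y \<or> 2 \<le> b v}"

lemma lookup_ea: "lookup ea i = (if i \<le> n then a i else 0)"
  by (simp add: ea_def lookup_sum lookup_single when_def)

lemma lookup_eb: "lookup eb i = (if i \<le> n then b i else 0)"
  by (simp add: eb_def lookup_sum lookup_single when_def)

lemma keys_ea: "keys ea = As" and keys_eb: "keys eb = Bs"
  by (auto simp: in_keys_iff lookup_ea lookup_eb As_def Bs_def vec_support_def split: if_splits)

lemma supports: "As \<subseteq> {0..n}" "Bs \<subseteq> {0..n}" "finite As" "finite Bs" "As \<inter> Bs = {}"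
  using disj by (auto simp: As_def Bs_def vec_support_def)

lemma ea_or_eb: "lookup ea i = 0 \<or> lookup eb i = 0"
proof -
  have "\<not> (i \<in> keys ea \<and> i \<in> keys eb)" using supports(5) unfolding keys_ea keys_eb by blast
  then show ?thesis by (simp only: in_keys_iff) blast
qed

lemma Y_iff: "f \<in> Y \<longleftrightarrow> f \<inter> As = {} \<and> f \<union> As \<in> X"
  unfolding Y_def link_def using face_down by blast

lemma U_iff: "f \<in> U \<longleftrightarrow> f \<inter> As = {} \<and> f \<union> As \<in> X \<and> f \<union> As \<union> Bs \<notin> X"
proof -
  have "f \<inter> As = {} \<Longrightarrow> (f \<union> Bs) \<inter> As = {}" using supports(5) by blast
  moreover have "f \<union> Bs \<union> As = f \<union> As \<union> Bs" by blast
  ultimately show ?thesis unfolding U_def U_faces_def Y_iff mem_Collect_eq by metis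
qed

lemma U1_iff: "f \<in> U1 \<longleftrightarrow> f \<in> U \<and> (\<exists>v\<in>Bs. (f \<union> As \<union> Bs) - {v} \<notin> X \<or> 2 \<le> b v)"
proof -
  have "(f \<union> Bs) - {v} \<notin> Y \<longleftrightarrow> (f \<union> As \<union> Bs) - {v} \<notin> X" if "f \<in> U" "v \<in> Bs" for v
  proof -
    have "((f \<union> Bs) - {v}) \<inter> As = {}" using that supports(5) by (auto simp: U_iff)
    moreover have "((f \<union> Bs) - {v}) \<union> As = (f \<union> As \<union> Bs) - {v}" using that supports(5) by auto
    ultimately show ?thesis by (simp add: Y_iff)
  qed
  then show ?thesis unfolding U1_def by blast
qed

lemma U_finite: "f \<in> U \<Longrightarrow> finite f" "f \<in> U \<Longrightarrow> f \<subseteq> {0..n}"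
proof -
  show "f \<subseteq> {0..n}" if "f \<in> U" using that face_subset[of "f \<union> As"] by (auto simp: U_iff)
  then show "finite f" if "f \<in> U" using that finite_subset by blast
qed

text \<open>For a monomial \<open>x\<^sup>t\<close> of \<open>A\<close> that is divisible by \<open>x\<^sup>a\<close>, this is a face of the link.\<close>

definition link_face :: "expo \<Rightarrow> nat set" where "link_face t = keys t - As"

lemma link_face_U:
  assumes "below ea t" "keys t \<in> X" "keys u \<notin> X" "keys u \<subseteq> keys t \<union> Bs"
  shows "link_face t \<in> U" "link_face t \<union> As = keys t"
proof -
  show eq: "link_face t \<union> As = keys t" using below_keys[OF assms(1)] keys_ea by (auto simp: link_face_def)
  have "keys t \<union> Bs \<notin> X" using assms(3,4) face_down by blast
  then show "link_face t \<in> U" using assms(2) unfolding U_iff eq by (auto simp: link_face_def)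
qed

text \<open>If \<open>b v\<close> is 1 then \<open>x\<^sub>v\<close> does not occur in \<open>x\<^sup>u\<close>, so the nonface in the support of \<open>u\<close> avoids \<open>v\<close>.\<close>

lemma link_face_U1:
  assumes t: "below ea t" "keys t \<in> X" and u: "keys u \<notin> X" "keys u \<subseteq> keys t \<union> Bs"
    and v: "v \<in> Bs" "lookup u v < b v"
  shows "link_face t \<in> U1"
proof -
  note f = link_face_U[OF t u]
  have "(link_face t \<union> As \<union> Bs) - {v} \<notin> X \<or> 2 \<le> b v"
  proof (cases "2 \<le> b v")
    case False
    then have "v \<notin> keys u" using v by (simp add: in_keys_iff)
    then have "keys u \<subseteq> (link_face t \<union> As \<union> Bs) - {v}" using u(2) f(2) by auto
    then show ?thesis using u(1) face_down by blast
  qed simp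
  then show ?thesis using f(1) v(1) U1_iff by blast
qed

text \<open>Over each face of \<open>U\<close>, a monomial of the ideal and the monomial of \<open>A\<close> to which degree \<open>c\<close> leads. The
  exponent \<open>K\<close> on the face is a parameter, so that the source can be made a multiple of given generators.\<close>

definition source :: "nat \<Rightarrow> nat set \<Rightarrow> expo" where "source K f = block K (f \<union> As) + eb"
definition target :: "nat \<Rightarrow> nat set \<Rightarrow> expo" where "target K f = block K (f \<union> As) + ea"

lemma source_target: "source K f + ea = target K f + eb"
  by (simp add: source_def target_def add_ac)

lemma
  assumes "f \<in> U" "0 < K"
  shows keys_source: "keys (source K f) = f \<union> As \<union> Bs" and keys_target: "keys (target K f) = f \<union> As"
    and keys_target_X: "keys (target K f) \<in> X" and below_target: "below ea (target K f)"
    and link_face_target: "link_face (target K f) = f"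
proof -
  have fin: "finite (f \<union> As)" using U_finite assms supports by simp
  show "keys (source K f) = f \<union> As \<union> Bs" and k: "keys (target K f) = f \<union> As"
    using assms fin by (auto simp: source_def target_def keys_add_nat keys_block keys_ea keys_eb)
  show "keys (target K f) \<in> X" unfolding k using assms(1) by (simp add: U_iff)
  show "below ea (target K f)" by (simp add: target_def)
  show "link_face (target K f) = f" using assms(1) unfolding link_face_def k by (auto simp: U_iff)
qed

lemma degree_eq_iff:
  assumes "keys s \<subseteq> {0..n}" "keys t \<subseteq> {0..n}"
  shows "(\<forall>i\<le>n. int (lookup t i) = int (lookup s i) + cdeg i) \<longleftrightarrow> t + eb = s + ea"
proof
  assume *: "\<forall>i\<le>n. int (lookup t i) = int (lookup s i) + cdeg i"
  show "t + eb = s + ea"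
  proof (rule poly_mapping_eqI)
    fix i
    show "lookup (t + eb) i = lookup (s + ea) i"
    proof (cases "i \<le> n")
      case True
      then show ?thesis using *[rule_format, OF True] by (simp add: lookup_add lookup_ea lookup_eb)
    next
      case False
      then have "i \<notin> keys s" "i \<notin> keys t" using assms by auto
      then show ?thesis using False by (simp add: lookup_add lookup_ea lookup_eb in_keys_iff)
    qed
  qed
next
  assume *: "t + eb = s + ea"
  show "\<forall>i\<le>n. int (lookup t i) = int (lookup s i) + cdeg i"
  proof (intro allI impI)
    fix i assume "i \<le> n"
    then show "int (lookup t i) = int (lookup s i) + cdeg i"
      using arg_cong[OF *, of "\<lambda>s. lookup s i"] by (simp add: lookup_add lookup_ea lookup_eb)
  qed
qed

lemma degree_shift_iff: "t + eb = s + ea \<longleftrightarrow> below ea t \<and> s = t - ea + eb"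
proof
  assume *: "t + eb = s + ea"
  then have l: "lookup t i + lookup eb i = lookup s i + lookup ea i" for i
    by (simp only: lookup_add[symmetric] *)
  have "lookup ea i \<le> lookup t i" for i using l[of i] ea_or_eb[of i] by auto
  moreover have "lookup s i = lookup t i - lookup ea i + lookup eb i" for i
    using l[of i] ea_or_eb[of i] by auto
  ultimately show "below ea t \<and> s = t - ea + eb"
    by (auto simp: below_def lookup_add lookup_minus intro: poly_mapping_eqI)
next
  assume *: "below ea t \<and> s = t - ea + eb"
  then have "t = ea + (t - ea)" using below_diff by simp
  then show "t + eb = s + ea" using * by (metis add.assoc add.commute)
qed

subsection \<open>Shifting polynomials by the multidegree\<close>

text \<open>The partially defined multiplication by \<open>x\<^sup>c\<close>, where the resulting monomial \<open>x\<^sup>t\<close> is weighted by \<open>w t\<close>.\<close>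

definition shift :: "(expo \<Rightarrow> complex) \<Rightarrow> mpoly \<Rightarrow> mpoly" where
  "shift w p = (\<Sum>s\<in>keys p. if below eb (s + ea) then single (s + ea - eb) (w (s + ea - eb) * lookup p s) else 0)"

lemma lookup_shift: "lookup (shift w p) t = (if below ea t then w t * lookup p (t - ea + eb) else 0)"
proof -
  have "lookup (shift w p) t = (\<Sum>s\<in>keys p. if s = t - ea + eb then (if below ea t then w t * lookup p s else 0) else 0)"
    unfolding shift_def lookup_sum
  proof (rule sum.cong[OF refl])
    fix s
    have "below eb (s + ea) \<and> s + ea - eb = t \<longleftrightarrow> t + eb = s + ea"
    proof
      assume "below eb (s + ea) \<and> s + ea - eb = t"
      then show "t + eb = s + ea" using below_diff[of eb "s + ea"] by (simp add: add.commute)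
    next
      assume *: "t + eb = s + ea"
      show "below eb (s + ea) \<and> s + ea - eb = t" unfolding *[symmetric] by simp
    qed
    then show "lookup (if below eb (s + ea) then single (s + ea - eb) (w (s + ea - eb) * lookup p s) else 0) t
        = (if s = t - ea + eb then (if below ea t then w t * lookup p s else 0) else 0)"
      unfolding degree_shift_iff by (auto simp: lookup_single when_def)
  qed
  also have "\<dots> = (if below ea t then w t * lookup p (t - ea + eb) else 0)"
    by (simp add: in_keys_iff)
  finally show ?thesis .
qed

lemma shift_add: "shift w (p + q) = shift w p + shift w q"
  by (rule poly_mapping_eqI) (simp add: lookup_add lookup_shift algebra_simps)

lemma shift_0 [simp]: "shift w 0 = 0"
  by (simp add: shift_def)

lemma keys_shift: "t \<in> keys (shift w p) \<Longrightarrow> t - ea + eb \<in> keys p \<and> below ea t \<and> w t \<noteq> 0"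
  by (auto simp: in_keys_iff lookup_shift split: if_splits)

lemma shift_closed:
  assumes "p \<in> carrier P"
  shows "shift w p \<in> carrier P"
  unfolding poly_ring_carrier
proof
  fix t assume "t \<in> keys (shift w p)"
  then have t: "t - ea + eb \<in> keys p" "below ea t" using keys_shift by blast+
  have "t + eb = (t - ea + eb) + ea" using degree_shift_iff t(2) by blast
  then have "keys t \<subseteq> keys (t - ea + eb) \<union> As" using keys_add_nat keys_ea by (metis Un_upper1)
  then show "keys t \<subseteq> {0..n}" using assms t(1) supports(1) unfolding poly_ring_carrier by blast
qed

lemma shift_grading:
  assumes "p \<in> poly_grading n d"
  shows "shift w p \<in> poly_grading n (\<lambda>i. d i + cdeg i)"
  unfolding poly_grading_def mem_Collect_eq
proof (intro conjI ballI allI impI)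
  have p: "p \<in> carrier P" using assms by (simp add: poly_grading_def)
  then show c: "shift w p \<in> carrier P" by (rule shift_closed)
  fix t i assume t: "t \<in> keys (shift w p)" and i: "i \<le> n"
  then have t': "t - ea + eb \<in> keys p" "below ea t" using keys_shift by blast+
  have "t + eb = (t - ea + eb) + ea" using degree_shift_iff t'(2) by blast
  moreover have "keys t \<subseteq> {0..n}" "keys (t - ea + eb) \<subseteq> {0..n}"
    using t t'(1) c p unfolding poly_ring_carrier by blast+
  ultimately have "int (lookup t i) = int (lookup (t - ea + eb) i) + cdeg i"
    using degree_eq_iff[of "t - ea + eb" t] i by blast
  moreover have "int (lookup (t - ea + eb) i) = d i" using assms t'(1) i by (simp add: poly_grading_def)
  ultimately show "int (lookup t i) = d i + cdeg i" by simp
qed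

text \<open>A monomial \<open>x\<^sup>t\<close> is to be reached from a multiple of \<open>x\<^sup>e\<close>. If the cofactor can be shifted, shifting commutes with
  the multiplication; otherwise the cofactor lacks part of a variable of \<open>b\<close> (\<open>shift_defect\<close>).\<close>

lemma shift_index:
  assumes "below e t" "below ea (t - e)"
  shows "below ea t" "below e (t - ea + eb)" "t - ea + eb - e = t - e - ea + eb"
proof -
  have l: "lookup e i + lookup ea i \<le> lookup t i" for i
    using assms unfolding below_def lookup_minus by (metis le_add_diff_inverse nat_add_left_cancel_le)
  show "below ea t" unfolding below_def using l by (metis add_leE)
  show "below e (t - ea + eb)" unfolding below_def lookup_add lookup_minus using l
    by (metis add.commute add_le_imp_le_diff trans_le_add1)
  show "t - ea + eb - e = t - e - ea + eb"
  proof (rule poly_mapping_eqI)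
    fix i show "lookup (t - ea + eb - e) i = lookup (t - e - ea + eb) i"
      using l[of i] by (simp add: lookup_add lookup_minus)
  qed
qed

lemma shift_defect:
  assumes "\<not> (below e t \<and> below ea (t - e))" "below ea t" "below e (t - ea + eb)"
  shows "\<exists>v\<in>Bs. lookup (t - ea + eb - e) v < b v"
proof -
  obtain i where i: "lookup t i < lookup e i + lookup ea i"
  proof -
    have "\<not> (\<forall>i. lookup e i + lookup ea i \<le> lookup t i)"
      using assms(1) unfolding below_def lookup_minus by (metis add_leE le_diff_conv2 add.commute)
    then show ?thesis using that not_le by blast
  qed
  have "lookup ea i \<le> lookup t i" "lookup e i \<le> lookup t i - lookup ea i + lookup eb i"
    using assms(2,3) unfolding below_def lookup_add lookup_minus by blast+
  then have "lookup (t - ea + eb - e) i < lookup eb i"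
    using i by (simp add: lookup_add lookup_minus)
  moreover from this have "i \<in> Bs" using keys_eb by (metis in_keys_iff not_less0)
  ultimately show ?thesis by (intro bexI[of _ i]) (auto simp: lookup_eb split: if_splits)
qed

lemma keys_shift_source:
  assumes "below ea t"
  shows "keys (t - ea + eb) \<subseteq> keys t \<union> Bs"
  by (auto simp: in_keys_iff lookup_add lookup_minus keys_eb[symmetric])

end

section \<open>The first cotangent module\<close>

context stanley_reisner
begin

lemma I_add: "p \<in> I \<Longrightarrow> q \<in> I \<Longrightarrow> p + q \<in> I"
  and I_mult: "r \<in> carrier P \<Longrightarrow> p \<in> I \<Longrightarrow> r * p \<in> I" and I_zero: "0 \<in> I"
  using II.I_l_closed[of p r] by (auto simp: I_iff lookup_add)

lemma I_nonface: "p \<in> I \<Longrightarrow> lookup p u \<noteq> 0 \<Longrightarrow> keys u \<notin> X"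
  unfolding I_iff by blast

lemma keys_diff_nat: "keys (t - e) \<subseteq> keys (t :: expo)"
  by (auto simp: in_keys_iff lookup_minus)

abbreviation M1 where "M1 \<equiv> ideal_module n I"
abbreviation NA where "NA \<equiv> quot_ring_module n I"

lemma NA_simps:
  "carrier NA = carrier A" "add NA = add A" "zero NA = zero A" "r \<odot>\<^bsub>NA\<^esub> C = cl r \<otimes>\<^bsub>A\<^esub> C"
  by (simp_all add: quot_ring_module_def restrict_scalars_def regular_module_def)

lemma M1_simps:
  "carrier M1 = I" "x \<oplus>\<^bsub>M1\<^esub> y = x + y" "zero M1 = 0" "r \<odot>\<^bsub>M1\<^esub> x = r * x"
  by (simp_all add: ideal_module_def regular_module_def)

lemma NA_abelian_group: "abelian_group NA"
proof (rule abelian_groupI)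
  fix C assume "C \<in> carrier NA"
  then show "\<exists>D\<in>carrier NA. D \<oplus>\<^bsub>NA\<^esub> C = \<zero>\<^bsub>NA\<^esub>"
    by (intro bexI[of _ "\<ominus>\<^bsub>A\<^esub> C"]) (auto simp: NA_simps AA.l_neg)
qed (auto simp: NA_simps AA.a_ac)

lemma NA_neg: "C \<in> carrier A \<Longrightarrow> \<ominus>\<^bsub>NA\<^esub> C = \<ominus>\<^bsub>A\<^esub> C"
  by (rule abelian_group.minus_equality[OF NA_abelian_group]) (auto simp: NA_simps AA.l_neg)

lemma A_neg: "C \<in> carrier A \<Longrightarrow> \<ominus>\<^bsub>A\<^esub> C = cl (poly_const (-1)) \<otimes>\<^bsub>A\<^esub> C"
proof -
  assume C: "C \<in> carrier A"
  then obtain p where p: "p \<in> carrier P" "C = cl p" by (auto simp: A_carrier)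
  have "poly_const (-1) * p + p = 0"
    by (rule poly_mapping_eqI) (simp add: lookup_add lookup_poly_const_mult)
  then have "cl (poly_const (-1)) \<otimes>\<^bsub>A\<^esub> C \<oplus>\<^bsub>A\<^esub> C = \<zero>\<^bsub>A\<^esub>"
    using p A_zero A_zero' by (simp add: A_mult A_add)
  then show ?thesis using C by (intro AA.minus_equality) auto
qed

lemma hom_target_ideal: "hom_target P M1 NA"
proof (rule hom_target.intro)
  show "r \<odot>\<^bsub>NA\<^esub> (s \<odot>\<^bsub>NA\<^esub> C) = s \<odot>\<^bsub>NA\<^esub> (r \<odot>\<^bsub>NA\<^esub> C)" if "r \<in> carrier P" "s \<in> carrier P" "C \<in> carrier NA" for r s C
    using that by (simp add: NA_simps AA.m_lcomm)
  show "abelian_group NA" by (rule NA_abelian_group)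
qed (auto simp: NA_simps M1_simps AA.r_distr I_add I_mult)

end

context multidegree
begin

interpretation HT: hom_target P M1 NA by (rule hom_target_ideal)

abbreviation Hom1 where "Hom1 \<equiv> hom_module P M1 NA"
abbreviation Hom1c where
  "Hom1c \<equiv> hom_grading P M1 (\<lambda>d. I \<inter> poly_grading n d) NA (quot_ring_grading n I) cdeg"

definition der_image :: "(mpoly \<Rightarrow> mpoly) \<Rightarrow> mpoly \<Rightarrow> mpoly set" where
  "der_image D = (\<lambda>f\<in>I. cl (D f))"

lemma Hom1c_mod_hom: "H \<in> Hom1c \<Longrightarrow> H \<in> mod_hom P M1 NA"
  by (simp add: hom_grading_def)

lemma Hom1_value: "H \<in> mod_hom P M1 NA \<Longrightarrow> p \<in> I \<Longrightarrow> H p \<in> carrier A"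
  using mod_homD(1)[of H P M1 NA p] by (simp add: NA_simps M1_simps)

lemma Hom1_mult: "H \<in> mod_hom P M1 NA \<Longrightarrow> r \<in> carrier P \<Longrightarrow> p \<in> I \<Longrightarrow> H (r * p) = cl r \<otimes>\<^bsub>A\<^esub> H p"
  using mod_homD(4)[of H P M1 NA r p] by (simp add: NA_simps M1_simps)

lemma Hom1_add: "H \<in> mod_hom P M1 NA \<Longrightarrow> p \<in> I \<Longrightarrow> q \<in> I \<Longrightarrow> H (p + q) = H p \<oplus>\<^bsub>A\<^esub> H q"
  using mod_homD(3)[of H P M1 NA p q] by (simp add: NA_simps M1_simps)

lemma Hom1c_graded:
  assumes "H \<in> Hom1c" "p \<in> I" "p \<in> poly_grading n d"
  shows "H p \<in> quot_ring_grading n I (\<lambda>i. d i + cdeg i)"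
  using assms(1)[unfolded hom_grading_def mem_Collect_eq, THEN conjunct2, THEN spec, THEN bspec, OF IntI[OF assms(2,3)]] .

abbreviation hc :: "(mpoly \<Rightarrow> mpoly set) \<Rightarrow> expo \<Rightarrow> expo \<Rightarrow> complex" where
  "hc H s t \<equiv> coef (H (single s 1)) t"

lemma hc_degree:
  assumes H: "H \<in> Hom1c" and s: "keys s \<subseteq> {0..n}" "keys s \<notin> X" and t: "keys t \<in> X" "hc H s t \<noteq> 0"
  shows "t + eb = s + ea"
proof -
  have "single s 1 \<in> poly_grading n (\<lambda>i. int (lookup s i))" using s by (simp add: poly_grading_def)
  then have "H (single s 1) \<in> quot_ring_grading n I (\<lambda>i. int (lookup s i) + cdeg i)"
    by (rule Hom1c_graded[OF H single_in_I[OF s]])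
  from quot_ring_gradingD(2)[OF this t]
  show ?thesis using degree_eq_iff[OF s(1) face_subset[OF t(1)]] by blast
qed

lemma hc_shift:
  assumes H: "H \<in> mod_hom P M1 NA" and s: "keys s \<subseteq> {0..n}" "keys s \<notin> X" and e: "keys e \<subseteq> {0..n}" and t: "keys t \<in> X"
  shows "hc H (e + s) t = (if below e t then hc H s (t - e) else 0)"
proof -
  have "H (single e 1 * single s 1) = cl (single e 1) \<otimes>\<^bsub>A\<^esub> H (single s 1)"
    by (rule Hom1_mult[OF H _ single_in_I[OF s]]) (use e in simp)
  then show ?thesis
    using coef_single_mult[OF e Hom1_value[OF H single_in_I[OF s]] t, of 1 1] by (simp add: mult_single)
qed

definition face_coefs :: "(mpoly \<Rightarrow> mpoly set) \<Rightarrow> nat set \<Rightarrow> complex" where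
  "face_coefs H = (\<lambda>f. if f \<in> U then hc H (source 1 f) (target 1 f) else 0)"

lemma source_nonface:
  assumes "f \<in> U"
  shows "keys (source 1 f) \<notin> X" "keys (source 1 f) \<subseteq> {0..n}"
  using assms keys_source[OF assms, of 1] U_finite[OF assms] supports by (auto simp: U_iff)

text \<open>The pairs \<open>(s, t)\<close> and \<open>(source 1 f, target 1 f)\<close> have a common multiple by monomials in the variables of \<open>x\<^sup>t\<close>.
  Such multiples of \<open>x\<^sup>t\<close> are nonzero in \<open>A\<close>, so the coefficient is preserved.\<close>

lemma hc_eq_face_coefs:
  assumes H: "H \<in> Hom1c" and s: "keys s \<subseteq> {0..n}" "keys s \<notin> X" and t: "keys t \<in> X" and d: "t + eb = s + ea"
  shows "link_face t \<in> U" "hc H s t = face_coefs H (link_face t)"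
proof -
  let ?f = "link_face t"
  have H': "H \<in> mod_hom P M1 NA" using H by (rule Hom1c_mod_hom)
  have bt: "below ea t" and st: "s = t - ea + eb" using d degree_shift_iff by auto
  have "keys s \<subseteq> keys t \<union> Bs" unfolding st by (rule keys_shift_source[OF bt])
  note f = link_face_U[OF bt t s(2) this]
  then show "?f \<in> U" by simp
  let ?e = "block 1 (keys t) + ea"
  have ke: "keys ?e \<subseteq> {0..n}" using face_subset[OF t] supports by (simp add: keys_add_nat keys_block keys_ea)
  have kte: "keys (?e + t) \<in> X"
  proof -
    have "keys (?e + t) = keys t" using below_keys[OF bt] by (simp add: keys_add_nat keys_block) blast
    then show ?thesis using t by simp
  qed
  have "?e + s = block 1 (keys t) + (s + ea)" by (simp add: add_ac)
  also have "\<dots> = t + source 1 ?f" unfolding d[symmetric] by (simp add: source_def f(2) add_ac)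
  finally have src: "?e + s = t + source 1 ?f" .
  have tgt: "?e + t = t + target 1 ?f" by (simp add: target_def f(2) add_ac)
  have "hc H s t = hc H (?e + s) (?e + t)" by (simp add: hc_shift[OF H' s ke kte])
  also have "\<dots> = hc H (t + source 1 ?f) (t + target 1 ?f)" unfolding src tgt ..
  also have "\<dots> = hc H (source 1 ?f) (target 1 ?f)"
    using hc_shift[OF H' source_nonface(2,1)[OF f(1)] face_subset[OF t], of "t + target 1 ?f"] kte
    unfolding tgt by simp
  finally show "hc H s t = face_coefs H ?f" using f(1) by (simp add: face_coefs_def)
qed

text \<open>For \<open>f \<in> U1\<close> the source is a multiple of a monomial of the ideal in which the exponent of some \<open>x\<^sub>v\<close> is less than
  \<open>b v\<close>. A homomorphism of degree \<open>c\<close> kills that monomial.\<close>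

lemma face_coefs_Z0:
  assumes H: "H \<in> Hom1c"
  shows "face_coefs H \<in> poset_Z0 U U1"
proof (rule poset_Z0I)
  have H': "H \<in> mod_hom P M1 NA" using H by (rule Hom1c_mod_hom)
  fix f g assume fg: "f \<in> U" "g \<in> U" "f \<subseteq> g"
  let ?e = "block 1 (g - f)"
  have fin: "finite f" "finite g" "finite As" using U_finite fg supports by auto
  have un: "g \<union> As = (g - f) \<union> (f \<union> As)" and dj: "(g - f) \<inter> (f \<union> As) = {}"
    using fg(3) fg(2) by (auto simp: U_iff)
  have blk: "block 1 (g \<union> As) = ?e + block 1 (f \<union> As)"
    unfolding block_def un by (rule sum.union_disjoint[OF _ _ dj]) (use fin in simp_all)
  then have st: "source 1 g = ?e + source 1 f" "target 1 g = ?e + target 1 f"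
    by (simp_all add: source_def target_def add_ac)
  have "keys ?e \<subseteq> {0..n}" using fin U_finite(2)[OF fg(2)] by (auto simp: keys_block)
  from hc_shift[OF H' source_nonface(2,1)[OF fg(1)] this keys_target_X[OF fg(2), of 1]]
  show "face_coefs H g = face_coefs H f" using fg by (simp add: face_coefs_def st)
next
  have H': "H \<in> mod_hom P M1 NA" using H by (rule Hom1c_mod_hom)
  fix f assume "f \<notin> U - U1"
  moreover have "hc H (source 1 f) (target 1 f) = 0" if f1: "f \<in> U1"
  proof -
    have f: "f \<in> U" using f1 by (simp add: U1_iff)
    obtain v where v: "v \<in> Bs" "(f \<union> As \<union> Bs) - {v} \<notin> X \<or> 2 \<le> b v" using f1[unfolded U1_iff] by blast
    define p where "p = (if (f \<union> As \<union> Bs) - {v} \<notin> X then (f \<union> As \<union> Bs) - {v} else f \<union> As \<union> Bs)"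
    have p: "finite p" "p \<notin> X" "p \<subseteq> {0..n}" "p \<subseteq> f \<union> As \<union> Bs"
      using U_finite[OF f] supports f by (auto simp: p_def U_iff)
    have lt: "lookup (block 1 p) v < b v"
      using v p(1) by (auto simp: lookup_block p_def Bs_def vec_support_def)
    have "below (block 1 p) (source 1 f)"
      unfolding below_def
    proof
      fix i
      have "i \<in> Bs \<Longrightarrow> 1 \<le> lookup eb i" by (simp add: keys_eb[symmetric] in_keys_iff)
      then show "lookup (block 1 p) i \<le> lookup (source 1 f) i"
        using p U_finite[OF f] supports by (auto simp: lookup_block source_def lookup_add)
    qed
    then have src: "source 1 f = (source 1 f - block 1 p) + block 1 p"
      using below_diff[of "block 1 p" "source 1 f"] by (simp add: add.commute)
    have kp: "keys (block 1 p) = p" using p(1) by (simp add: keys_block)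
    have zero: "hc H (block 1 p) t = 0" if t: "keys t \<in> X" for t
    proof (rule ccontr)
      assume "hc H (block 1 p) t \<noteq> 0"
      then have "t + eb = block 1 p + ea" using hc_degree[OF H _ _ t, of "block 1 p"] p kp by simp
      then have "lookup t v + lookup eb v = lookup (block 1 p) v + lookup ea v" by (simp only: lookup_add[symmetric])
      moreover have "lookup ea v = 0" "lookup eb v = b v"
        using v(1) ea_or_eb[of v] supports keys_eb by (auto simp: lookup_eb Bs_def vec_support_def)
      ultimately show False using lt by simp
    qed
    have e: "keys (source 1 f - block 1 p) \<subseteq> {0..n}"
      using source_nonface(2)[OF f] by (auto simp: in_keys_iff lookup_minus)
    have X: "keys (target 1 f - (source 1 f - block 1 p)) \<in> X"
      by (rule face_down[OF keys_target_X[OF f, of 1]]) (auto simp: in_keys_iff lookup_minus)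
    show ?thesis
      using hc_shift[OF H' _ _ e keys_target_X[OF f, of 1], of "block 1 p"] kp p zero[OF X] src[symmetric] by auto
  qed
  ultimately show "face_coefs H f = 0" by (auto simp: face_coefs_def)
qed

lemma Hom1_sum:
  assumes H: "H \<in> mod_hom P M1 NA" and p: "p \<in> I" and t: "keys t \<in> X"
  shows "coef (H p) t = (\<Sum>s\<in>keys p. lookup p s * hc H s t)"
proof -
  have sI: "single s z \<in> I" if "s \<in> keys p" for s z
    using p that single_in_I by (auto simp: I_eq poly_ring_carrier)
  have "K \<subseteq> keys p \<longrightarrow> (\<Sum>s\<in>K. single s (lookup p s)) \<in> I \<and>
      coef (H (\<Sum>s\<in>K. single s (lookup p s))) t = (\<Sum>s\<in>K. lookup p s * hc H s t)" for K
  proof (induction K rule: infinite_finite_induct)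
    case empty
    have H0: "H 0 \<in> carrier A" by (rule Hom1_value[OF H]) (rule I_zero)
    have "H 0 = cl 0 \<otimes>\<^bsub>A\<^esub> H 0" using Hom1_mult[OF H _ I_zero, of 0] by simp
    also have "\<dots> = I" unfolding A_zero'[symmetric] using H0 by (rule AA.l_null[unfolded A_zero])
    finally have "H 0 = I" .
    then show ?case using I_zero coef_zero[OF t] by simp
  next
    case (insert s K)
    show ?case
    proof
      assume *: "insert s K \<subseteq> keys p"
      let ?S = "\<Sum>s\<in>K. single s (lookup p s)"
      have ih: "?S \<in> I" "coef (H ?S) t = (\<Sum>s\<in>K. lookup p s * hc H s t)" using insert * by auto
      have s: "single s 1 \<in> I" "single s (lookup p s) \<in> I" using sI * by auto
      have "single s (lookup p s) = poly_const (lookup p s) * single s 1" by (simp add: poly_const_def mult_single)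
      then have "H (single s (lookup p s)) = cl (poly_const (lookup p s)) \<otimes>\<^bsub>A\<^esub> H (single s 1)"
        using Hom1_mult[OF H _ s(1)] by simp
      then have "coef (H (single s (lookup p s))) t = lookup p s * hc H s t"
        using coef_const_mult[OF Hom1_value[OF H s(1)] t] by simp
      moreover have "coef (H (single s (lookup p s) + ?S)) t = coef (H (single s (lookup p s))) t + coef (H ?S) t"
        using Hom1_add[OF H s(2) ih(1)] coef_add[OF Hom1_value[OF H s(2)] Hom1_value[OF H ih(1)] t] by simp
      ultimately show "(\<Sum>s\<in>insert s K. single s (lookup p s)) \<in> I \<and>
        coef (H (\<Sum>s\<in>insert s K. single s (lookup p s))) t = (\<Sum>s\<in>insert s K. lookup p s * hc H s t)"
        using insert(1,2) ih I_add[OF s(2) ih(1)] by simp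
    qed
  qed (use finite_subset finite_keys in blast)
  from this[THEN mp, OF order_refl] show ?thesis unfolding poly_eq_sum_single[symmetric] by blast
qed

lemma Hom1c_eqI:
  assumes H: "H \<in> Hom1c" "G \<in> Hom1c" and eq: "\<And>f. f \<in> U \<Longrightarrow> face_coefs H f = face_coefs G f"
  shows "H = G"
proof
  fix p
  have H': "H \<in> mod_hom P M1 NA" "G \<in> mod_hom P M1 NA" using H by (auto intro: Hom1c_mod_hom)
  show "H p = G p"
  proof (cases "p \<in> I")
    case True
    show ?thesis
    proof (rule A_eqI[OF Hom1_value[OF H'(1) True] Hom1_value[OF H'(2) True]])
      fix t :: expo assume t: "keys t \<in> X"
      have "hc H s t = hc G s t" if "s \<in> keys p" for s
      proof -
        have s: "keys s \<subseteq> {0..n}" "keys s \<notin> X" using True that by (auto simp: I_eq poly_ring_carrier)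
        show ?thesis
        proof (cases "t + eb = s + ea")
          case d: True
          note f = hc_eq_face_coefs[OF H(1) s t d] hc_eq_face_coefs[OF H(2) s t d]
          show ?thesis unfolding f(2) f(4) by (rule eq[OF f(1)])
        next
          case False
          then have "hc H s t = 0" "hc G s t = 0" using hc_degree[OF H(1) s t] hc_degree[OF H(2) s t] by blast+
          then show ?thesis by simp
        qed
      qed
      then show "coef (H p) t = coef (G p) t"
        using Hom1_sum[OF H'(1) True t] Hom1_sum[OF H'(2) True t] by (simp cong: sum.cong)
    qed
  next
    case False
    then show ?thesis using mod_homD(2)[OF H'(1)] mod_homD(2)[OF H'(2)] by (simp add: M1_simps extensional_def)
  qed
qed

subsection \<open>From poset cocycles to homomorphisms\<close>

definition spread_hom :: "(nat set \<Rightarrow> complex) \<Rightarrow> mpoly \<Rightarrow> mpoly set" where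
  "spread_hom l = (\<lambda>p\<in>I. cl (shift (\<lambda>t. l (link_face t)) p))"

text \<open>The only obstacle to linearity is a product \<open>x\<^sup>e x\<^sup>s\<close> that can be shifted although \<open>x\<^sup>s\<close> cannot. Then
  \<open>x\<^sup>s\<close> lacks part of some \<open>x\<^sub>v\<close> with \<open>v\<close> in \<open>b\<close> by \<open>shift_defect\<close>, so the face of the shifted product lies in
  \<open>U1\<close>, where \<open>l\<close> vanishes.\<close>

lemma spread_hom_Hom1c:
  assumes l: "l \<in> poset_Z0 U U1"
  shows "spread_hom l \<in> Hom1c"
proof -
  let ?w = "\<lambda>t. l (link_face t)"
  have linear: "cl (shift ?w (r * p)) = cl r \<otimes>\<^bsub>A\<^esub> cl (shift ?w p)" if r: "r \<in> carrier P" and p: "p \<in> I" for r p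
  proof (rule A_eqI)
    have pc: "p \<in> carrier P" using p I_carrier by blast
    show "cl (shift ?w (r * p)) \<in> carrier A" "cl r \<otimes>\<^bsub>A\<^esub> cl (shift ?w p) \<in> carrier A"
      using shift_closed[OF pc] shift_closed[of "r * p"] r pc by simp_all
    fix t :: expo assume t: "keys t \<in> X"
    have termwise: "(if below ea t then ?w t * (if below e (t - ea + eb) then lookup p (t - ea + eb - e) else 0) else 0)
       = (if below e t then lookup (shift ?w p) (t - e) else 0)" for e
    proof (cases "below e t \<and> below ea (t - e)")
      case True
      note idx = shift_index[OF conjunct1[OF True] conjunct2[OF True]]
      let ?u = "t - e - ea + eb"
      have "?w t = ?w (t - e)" if nz: "lookup p ?u \<noteq> 0"
      proof -
        have u: "keys ?u \<notin> X" by (rule I_nonface[OF p nz])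
        have te: "keys (t - e) \<subseteq> keys t" by (rule keys_diff_nat)
        have f: "link_face (t - e) \<in> U"
          by (rule link_face_U(1)[OF conjunct2[OF True] face_down[OF t te] u keys_shift_source[OF conjunct2[OF True]]])
        have g: "link_face t \<in> U"
          by (rule link_face_U(1)[OF idx(1) t u order_trans[OF keys_shift_source[OF conjunct2[OF True]] Un_mono[OF te order_refl]]])
        have "link_face (t - e) \<subseteq> link_face t" using te by (auto simp: link_face_def)
        from poset_Z0D(2)[OF l f g this] show ?thesis .
      qed
      then show ?thesis using True idx by (auto simp: lookup_shift)
    next
      case False
      have "?w t = 0" if nz: "below ea t" "below e (t - ea + eb)" "lookup p (t - ea + eb - e) \<noteq> 0"
      proof -
        let ?u = "t - ea + eb - e"
        have u: "keys ?u \<notin> X" by (rule I_nonface[OF p nz(3)])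
        have ku: "keys ?u \<subseteq> keys t \<union> Bs" using keys_shift_source[OF nz(1)] by (rule order_trans[OF keys_diff_nat])
        obtain v where "v \<in> Bs" "lookup ?u v < b v" using shift_defect[OF False nz(1,2)] by blast
        then have "link_face t \<in> U1" using link_face_U1[OF nz(1) t u ku] by blast
        then show ?thesis using poset_Z0D(1)[OF l] by simp
      qed
      then show ?thesis using False by (auto simp: lookup_shift)
    qed
    have "coef (cl (shift ?w (r * p))) t = lookup (shift ?w (r * p)) t"
      by (rule coef_cl[OF shift_closed t]) (use r pc in simp)
    also have "\<dots> = (\<Sum>e\<in>keys r. lookup r e * (if below ea t then ?w t * (if below e (t - ea + eb) then lookup p (t - ea + eb - e) else 0) else 0))"
      unfolding lookup_shift lookup_mult_sum by (auto simp: sum_distrib_left mult_ac intro!: sum.cong)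
    also have "\<dots> = (\<Sum>e\<in>keys r. lookup r e * (if below e t then lookup (shift ?w p) (t - e) else 0))"
      by (simp only: termwise)
    also have "\<dots> = coef (cl r \<otimes>\<^bsub>A\<^esub> cl (shift ?w p)) t"
      unfolding A_mult[OF r shift_closed[OF pc]]
      using r pc shift_closed[OF pc] t by (subst coef_cl) (auto simp: lookup_mult_sum intro!: sum.cong)
    finally show "coef (cl (shift ?w (r * p))) t = coef (cl r \<otimes>\<^bsub>A\<^esub> cl (shift ?w p)) t" .
  qed
  have "spread_hom l \<in> mod_hom P M1 NA"
  proof (rule mod_homI)
    fix x y assume "x \<in> carrier M1" "y \<in> carrier M1"
    then have xy: "x \<in> I" "y \<in> I" by (auto simp: M1_simps)
    then show "spread_hom l (x \<oplus>\<^bsub>M1\<^esub> y) = spread_hom l x \<oplus>\<^bsub>NA\<^esub> spread_hom l y"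
      using I_add[OF xy] shift_closed[OF I_carrier[OF xy(1)]] shift_closed[OF I_carrier[OF xy(2)]]
      by (simp add: spread_hom_def NA_simps M1_simps shift_add A_add)
  next
    fix r x assume rx: "r \<in> carrier P" "x \<in> carrier M1"
    then have "x \<in> I" by (simp add: M1_simps)
    then show "spread_hom l (r \<odot>\<^bsub>M1\<^esub> x) = r \<odot>\<^bsub>NA\<^esub> spread_hom l x"
      using linear[OF rx(1)] I_mult[OF rx(1)] by (simp add: spread_hom_def NA_simps M1_simps)
  next
    fix x assume "x \<in> carrier M1"
    then have "x \<in> I" by (simp add: M1_simps)
    then show "spread_hom l x \<in> carrier NA"
      using shift_closed[OF I_carrier[of x]] by (simp add: spread_hom_def NA_simps)
  qed (simp add: spread_hom_def M1_simps)
  moreover have "spread_hom l x \<in> quot_ring_grading n I (\<lambda>i. d i + cdeg i)" if "x \<in> I \<inter> poly_grading n d" for x d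
    using that shift_grading[of x d] by (auto simp: spread_hom_def intro!: quot_ring_gradingI)
  ultimately show ?thesis unfolding hom_grading_def by blast
qed

lemma face_coefs_spread_hom:
  assumes l: "l \<in> poset_Z0 U U1"
  shows "face_coefs (spread_hom l) = l"
proof
  fix f
  show "face_coefs (spread_hom l) f = l f"
  proof (cases "f \<in> U")
    case True
    have s: "single (source 1 f) 1 \<in> I" using source_nonface[OF True] single_in_I by blast
    have "target 1 f + eb = source 1 f + ea" by (simp add: source_target)
    then have *: "below ea (target 1 f)" "source 1 f = target 1 f - ea + eb" using degree_shift_iff by blast+
    have "coef (spread_hom l (single (source 1 f) 1)) (target 1 f) = lookup (shift (\<lambda>t. l (link_face t)) (single (source 1 f) 1)) (target 1 f)"
      using s shift_closed[OF I_carrier[OF s]] keys_target_X[OF True, of 1] by (simp add: spread_hom_def coef_cl)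
    also have "\<dots> = l (link_face (target 1 f))" using * by (simp add: lookup_shift)
    finally show ?thesis using True link_face_target[OF True, of 1] by (simp add: face_coefs_def)
  qed (use poset_Z0D(1)[OF l, of f] in \<open>simp add: face_coefs_def\<close>)
qed

subsection \<open>Derivations\<close>

lemma derivationD:
  assumes "D \<in> poly_derivations n"
  shows "p \<in> carrier P \<Longrightarrow> D p \<in> carrier P"
    "p \<in> carrier P \<Longrightarrow> q \<in> carrier P \<Longrightarrow> D (p + q) = D p + D q"
    "p \<in> carrier P \<Longrightarrow> q \<in> carrier P \<Longrightarrow> D (p * q) = p * D q + q * D p"
    "p \<in> carrier P \<Longrightarrow> D (poly_const z * p) = poly_const z * D p"
  using assms unfolding poly_derivations_def PiE_def by auto

lemma poly_derivationsI:
  assumes "\<And>p. p \<in> carrier P \<Longrightarrow> D p \<in> carrier P" "D \<in> extensional (carrier P)"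
    "\<And>p q. p \<in> carrier P \<Longrightarrow> q \<in> carrier P \<Longrightarrow> D (p + q) = D p + D q"
    "\<And>p q. p \<in> carrier P \<Longrightarrow> q \<in> carrier P \<Longrightarrow> D (p * q) = p * D q + q * D p"
    "\<And>z p. p \<in> carrier P \<Longrightarrow> D (poly_const z * p) = poly_const z * D p"
  shows "D \<in> poly_derivations n"
  using assms unfolding poly_derivations_def PiE_def by auto

abbreviation unit :: "nat \<Rightarrow> expo" where "unit i \<equiv> single i 1"

lemma poly_var_closed: "i \<le> n \<Longrightarrow> poly_var i \<in> carrier P"
  by (simp add: poly_var_def)

text \<open>The Leibniz rule, by induction on the degree of the monomial.\<close>

lemma derivation_monomial:
  assumes D: "D \<in> poly_derivations n" and s: "keys s \<subseteq> {0..n}"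
  shows "D (single s 1) = (\<Sum>i\<le>n. single (s - unit i) (of_nat (lookup s i)) * D (poly_var i))"
  using s
proof (induction "\<Sum>i\<le>n. lookup s i" arbitrary: s)
  case 0
  have "lookup s i = 0" for i
  proof (cases "i \<le> n")
    case False
    then have "i \<notin> keys s" using 0(2) by auto
    then show ?thesis by (simp add: in_keys_iff)
  qed (use 0(1) in simp)
  then have s: "s = 0" by (intro poly_mapping_eqI) simp
  have "D (1 * 1) = 1 * D 1 + 1 * D 1" by (rule derivationD(3)[OF D]) auto
  then have "D 1 = 0" by simp
  then show ?case by (simp add: s)
next
  case (Suc N)
  have "\<exists>j\<le>n. lookup s j \<noteq> 0"
  proof (rule ccontr)
    assume "\<not> (\<exists>j\<le>n. lookup s j \<noteq> 0)"
    then have "(\<Sum>i\<le>n. lookup s i) = 0" by simp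
    then show False using Suc(2) by simp
  qed
  then obtain j where j: "j \<le> n" "lookup s j \<noteq> 0" by blast
  define s' where "s' = s - unit j"
  have "below (unit j) s" using j by (auto simp: below_def lookup_single when_def)
  then have s: "s = unit j + s'" unfolding s'_def by (simp add: below_diff)
  have ks: "keys s' \<subseteq> {0..n}" using Suc(3) keys_diff_nat[of s "unit j"] unfolding s'_def by blast
  have "(\<Sum>i\<le>n. lookup s i) = (\<Sum>i\<le>n. (if i = j then 1 else 0) + lookup s' i)"
    by (rule sum.cong) (auto simp: s lookup_add lookup_single when_def)
  also have "\<dots> = Suc (\<Sum>i\<le>n. lookup s' i)" using j(1) by (simp add: sum.distrib)
  finally have "N = (\<Sum>i\<le>n. lookup s' i)" using Suc(2) by simp
  from Suc(1)[OF this ks] have ih: "D (single s' 1) = (\<Sum>i\<le>n. single (s' - unit i) (of_nat (lookup s' i)) * D (poly_var i))" .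
  have "D (poly_var j * single s' 1) = poly_var j * D (single s' 1) + single s' 1 * D (poly_var j)"
    by (rule derivationD(3)[OF D poly_var_closed[OF j(1)]]) (use ks in simp)
  moreover have "poly_var j * single s' 1 = single s 1" by (simp add: poly_var_def mult_single s)
  moreover have "poly_var j * D (single s' 1) = (\<Sum>i\<le>n. single (s - unit i) (of_nat (lookup s' i)) * D (poly_var i))"
    unfolding ih sum_distrib_left
  proof (rule sum.cong[OF refl])
    fix i
    have "poly_var j * single (s' - unit i) (of_nat (lookup s' i)) = single (s - unit i) (of_nat (lookup s' i) :: complex)"
    proof (cases "lookup s' i = 0")
      case False
      then have "below (unit i) s'" by (auto simp: below_def lookup_single when_def)
      then have e: "unit i + (s' - unit i) = s'" by (rule below_diff)
      have "unit i + (unit j + (s' - unit i)) = s"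
        unfolding add.left_commute[of "unit i" "unit j"] e s[symmetric] ..
      then have "s - unit i = unit j + (s' - unit i)" using add_diff_cancel_left'[of "unit i"] by blast
      then show ?thesis by (simp add: poly_var_def mult_single)
    qed simp
    then show "poly_var j * (single (s' - unit i) (of_nat (lookup s' i)) * D (poly_var i)) =
        single (s - unit i) (of_nat (lookup s' i)) * D (poly_var i)"
      by (simp add: mult.assoc[symmetric])
  qed
  moreover have "single s' 1 * D (poly_var j) = (\<Sum>i\<le>n. single (s - unit i) (if i = j then 1 else 0) * D (poly_var i))"
  proof -
    have "(\<Sum>i\<le>n. single (s - unit i) (if i = j then 1 else 0) * D (poly_var i)) =
        (\<Sum>i\<le>n. if i = j then single (s - unit i) 1 * D (poly_var i) else 0)"
      by (rule sum.cong) auto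
    then show ?thesis using j(1) by (simp add: s'_def)
  qed
  ultimately have "D (single s 1) = (\<Sum>i\<le>n. single (s - unit i) (of_nat (lookup s' i)) * D (poly_var i) +
      single (s - unit i) (if i = j then 1 else 0) * D (poly_var i))"
    by (simp add: sum.distrib)
  also have "\<dots> = (\<Sum>i\<le>n. single (s - unit i) (of_nat (lookup s i)) * D (poly_var i))"
    by (rule sum.cong) (auto simp: s lookup_add lookup_single when_def distrib_right[symmetric] single_add[symmetric] add.commute)
  finally show ?case .
qed

lemma der_image_mod_hom:
  assumes D: "D \<in> poly_derivations n"
  shows "der_image D \<in> mod_hom P M1 NA"
proof (rule mod_homI)
  fix x assume "x \<in> carrier M1"
  then have x: "x \<in> I" "x \<in> carrier P" using I_carrier by (auto simp: M1_simps)
  then show "der_image D x \<in> carrier NA" using derivationD(1)[OF D] by (simp add: der_image_def NA_simps)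
  fix y assume "y \<in> carrier M1"
  then have y: "y \<in> I" "y \<in> carrier P" using I_carrier by (auto simp: M1_simps)
  show "der_image D (x \<oplus>\<^bsub>M1\<^esub> y) = der_image D x \<oplus>\<^bsub>NA\<^esub> der_image D y"
    using derivationD(1,2)[OF D] x y I_add[OF x(1) y(1)] by (simp add: der_image_def NA_simps M1_simps A_add)
next
  fix r x assume r: "r \<in> carrier P" and "x \<in> carrier M1"
  then have x: "x \<in> I" "x \<in> carrier P" using I_carrier by (auto simp: M1_simps)
  have Dx: "D x \<in> carrier P" "D r \<in> carrier P" using derivationD(1)[OF D] r x by auto
  have "cl (r * D x + x * D r) = cl (r * D x)"
  proof (subst cl_eq_iff)
    have "x * D r \<in> I" using I_mult[OF Dx(2) x(1)] by (simp add: mult.commute)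
    then show "\<forall>t. keys t \<in> X \<longrightarrow> lookup (r * D x + x * D r) t = lookup (r * D x) t"
      by (simp add: I_iff lookup_add)
  qed (use r x Dx in auto)
  then show "der_image D (r \<odot>\<^bsub>M1\<^esub> x) = r \<odot>\<^bsub>NA\<^esub> der_image D x"
    using derivationD(3)[OF D r x(2)] I_mult[OF r x(1)] x r Dx
    by (simp add: der_image_def NA_simps M1_simps A_mult)
qed (simp add: der_image_def M1_simps)

text \<open>The coefficient at the target involves only those \<open>x\<^sub>i\<close> for which the source divided by \<open>x\<^sub>i\<close> divides the
  target. Then \<open>x\<^sup>b\<close> divides \<open>x\<^sub>i\<close>, and \<open>b\<close> is not 0 because \<open>f\<close> is in \<open>U\<close>.\<close>

lemma face_coefs_derivation:
  assumes D: "D \<in> poly_derivations n" and f: "f \<in> U"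
  shows "face_coefs (der_image D) f =
    (\<Sum>i\<le>n. if eb = unit i then lookup (D (poly_var i)) ea else 0)"
proof -
  let ?s = "source 1 f" and ?t = "target 1 f"
  have s: "single ?s 1 \<in> I" using source_nonface[OF f] single_in_I by blast
  have "face_coefs (der_image D) f = lookup (D (single ?s 1)) ?t"
    using f s keys_target_X[OF f, of 1] derivationD(1)[OF D I_carrier[OF s]]
    by (simp add: face_coefs_def der_image_def coef_cl)
  also have "\<dots> = (\<Sum>i\<le>n. lookup (single (?s - unit i) (of_nat (lookup ?s i)) * D (poly_var i)) ?t)"
    unfolding derivation_monomial[OF D source_nonface(2)[OF f]] by (rule lookup_sum)
  also have "\<dots> = (\<Sum>i\<le>n. if eb = unit i then lookup (D (poly_var i)) ea else 0)"
  proof (rule sum.cong[OF refl])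
    fix i assume "i \<in> {..n}"
    have fin: "finite (f \<union> As)" using U_finite[OF f] supports by simp
    show "lookup (single (?s - unit i) (of_nat (lookup ?s i)) * D (poly_var i)) ?t =
        (if eb = unit i then lookup (D (poly_var i)) ea else 0)"
    proof (cases "eb = unit i")
      case True
      then have B: "Bs = {i}" using keys_eb by simp
      have i: "i \<notin> f \<union> As"
      proof
        assume "i \<in> f \<union> As"
        then have "f \<union> As \<union> Bs = f \<union> As" unfolding B by auto
        then show False using f by (simp add: U_iff)
      qed
      then have "lookup ?s i = 1" using fin True by (simp add: source_def lookup_add lookup_block lookup_single)
      moreover have "?s - unit i = block 1 (f \<union> As)" using True by (simp add: source_def)
      ultimately show ?thesis using True by (simp add: lookup_single_mult target_def)
    next
      case False
      have "\<not> below (?s - unit i) ?t" if nz: "lookup ?s i \<noteq> 0"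
      proof
        assume b: "below (?s - unit i) ?t"
        have le: "lookup eb j \<le> lookup (unit i) j" for j
          using spec[OF b[unfolded below_def], of j] ea_or_eb[of j]
          by (auto simp: source_def target_def lookup_add lookup_minus)
        have "eb \<noteq> 0"
        proof
          assume "eb = 0"
          then have "Bs = {}" using keys_eb by simp
          then show False using f by (simp add: U_iff)
        qed
        then have "keys eb \<noteq> {}" by simp
        then obtain j where "j \<in> keys eb" by blast
        then have j: "lookup eb j \<noteq> 0" by (simp add: in_keys_iff)
        have "eb = unit i"
        proof (rule poly_mapping_eqI)
          fix k show "lookup eb k = lookup (unit i) k"
            using le[of k] le[of j] j by (cases "k = i"; cases "j = i") (auto simp: lookup_single when_def)
        qed
        then show False using False by simp
      qed
      then show ?thesis using False by (auto simp: lookup_single_mult)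
    qed
  qed
  finally show ?thesis .
qed

text \<open>The derivation \<open>z x\<^sup>a \<partial>/\<partial>x\<^sub>v\<close>.\<close>

definition partial :: "nat \<Rightarrow> complex \<Rightarrow> mpoly \<Rightarrow> mpoly" where
  "partial v z = (\<lambda>p\<in>carrier P. \<Sum>s\<in>keys p. single (s - unit v + ea) (lookup p s * (z * of_nat (lookup s v))))"

lemma additive_ext:
  fixes F G :: "mpoly \<Rightarrow> mpoly"
  assumes "\<And>p q. F (p + q) = F p + F q" "\<And>p q. G (p + q) = G p + G q" "\<And>s z. F (single s z) = G (single s z)"
  shows "F p = G p"
proof -
  have F0: "F 0 = 0" and G0: "G 0 = 0" using assms(1)[of 0 0] assms(2)[of 0 0] by simp_all
  have "F (\<Sum>s\<in>keys p. single s (lookup p s)) = G (\<Sum>s\<in>keys p. single s (lookup p s))"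
    unfolding additive_sum[of F, OF F0 assms(1)] additive_sum[of G, OF G0 assms(2)] assms(3) ..
  then show ?thesis unfolding poly_eq_sum_single[symmetric] .
qed

lemma partial_derivation:
  assumes v: "v \<le> n"
  shows "partial v z \<in> poly_derivations n"
    and "keys s \<subseteq> {0..n} \<Longrightarrow> partial v z (single s x) = single (s - unit v + ea) (x * (z * of_nat (lookup s v)))"
    and "p \<in> carrier P \<Longrightarrow> t \<in> keys (partial v z p) \<Longrightarrow> \<exists>s\<in>keys p. lookup s v \<noteq> 0 \<and> t = s - unit v + ea"
proof -
  define d where "d p = (\<Sum>s\<in>keys p. single (s - unit v + ea) (lookup p s * (z * of_nat (lookup s v))))" for p :: mpoly
  have pd: "partial v z p = d p" if "p \<in> carrier P" for p using that by (simp add: partial_def d_def)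
  have d_add: "d (p + q) = d p + d q" for p q
    unfolding d_def by (rule setsum_keys_plus_distrib) (simp_all add: algebra_simps single_add)
  have d_single: "d (single s x) = single (s - unit v + ea) (x * (z * of_nat (lookup s v)))" for s x
    by (cases "x = 0") (simp_all add: d_def)
  have d_keys: "\<exists>s\<in>keys p. lookup s v \<noteq> 0 \<and> t = s - unit v + ea" if t: "t \<in> keys (d p)" for t p
  proof -
    have "lookup (d p) t \<noteq> 0" using t by (simp add: in_keys_iff)
    then obtain s where "s \<in> keys p" "lookup (single (s - unit v + ea) (lookup p s * (z * of_nat (lookup s v)))) t \<noteq> 0"
      unfolding d_def lookup_sum using sum.not_neutral_contains_not_neutral by blast
    then show ?thesis by (intro bexI[of _ s]) (auto simp: lookup_single when_def split: if_splits)
  qed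
  have mono: "single s x * d (single t y) + single t y * d (single s x) = d (single s x * single t y)" for s t x y
  proof -
    have 1: "s + (t - unit v + ea) = s + t - unit v + ea" if "lookup t v \<noteq> 0" for s t
    proof -
      have "below (unit v) t" using that by (auto simp: below_def lookup_single when_def)
      then have e: "unit v + (t - unit v) = t" by (rule below_diff)
      have "unit v + (s + (t - unit v)) = s + t" unfolding add.left_commute[of "unit v" s] e ..
      then have e2: "s + t = unit v + (s + (t - unit v))" by (rule sym)
      have "s + t - unit v = s + (t - unit v)" by (simp only: e2 add_diff_cancel_left')
      then show ?thesis by (simp add: add_ac)
    qed
    have "single s x * d (single t y) = single (s + t - unit v + ea) (x * y * (z * of_nat (lookup t v)))"
      using 1[of t s] by (cases "lookup t v = 0") (simp_all add: d_single mult_single mult_ac)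
    moreover have "single t y * d (single s x) = single (s + t - unit v + ea) (x * y * (z * of_nat (lookup s v)))"
      using 1[of s t] by (cases "lookup s v = 0") (simp_all add: d_single mult_single mult_ac add.commute[of t s])
    ultimately show ?thesis
      by (simp add: d_single mult_single single_add[symmetric] lookup_add algebra_simps)
  qed
  have leibniz: "d (p * q) = p * d q + q * d p" for p q
  proof -
    have step: "d (single s x * q) = single s x * d q + q * d (single s x)" for s x q
    proof (rule additive_ext[where F = "\<lambda>q. d (single s x * q)" and G = "\<lambda>q. single s x * d q + q * d (single s x)"])
      show "d (single s x * single t y) = single s x * d (single t y) + single t y * d (single s x)" for t y
        by (rule mono[symmetric])
    qed (simp_all only: distrib_left distrib_right d_add add_ac)
    show ?thesis
    proof (rule additive_ext[where F = "\<lambda>p. d (p * q)" and G = "\<lambda>p. p * d q + q * d p"])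
      show "d (single s x * q) = single s x * d q + q * d (single s x)" for s x by (rule step)
    qed (simp_all only: distrib_left distrib_right d_add add_ac)
  qed
  have d_const: "d (poly_const c) = 0" for c by (simp add: poly_const_def d_single)
  have d_closed: "d p \<in> carrier P" if p: "p \<in> carrier P" for p
    unfolding poly_ring_carrier
  proof
    fix t assume "t \<in> keys (d p)"
    then obtain s where s: "s \<in> keys p" "t = s - unit v + ea" using d_keys by blast
    have "keys s \<subseteq> {0..n}" using p s(1) unfolding poly_ring_carrier by blast
    then show "keys t \<subseteq> {0..n}"
      using keys_diff_nat[of s "unit v"] supports(1) unfolding s(2) keys_add_nat keys_ea by blast
  qed
  show "partial v z \<in> poly_derivations n"
  proof (rule poly_derivationsI)
    show "partial v z \<in> extensional (carrier P)" by (simp add: partial_def)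
  qed (simp_all add: pd d_closed d_add leibniz d_const)
  show "partial v z (single s x) = single (s - unit v + ea) (x * (z * of_nat (lookup s v)))" if "keys s \<subseteq> {0..n}"
    using pd[OF single_closed[OF that]] d_single by simp
  show "\<exists>s\<in>keys p. lookup s v \<noteq> 0 \<and> t = s - unit v + ea" if "p \<in> carrier P" "t \<in> keys (partial v z p)"
    using d_keys[of t p] pd[OF that(1)] that(2) by simp
qed

subsection \<open>The graded piece of the first cotangent module\<close>

lemma scaled_derivation:
  assumes D: "D \<in> poly_derivations n" and E: "E \<in> poly_derivations n"
  shows "(\<lambda>p\<in>carrier P. D p + E p) \<in> poly_derivations n"
    and "(\<lambda>p\<in>carrier P. poly_const z * D p) \<in> poly_derivations n"
proof -
  note d = derivationD[OF D] and e = derivationD[OF E]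
  show "(\<lambda>p\<in>carrier P. D p + E p) \<in> poly_derivations n"
  proof (rule poly_derivationsI)
    show "(\<lambda>p\<in>carrier P. D p + E p) (p * q) = p * (\<lambda>p\<in>carrier P. D p + E p) q + q * (\<lambda>p\<in>carrier P. D p + E p) p"
      if "p \<in> carrier P" "q \<in> carrier P" for p q
      using that by (simp add: d(3)[OF that] e(3)[OF that] algebra_simps)
    show "(\<lambda>p\<in>carrier P. D p + E p) (poly_const z * p) = poly_const z * (\<lambda>p\<in>carrier P. D p + E p) p"
      if "p \<in> carrier P" for z p
      using that by (simp add: d(4)[OF that] e(4)[OF that] distrib_left)
  qed (auto simp: d(1,2) e(1,2))
  show "(\<lambda>p\<in>carrier P. poly_const z * D p) \<in> poly_derivations n"
  proof (rule poly_derivationsI)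
    show "(\<lambda>p\<in>carrier P. poly_const z * D p) (p * q) =
        p * (\<lambda>p\<in>carrier P. poly_const z * D p) q + q * (\<lambda>p\<in>carrier P. poly_const z * D p) p"
      if "p \<in> carrier P" "q \<in> carrier P" for p q
      using that by (simp add: d(3)[OF that] algebra_simps)
    show "(\<lambda>p\<in>carrier P. poly_const z * D p) (poly_const w * p) = poly_const w * (\<lambda>p\<in>carrier P. poly_const z * D p) p"
      if "p \<in> carrier P" for w p
      using that by (simp add: d(4)[OF that] mult.left_commute)
  qed (auto simp: d(1,2) algebra_simps)
qed

lemma zero_derivation: "(\<lambda>p\<in>carrier P. 0) \<in> poly_derivations n"
  by (rule poly_derivationsI) auto

lemma Hom1_neg:
  assumes "H \<in> mod_hom P M1 NA"
  shows "\<ominus>\<^bsub>Hom1\<^esub> H = poly_const (-1) \<odot>\<^bsub>Hom1\<^esub> H"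
  unfolding HT.hom_neg_eq[OF assms] hom_module_simps
  by (rule restrict_ext) (use Hom1_value[OF assms] in \<open>simp add: M1_simps NA_neg A_neg NA_simps\<close>)

lemma der_image_subgroup: "additive_subgroup (der_image ` poly_derivations n) Hom1"
proof (intro additive_subgroup.intro subgroup.intro)
  show "der_image ` poly_derivations n \<subseteq> carrier (add_monoid Hom1)"
    using der_image_mod_hom by (auto simp: hom_module_simps)
  show "g \<otimes>\<^bsub>add_monoid Hom1\<^esub> h \<in> der_image ` poly_derivations n"
    if gh: "g \<in> der_image ` poly_derivations n" "h \<in> der_image ` poly_derivations n" for g h
  proof -
    obtain D E where DE: "D \<in> poly_derivations n" "g = der_image D" "E \<in> poly_derivations n" "h = der_image E" using gh by auto
    have "g \<oplus>\<^bsub>Hom1\<^esub> h = der_image (\<lambda>p\<in>carrier P. D p + E p)"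
      unfolding DE hom_module_simps M1_simps
      by (auto simp: der_image_def NA_simps derivationD[OF DE(1)] derivationD[OF DE(3)] I_carrier A_add intro!: restrict_ext)
    then show ?thesis using scaled_derivation(1)[OF DE(1,3)] by simp
  qed
  show "\<one>\<^bsub>add_monoid Hom1\<^esub> \<in> der_image ` poly_derivations n"
  proof (rule image_eqI[OF _ zero_derivation])
    show "\<one>\<^bsub>add_monoid Hom1\<^esub> = der_image (\<lambda>p\<in>carrier P. 0)"
      using A_zero A_zero' by (auto simp: hom_module_simps der_image_def NA_simps M1_simps I_carrier intro!: restrict_ext)
  qed
  show "inv\<^bsub>add_monoid Hom1\<^esub> g \<in> der_image ` poly_derivations n" if g: "g \<in> der_image ` poly_derivations n" for g
  proof -
    obtain D where D: "D \<in> poly_derivations n" "g = der_image D" using g by auto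
    have "inv\<^bsub>add_monoid Hom1\<^esub> g = poly_const (-1) \<odot>\<^bsub>Hom1\<^esub> g"
      using Hom1_neg[OF der_image_mod_hom[OF D(1)]] D(2) by (simp add: a_inv_def)
    also have "\<dots> = der_image (\<lambda>p\<in>carrier P. poly_const (-1) * D p)"
      unfolding D(2) hom_module_simps M1_simps
      by (auto simp: der_image_def NA_simps derivationD(1)[OF D(1)] I_carrier A_mult intro!: restrict_ext)
    finally show ?thesis using scaled_derivation(2)[OF D(1) D(1)] by simp
  qed
qed

lemma der_image_smult:
  assumes "g \<in> der_image ` poly_derivations n"
  shows "poly_const z \<odot>\<^bsub>Hom1\<^esub> g \<in> der_image ` poly_derivations n"
proof -
  obtain D where D: "D \<in> poly_derivations n" "g = der_image D" using assms by auto
  have "poly_const z \<odot>\<^bsub>Hom1\<^esub> g = der_image (\<lambda>p\<in>carrier P. poly_const z * D p)"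
    unfolding D(2) hom_module_simps M1_simps
    by (auto simp: der_image_def NA_simps derivationD(1)[OF D(1)] I_carrier A_mult intro!: restrict_ext)
  then show ?thesis using scaled_derivation(2)[OF D(1) D(1)] by simp
qed

lemma quot_ring_grading_closed:
  assumes "C \<in> quot_ring_grading n I d"
  shows "D \<in> quot_ring_grading n I d \<Longrightarrow> C \<oplus>\<^bsub>A\<^esub> D \<in> quot_ring_grading n I d"
    and "cl (poly_const z) \<otimes>\<^bsub>A\<^esub> C \<in> quot_ring_grading n I d"
proof -
  have rep: "\<exists>p\<in>poly_grading n d. C = cl p" if "C \<in> quot_ring_grading n I d" for C
    using that by (auto simp: quot_ring_grading_def quot_grading_def regular_module_def a_r_coset_def')
  obtain p where p: "p \<in> poly_grading n d" "C = cl p" using rep[OF assms] by blast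
  have pc: "p \<in> carrier P" using p(1) by (simp add: poly_grading_def)
  show "C \<oplus>\<^bsub>A\<^esub> D \<in> quot_ring_grading n I d" if D: "D \<in> quot_ring_grading n I d"
  proof -
    obtain q where q: "q \<in> poly_grading n d" "D = cl q" using rep[OF D] by blast
    have qc: "q \<in> carrier P" using q(1) by (simp add: poly_grading_def)
    have "p + q \<in> poly_grading n d" using p(1) q(1) keys_add[of p q] by (auto simp: poly_grading_def)
    then show ?thesis using quot_ring_gradingI p(2) q(2) A_add[OF pc qc] by simp
  qed
  have "keys (poly_const z * p) \<subseteq> keys p" by (auto simp: in_keys_iff lookup_poly_const_mult)
  then have "poly_const z * p \<in> poly_grading n d" using p(1) pc by (auto simp: poly_grading_def)
  then show "cl (poly_const z) \<otimes>\<^bsub>A\<^esub> C \<in> quot_ring_grading n I d"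
    using quot_ring_gradingI p(2) A_mult[OF poly_const_closed pc] by simp
qed

lemma Hom1c_closed:
  assumes "H \<in> Hom1c"
  shows "G \<in> Hom1c \<Longrightarrow> H \<oplus>\<^bsub>Hom1\<^esub> G \<in> Hom1c" and "poly_const z \<odot>\<^bsub>Hom1\<^esub> H \<in> Hom1c"
proof -
  have H: "H \<in> mod_hom P M1 NA" using assms by (rule Hom1c_mod_hom)
  show "H \<oplus>\<^bsub>Hom1\<^esub> G \<in> Hom1c" if G: "G \<in> Hom1c"
    unfolding hom_grading_def mem_Collect_eq
  proof (intro conjI allI ballI)
    show "H \<oplus>\<^bsub>Hom1\<^esub> G \<in> mod_hom P M1 NA"
      using HT.hom_add[OF H Hom1c_mod_hom[OF G]] by (simp add: hom_module_simps)
    fix d p assume p: "p \<in> I \<inter> poly_grading n d"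
    then show "(H \<oplus>\<^bsub>Hom1\<^esub> G) p \<in> quot_ring_grading n I (\<lambda>i. d i + cdeg i)"
      using quot_ring_grading_closed(1)[OF Hom1c_graded[OF assms, of p d] Hom1c_graded[OF G, of p d]]
      by (simp add: hom_module_simps M1_simps NA_simps)
  qed
  show "poly_const z \<odot>\<^bsub>Hom1\<^esub> H \<in> Hom1c"
    unfolding hom_grading_def mem_Collect_eq
  proof (intro conjI allI ballI)
    show "poly_const z \<odot>\<^bsub>Hom1\<^esub> H \<in> mod_hom P M1 NA"
      using HT.hom_smult[OF H poly_const_closed] by (simp add: hom_module_simps)
    fix d p assume p: "p \<in> I \<inter> poly_grading n d"
    then show "(poly_const z \<odot>\<^bsub>Hom1\<^esub> H) p \<in> quot_ring_grading n I (\<lambda>i. d i + cdeg i)"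
      using quot_ring_grading_closed(2)[OF Hom1c_graded[OF assms, of p d]]
      by (simp add: hom_module_simps M1_simps NA_simps)
  qed
qed

lemma face_coefs_linear:
  assumes H: "H \<in> Hom1c"
  shows "G \<in> Hom1c \<Longrightarrow> face_coefs (H \<oplus>\<^bsub>Hom1\<^esub> G) = (\<lambda>f. face_coefs H f + face_coefs G f)"
    and "face_coefs (poly_const z \<odot>\<^bsub>Hom1\<^esub> H) = (\<lambda>f. z * face_coefs H f)"
proof -
  have s: "single (source 1 f) 1 \<in> I" if "f \<in> U" for f
    using single_in_I[OF source_nonface(2,1)[OF that]] .
  note H' = Hom1_value[OF Hom1c_mod_hom[OF H] s]
  show "face_coefs (H \<oplus>\<^bsub>Hom1\<^esub> G) = (\<lambda>f. face_coefs H f + face_coefs G f)" if G: "G \<in> Hom1c"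
  proof
    fix f
    show "face_coefs (H \<oplus>\<^bsub>Hom1\<^esub> G) f = face_coefs H f + face_coefs G f"
    proof (cases "f \<in> U")
      case True
      then show ?thesis
        using coef_add[OF H'[OF True] Hom1_value[OF Hom1c_mod_hom[OF G] s[OF True]] keys_target_X[OF True, of 1]] s[OF True]
        by (simp add: face_coefs_def hom_module_simps M1_simps NA_simps)
    qed (simp add: face_coefs_def)
  qed
  show "face_coefs (poly_const z \<odot>\<^bsub>Hom1\<^esub> H) = (\<lambda>f. z * face_coefs H f)"
  proof
    fix f
    show "face_coefs (poly_const z \<odot>\<^bsub>Hom1\<^esub> H) f = z * face_coefs H f"
    proof (cases "f \<in> U")
      case True
      then show ?thesis
        using coef_const_mult[OF H'[OF True] keys_target_X[OF True, of 1]] s[OF True]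
        by (simp add: face_coefs_def hom_module_simps M1_simps NA_simps)
    qed (simp add: face_coefs_def)
  qed
qed

lemma der_image_partial:
  assumes v: "eb = unit v"
  shows "v \<le> n" and "der_image (partial v z) \<in> Hom1c"
    and "face_coefs (der_image (partial v z)) = (\<lambda>f. if f \<in> U then z else 0)"
proof -
  have "Bs = {v}" using v keys_eb by simp
  then show vn: "v \<le> n" using supports(2) by auto
  note D = partial_derivation(1)[OF vn, of z]
  show "der_image (partial v z) \<in> Hom1c"
    unfolding hom_grading_def mem_Collect_eq
  proof (intro conjI allI ballI)
    show "der_image (partial v z) \<in> mod_hom P M1 NA" by (rule der_image_mod_hom[OF D])
    fix d p assume p: "p \<in> I \<inter> poly_grading n d"
    then have pc: "p \<in> carrier P" by (simp add: poly_grading_def)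
    have c: "partial v z p \<in> carrier P" by (rule derivationD(1)[OF D pc])
    have "partial v z p \<in> poly_grading n (\<lambda>i. d i + cdeg i)"
      unfolding poly_grading_def mem_Collect_eq
    proof (intro conjI ballI allI impI c)
      fix t i assume t: "t \<in> keys (partial v z p)" and i: "i \<le> n"
      obtain s where s: "s \<in> keys p" "lookup s v \<noteq> 0" "t = s - unit v + ea"
        using partial_derivation(3)[OF vn pc t] by blast
      have "below (unit v) s" using s(2) by (auto simp: below_def lookup_single when_def)
      then have eq: "unit v + (s - unit v) = s" by (rule below_diff)
      have "t + eb = (unit v + (s - unit v)) + ea" unfolding s(3) v by (simp only: add_ac)
      also have "\<dots> = s + ea" unfolding eq ..
      finally have "t + eb = s + ea" .
      moreover have "keys t \<subseteq> {0..n}" "keys s \<subseteq> {0..n}" using t c s(1) pc unfolding poly_ring_carrier by blast+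
      ultimately have "int (lookup t i) = int (lookup s i) + cdeg i" using degree_eq_iff[of s t] i by blast
      then show "int (lookup t i) = d i + cdeg i" using p s(1) i by (simp add: poly_grading_def)
    qed
    then show "der_image (partial v z) p \<in> quot_ring_grading n I (\<lambda>i. d i + cdeg i)"
      using p quot_ring_gradingI by (simp add: der_image_def)
  qed
  show "face_coefs (der_image (partial v z)) = (\<lambda>f. if f \<in> U then z else 0)"
  proof
    fix f
    show "face_coefs (der_image (partial v z)) f = (if f \<in> U then z else 0)"
    proof (cases "f \<in> U")
      case True
      have inj: "eb = unit i \<longleftrightarrow> i = v" for i
      proof
        assume "eb = unit i"
        then have "keys (unit i) = keys (unit v)" using v by simp
        then show "i = v" by simp
      qed (use v in simp)
      have "partial v z (poly_var v) = single ea z"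
        using partial_derivation(2)[OF vn, of "unit v" z 1] vn by (simp add: poly_var_def)
      then have "(\<Sum>i\<le>n. if eb = unit i then lookup (partial v z (poly_var i)) ea else 0) = z"
        unfolding inj using vn by simp
      then show ?thesis using face_coefs_derivation[OF D True] True by simp
    qed (simp add: face_coefs_def)
  qed
qed

text \<open>The functions on faces that come from derivations.\<close>

definition trivial_coefs :: "(nat set \<Rightarrow> complex) set" where
  "trivial_coefs = (if \<exists>v. eb = unit v then poset_const U else {\<lambda>_. 0})"

lemma face_coefs_trivial_iff:
  assumes H: "H \<in> Hom1c"
  shows "face_coefs H \<in> trivial_coefs \<longleftrightarrow> H \<in> der_image ` poly_derivations n"
proof
  assume "H \<in> der_image ` poly_derivations n"
  then obtain D where D: "D \<in> poly_derivations n" "H = der_image D" by auto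
  define z where "z = (\<Sum>i\<le>n. if eb = unit i then lookup (D (poly_var i)) ea else 0)"
  have eq: "face_coefs H = (\<lambda>f. if f \<in> U then z else 0)"
    using face_coefs_derivation[OF D(1)] unfolding D(2) z_def by (auto simp: face_coefs_def)
  show "face_coefs H \<in> trivial_coefs"
  proof (cases "\<exists>v. eb = unit v")
    case True
    then show ?thesis unfolding trivial_coefs_def eq poset_const_def by auto
  next
    case False
    then have "z = 0" unfolding z_def by simp
    then show ?thesis using False unfolding trivial_coefs_def eq by auto
  qed
next
  assume triv: "face_coefs H \<in> trivial_coefs"
  show "H \<in> der_image ` poly_derivations n"
  proof (cases "\<exists>v. eb = unit v")
    case True
    then obtain v where v: "eb = unit v" by blast
    obtain z where z: "face_coefs H = (\<lambda>f. if f \<in> U then z else 0)"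
      using triv True unfolding trivial_coefs_def poset_const_def by auto
    have "H = der_image (partial v z)"
      by (rule Hom1c_eqI[OF H der_image_partial(2)[OF v]]) (simp add: z der_image_partial(3)[OF v])
    then show ?thesis using partial_derivation(1)[OF der_image_partial(1)[OF v]] by blast
  next
    case False
    then have z: "face_coefs H = (\<lambda>_. 0)" using triv unfolding trivial_coefs_def by simp
    have "poly_const 0 \<odot>\<^bsub>Hom1\<^esub> H \<in> Hom1c" by (rule Hom1c_closed(2)[OF H])
    then have "H = poly_const 0 \<odot>\<^bsub>Hom1\<^esub> H"
      by (rule Hom1c_eqI[OF H]) (simp add: face_coefs_linear(2)[OF H] z)
    also have "\<dots> = der_image (\<lambda>p\<in>carrier P. 0)"
      unfolding hom_module_simps M1_simps der_image_def
    proof (rule restrict_ext)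
      fix p assume p: "p \<in> I"
      have c: "H p \<in> carrier A" by (rule Hom1_value[OF Hom1c_mod_hom[OF H] p])
      have "poly_const 0 = (0 :: mpoly)" by (simp add: poly_const_def)
      then have "poly_const 0 \<odot>\<^bsub>NA\<^esub> H p = cl 0" using AA.l_null[OF c] A_zero A_zero' by (simp add: NA_simps)
      then show "poly_const 0 \<odot>\<^bsub>NA\<^esub> H p = cl ((\<lambda>p\<in>carrier P. 0) p)" using I_carrier[OF p] by simp
    qed
    finally show ?thesis using zero_derivation by blast
  qed
qed

lemma T1_piece_vector_quotient: "vector_quotient (T1_piece n I cdeg) (poset_Z0 U U1) trivial_coefs"
proof (rule vector_quotient_quot[where M = Hom1 and N = "der_image ` poly_derivations n" and s = poly_const
      and G = Hom1c and F = face_coefs])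
  show "abelian_group Hom1" by (rule HT.hom_abelian_group)
  show "additive_subgroup (der_image ` poly_derivations n) Hom1" by (rule der_image_subgroup)
  show "Hom1c \<subseteq> carrier Hom1" using Hom1c_mod_hom by (auto simp: hom_module_simps)
  show "poly_const z \<odot>\<^bsub>Hom1\<^esub> (x \<oplus>\<^bsub>Hom1\<^esub> y) = poly_const z \<odot>\<^bsub>Hom1\<^esub> x \<oplus>\<^bsub>Hom1\<^esub> poly_const z \<odot>\<^bsub>Hom1\<^esub> y"
    if "x \<in> carrier Hom1" "y \<in> carrier Hom1" for z x y
    using HT.hom_smult_distr[of x y "poly_const z"] that by (simp add: hom_module_simps(1))
  show "poly_const z \<odot>\<^bsub>Hom1\<^esub> x \<in> carrier Hom1" if "x \<in> carrier Hom1" for z x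
    using HT.hom_smult[of x "poly_const z"] that by (simp add: hom_module_simps)
  show "carrier (T1_piece n I cdeg) = (\<lambda>x. (der_image ` poly_derivations n) +>\<^bsub>Hom1\<^esub> x) ` Hom1c"
    by (simp add: T1_piece_def quot_grading_def der_image_def)
  show "add (T1_piece n I cdeg) = set_add Hom1"
    by (simp add: T1_piece_def T1_def restrict_scalars_def quot_module_def)
  show "z \<odot>\<^bsub>T1_piece n I cdeg\<^esub> x = (\<Union>y\<in>x. (der_image ` poly_derivations n) +>\<^bsub>Hom1\<^esub> (poly_const z \<odot>\<^bsub>Hom1\<^esub> y))" for z x
    by (simp add: T1_piece_def T1_def restrict_scalars_def quot_module_def der_image_def)
  show "(\<lambda>x. 0) \<in> trivial_coefs" by (simp add: trivial_coefs_def poset_const_closed)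
  show "(\<lambda>x. v x + w x) \<in> trivial_coefs" if "v \<in> trivial_coefs" "w \<in> trivial_coefs" for v w
    using that by (auto simp: trivial_coefs_def poset_const_closed split: if_splits)
  show "(\<lambda>x. z * v x) \<in> trivial_coefs" if "v \<in> trivial_coefs" for z v
    using that by (auto simp: trivial_coefs_def poset_const_closed split: if_splits)
  show "face_coefs x \<in> trivial_coefs \<longleftrightarrow> x \<in> der_image ` poly_derivations n" if "x \<in> Hom1c" for x
    by (rule face_coefs_trivial_iff[OF that])
  show "\<exists>x\<in>Hom1c. (\<lambda>i. v i - face_coefs x i) \<in> trivial_coefs" if "v \<in> poset_Z0 U U1" for v
    using spread_hom_Hom1c[OF that] face_coefs_spread_hom[OF that]
    by (intro bexI[of _ "spread_hom v"]) (simp_all add: trivial_coefs_def poset_const_closed)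
  show "\<ominus>\<^bsub>Hom1\<^esub> x = poly_const (-1) \<odot>\<^bsub>Hom1\<^esub> x" if "x \<in> Hom1c" for x
    by (rule Hom1_neg[OF Hom1c_mod_hom[OF that]])
qed (assumption | rule Hom1c_closed poset_Z0_closed face_coefs_Z0 face_coefs_linear der_image_smult)+

lemma T1_piece_zero: "\<zero>\<^bsub>T1_piece n I cdeg\<^esub> \<in> carrier (T1_piece n I cdeg)"
proof -
  interpret H: abelian_group Hom1 by (rule HT.hom_abelian_group)
  have "spread_hom (\<lambda>_. 0) \<in> Hom1c" by (rule spread_hom_Hom1c) (auto intro: poset_Z0I)
  have z: "spread_hom (\<lambda>_. 0) = \<zero>\<^bsub>Hom1\<^esub>"
    unfolding spread_hom_def hom_module_simps M1_simps NA_simps A_zero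
  proof (rule restrict_ext)
    fix p
    have "shift (\<lambda>t. 0) p = 0" by (rule poly_mapping_eqI) (simp add: lookup_shift)
    then show "cl (shift (\<lambda>t. 0) p) = I" by (simp only: A_zero'[symmetric])
  qed
  have sub: "der_image ` poly_derivations n \<subseteq> carrier Hom1"
    using der_image_mod_hom by (auto simp: hom_module_simps)
  have "\<zero>\<^bsub>T1_piece n I cdeg\<^esub> = der_image ` poly_derivations n"
    by (simp add: T1_piece_def T1_def restrict_scalars_def quot_module_def der_image_def)
  also have "\<dots> = (der_image ` poly_derivations n) +>\<^bsub>Hom1\<^esub> spread_hom (\<lambda>_. 0)"
    unfolding z using H.a_coset_add_zero[OF sub] by simp
  finally show ?thesis
    using \<open>spread_hom (\<lambda>_. 0) \<in> Hom1c\<close>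
    by (simp add: T1_piece_def quot_grading_def der_image_def)
qed

end

section \<open>Presentations of the ideal\<close>

locale presented = multidegree +
  fixes m :: nat and Deg :: "nat \<Rightarrow> mdeg" and j :: "(nat \<Rightarrow> mpoly) \<Rightarrow> mpoly"
  assumes pres: "graded_presentation n (stanley_reisner_ideal n X) m Deg j"
begin

abbreviation Fm where "Fm \<equiv> free_module P m"
abbreviation Rel where "Rel \<equiv> rel_carrier n m j"
abbreviation Kos where "Kos \<equiv> koszul_rels n m j"
abbreviation RM where "RM \<equiv> rel_module n m j"
abbreviation RQ where "RQ \<equiv> rel_quot n m j"
abbreviation RA where "RA \<equiv> regular_module A"

lemma Fm_simps:
  "carrier Fm = {..<m} \<rightarrow>\<^sub>E carrier P" "zero Fm = (\<lambda>k\<in>{..<m}. 0)"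
  "x \<oplus>\<^bsub>Fm\<^esub> y = (\<lambda>k\<in>{..<m}. x k + y k)" "r \<odot>\<^bsub>Fm\<^esub> x = (\<lambda>k\<in>{..<m}. r * x k)"
  by (simp_all add: free_module_def)

lemma RM_simps:
  "carrier RM = Rel" "zero RM = zero Fm" "add RM = add Fm" "smult RM = smult Fm"
  by (simp_all add: rel_module_def)

lemma Fm_closed:
  "x \<in> carrier Fm \<Longrightarrow> y \<in> carrier Fm \<Longrightarrow> x \<oplus>\<^bsub>Fm\<^esub> y \<in> carrier Fm"
  "r \<in> carrier P \<Longrightarrow> x \<in> carrier Fm \<Longrightarrow> r \<odot>\<^bsub>Fm\<^esub> x \<in> carrier Fm" "zero Fm \<in> carrier Fm"
  "x \<in> carrier Fm \<Longrightarrow> k < m \<Longrightarrow> x k \<in> carrier P"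
  by (auto simp: Fm_simps PiE_iff)

lemma Fm_eqI: "x \<in> carrier Fm \<Longrightarrow> y \<in> carrier Fm \<Longrightarrow> (\<And>k. k < m \<Longrightarrow> x k = y k) \<Longrightarrow> x = y"
  unfolding Fm_simps by (rule PiE_ext) auto

lemma j_props:
  "x \<in> carrier Fm \<Longrightarrow> j x \<in> carrier P" "x \<in> carrier Fm \<Longrightarrow> j x \<in> I"
  "x \<in> carrier Fm \<Longrightarrow> y \<in> carrier Fm \<Longrightarrow> j (x \<oplus>\<^bsub>Fm\<^esub> y) = j x + j y"
  "r \<in> carrier P \<Longrightarrow> x \<in> carrier Fm \<Longrightarrow> j (r \<odot>\<^bsub>Fm\<^esub> x) = r * j x"
  "p \<in> I \<Longrightarrow> \<exists>x\<in>carrier Fm. p = j x"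
  "x \<in> free_grading n m Deg d \<Longrightarrow> j x \<in> poly_grading n d"
proof -
  have h: "j \<in> mod_hom P Fm (regular_module P)" and im: "j ` carrier Fm = I"
    and gr: "\<forall>d. \<forall>e\<in>free_grading n m Deg d. j e \<in> poly_grading n d"
    using pres unfolding graded_presentation_def by blast+
  note D = mod_homD[OF h]
  show "x \<in> carrier Fm \<Longrightarrow> j x \<in> carrier P" using D(1) by (simp add: regular_module_def)
  show "x \<in> carrier Fm \<Longrightarrow> j x \<in> I" using im by blast
  show "x \<in> carrier Fm \<Longrightarrow> y \<in> carrier Fm \<Longrightarrow> j (x \<oplus>\<^bsub>Fm\<^esub> y) = j x + j y"
    using D(3)[of x y] by (simp add: regular_module_def)
  show "r \<in> carrier P \<Longrightarrow> x \<in> carrier Fm \<Longrightarrow> j (r \<odot>\<^bsub>Fm\<^esub> x) = r * j x"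
    using D(4)[of r x] by (simp add: regular_module_def)
  show "p \<in> I \<Longrightarrow> \<exists>x\<in>carrier Fm. p = j x" using im by blast
  show "x \<in> free_grading n m Deg d \<Longrightarrow> j x \<in> poly_grading n d" using gr by blast
qed

definition bas :: "nat \<Rightarrow> mpoly \<Rightarrow> nat \<Rightarrow> mpoly" where
  "bas k p = (\<lambda>i\<in>{..<m}. if i = k then p else 0)"

definition gen :: "nat \<Rightarrow> mpoly" where "gen k = j (bas k 1)"

lemma bas_closed [simp]: "p \<in> carrier P \<Longrightarrow> bas k p \<in> carrier Fm"
  by (auto simp: bas_def Fm_simps PiE_def)

lemma smult_bas: "r \<odot>\<^bsub>Fm\<^esub> bas k p = bas k (r * p)"
  by (auto simp: Fm_simps bas_def intro!: restrict_ext)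

lemma j_zero: "j (zero Fm) = 0"
proof -
  have "j (0 \<odot>\<^bsub>Fm\<^esub> zero Fm) = 0 * j (zero Fm)" by (rule j_props(4)) (auto simp: Fm_closed)
  moreover have "0 \<odot>\<^bsub>Fm\<^esub> zero Fm = zero Fm" by (auto simp: Fm_simps intro!: restrict_ext)
  ultimately show ?thesis by simp
qed

lemma j_eq:
  assumes x: "x \<in> carrier Fm"
  shows "j x = (\<Sum>k<m. gen k * x k)"
proof -
  have "l \<le> m \<Longrightarrow> j (\<lambda>i\<in>{..<m}. if i < l then x i else 0) = (\<Sum>k<l. gen k * x k)" for l
  proof (induction l)
    case 0
    have "(\<lambda>i\<in>{..<m}. if i < (0::nat) then x i else 0) = zero Fm" by (simp add: Fm_simps)
    then show ?case using j_zero by simp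
  next
    case (Suc l)
    let ?t = "\<lambda>i\<in>{..<m}. if i < l then x i else 0"
    have eq: "(\<lambda>i\<in>{..<m}. if i < Suc l then x i else 0) = ?t \<oplus>\<^bsub>Fm\<^esub> (x l \<odot>\<^bsub>Fm\<^esub> bas l 1)"
      unfolding smult_bas by (auto simp: Fm_simps bas_def less_Suc_eq intro!: restrict_ext)
    have t: "?t \<in> carrier Fm" using Fm_closed(4)[OF x] by (auto simp: Fm_simps PiE_def)
    have xl: "x l \<in> carrier P" using Fm_closed(4)[OF x] Suc(2) by simp
    have "j (x l \<odot>\<^bsub>Fm\<^esub> bas l 1) = x l * gen l" unfolding gen_def by (rule j_props(4)[OF xl]) simp
    then show ?case
      unfolding eq using j_props(3)[OF t Fm_closed(2)[OF xl bas_closed[of 1 l]]] Suc by (simp add: mult.commute)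
  qed
  from this[OF order_refl] have "j (\<lambda>i\<in>{..<m}. if i < m then x i else 0) = (\<Sum>k<m. gen k * x k)" .
  moreover have "(\<lambda>i\<in>{..<m}. if i < m then x i else 0) = x"
    using x by (intro ext) (auto simp: Fm_simps PiE_def extensional_def)
  ultimately show ?thesis by simp
qed

text \<open>Each generator is homogeneous for the fine grading, hence a single term with exponent \<open>D k\<close> and coefficient
  \<open>zc k\<close>. For a zero generator the exponent 0 is a dummy.\<close>

definition D :: "nat \<Rightarrow> expo" where "D k = (if gen k = 0 then 0 else SOME d. d \<in> keys (gen k))"
definition zc :: "nat \<Rightarrow> complex" where "zc k = lookup (gen k) (D k)"

lemma poly_grading_zero [simp]: "0 \<in> poly_grading n d"
  by (simp add: poly_grading_def)

lemma gen_monomial: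
  assumes k: "k < m"
  shows "gen k = single (D k) (zc k)"
    and "zc k \<noteq> 0 \<Longrightarrow> keys (D k) \<subseteq> {0..n}" "zc k \<noteq> 0 \<Longrightarrow> keys (D k) \<notin> X"
    and "zc k \<noteq> 0 \<Longrightarrow> i \<le> n \<Longrightarrow> Deg k i = int (lookup (D k) i)"
proof -
  have "bas k 1 \<in> free_grading n m Deg (Deg k)"
    unfolding free_grading_def mem_Collect_eq
    by (intro conjI allI impI bas_closed) (auto simp: bas_def poly_grading_def)
  then have gr: "gen k \<in> poly_grading n (Deg k)" unfolding gen_def by (rule j_props(6))
  have gI: "gen k \<in> I" unfolding gen_def by (rule j_props(2)) simp
  have Dk: "D k \<in> keys (gen k)" if "gen k \<noteq> 0"
  proof -
    have "keys (gen k) \<noteq> {}" using that by simp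
    then have "\<exists>d. d \<in> keys (gen k)" by blast
    from someI_ex[OF this] show ?thesis using that by (simp add: D_def)
  qed
  have uniq: "t = D k" if t: "t \<in> keys (gen k)" for t
  proof (rule poly_mapping_eqI)
    fix i
    have g: "gen k \<noteq> 0" using t by auto
    have kt: "keys t \<subseteq> {0..n}" "keys (D k) \<subseteq> {0..n}"
      using I_carrier[OF gI] t Dk[OF g] unfolding poly_ring_carrier by blast+
    show "lookup t i = lookup (D k) i"
    proof (cases "i \<le> n")
      case True
      then have "int (lookup t i) = Deg k i" "int (lookup (D k) i) = Deg k i"
        using gr t Dk[OF g] unfolding poly_grading_def by blast+
      then show ?thesis by simp
    next
      case False
      then have "i \<notin> keys t" "i \<notin> keys (D k)" using kt by auto
      then show ?thesis by (simp add: in_keys_iff)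
    qed
  qed
  show "gen k = single (D k) (zc k)"
  proof (rule poly_mapping_eqI)
    fix t show "lookup (gen k) t = lookup (single (D k) (zc k)) t"
      using uniq[of t] by (auto simp: lookup_single when_def zc_def in_keys_iff)
  qed
  assume z: "zc k \<noteq> 0"
  then have key: "D k \<in> keys (gen k)" by (simp add: zc_def in_keys_iff)
  show "keys (D k) \<subseteq> {0..n}" using I_carrier[OF gI] key unfolding poly_ring_carrier by blast
  show "keys (D k) \<notin> X" by (rule I_nonface[OF gI]) (use z in \<open>simp add: zc_def\<close>)
  show "Deg k i = int (lookup (D k) i)" if "i \<le> n" using gr key that unfolding poly_grading_def by simp
qed

lemma lookup_gen_mult:
  "k < m \<Longrightarrow> lookup (gen k * p) u = (if below (D k) u then zc k * lookup p (u - D k) else 0)"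
  by (simp add: gen_monomial(1) lookup_single_mult)

lemma gen_exists:
  assumes "keys t \<subseteq> {0..n}" "keys t \<notin> X"
  shows "\<exists>k<m. zc k \<noteq> 0 \<and> below (D k) t"
proof -
  obtain x where x: "x \<in> carrier Fm" "single t 1 = j x" using j_props(5)[OF single_in_I[OF assms]] by blast
  have "lookup (j x) t = 1" unfolding x(2)[symmetric] by simp
  then have "(\<Sum>k<m. lookup (gen k * x k) t) \<noteq> 0" unfolding j_eq[OF x(1)] lookup_sum by simp
  then obtain k where k: "k < m" "lookup (gen k * x k) t \<noteq> 0"
    using sum.not_neutral_contains_not_neutral[of "\<lambda>k. lookup (gen k * x k) t" "{..<m}"] by blast
  then show ?thesis using lookup_gen_mult[OF k(1)] by (intro exI[of _ k]) (auto split: if_splits)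
qed

text \<open>The generators whose shifted exponent \<open>D k + c\<close> has a negative entry.\<close>

definition special :: "nat \<Rightarrow> bool" where "special k \<longleftrightarrow> (\<exists>v\<in>Bs. lookup (D k) v < b v)"

lemma on_Bs: "v \<in> Bs \<Longrightarrow> lookup ea v = 0" "v \<in> Bs \<Longrightarrow> lookup eb v = b v" "v \<in> Bs \<Longrightarrow> 1 \<le> b v"
proof -
  assume v: "v \<in> Bs"
  then have "v \<notin> keys ea" "v \<in> keys eb" using supports(5) keys_ea keys_eb by auto
  moreover have "v \<le> n" using v supports(2) by auto
  ultimately show "lookup ea v = 0" "lookup eb v = b v" "1 \<le> b v"
    using ea_or_eb[of v] by (auto simp: in_keys_iff lookup_eb)
qed

lemma not_special_below: "\<not> special k \<longleftrightarrow> below eb (D k + ea)"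
proof
  assume ns: "\<not> special k"
  show "below eb (D k + ea)"
    unfolding below_def
  proof
    fix i show "lookup eb i \<le> lookup (D k + ea) i"
    proof (cases "i \<in> Bs")
      case True
      then show ?thesis using ns on_Bs(2)[OF True] unfolding special_def by (auto simp: lookup_add not_less trans_le_add1)
    next
      case False
      then have "i \<notin> keys eb" using keys_eb by simp
      then show ?thesis by (simp add: in_keys_iff)
    qed
  qed
next
  assume *: "below eb (D k + ea)"
  show "\<not> special k"
    unfolding special_def
  proof (intro notI, elim bexE)
    fix v assume v: "v \<in> Bs" "lookup (D k) v < b v"
    then show False using spec[OF *[unfolded below_def], of v] on_Bs[OF v(1)] by (simp add: lookup_add)
  qed
qed

section \<open>Relations modulo Koszul relations\<close>

lemma Fm_abelian_group: "abelian_group Fm"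
proof (rule abelian_groupI)
  fix x assume x: "x \<in> carrier Fm"
  show "\<zero>\<^bsub>Fm\<^esub> \<oplus>\<^bsub>Fm\<^esub> x = x"
    by (rule Fm_eqI[OF Fm_closed(1)[OF Fm_closed(3) x] x]) (simp add: Fm_simps)
  show "\<exists>y\<in>carrier Fm. y \<oplus>\<^bsub>Fm\<^esub> x = \<zero>\<^bsub>Fm\<^esub>"
  proof (rule bexI[of _ "\<lambda>k\<in>{..<m}. - x k"])
    show "(\<lambda>k\<in>{..<m}. - x k) \<in> carrier Fm"
      unfolding Fm_simps(1) restrict_PiE_iff by (intro ballI poly_ring_closed Fm_closed(4)[OF x]) simp
    show "(\<lambda>k\<in>{..<m}. - x k) \<oplus>\<^bsub>Fm\<^esub> x = \<zero>\<^bsub>Fm\<^esub>"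
      unfolding Fm_simps by (rule restrict_ext) simp
  qed
next
  fix x y w
  show "x \<oplus>\<^bsub>Fm\<^esub> y = y \<oplus>\<^bsub>Fm\<^esub> x" unfolding Fm_simps by (rule restrict_ext) (rule add.commute)
  show "x \<oplus>\<^bsub>Fm\<^esub> y \<oplus>\<^bsub>Fm\<^esub> w = x \<oplus>\<^bsub>Fm\<^esub> (y \<oplus>\<^bsub>Fm\<^esub> w)"
    unfolding Fm_simps by (rule restrict_ext) (simp add: add.assoc)
qed (rule Fm_closed; assumption)+

lemma Fm_neg: "x \<in> carrier Fm \<Longrightarrow> \<ominus>\<^bsub>Fm\<^esub> x = poly_const (-1) \<odot>\<^bsub>Fm\<^esub> x"
proof (rule abelian_group.minus_equality[OF Fm_abelian_group])
  have "poly_const (-1) * p + p = 0" for p :: mpoly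
    by (rule poly_mapping_eqI) (simp add: lookup_add lookup_poly_const_mult)
  then show "poly_const (-1) \<odot>\<^bsub>Fm\<^esub> x \<oplus>\<^bsub>Fm\<^esub> x = \<zero>\<^bsub>Fm\<^esub>" if "x \<in> carrier Fm"
    by (auto simp: Fm_simps intro!: restrict_ext)
qed (auto simp: Fm_closed(2))

lemma submodule_FmI:
  assumes "N \<subseteq> carrier Fm" "zero Fm \<in> N" "\<And>x y. x \<in> N \<Longrightarrow> y \<in> N \<Longrightarrow> x \<oplus>\<^bsub>Fm\<^esub> y \<in> N"
    "\<And>r x. r \<in> carrier P \<Longrightarrow> x \<in> N \<Longrightarrow> r \<odot>\<^bsub>Fm\<^esub> x \<in> N"
  shows "submodule N P Fm"
proof (intro submodule.intro subgroup.intro submodule_axioms.intro)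
  fix x assume x: "x \<in> N"
  have "\<ominus>\<^bsub>Fm\<^esub> x = poly_const (-1) \<odot>\<^bsub>Fm\<^esub> x" by (rule Fm_neg) (use x assms(1) in blast)
  then have eq: "inv\<^bsub>add_monoid Fm\<^esub> x = poly_const (-1) \<odot>\<^bsub>Fm\<^esub> x" unfolding a_inv_def .
  show "inv\<^bsub>add_monoid Fm\<^esub> x \<in> N" unfolding eq by (rule assms(4)[OF poly_const_closed x])
qed (use assms in auto)

definition koszul_gens :: "(nat \<Rightarrow> mpoly) set" where
  "koszul_gens = {(\<lambda>k\<in>{..<m}. j f * e k - j e * f k) | e f. e \<in> carrier Fm \<and> f \<in> carrier Fm}"

lemma Kos_eq: "Kos = \<Inter>{N. submodule N P Fm \<and> koszul_gens \<subseteq> N}"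
proof -
  have "(j f \<odot>\<^bsub>Fm\<^esub> e) \<ominus>\<^bsub>Fm\<^esub> (j e \<odot>\<^bsub>Fm\<^esub> f) = (\<lambda>k\<in>{..<m}. j f * e k - j e * f k)"
    if "e \<in> carrier Fm" "f \<in> carrier Fm" for e f
  proof -
    have "j e \<odot>\<^bsub>Fm\<^esub> f \<in> carrier Fm" using Fm_closed(2)[OF j_props(1)] that by blast
    then have "(j f \<odot>\<^bsub>Fm\<^esub> e) \<ominus>\<^bsub>Fm\<^esub> (j e \<odot>\<^bsub>Fm\<^esub> f) = (j f \<odot>\<^bsub>Fm\<^esub> e) \<oplus>\<^bsub>Fm\<^esub> (poly_const (-1) \<odot>\<^bsub>Fm\<^esub> (j e \<odot>\<^bsub>Fm\<^esub> f))"
      by (simp add: a_minus_def Fm_neg)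
    also have "\<dots> = (\<lambda>k\<in>{..<m}. j f * e k - j e * f k)"
    proof -
      have "p + poly_const (-1) * q = p - q" for p q :: mpoly
        by (rule poly_mapping_eqI) (simp add: lookup_add lookup_minus lookup_poly_const_mult)
      then show ?thesis by (auto simp: Fm_simps intro!: restrict_ext)
    qed
    finally show ?thesis .
  qed
  then have "{(j f \<odot>\<^bsub>Fm\<^esub> e) \<ominus>\<^bsub>Fm\<^esub> (j e \<odot>\<^bsub>Fm\<^esub> f) | e f. e \<in> carrier Fm \<and> f \<in> carrier Fm} = koszul_gens"
    unfolding koszul_gens_def by (intro Collect_cong) (metis (no_types, lifting))
  then show ?thesis unfolding koszul_rels_def span_module_def Let_def by simp
qed

lemma Rel_iff: "x \<in> Rel \<longleftrightarrow> x \<in> carrier Fm \<and> j x = 0"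
  by (simp add: rel_carrier_def)

lemma Rel_closed:
  "x \<in> Rel \<Longrightarrow> y \<in> Rel \<Longrightarrow> x \<oplus>\<^bsub>Fm\<^esub> y \<in> Rel" "r \<in> carrier P \<Longrightarrow> x \<in> Rel \<Longrightarrow> r \<odot>\<^bsub>Fm\<^esub> x \<in> Rel"
  "zero Fm \<in> Rel" "x \<in> Rel \<Longrightarrow> x \<in> carrier Fm"
  by (simp_all add: Rel_iff Fm_closed(1-3) j_props(3,4) j_zero)

lemma Rel_submodule: "submodule Rel P Fm"
  by (rule submodule_FmI) (use Rel_closed in blast)+

lemma koszul_gens_Rel: "koszul_gens \<subseteq> Rel"
proof
  fix x assume "x \<in> koszul_gens"
  then obtain e f where ef: "e \<in> carrier Fm" "f \<in> carrier Fm" "x = (\<lambda>k\<in>{..<m}. j f * e k - j e * f k)"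
    unfolding koszul_gens_def by blast
  have c: "x \<in> carrier Fm"
    unfolding ef(3) using Fm_closed(4) ef(1,2) j_props(1) by (auto simp: Fm_simps(1) PiE_def)
  have "j x = (\<Sum>k<m. j f * (gen k * e k) - j e * (gen k * f k))"
    unfolding j_eq[OF c] by (rule sum.cong) (auto simp: ef(3) algebra_simps)
  also have "\<dots> = j f * j e - j e * j f"
    unfolding sum_subtractf sum_distrib_left[symmetric] j_eq[OF ef(1), symmetric] j_eq[OF ef(2), symmetric] ..
  finally show "x \<in> Rel" using c by (simp add: Rel_iff)
qed

lemma Kos_least: "submodule N P Fm \<Longrightarrow> koszul_gens \<subseteq> N \<Longrightarrow> Kos \<subseteq> N"
  unfolding Kos_eq by blast

lemma Kos_Rel: "Kos \<subseteq> Rel"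
  by (rule Kos_least[OF Rel_submodule koszul_gens_Rel])

lemma Kos_gens: "koszul_gens \<subseteq> Kos"
  unfolding Kos_eq by blast

lemma Kos_iff: "x \<in> Kos \<longleftrightarrow> (\<forall>N. submodule N P Fm \<longrightarrow> koszul_gens \<subseteq> N \<longrightarrow> x \<in> N)"
  unfolding Kos_eq Inter_iff Ball_def mem_Collect_eq imp_conjL by (rule refl)

lemma Kos_closed:
  "x \<in> Kos \<Longrightarrow> y \<in> Kos \<Longrightarrow> x \<oplus>\<^bsub>Fm\<^esub> y \<in> Kos" "r \<in> carrier P \<Longrightarrow> x \<in> Kos \<Longrightarrow> r \<odot>\<^bsub>Fm\<^esub> x \<in> Kos" "zero Fm \<in> Kos"
proof -
  have sub: "subgroup N (add_monoid Fm)" if "submodule N P Fm" for N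
    using that unfolding submodule_def by (rule conjunct1)
  have mem: "x \<in> N" if "x \<in> Kos" "submodule N P Fm" "koszul_gens \<subseteq> N" for x N
    using that(1)[unfolded Kos_iff] that(2,3) by simp
  show "x \<oplus>\<^bsub>Fm\<^esub> y \<in> Kos" if xy: "x \<in> Kos" "y \<in> Kos"
    unfolding Kos_iff
  proof (intro allI impI)
    fix N assume N: "submodule N P Fm" "koszul_gens \<subseteq> N"
    show "x \<oplus>\<^bsub>Fm\<^esub> y \<in> N"
      using subgroup.m_closed[OF sub[OF N(1)] mem[OF xy(1) N] mem[OF xy(2) N]] by simp
  qed
  show "r \<odot>\<^bsub>Fm\<^esub> x \<in> Kos" if r: "r \<in> carrier P" and x: "x \<in> Kos"
    unfolding Kos_iff
  proof (intro allI impI)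
    fix N assume N: "submodule N P Fm" "koszul_gens \<subseteq> N"
    show "r \<odot>\<^bsub>Fm\<^esub> x \<in> N" by (rule submodule.smult_closed[OF N(1) r mem[OF x N]])
  qed
  show "zero Fm \<in> Kos"
    unfolding Kos_iff
  proof (intro allI impI)
    fix N assume N: "submodule N P Fm" "koszul_gens \<subseteq> N"
    show "zero Fm \<in> N" using subgroup.one_closed[OF sub[OF N(1)]] by simp
  qed
qed

lemma RM_abelian_group: "abelian_group RM"
proof (rule abelian_groupI)
  fix x assume x: "x \<in> carrier RM"
  interpret F: abelian_group Fm by (rule Fm_abelian_group)
  have xc: "x \<in> carrier Fm" using x by (simp add: RM_simps Rel_iff)
  show "\<zero>\<^bsub>RM\<^esub> \<oplus>\<^bsub>RM\<^esub> x = x" using F.l_zero[OF xc] by (simp only: RM_simps)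
  have "poly_const (-1) \<odot>\<^bsub>Fm\<^esub> x \<oplus>\<^bsub>Fm\<^esub> x = \<zero>\<^bsub>Fm\<^esub>" using F.l_neg[OF xc] Fm_neg[OF xc] by simp
  then show "\<exists>y\<in>carrier RM. y \<oplus>\<^bsub>RM\<^esub> x = \<zero>\<^bsub>RM\<^esub>"
    using x Rel_closed(2) by (intro bexI[of _ "poly_const (-1) \<odot>\<^bsub>Fm\<^esub> x"]) (simp_all only: RM_simps poly_const_closed)
next
  interpret F: abelian_group Fm by (rule Fm_abelian_group)
  show "\<zero>\<^bsub>RM\<^esub> \<in> carrier RM" using Rel_closed(3) by (simp only: RM_simps)
  fix x y assume xy: "x \<in> carrier RM" "y \<in> carrier RM"
  then show "x \<oplus>\<^bsub>RM\<^esub> y \<in> carrier RM" using Rel_closed(1) by (simp only: RM_simps)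
  have c: "x \<in> carrier Fm" "y \<in> carrier Fm" using xy by (simp_all add: RM_simps Rel_iff)
  show "x \<oplus>\<^bsub>RM\<^esub> y = y \<oplus>\<^bsub>RM\<^esub> x" unfolding RM_simps using F.a_comm[OF c] .
  fix w assume "w \<in> carrier RM"
  then have "w \<in> carrier Fm" by (simp add: RM_simps Rel_iff)
  then show "x \<oplus>\<^bsub>RM\<^esub> y \<oplus>\<^bsub>RM\<^esub> w = x \<oplus>\<^bsub>RM\<^esub> (y \<oplus>\<^bsub>RM\<^esub> w)" unfolding RM_simps using F.a_assoc[OF c] by blast
qed

lemma Kos_subgroup: "additive_subgroup Kos RM"
proof (intro additive_subgroup.intro subgroup.intro)
  show "Kos \<subseteq> carrier (add_monoid RM)" using Kos_Rel by (simp add: RM_simps)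
  fix x assume x: "x \<in> Kos"
  then have xR: "x \<in> Rel" using Kos_Rel by blast
  interpret F: abelian_group Fm by (rule Fm_abelian_group)
  have xc: "x \<in> carrier Fm" using Rel_closed(4)[OF xR] .
  have "\<ominus>\<^bsub>RM\<^esub> x = poly_const (-1) \<odot>\<^bsub>Fm\<^esub> x"
  proof (rule abelian_group.minus_equality[OF RM_abelian_group])
    show "poly_const (-1) \<odot>\<^bsub>Fm\<^esub> x \<oplus>\<^bsub>RM\<^esub> x = \<zero>\<^bsub>RM\<^esub>"
      using F.l_neg[OF xc] Fm_neg[OF xc] by (simp add: RM_simps(2,3))
  qed (use xR Rel_closed(2) in \<open>simp_all only: RM_simps poly_const_closed\<close>)
  then show "inv\<^bsub>add_monoid RM\<^esub> x \<in> Kos" using Kos_closed(2)[OF poly_const_closed x] by (simp add: a_inv_def)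
qed (use Kos_closed in \<open>simp_all add: RM_simps\<close>)

definition rc :: "(nat \<Rightarrow> mpoly) \<Rightarrow> (nat \<Rightarrow> mpoly) set" where "rc r = Kos +>\<^bsub>RM\<^esub> r"

lemma rc_eqD:
  assumes "r \<in> Rel" "s \<in> Rel" "rc r = rc s"
  shows "\<exists>d\<in>Kos. r = d \<oplus>\<^bsub>Fm\<^esub> s"
proof -
  interpret abelian_subgroup Kos RM using RM_abelian_group Kos_subgroup by (meson abelian_subgroupI3)
  have "r \<in> rc s" using a_rcos_self[of r] assms by (simp add: rc_def RM_simps)
  then show ?thesis by (auto simp: rc_def a_r_coset_def' RM_simps)
qed

lemma rc_eqI:
  assumes "s \<in> Rel" "d \<in> Kos"
  shows "rc (d \<oplus>\<^bsub>Fm\<^esub> s) = rc s"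
proof -
  interpret abelian_subgroup Kos RM using RM_abelian_group Kos_subgroup by (meson abelian_subgroupI3)
  have "d \<oplus>\<^bsub>Fm\<^esub> s \<in> rc s" using assms(2) by (auto simp: rc_def a_r_coset_def' RM_simps)
  then show ?thesis using a_repr_independence'[of "d \<oplus>\<^bsub>Fm\<^esub> s" s] assms(1) by (simp add: rc_def RM_simps)
qed

lemma RQ_carrier: "carrier RQ = rc ` Rel"
  by (auto simp: rel_quot_def factor_scalars_def quot_module_def A_RCOSETS_def' rc_def RM_simps)

lemma RQ_add: "r \<in> Rel \<Longrightarrow> s \<in> Rel \<Longrightarrow> rc r \<oplus>\<^bsub>RQ\<^esub> rc s = rc (r \<oplus>\<^bsub>Fm\<^esub> s)"
proof -
  assume rs: "r \<in> Rel" "s \<in> Rel"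
  interpret abelian_subgroup Kos RM using RM_abelian_group Kos_subgroup by (meson abelian_subgroupI3)
  show ?thesis using a_rcos_sum[of r s] rs
    by (simp add: rel_quot_def factor_scalars_def quot_module_def rc_def RM_simps)
qed

lemma Fm_distr:
  "r \<odot>\<^bsub>Fm\<^esub> (x \<oplus>\<^bsub>Fm\<^esub> y) = (r \<odot>\<^bsub>Fm\<^esub> x) \<oplus>\<^bsub>Fm\<^esub> (r \<odot>\<^bsub>Fm\<^esub> y)"
  "(p + q) \<odot>\<^bsub>Fm\<^esub> x = (p \<odot>\<^bsub>Fm\<^esub> x) \<oplus>\<^bsub>Fm\<^esub> (q \<odot>\<^bsub>Fm\<^esub> x)"
  by (auto simp: Fm_simps algebra_simps intro!: restrict_ext)

text \<open>For \<open>i = j f\<close> the product \<open>i r\<close> is the Koszul relation \<open>j f r - j r f\<close>, as \<open>j r = 0\<close>.\<close>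

lemma I_smult_Rel: "i \<in> I \<Longrightarrow> r \<in> Rel \<Longrightarrow> i \<odot>\<^bsub>Fm\<^esub> r \<in> Kos"
proof -
  assume i: "i \<in> I" and r: "r \<in> Rel"
  obtain f where f: "f \<in> carrier Fm" "i = j f" using j_props(5)[OF i] by blast
  have "i \<odot>\<^bsub>Fm\<^esub> r = (\<lambda>k\<in>{..<m}. j f * r k - j r * f k)"
    using r f(2) by (auto simp: Fm_simps Rel_iff intro!: restrict_ext)
  then have "i \<odot>\<^bsub>Fm\<^esub> r \<in> koszul_gens" using f(1) Rel_closed(4)[OF r] unfolding koszul_gens_def by blast
  then show ?thesis using Kos_gens by blast
qed

lemma RQ_smult: "p \<in> carrier P \<Longrightarrow> r \<in> Rel \<Longrightarrow> cl p \<odot>\<^bsub>RQ\<^esub> rc r = rc (p \<odot>\<^bsub>Fm\<^esub> r)"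
proof -
  assume p: "p \<in> carrier P" and r: "r \<in> Rel"
  let ?QM = "quot_module RM Kos"
  have sm: "q \<odot>\<^bsub>?QM\<^esub> rc r = rc (q \<odot>\<^bsub>Fm\<^esub> r)" if q: "q \<in> carrier P" for q
  proof -
    have "(\<Union>y\<in>Kos +>\<^bsub>RM\<^esub> r. Kos +>\<^bsub>RM\<^esub> (q \<odot>\<^bsub>Fm\<^esub> y)) = Kos +>\<^bsub>RM\<^esub> (q \<odot>\<^bsub>Fm\<^esub> r)"
      by (rule coset_smult[OF RM_abelian_group Kos_subgroup])
        (use r q Fm_distr(1) Rel_closed(2) Kos_closed(2) in \<open>simp_all only: RM_simps\<close>)
    then show ?thesis by (simp add: quot_module_def rc_def RM_simps)
  qed
  have "(\<lambda>q. q \<odot>\<^bsub>?QM\<^esub> rc r) ` cl p = {rc (p \<odot>\<^bsub>Fm\<^esub> r)}"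
  proof -
    have "q \<odot>\<^bsub>?QM\<^esub> rc r = rc (p \<odot>\<^bsub>Fm\<^esub> r)" if q: "q \<in> cl p" for q
    proof -
      obtain i where i: "i \<in> I" "q = i + p" using q by (auto simp: a_r_coset_def')
      then have qc: "q \<in> carrier P" using p I_carrier by simp
      have "rc (q \<odot>\<^bsub>Fm\<^esub> r) = rc (p \<odot>\<^bsub>Fm\<^esub> r)"
        unfolding i(2) Fm_distr(2) by (rule rc_eqI[OF Rel_closed(2)[OF p r] I_smult_Rel[OF i(1) r]])
      then show ?thesis using sm[OF qc] by simp
    qed
    moreover have "p \<in> cl p" using II.a_rcos_self[of p] p by simp
    ultimately show ?thesis by blast
  qed
  then show ?thesis by (simp add: rel_quot_def factor_scalars_def)
qed

lemma RA_simps: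
  "carrier RA = carrier A" "add RA = add A" "zero RA = zero A" "smult RA = mult A"
  by (simp_all add: regular_module_def)

lemma RA_abelian_group: "abelian_group RA"
proof (rule abelian_groupI)
  fix C assume "C \<in> carrier RA"
  then show "\<exists>E\<in>carrier RA. E \<oplus>\<^bsub>RA\<^esub> C = \<zero>\<^bsub>RA\<^esub>"
    by (intro bexI[of _ "\<ominus>\<^bsub>A\<^esub> C"]) (auto simp: RA_simps AA.l_neg)
qed (auto simp: RA_simps AA.a_ac)

lemma RA_neg: "C \<in> carrier A \<Longrightarrow> \<ominus>\<^bsub>RA\<^esub> C = \<ominus>\<^bsub>A\<^esub> C"
  by (rule abelian_group.minus_equality[OF RA_abelian_group]) (auto simp: RA_simps AA.l_neg)

lemma hom_target_RQ: "hom_target A RQ RA"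
proof (rule hom_target.intro)
  show "abelian_group RA" by (rule RA_abelian_group)
  show "x \<oplus>\<^bsub>RQ\<^esub> y \<in> carrier RQ" if "x \<in> carrier RQ" "y \<in> carrier RQ" for x y
    using that RQ_add Rel_closed(1) unfolding RQ_carrier by force
  show "C \<odot>\<^bsub>RQ\<^esub> x \<in> carrier RQ" if "C \<in> carrier A" "x \<in> carrier RQ" for C x
    using that RQ_smult Rel_closed(2) unfolding RQ_carrier A_carrier by force
qed (auto simp: RA_simps AA.r_distr AA.m_lcomm)

interpretation H2: hom_target A RQ RA by (rule hom_target_RQ)

abbreviation HA where "HA \<equiv> mod_hom A RQ RA"
abbreviation Hom2 where "Hom2 \<equiv> rel_hom_module n I m j"

lemma Hom2_eq: "Hom2 = hom_module A RQ RA"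
  by (simp add: rel_hom_module_def)

lemma eta:
  assumes H: "H \<in> HA"
  shows "r \<in> Rel \<Longrightarrow> H (rc r) \<in> carrier A"
    "r \<in> Rel \<Longrightarrow> s \<in> Rel \<Longrightarrow> H (rc (r \<oplus>\<^bsub>Fm\<^esub> s)) = H (rc r) \<oplus>\<^bsub>A\<^esub> H (rc s)"
    "p \<in> carrier P \<Longrightarrow> r \<in> Rel \<Longrightarrow> H (rc (p \<odot>\<^bsub>Fm\<^esub> r)) = cl p \<otimes>\<^bsub>A\<^esub> H (rc r)"
    "d \<in> Kos \<Longrightarrow> H (rc d) = I"
proof -
  note h = mod_homD[OF H]
  show v: "r \<in> Rel \<Longrightarrow> H (rc r) \<in> carrier A" for r using h(1)[of "rc r"] by (auto simp: RQ_carrier RA_simps)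
  show "r \<in> Rel \<Longrightarrow> s \<in> Rel \<Longrightarrow> H (rc (r \<oplus>\<^bsub>Fm\<^esub> s)) = H (rc r) \<oplus>\<^bsub>A\<^esub> H (rc s)"
    using h(3)[of "rc r" "rc s"] by (simp add: RQ_carrier RQ_add RA_simps)
  show sm: "p \<in> carrier P \<Longrightarrow> r \<in> Rel \<Longrightarrow> H (rc (p \<odot>\<^bsub>Fm\<^esub> r)) = cl p \<otimes>\<^bsub>A\<^esub> H (rc r)" for p r
    using h(4)[of "cl p" "rc r"] by (simp add: RQ_carrier RQ_smult RA_simps)
  assume d: "d \<in> Kos"
  interpret F: abelian_group Fm by (rule Fm_abelian_group)
  have dc: "d \<in> carrier Fm" using d Kos_Rel Rel_closed(4) by blast
  have "rc d = rc (zero Fm)" using rc_eqI[OF Rel_closed(3) d] F.r_zero[OF dc] by simp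
  also have "zero Fm = 0 \<odot>\<^bsub>Fm\<^esub> zero Fm" by (auto simp: Fm_simps intro!: restrict_ext)
  finally have "H (rc d) = H (rc (0 \<odot>\<^bsub>Fm\<^esub> zero Fm))" by simp
  also have "\<dots> = cl 0 \<otimes>\<^bsub>A\<^esub> H (rc (zero Fm))" by (rule sm[OF _ Rel_closed(3)]) simp
  also have "\<dots> = I" unfolding A_zero'[symmetric] using v[OF Rel_closed(3)] by (rule AA.l_null[unfolded A_zero])
  finally show "H (rc d) = I" .
qed

lemma HA_eqI:
  assumes "H \<in> HA" "G \<in> HA" "\<And>r. r \<in> Rel \<Longrightarrow> H (rc r) = G (rc r)"
  shows "H = G"
proof
  fix x show "H x = G x"
  proof (cases "x \<in> carrier RQ")
    case True
    then show ?thesis using assms(3) by (auto simp: RQ_carrier)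
  next
    case False
    then show ?thesis using mod_homD(2)[OF assms(1)] mod_homD(2)[OF assms(2)] by (simp add: extensional_def)
  qed
qed

lemma HA_I:
  assumes val: "\<And>r. r \<in> Rel \<Longrightarrow> H (rc r) = \<psi> r" and ext: "H \<in> extensional (carrier RQ)"
    and \<psi>: "\<And>r. r \<in> Rel \<Longrightarrow> \<psi> r \<in> carrier A"
      "\<And>r s. r \<in> Rel \<Longrightarrow> s \<in> Rel \<Longrightarrow> \<psi> (r \<oplus>\<^bsub>Fm\<^esub> s) = \<psi> r \<oplus>\<^bsub>A\<^esub> \<psi> s"
      "\<And>p r. p \<in> carrier P \<Longrightarrow> r \<in> Rel \<Longrightarrow> \<psi> (p \<odot>\<^bsub>Fm\<^esub> r) = cl p \<otimes>\<^bsub>A\<^esub> \<psi> r"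
  shows "H \<in> HA"
proof (rule mod_homI[OF _ ext])
  show "H x \<in> carrier RA" if "x \<in> carrier RQ" for x using that val \<psi>(1) by (auto simp: RQ_carrier RA_simps)
  fix x assume "x \<in> carrier RQ"
  then obtain r where r: "r \<in> Rel" "x = rc r" by (auto simp: RQ_carrier)
  show "H (x \<oplus>\<^bsub>RQ\<^esub> y) = H x \<oplus>\<^bsub>RA\<^esub> H y" if y: "y \<in> carrier RQ" for y
  proof -
    obtain s where s: "s \<in> Rel" "y = rc s" using y by (auto simp: RQ_carrier)
    show ?thesis using r s val \<psi>(2) Rel_closed(1) by (simp add: RQ_add RA_simps)
  qed
  show "H (C \<odot>\<^bsub>RQ\<^esub> x) = C \<odot>\<^bsub>RA\<^esub> H x" if C: "C \<in> carrier A" for C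
  proof -
    obtain p where p: "p \<in> carrier P" "C = cl p" using C by (auto simp: A_carrier)
    show ?thesis using r p val \<psi>(3) Rel_closed(2) by (simp add: RQ_smult RA_simps)
  qed
qed

text \<open>The representative is arbitrary; \<open>\<psi>\<close> is meant to vanish on the Koszul relations.\<close>

definition descend :: "((nat \<Rightarrow> mpoly) \<Rightarrow> mpoly set) \<Rightarrow> (nat \<Rightarrow> mpoly) set \<Rightarrow> mpoly set" where
  "descend \<psi> = (\<lambda>x\<in>carrier RQ. \<psi> (SOME r. r \<in> Rel \<and> x = rc r))"

lemma descend:
  assumes \<psi>: "\<And>r. r \<in> Rel \<Longrightarrow> \<psi> r \<in> carrier A"
      "\<And>r s. r \<in> Rel \<Longrightarrow> s \<in> Rel \<Longrightarrow> \<psi> (r \<oplus>\<^bsub>Fm\<^esub> s) = \<psi> r \<oplus>\<^bsub>A\<^esub> \<psi> s"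
      "\<And>p r. p \<in> carrier P \<Longrightarrow> r \<in> Rel \<Longrightarrow> \<psi> (p \<odot>\<^bsub>Fm\<^esub> r) = cl p \<otimes>\<^bsub>A\<^esub> \<psi> r"
      "\<And>d. d \<in> Kos \<Longrightarrow> \<psi> d = I"
  shows "descend \<psi> \<in> HA" and "r \<in> Rel \<Longrightarrow> descend \<psi> (rc r) = \<psi> r"
proof -
  have val: "descend \<psi> (rc r) = \<psi> r" if r: "r \<in> Rel" for r
  proof -
    let ?s = "SOME s. s \<in> Rel \<and> rc r = rc s"
    have s: "?s \<in> Rel \<and> rc r = rc ?s" by (rule someI[of _ r]) (use r in simp)
    then obtain d where d: "d \<in> Kos" "r = d \<oplus>\<^bsub>Fm\<^esub> ?s" using rc_eqD[OF r, of ?s] by blast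
    have "\<psi> r = \<psi> d \<oplus>\<^bsub>A\<^esub> \<psi> ?s" using \<psi>(2)[of d ?s] d Kos_Rel s by auto
    also have "\<dots> = \<psi> ?s" unfolding \<psi>(4)[OF d(1)] using AA.l_zero[unfolded A_zero, OF \<psi>(1)[of ?s]] s by blast
    finally show ?thesis using r by (simp add: descend_def RQ_carrier)
  qed
  then show "r \<in> Rel \<Longrightarrow> descend \<psi> (rc r) = \<psi> r" .
  show "descend \<psi> \<in> HA"
    by (rule HA_I[of _ \<psi>, OF val _ \<psi>(1-3)]) (assumption | simp only: descend_def restrict_extensional)+
qed

text \<open>The value of \<open>\<phi>\<close> on \<open>j f e - j e f\<close> is a combination of elements of \<open>A\<close> with coefficients in the ideal, and
  the ideal annihilates \<open>A\<close>.\<close>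

lemma free_hom_Kos:
  assumes \<phi>: "\<phi> \<in> mod_hom P Fm NA" and d: "d \<in> Kos"
  shows "\<phi> d = I"
proof -
  note h = mod_homD[OF \<phi>]
  have v: "\<phi> x \<in> carrier A" if "x \<in> carrier Fm" for x using h(1)[OF that] by (simp add: NA_simps)
  have sm: "\<phi> (r \<odot>\<^bsub>Fm\<^esub> x) = cl r \<otimes>\<^bsub>A\<^esub> \<phi> x" if "r \<in> carrier P" "x \<in> carrier Fm" for r x
    using h(4)[OF that] by (simp add: NA_simps)
  have ad: "\<phi> (x \<oplus>\<^bsub>Fm\<^esub> y) = \<phi> x \<oplus>\<^bsub>A\<^esub> \<phi> y" if "x \<in> carrier Fm" "y \<in> carrier Fm" for x y
    using h(3)[OF that] by (simp add: NA_simps)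
  have II0: "I \<oplus>\<^bsub>A\<^esub> I = I" using AA.l_zero[OF AA.zero_closed] by (simp add: A_zero)
  have rI: "cl r \<otimes>\<^bsub>A\<^esub> I = I" if "r \<in> carrier P" for r using AA.r_null[OF cl_in_A[OF that]] by (simp add: A_zero)
  have Iz: "cl i \<otimes>\<^bsub>A\<^esub> \<phi> x = I" if "i \<in> I" "x \<in> carrier Fm" for i x
  proof -
    have "cl i = I" by (rule II.a_rcos_const[OF that(1)])
    then show ?thesis using AA.l_null[OF v[OF that(2)]] by (simp add: A_zero)
  qed
  have "submodule {x \<in> carrier Fm. \<phi> x = I} P Fm"
  proof (rule submodule_FmI)
    have "\<phi> (0 \<odot>\<^bsub>Fm\<^esub> zero Fm) = I"
      using sm[OF _ Fm_closed(3), of 0] Iz[OF I_zero Fm_closed(3)] by simp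
    moreover have "0 \<odot>\<^bsub>Fm\<^esub> zero Fm = zero Fm" by (auto simp: Fm_simps intro!: restrict_ext)
    ultimately show "zero Fm \<in> {x \<in> carrier Fm. \<phi> x = I}" using Fm_closed(3) by simp
  qed (use Fm_closed(1,2) ad sm II0 rI in auto)
  moreover have "koszul_gens \<subseteq> {x \<in> carrier Fm. \<phi> x = I}"
  proof
    fix x assume x: "x \<in> koszul_gens"
    then obtain e f where ef: "e \<in> carrier Fm" "f \<in> carrier Fm" "x = (\<lambda>k\<in>{..<m}. j f * e k - j e * f k)"
      unfolding koszul_gens_def by blast
    have jI: "j f \<in> I" "- j e \<in> I" "j f \<in> carrier P" "- j e \<in> carrier P"
      using j_props(1,2) ef(1,2) by (simp_all add: I_iff)
    have "x = (j f \<odot>\<^bsub>Fm\<^esub> e) \<oplus>\<^bsub>Fm\<^esub> (- j e \<odot>\<^bsub>Fm\<^esub> f)"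
      unfolding ef(3) by (auto simp: Fm_simps intro!: restrict_ext)
    then have "\<phi> x = cl (j f) \<otimes>\<^bsub>A\<^esub> \<phi> e \<oplus>\<^bsub>A\<^esub> cl (- j e) \<otimes>\<^bsub>A\<^esub> \<phi> f"
      using ad sm jI ef(1,2) Fm_closed(2) by simp
    then have "\<phi> x = I" using Iz[OF jI(1) ef(1)] Iz[OF jI(2) ef(2)] II0 by simp
    then show "x \<in> {x \<in> carrier Fm. \<phi> x = I}" using koszul_gens_Rel x Rel_closed(4) by blast
  qed
  ultimately have "Kos \<subseteq> {x \<in> carrier Fm. \<phi> x = I}" by (rule Kos_least)
  then show ?thesis using d by blast
qed

abbreviation N2 where "N2 \<equiv> rel_hom_image n I m j"

lemma N2_iff: "H \<in> N2 \<longleftrightarrow> H \<in> HA \<and> (\<exists>\<phi>\<in>mod_hom P Fm NA. \<forall>r\<in>Rel. H (rc r) = \<phi> r)"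
proof -
  define T where "T \<phi> = (\<lambda>x\<in>carrier RQ. the_elem (\<phi> ` x))" for \<phi> :: "(nat \<Rightarrow> mpoly) \<Rightarrow> mpoly set"
  have T: "T \<phi> \<in> HA" "\<forall>r\<in>Rel. T \<phi> (rc r) = \<phi> r" if \<phi>: "\<phi> \<in> mod_hom P Fm NA" for \<phi>
  proof -
    note h = mod_homD[OF \<phi>]
    have v: "\<phi> x \<in> carrier A" if "x \<in> Rel" for x using h(1) Rel_closed(4)[OF that] by (simp add: NA_simps)
    have val: "T \<phi> (rc r) = \<phi> r" if r: "r \<in> Rel" for r
    proof -
      have "\<phi> x = \<phi> r" if x: "x \<in> rc r" for x
      proof -
        obtain d where d: "d \<in> Kos" "x = d \<oplus>\<^bsub>Fm\<^esub> r" using x by (auto simp: rc_def a_r_coset_def' RM_simps)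
        have "\<phi> x = \<phi> d \<oplus>\<^bsub>A\<^esub> \<phi> r"
          unfolding d(2) using h(3) d(1) Kos_Rel r Rel_closed(4) by (simp add: NA_simps subset_iff)
        then show ?thesis unfolding free_hom_Kos[OF \<phi> d(1)] using AA.l_zero[unfolded A_zero, OF v[OF r]] by simp
      qed
      moreover have "rc r \<noteq> {}"
      proof -
        interpret abelian_subgroup Kos RM using RM_abelian_group Kos_subgroup by (meson abelian_subgroupI3)
        show ?thesis using a_rcos_self[of r] r by (auto simp: rc_def RM_simps)
      qed
      ultimately have "\<phi> ` rc r = {\<phi> r}" by blast
      then show ?thesis using r by (simp add: T_def RQ_carrier)
    qed
    then show "\<forall>r\<in>Rel. T \<phi> (rc r) = \<phi> r" by blast
    have ext: "T \<phi> \<in> extensional (carrier RQ)" unfolding T_def by (rule restrict_extensional)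
    show "T \<phi> \<in> HA"
      by (rule HA_I[of _ \<phi>, OF val ext]) (use v h(3,4) Rel_closed(4) in \<open>simp_all add: NA_simps\<close>)
  qed
  have N2: "N2 = T ` mod_hom P Fm NA" unfolding rel_hom_image_def T_def ..
  show ?thesis
  proof
    assume "H \<in> N2"
    then show "H \<in> HA \<and> (\<exists>\<phi>\<in>mod_hom P Fm NA. \<forall>r\<in>Rel. H (rc r) = \<phi> r)" using T unfolding N2 by blast
  next
    assume "H \<in> HA \<and> (\<exists>\<phi>\<in>mod_hom P Fm NA. \<forall>r\<in>Rel. H (rc r) = \<phi> r)"
    then obtain \<phi> where \<phi>: "H \<in> HA" "\<phi> \<in> mod_hom P Fm NA" "\<forall>r\<in>Rel. H (rc r) = \<phi> r" by blast
    have "H = T \<phi>" by (rule HA_eqI[OF \<phi>(1) T(1)[OF \<phi>(2)]]) (use \<phi>(3) T(2)[OF \<phi>(2)] in simp)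
    then show "H \<in> N2" unfolding N2 using \<phi>(2) by blast
  qed
qed

lemma free_hom_target: "hom_target P Fm NA"
proof (rule hom_target.intro)
  show "abelian_group NA" by (rule NA_abelian_group)
qed (auto simp: NA_simps AA.r_distr AA.m_lcomm Fm_closed(1,2))

abbreviation Hom2c where
  "Hom2c \<equiv> hom_grading A RQ (quot_grading RM Kos (\<lambda>d. Rel \<inter> free_grading n m Deg d)) RA (quot_ring_grading n I) cdeg"

lemma Hom2c_iff: "H \<in> Hom2c \<longleftrightarrow> H \<in> HA \<and>
    (\<forall>d. \<forall>r\<in>Rel \<inter> free_grading n m Deg d. H (rc r) \<in> quot_ring_grading n I (\<lambda>i. d i + cdeg i))"
  unfolding hom_grading_def quot_grading_def rc_def by (simp add: ball_simps)

lemma Hom2_neg: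
  assumes "H \<in> HA"
  shows "\<ominus>\<^bsub>Hom2\<^esub> H = cl (poly_const (-1)) \<odot>\<^bsub>Hom2\<^esub> H"
  unfolding Hom2_eq H2.hom_neg_eq[OF assms] hom_module_simps
  by (rule restrict_ext) (use mod_homD(1)[OF assms] in \<open>simp add: RA_simps RA_neg A_neg\<close>)

lemma Hom2_ops:
  assumes "r \<in> Rel"
  shows "(H \<oplus>\<^bsub>Hom2\<^esub> G) (rc r) = H (rc r) \<oplus>\<^bsub>A\<^esub> G (rc r)"
    and "(C \<odot>\<^bsub>Hom2\<^esub> H) (rc r) = C \<otimes>\<^bsub>A\<^esub> H (rc r)"
  using assms by (simp_all add: Hom2_eq hom_module_simps RA_simps RQ_carrier)

lemma Hom2_closed:
  assumes "H \<in> HA"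
  shows "G \<in> HA \<Longrightarrow> H \<oplus>\<^bsub>Hom2\<^esub> G \<in> HA" "C \<in> carrier A \<Longrightarrow> C \<odot>\<^bsub>Hom2\<^esub> H \<in> HA"
  using H2.hom_add[OF assms] H2.hom_smult[OF assms] by (simp_all add: Hom2_eq hom_module_simps)

lemma N2_smult:
  assumes H: "H \<in> N2" and p: "p \<in> carrier P"
  shows "cl p \<odot>\<^bsub>Hom2\<^esub> H \<in> N2"
proof -
  obtain \<phi> where \<phi>: "H \<in> HA" "\<phi> \<in> mod_hom P Fm NA" "\<forall>r\<in>Rel. H (rc r) = \<phi> r" using H N2_iff by blast
  interpret FT: hom_target P Fm NA by (rule free_hom_target)
  have "(\<lambda>x\<in>carrier Fm. p \<odot>\<^bsub>NA\<^esub> \<phi> x) \<in> mod_hom P Fm NA" by (rule FT.hom_smult[OF \<phi>(2) p])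
  moreover have "\<forall>r\<in>Rel. (cl p \<odot>\<^bsub>Hom2\<^esub> H) (rc r) = (\<lambda>x\<in>carrier Fm. p \<odot>\<^bsub>NA\<^esub> \<phi> x) r"
    using \<phi>(3) Rel_closed(4) by (simp add: Hom2_ops NA_simps)
  ultimately show ?thesis unfolding N2_iff using Hom2_closed(2)[OF \<phi>(1) cl_in_A[OF p]] by blast
qed

lemma N2_subgroup: "additive_subgroup N2 Hom2"
proof (intro additive_subgroup.intro subgroup.intro)
  interpret FT: hom_target P Fm NA by (rule free_hom_target)
  show "N2 \<subseteq> carrier (add_monoid Hom2)" using N2_iff by (auto simp: Hom2_eq hom_module_simps)
  show "g \<otimes>\<^bsub>add_monoid Hom2\<^esub> h \<in> N2" if "g \<in> N2" "h \<in> N2" for g h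
  proof -
    obtain \<phi> where \<phi>: "g \<in> HA" "\<phi> \<in> mod_hom P Fm NA" "\<forall>r\<in>Rel. g (rc r) = \<phi> r"
      using \<open>g \<in> N2\<close> N2_iff by blast
    obtain \<xi> where \<xi>: "h \<in> HA" "\<xi> \<in> mod_hom P Fm NA" "\<forall>r\<in>Rel. h (rc r) = \<xi> r"
      using \<open>h \<in> N2\<close> N2_iff by blast
    have "\<forall>r\<in>Rel. (g \<oplus>\<^bsub>Hom2\<^esub> h) (rc r) = (\<lambda>x\<in>carrier Fm. \<phi> x \<oplus>\<^bsub>NA\<^esub> \<xi> x) r"
    proof
      fix r assume r: "r \<in> Rel"
      show "(g \<oplus>\<^bsub>Hom2\<^esub> h) (rc r) = (\<lambda>x\<in>carrier Fm. \<phi> x \<oplus>\<^bsub>NA\<^esub> \<xi> x) r"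
        unfolding Hom2_ops(1)[OF r] restrict_apply'[OF Rel_closed(4)[OF r]] bspec[OF \<phi>(3) r] bspec[OF \<xi>(3) r] NA_simps
        by (rule refl)
    qed
    then have "g \<oplus>\<^bsub>Hom2\<^esub> h \<in> N2" unfolding N2_iff
      by (intro conjI bexI[OF _ FT.hom_add[OF \<phi>(2) \<xi>(2)]] Hom2_closed(1)[OF \<phi>(1) \<xi>(1)])
    then show ?thesis by simp
  qed
  have "\<zero>\<^bsub>Hom2\<^esub> \<in> HA" using H2.hom_zero by (simp add: Hom2_eq hom_module_simps)
  moreover have "\<forall>r\<in>Rel. \<zero>\<^bsub>Hom2\<^esub> (rc r) = (\<lambda>x\<in>carrier Fm. \<zero>\<^bsub>NA\<^esub>) r"
    using Rel_closed(4) by (simp add: Hom2_eq hom_module_simps RQ_carrier RA_simps NA_simps)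
  ultimately have "\<zero>\<^bsub>Hom2\<^esub> \<in> N2" unfolding N2_iff by (intro conjI bexI[OF _ FT.hom_zero])
  then show "\<one>\<^bsub>add_monoid Hom2\<^esub> \<in> N2" by simp
  show "inv\<^bsub>add_monoid Hom2\<^esub> g \<in> N2" if g: "g \<in> N2" for g
  proof -
    have "inv\<^bsub>add_monoid Hom2\<^esub> g = cl (poly_const (-1)) \<odot>\<^bsub>Hom2\<^esub> g"
      using Hom2_neg[of g] g N2_iff by (simp add: a_inv_def)
    then show ?thesis using N2_smult[OF g poly_const_closed, of "-1"] by simp
  qed
qed

section \<open>The basic relations\<close>

text \<open>The monomial \<open>x\<^sup>d\<close> is a multiple of the \<open>k\<close>-th generator.\<close>

definition over :: "expo \<Rightarrow> nat \<Rightarrow> bool" where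
  "over d k \<longleftrightarrow> k < m \<and> zc k \<noteq> 0 \<and> below (D k) d"

text \<open>The difference of the two ways of writing \<open>x\<^sup>d\<close> as a multiple of the generators \<open>k\<close> and \<open>l\<close>.\<close>

definition rho :: "expo \<Rightarrow> nat \<Rightarrow> nat \<Rightarrow> nat \<Rightarrow> mpoly" where
  "rho d k l = (\<lambda>i\<in>{..<m}. (if i = k then single (d - D k) (1 / zc k) else 0) -
     (if i = l then single (d - D l) (1 / zc l) else 0))"

definition join :: "expo \<Rightarrow> expo \<Rightarrow> expo" where "join s t = s + (t - s)"

lemma lookup_join: "lookup (join s t) i = max (lookup s i) (lookup t i)"
  by (simp add: join_def lookup_add lookup_minus)

lemma below_join: "below s (join s t)" "below t (join s t)" "below s u \<Longrightarrow> below t u \<Longrightarrow> below (join s t) u"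
  by (auto simp: below_def lookup_join)

lemma add_diff_below: "below s d \<Longrightarrow> e + d - s = e + (d - s)"
proof -
  assume "below s d"
  then have e: "s + (d - s) = d" by (rule below_diff)
  have "s + (e + (d - s)) = e + d" unfolding add.left_commute[of s e] e ..
  then have "e + d = s + (e + (d - s))" by (rule sym)
  then show ?thesis by (simp only: add_diff_cancel_left')
qed

lemma rho_carrier:
  assumes "keys d \<subseteq> {0..n}"
  shows "rho d k l \<in> carrier Fm"
proof -
  have "keys (d - s) \<subseteq> {0..n}" for s using assms keys_diff_nat[of d s] by blast
  then show ?thesis by (auto simp: rho_def Fm_simps(1) PiE_def)
qed

lemma gen_mult_part: "over d k \<Longrightarrow> gen k * single (d - D k) (1 / zc k) = single d 1"
  unfolding over_def by (simp add: gen_monomial(1) mult_single below_diff)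

lemma rho_Rel:
  assumes d: "keys d \<subseteq> {0..n}" and k: "over d k" and l: "over d l"
  shows "rho d k l \<in> Rel"
proof -
  have km: "k < m" "l < m" using k l by (simp_all add: over_def)
  have "j (rho d k l) = (\<Sum>i<m. (if i = k then gen k * single (d - D k) (1 / zc k) else 0) -
      (if i = l then gen l * single (d - D l) (1 / zc l) else 0))"
    unfolding j_eq[OF rho_carrier[OF d]] by (rule sum.cong) (auto simp: rho_def algebra_simps)
  also have "\<dots> = 0" unfolding gen_mult_part[OF k] gen_mult_part[OF l] using km by (simp add: sum_subtractf)
  finally show ?thesis using rho_carrier[OF d] by (simp add: Rel_iff)
qed

lemma poly_grading_diff: "p \<in> poly_grading n d \<Longrightarrow> q \<in> poly_grading n d \<Longrightarrow> p - q \<in> poly_grading n d"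
  using keys_diff_subset[of p q] by (auto simp: poly_grading_def)

lemma rho_free_grading:
  assumes d: "keys d \<subseteq> {0..n}" and k: "over d k" and l: "over d l"
  shows "rho d k l \<in> free_grading n m Deg (\<lambda>i. int (lookup d i))"
  unfolding free_grading_def mem_Collect_eq
proof (intro conjI allI impI rho_carrier[OF d])
  have part: "single (d - D k) x \<in> poly_grading n (\<lambda>i. int (lookup d i) - Deg k i)" if k: "over d k" for k x
    unfolding poly_grading_def mem_Collect_eq
  proof (intro conjI ballI allI impI)
    show "single (d - D k) x \<in> carrier P" using d keys_diff_nat[of d "D k"] by (intro single_closed) blast
    fix t i assume t: "t \<in> keys (single (d - D k) x)" and i: "i \<le> n"
    have "t = d - D k" using t by (simp split: if_splits)
    moreover have "lookup (D k) i \<le> lookup d i" "k < m" "zc k \<noteq> 0" using k by (auto simp: over_def below_def)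
    ultimately show "int (lookup t i) = int (lookup d i) - Deg k i"
      using gen_monomial(4)[of k i] i by (simp add: lookup_minus of_nat_diff)
  qed
  fix i assume i: "i < m"
  have "(if i = k then single (d - D k) (1 / zc k) else 0) \<in> poly_grading n (\<lambda>i'. int (lookup d i') - Deg i i')"
    "(if i = l then single (d - D l) (1 / zc l) else 0) \<in> poly_grading n (\<lambda>i'. int (lookup d i') - Deg i i')"
    using part[OF k] part[OF l] by auto
  from poly_grading_diff[OF this] show "rho d k l i \<in> poly_grading n (\<lambda>i'. int (lookup d i') - Deg i i')"
    using i by (simp add: rho_def)
qed

lemma rho_shift:
  assumes k: "over d k" and l: "over d l"
  shows "rho (e + d) k l = single e 1 \<odot>\<^bsub>Fm\<^esub> rho d k l"
proof -
  have eq: "e + d - D k = e + (d - D k)" "e + d - D l = e + (d - D l)"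
    using k l add_diff_below unfolding over_def by blast+
  show ?thesis
    unfolding Fm_simps rho_def eq
    by (rule restrict_ext) (simp add: right_diff_distrib mult_single if_distrib[of "\<lambda>p. single e 1 * p"])
qed

lemma rho_add: "rho d k l \<oplus>\<^bsub>Fm\<^esub> rho d l q = rho d k q"
  unfolding Fm_simps rho_def by (rule restrict_ext) simp

lemma rho_koszul:
  assumes k: "k < m" "zc k \<noteq> 0" and l: "l < m" "zc l \<noteq> 0"
  shows "rho (D k + D l) k l \<in> Kos"
proof -
  let ?g = "\<lambda>i\<in>{..<m}. j (bas k 1) * bas l 1 i - j (bas l 1) * bas k 1 i"
  have "?g \<in> koszul_gens"
    unfolding koszul_gens_def mem_Collect_eq
    by (intro exI[of _ "bas l 1"] exI[of _ "bas k 1"] conjI refl bas_closed poly_ring_closed)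
  then have "poly_const (- 1 / (zc k * zc l)) \<odot>\<^bsub>Fm\<^esub> ?g \<in> Kos" using Kos_gens Kos_closed(2) poly_const_closed by blast
  moreover have "poly_const (- 1 / (zc k * zc l)) \<odot>\<^bsub>Fm\<^esub> ?g = rho (D k + D l) k l"
    unfolding Fm_simps rho_def
  proof (rule restrict_ext)
    fix i assume "i \<in> {..<m}"
    have c: "poly_const x * single s y = single s (x * y)" for x y s by (simp add: poly_const_def mult_single)
    have g: "j (bas k 1) = single (D k) (zc k)" "j (bas l 1) = single (D l) (zc l)"
      using gen_monomial(1) k(1) l(1) by (simp_all add: gen_def)
    have "poly_const (- 1 / (zc k * zc l)) * (single (D k) (zc k) * bas l 1 i - single (D l) (zc l) * bas k 1 i)
      = (if i = k then single (D l) (1 / zc k) else 0) - (if i = l then single (D k) (1 / zc l) else 0)"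
    proof -
      have 1: "poly_const (- 1 / (zc k * zc l)) * single (D k) (zc k) = - single (D k) (1 / zc l)"
        "poly_const (- 1 / (zc k * zc l)) * single (D l) (zc l) = - single (D l) (1 / zc k)"
        unfolding c using k(2) l(2) by (simp_all add: single_uminus[symmetric] field_simps)
      show ?thesis
        using \<open>i \<in> {..<m}\<close> unfolding right_diff_distrib mult.assoc[symmetric] 1 by (simp add: bas_def)
    qed
    then show "poly_const (- 1 / (zc k * zc l)) * ?g i = (if i = k then single (D k + D l - D k) (1 / zc k) else 0) -
        (if i = l then single (D k + D l - D l) (1 / zc l) else 0)"
      using \<open>i \<in> {..<m}\<close> g by simp
  qed
  ultimately show ?thesis by simp
qed

text \<open>The coefficient at \<open>x\<^sup>t\<close> of the value of \<open>H\<close> on the basic relation.\<close>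

definition sg :: "((nat \<Rightarrow> mpoly) set \<Rightarrow> mpoly set) \<Rightarrow> expo \<Rightarrow> expo \<Rightarrow> nat \<Rightarrow> nat \<Rightarrow> complex" where
  "sg H d t k l = coef (H (rc (rho d k l))) t"

lemma sg_shift:
  assumes H: "H \<in> HA" and d: "keys d \<subseteq> {0..n}" and k: "over d k" and l: "over d l"
    and e: "keys e \<subseteq> {0..n}" and t: "keys t \<in> X"
  shows "sg H (e + d) t k l = (if below e t then sg H d (t - e) k l else 0)"
proof -
  note r = rho_Rel[OF d k l]
  have "H (rc (rho (e + d) k l)) = cl (single e 1) \<otimes>\<^bsub>A\<^esub> H (rc (rho d k l))"
    unfolding rho_shift[OF k l] by (rule eta(3)[OF H single_closed[OF e] r])
  then show ?thesis using coef_single_mult[OF e eta(1)[OF H r] t, of 1] by (simp add: sg_def)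
qed

lemma sg_add:
  assumes H: "H \<in> HA" and d: "keys d \<subseteq> {0..n}" and o: "over d k" "over d l" "over d q" and t: "keys t \<in> X"
  shows "sg H d t k q = sg H d t k l + sg H d t l q"
proof -
  note r = rho_Rel[OF d o(1,2)] rho_Rel[OF d o(2,3)]
  have "H (rc (rho d k q)) = H (rc (rho d k l)) \<oplus>\<^bsub>A\<^esub> H (rc (rho d l q))"
    unfolding rho_add[of d k l q, symmetric] by (rule eta(2)[OF H r])
  then show ?thesis using coef_add[OF eta(1)[OF H r(1)] eta(1)[OF H r(2)] t] by (simp add: sg_def)
qed

lemma Hom2c_HA: "H \<in> Hom2c \<Longrightarrow> H \<in> HA"
  using Hom2c_iff by blast

lemma Hom2c_graded:
  assumes "H \<in> Hom2c" "r \<in> Rel" "r \<in> free_grading n m Deg d"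
  shows "H (rc r) \<in> quot_ring_grading n I (\<lambda>i. d i + cdeg i)"
  by (rule assms(1)[unfolded Hom2c_iff, THEN conjunct2, THEN spec, THEN bspec, OF IntI[OF assms(2,3)]])

lemma sg_degree:
  assumes H: "H \<in> Hom2c" and d: "keys d \<subseteq> {0..n}" and o: "over d k" "over d l" and t: "keys t \<in> X"
    and nz: "sg H d t k l \<noteq> 0"
  shows "t + eb = d + ea"
proof -
  have "H (rc (rho d k l)) \<in> quot_ring_grading n I (\<lambda>i. int (lookup d i) + cdeg i)"
    by (rule Hom2c_graded[OF H rho_Rel[OF d o] rho_free_grading[OF d o]])
  from quot_ring_gradingD(2)[OF this t] nz
  show ?thesis using degree_eq_iff[OF d face_subset[OF t]] unfolding sg_def by blast
qed

text \<open>An exponent that no generator exceeds. Hence \<open>src f\<close> is divisible by every generator that divides some monomial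
  whose shift by \<open>c\<close> has the face \<open>f\<close>.\<close>

definition Kb :: nat where "Kb = Suc (\<Sum>k<m. \<Sum>i\<le>n. lookup (D k) i)"
abbreviation src :: "nat set \<Rightarrow> expo" where "src f \<equiv> source Kb f"
abbreviation tgt :: "nat set \<Rightarrow> expo" where "tgt f \<equiv> target Kb f"

lemma Kb_pos: "0 < Kb" by (simp add: Kb_def)

lemma D_le_Kb:
  assumes "k < m" "i \<le> n"
  shows "lookup (D k) i \<le> Kb"
proof -
  have "lookup (D k) i \<le> (\<Sum>i\<le>n. lookup (D k) i)" using assms(2) by (intro member_le_sum) auto
  also have "\<dots> \<le> (\<Sum>k<m. \<Sum>i\<le>n. lookup (D k) i)"
    using assms(1) by (intro member_le_sum[of k "{..<m}" "\<lambda>k. \<Sum>i\<le>n. lookup (D k) i"]) auto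
  finally show ?thesis by (simp add: Kb_def)
qed

lemma src_subset: "f \<in> U \<Longrightarrow> keys (src f) \<subseteq> {0..n}" and tgt_X: "f \<in> U \<Longrightarrow> keys (tgt f) \<in> X"
  using keys_source[OF _ Kb_pos, of f] U_finite[of f] supports keys_target_X[OF _ Kb_pos, of f] by (auto simp: U_iff)

lemma lookup_src: "f \<in> U \<Longrightarrow> lookup (src f) i = (if i \<in> f \<union> As then Kb else 0) + lookup eb i"
  and lookup_tgt: "f \<in> U \<Longrightarrow> lookup (tgt f) i = (if i \<in> f \<union> As then Kb else 0) + lookup ea i"
  using U_finite[of f] supports by (simp_all add: source_def target_def lookup_add lookup_block)

lemma src_tgt_shift:
  assumes "f \<in> U" "g \<in> U" "f \<subseteq> g"
  shows "\<exists>e. keys e \<subseteq> {0..n} \<and> src g = e + src f \<and> tgt g = e + tgt f"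
proof -
  have fin: "finite f" "finite g" "finite As" using U_finite assms supports by auto
  have un: "g \<union> As = (g - f) \<union> (f \<union> As)" and dj: "(g - f) \<inter> (f \<union> As) = {}"
    using assms by (auto simp: U_iff)
  have blk: "block Kb (g \<union> As) = block Kb (g - f) + block Kb (f \<union> As)"
    unfolding block_def un by (rule sum.union_disjoint[OF _ _ dj]) (use fin in simp_all)
  have "keys (block Kb (g - f)) \<subseteq> {0..n}" using fin U_finite(2)[OF assms(2)] by (auto simp: keys_block)
  then show ?thesis by (intro exI[of _ "block Kb (g - f)"]) (simp add: source_def target_def blk add_ac)
qed

lemma over_mono: "over d k \<Longrightarrow> below d d' \<Longrightarrow> over d' k"
  unfolding over_def using below_trans by blast

lemma over_src_mono: "f \<in> U \<Longrightarrow> g \<in> U \<Longrightarrow> f \<subseteq> g \<Longrightarrow> over (src f) k \<Longrightarrow> over (src g) k"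
  using src_tgt_shift[of f g] over_mono[of "src f" k "src g"] by auto

text \<open>Outside the face of \<open>t\<close> the exponents of \<open>d\<close> and \<open>src (link_face t)\<close> are those of \<open>b\<close>, and on it the latter
  are at least \<open>Kb\<close>.\<close>

lemma over_src:
  assumes k: "over d k" and t: "keys t \<in> X" and d: "t + eb = d + ea"
  shows "link_face t \<in> U" "link_face t \<union> As = keys t" "over (src (link_face t)) k"
proof -
  have bt: "below ea t" and dt: "d = t - ea + eb" using d degree_shift_iff by auto
  have kD: "k < m" "zc k \<noteq> 0" "below (D k) d" using k by (auto simp: over_def)
  have nX: "keys (D k) \<notin> X" and nn: "keys (D k) \<subseteq> {0..n}" using gen_monomial(2,3) kD by blast+
  have sub: "keys (D k) \<subseteq> keys t \<union> Bs"
    using below_keys[OF kD(3)] keys_shift_source[OF bt] unfolding dt by blast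
  note f = link_face_U[OF bt t nX sub]
  show "link_face t \<in> U" "link_face t \<union> As = keys t" by (rule f)+
  have "below (D k) (src (link_face t))"
    unfolding below_def
  proof
    fix i
    show "lookup (D k) i \<le> lookup (src (link_face t)) i"
    proof (cases "i \<in> keys t")
      case True
      then have "i \<le> n" using face_subset[OF t] by auto
      then show ?thesis using D_le_Kb[OF kD(1)] True f(2) lookup_src[OF f(1), of i] by (simp add: trans_le_add1)
    next
      case False
      then have "lookup t i = 0" by (simp add: in_keys_iff)
      then have "lookup d i = lookup eb i" by (simp add: dt lookup_add lookup_minus)
      then show ?thesis using kD(3) lookup_src[OF f(1), of i] unfolding below_def by (metis le_add2 le_trans)
    qed
  qed
  then show "over (src (link_face t)) k" using kD by (simp add: over_def)
qed

text \<open>As for homomorphisms on the ideal: both sides are compared on a common multiple by monomials in the variables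
  of \<open>x\<^sup>t\<close>.\<close>

lemma sg_face:
  assumes H: "H \<in> HA" and d: "keys d \<subseteq> {0..n}" and o: "over d k" "over d l" and t: "keys t \<in> X" and dt: "t + eb = d + ea"
  shows "sg H d t k l = sg H (src (link_face t)) (tgt (link_face t)) k l"
proof -
  let ?f = "link_face t"
  note f = over_src[OF o(1) t dt] over_src(3)[OF o(2) t dt]
  have bt: "below ea t" using dt degree_shift_iff by auto
  \<comment> \<open>With this multiplier both degrees become \<open>t + src ?f\<close> and \<open>t + tgt ?f\<close>.\<close>
  let ?e = "block Kb (keys t) + ea"
  have ke: "keys ?e \<subseteq> {0..n}" using face_subset[OF t] supports Kb_pos by (simp add: keys_add_nat keys_block keys_ea)
  have kt: "keys (?e + t) = keys t" using below_keys[OF bt] Kb_pos by (simp add: keys_add_nat keys_block) blast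
  then have kte: "keys (?e + t) \<in> X" using t by simp
  have "?e + d = block Kb (keys t) + (d + ea)" by (simp add: add_ac)
  also have "\<dots> = t + src ?f" unfolding dt[symmetric] by (simp add: source_def f(2) add_ac)
  finally have s: "?e + d = t + src ?f" .
  have g: "?e + t = t + tgt ?f" by (simp add: target_def f(2) add_ac)
  have "sg H d t k l = sg H (?e + d) (?e + t) k l" by (simp add: sg_shift[OF H d o ke kte])
  also have "\<dots> = sg H (src ?f) (tgt ?f) k l"
    unfolding s g using sg_shift[OF H src_subset[OF f(1)] f(3,4) face_subset[OF t], of "t + tgt ?f"] kte
    unfolding g by simp
  finally show ?thesis .
qed

subsection \<open>Generators that miss a variable of \<open>b\<close>\<close>

lemma special_U1:
  assumes f: "f \<in> U" and k: "over (src f) k" "special k"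
  shows "f \<in> U1"
proof -
  obtain v where v: "v \<in> Bs" "lookup (D k) v < b v" using k(2) special_def by blast
  have kD: "k < m" "zc k \<noteq> 0" "below (D k) (src f)" using k by (auto simp: over_def)
  have "keys (D k) \<subseteq> f \<union> As \<union> Bs" using below_keys[OF kD(3)] keys_source[OF f Kb_pos] by simp
  then have "keys (D k) \<subseteq> keys (tgt f) \<union> Bs" using keys_target[OF f Kb_pos] by simp
  from link_face_U1[OF below_target[OF f Kb_pos] tgt_X[OF f] gen_monomial(3)[OF kD(1,2)] this v]
  show ?thesis using link_face_target[OF f Kb_pos] by simp
qed

lemma below_block_src:
  assumes f: "f \<in> U" and p: "p \<subseteq> f \<union> As \<union> Bs"
  shows "below (block 1 p) (src f)"
  unfolding below_def
proof
  have fin: "finite p" using p U_finite[OF f] supports finite_subset by (metis finite_UnI)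
  fix i
  have "i \<in> Bs \<Longrightarrow> 1 \<le> lookup eb i" by (simp add: keys_eb[symmetric] in_keys_iff)
  then show "lookup (block 1 p) i \<le> lookup (src f) i"
    using p Kb_pos fin by (auto simp: lookup_block lookup_src[OF f])
qed

lemma over_exists:
  assumes f: "f \<in> U" and p: "p \<subseteq> f \<union> As \<union> Bs" "p \<notin> X"
  shows "\<exists>k. over (src f) k \<and> below (D k) (block 1 p)"
proof -
  have p': "finite p" "p \<subseteq> {0..n}" using p(1) U_finite[OF f] supports finite_subset[of p "{0..n}"] by auto
  then have "keys (block 1 p) = p" by (simp add: keys_block)
  then obtain k where k: "k < m" "zc k \<noteq> 0" "below (D k) (block 1 p)" using gen_exists[of "block 1 p"] p(2) p'(2) by auto
  then show ?thesis using below_trans[OF k(3) below_block_src[OF f p(1)]] by (auto simp: over_def)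
qed

text \<open>A generator that divides the squarefree monomial on a nonface avoiding \<open>v\<close>, or any generator on the nonface if
  \<open>2 \<le> b v\<close>.\<close>

lemma special_exists:
  assumes "f \<in> U1"
  shows "\<exists>k. over (src f) k \<and> special k"
proof -
  have f: "f \<in> U" using assms by (simp add: U1_iff)
  obtain v where v: "v \<in> Bs" "(f \<union> As \<union> Bs) - {v} \<notin> X \<or> 2 \<le> b v" using assms[unfolded U1_iff] by blast
  define p where "p = (if (f \<union> As \<union> Bs) - {v} \<notin> X then (f \<union> As \<union> Bs) - {v} else f \<union> As \<union> Bs)"
  have p: "p \<notin> X" "p \<subseteq> f \<union> As \<union> Bs" using f by (auto simp: p_def U_iff)
  have fin: "finite p" using U_finite[OF f] supports by (simp add: p_def)
  have lt: "lookup (block 1 p) v < b v" using v on_Bs(3)[OF v(1)] fin by (auto simp: lookup_block p_def)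
  obtain k where k: "over (src f) k" "below (D k) (block 1 p)" using over_exists[OF f p(2,1)] by blast
  have "lookup (D k) v < b v" using k(2) lt unfolding below_def by (meson le_less_trans)
  then show ?thesis using k(1) v(1) special_def by blast
qed

text \<open>A generator that divides \<open>src f\<close>, special over \<open>U1\<close>. For the other faces no such generator is special, by
  \<open>special_U1\<close>.\<close>

definition rep :: "nat set \<Rightarrow> nat" where
  "rep f = (SOME k. over (src f) k \<and> (f \<in> U1 \<longrightarrow> special k))"

lemma rep:
  assumes f: "f \<in> U"
  shows "over (src f) (rep f)" "f \<in> U1 \<Longrightarrow> special (rep f)"
proof -
  have "\<exists>k. over (src f) k \<and> (f \<in> U1 \<longrightarrow> special k)"
  proof (cases "f \<in> U1")
    case True
    then show ?thesis using special_exists by blast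
  next
    case False
    have "f \<union> As \<union> Bs \<notin> X" using f by (simp add: U_iff)
    then show ?thesis using over_exists[OF f order_refl] False by blast
  qed
  from someI_ex[OF this] show "over (src f) (rep f)" "f \<in> U1 \<Longrightarrow> special (rep f)"
    unfolding rep_def by blast+
qed

text \<open>The relation is a multiple of the one in the degree of the least common multiple. There the exponent of \<open>x\<^sub>v\<close> is
  still less than \<open>b v\<close>, so degree \<open>c\<close> leaves no monomial for its value.\<close>

lemma sg_common_defect:
  assumes H: "H \<in> Hom2c" and f: "f \<in> U" and o: "over (src f) k" "over (src f) l"
    and v: "v \<in> Bs" "lookup (D k) v < b v" "lookup (D l) v < b v"
  shows "sg H (src f) (tgt f) k l = 0"
proof (rule ccontr)
  assume nz: "sg H (src f) (tgt f) k l \<noteq> 0"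
  let ?d = "join (D k) (D l)" and ?e = "src f - join (D k) (D l)"
  have bl: "below ?d (src f)" using o below_join(3) by (auto simp: over_def)
  then have s: "src f = ?e + ?d" using below_diff[OF bl] by (simp add: add.commute)
  have kd: "keys ?d \<subseteq> {0..n}" using below_keys[OF bl] src_subset[OF f] by blast
  have ke: "keys ?e \<subseteq> {0..n}" using keys_diff_nat[of "src f" ?d] src_subset[OF f] by blast
  have od: "over ?d k" "over ?d l" using o below_join by (auto simp: over_def)
  have X: "keys (tgt f - ?e) \<in> X" by (rule face_down[OF tgt_X[OF f] keys_diff_nat])
  have "sg H (?e + ?d) (tgt f) k l = (if below ?e (tgt f) then sg H ?d (tgt f - ?e) k l else 0)"
    by (rule sg_shift[OF Hom2c_HA[OF H] kd od ke tgt_X[OF f]])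
  then have "sg H ?d (tgt f - ?e) k l \<noteq> 0" using nz s by (auto split: if_splits)
  then have "(tgt f - ?e) + eb = ?d + ea" by (rule sg_degree[OF H kd od X])
  then have "lookup (tgt f - ?e) v + lookup eb v = lookup ?d v + lookup ea v" by (simp only: lookup_add[symmetric])
  then show False using v on_Bs[OF v(1)] by (simp add: lookup_join)
qed

text \<open>Two generators that both miss a variable of \<open>b\<close> are not separated by a homomorphism of degree
  \<open>c\<close>. If they miss different variables \<open>v\<close> and \<open>w\<close>, either a third generator misses both, or the
  Koszul relation of the two generators is visible in the given degree.\<close>

lemma sg_special:
  assumes H: "H \<in> Hom2c" and f: "f \<in> U" and o: "over (src f) k" "over (src f) l" and sp: "special k" "special l"
  shows "sg H (src f) (tgt f) k l = 0"
proof -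
  note HA = Hom2c_HA[OF H]
  note add = sg_add[OF HA src_subset[OF f] _ _ _ tgt_X[OF f]]
  have reduce: "\<exists>q v. over (src f) q \<and> v \<in> Bs \<and> lookup (D q) v < b v \<and> (\<forall>i. lookup (D q) i \<le> 1) \<and>
      sg H (src f) (tgt f) k q = 0 \<and> sg H (src f) (tgt f) q k = 0" if k: "over (src f) k" "special k" for k
  proof -
    obtain v where v: "v \<in> Bs" "lookup (D k) v < b v" using k(2) special_def by blast
    have kD: "k < m" "zc k \<noteq> 0" "below (D k) (src f)" using k by (auto simp: over_def)
    have "keys (D k) \<subseteq> f \<union> As \<union> Bs" using below_keys[OF kD(3)] keys_source[OF f Kb_pos] by simp
    from over_exists[OF f this gen_monomial(3)[OF kD(1,2)]]
    obtain q where q: "over (src f) q" "below (D q) (block 1 (keys (D k)))" by (elim exE conjE)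
    have le: "lookup (D q) i \<le> lookup (block 1 (keys (D k))) i" for i using q(2) unfolding below_def by blast
    have "lookup (block 1 (keys (D k))) i \<le> 1" for i by (simp add: lookup_block)
    then have le1: "lookup (D q) i \<le> 1" for i using le[of i] order_trans by blast
    have "lookup (block 1 (keys (D k))) v \<le> lookup (D k) v" by (simp add: lookup_block in_keys_iff)
    then have lt: "lookup (D q) v < b v" using v(2) le[of v] by linarith
    show ?thesis
      using q(1) v lt le1 sg_common_defect[OF H f k(1) q(1) v(1,2) lt] sg_common_defect[OF H f q(1) k(1) v(1) lt v(2)]
      by blast
  qed
  obtain p v where p: "over (src f) p" "v \<in> Bs" "lookup (D p) v < b v" "\<forall>i. lookup (D p) i \<le> 1" "sg H (src f) (tgt f) k p = 0"
    using reduce[OF o(1) sp(1)] by blast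
  obtain q w where q: "over (src f) q" "w \<in> Bs" "lookup (D q) w < b w" "\<forall>i. lookup (D q) i \<le> 1" "sg H (src f) (tgt f) q l = 0"
    using reduce[OF o(2) sp(2)] by blast
  have "sg H (src f) (tgt f) p q = 0"
  proof (cases "\<exists>u\<in>Bs. lookup (D p) u < b u \<and> lookup (D q) u < b u")
    case True
    then show ?thesis using sg_common_defect[OF H f p(1) q(1)] by blast
  next
    case False
    have pv: "lookup (D p) v = 0" and qw: "lookup (D q) w = 0" and vw: "v \<noteq> w"
    proof -
      have "\<not> lookup (D q) v < b v" using False p(2,3) by blast
      then have "b v \<le> lookup (D q) v" by simp
      moreover have "\<not> lookup (D p) w < b w" using False q(2,3) by blast
      then have "b w \<le> lookup (D p) w" by simp
      moreover have "lookup (D q) v \<le> 1" "lookup (D p) w \<le> 1" using p(4) q(4) by blast+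
      ultimately show "lookup (D p) v = 0" "lookup (D q) w = 0" "v \<noteq> w" using p(3) q(3) by auto
    qed
    \<comment> \<open>If \<open>?Q\<close> is a nonface it carries a generator that misses both \<open>v\<close> and \<open>w\<close>.\<close>
    let ?Q = "(f \<union> As \<union> Bs) - {v, w}"
    show ?thesis
    proof (cases "?Q \<in> X")
      case False
      have "?Q \<subseteq> f \<union> As \<union> Bs" by blast
      then obtain r where r: "over (src f) r" "below (D r) (block 1 ?Q)" using over_exists[OF f _ False] by blast
      have fin: "finite ?Q" using U_finite[OF f] supports by simp
      have le: "lookup (D r) i \<le> lookup (block 1 ?Q) i" for i using r(2) unfolding below_def by blast
      have "lookup (D r) v = 0" "lookup (D r) w = 0" using le[of v] le[of w] by (simp_all add: lookup_block[OF fin])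
      then have "sg H (src f) (tgt f) p r = 0" "sg H (src f) (tgt f) r q = 0"
        using sg_common_defect[OF H f p(1) r(1) p(2,3)] sg_common_defect[OF H f r(1) q(1) q(2) _ q(3)]
          on_Bs(3)[OF p(2)] on_Bs(3)[OF q(2)] by simp_all
      then show ?thesis using add[OF p(1) r(1) q(1)] by simp
    next
      case QX: True
      show ?thesis
      proof (rule ccontr)
        assume nz: "sg H (src f) (tgt f) p q \<noteq> 0"
        let ?d = "join (D p) (D q)" and ?e = "src f - join (D p) (D q)"
        have bl: "below ?d (src f)" using p(1) q(1) below_join(3) by (auto simp: over_def)
        then have s: "src f = ?e + ?d" using below_diff[OF bl] by (simp add: add.commute)
        have kd: "keys ?d \<subseteq> {0..n}" using below_keys[OF bl] src_subset[OF f] by blast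
        have ke: "keys ?e \<subseteq> {0..n}" using keys_diff_nat[of "src f" ?d] src_subset[OF f] by blast
        have od: "over ?d p" "over ?d q" using p(1) q(1) below_join by (auto simp: over_def)
        let ?t = "tgt f - ?e"
        have tX: "keys ?t \<in> X" by (rule face_down[OF tgt_X[OF f] keys_diff_nat])
        have "sg H (?e + ?d) (tgt f) p q = (if below ?e (tgt f) then sg H ?d ?t p q else 0)"
          by (rule sg_shift[OF HA kd od ke tgt_X[OF f]])
        then have nz': "sg H ?d ?t p q \<noteq> 0" using nz s by (auto split: if_splits)
        then have deg: "?t + eb = ?d + ea" by (rule sg_degree[OF H kd od tX])
        \<comment> \<open>Multiplication by the greatest common divisor \<open>g\<close> leads from the least common multiple to the product of
          the generators, the degree of their Koszul relation.\<close>
        define g where "g = D p + D q - ?d"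
        have lg: "lookup g i = min (lookup (D p) i) (lookup (D q) i)" for i
          by (simp add: g_def lookup_minus lookup_add lookup_join min_def max_def)
        have gd: "g + ?d = D p + D q"
          by (rule poly_mapping_eqI) (simp add: lookup_add lg lookup_join min_def max_def)
        have kg: "keys g \<subseteq> {0..n}" using lg kd by (auto simp: in_keys_iff lookup_join subset_iff)
        have lt: "lookup ?t i + lookup eb i = lookup ?d i + lookup ea i" for i
          using deg by (simp only: lookup_add[symmetric])
        have dsub: "keys ?d \<subseteq> f \<union> As \<union> Bs" using below_keys[OF bl] keys_source[OF f Kb_pos] by simp
        have AB: "v \<notin> As" "w \<notin> As" using p(2) q(2) supports(5) by auto
        have "i \<in> ?Q" if i: "i \<in> keys (g + ?t)" for i
        proof (cases "i \<in> keys g")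
          case True
          then have "lookup (D p) i \<noteq> 0" "lookup (D q) i \<noteq> 0" by (auto simp: in_keys_iff lg)
          moreover from this have "i \<in> keys ?d" by (simp add: in_keys_iff lookup_join)
          ultimately show ?thesis using dsub pv qw by auto
        next
          case False
          then have t: "lookup ?t i \<noteq> 0" using i by (simp add: keys_add_nat in_keys_iff)
          show ?thesis
          proof (cases "i \<in> As")
            case True
            then show ?thesis using AB by auto
          next
            case nA: False
            then have "lookup ea i = 0" using keys_ea by (simp add: in_keys_iff[symmetric] not_in_keys_iff_lookup_eq_zero[symmetric])
            then have l: "lookup eb i < lookup ?d i" using lt[of i] t by linarith
            moreover have "lookup ?d i \<le> 1" using p(4) q(4) by (simp add: lookup_join)
            ultimately have "lookup eb i = 0" by linarith
            then have "i \<notin> Bs" using keys_eb by (simp add: in_keys_iff[symmetric] not_in_keys_iff_lookup_eq_zero[symmetric])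
            moreover have "i \<in> keys ?d" using l by (simp add: in_keys_iff)
            ultimately show ?thesis using dsub p(2) q(2) by auto
          qed
        qed
        then have "keys (g + ?t) \<subseteq> ?Q" by blast
        then have gX: "keys (g + ?t) \<in> X" by (rule face_down[OF QX])
        have "sg H (g + ?d) (g + ?t) p q = sg H ?d ?t p q" by (simp add: sg_shift[OF HA kd od kg gX])
        moreover have "sg H (D p + D q) (g + ?t) p q = 0"
          using eta(4)[OF HA rho_koszul] p(1) q(1) coef_zero[OF gX] by (simp add: sg_def over_def)
        ultimately show False using nz' unfolding gd by simp
      qed
    qed
  qed
  then show ?thesis using add[OF o(1) p(1) o(2)] add[OF p(1) q(1) o(2)] p(5) q(5) by simp
qed

section \<open>From homomorphisms to poset cocycles\<close>

definition rel_coefs :: "((nat \<Rightarrow> mpoly) set \<Rightarrow> mpoly set) \<Rightarrow> nat set \<times> nat set \<Rightarrow> complex" where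
  "rel_coefs H = (\<lambda>(f, g). if f \<in> U \<and> g \<in> U \<and> f \<subseteq> g then sg H (src g) (tgt g) (rep f) (rep g) else 0)"

lemma sg_src_mono:
  assumes H: "H \<in> HA" and fg: "f \<in> U" "g \<in> U" "f \<subseteq> g" and o: "over (src f) k" "over (src f) l"
  shows "sg H (src g) (tgt g) k l = sg H (src f) (tgt f) k l"
proof -
  obtain e where e: "keys e \<subseteq> {0..n}" "src g = e + src f" "tgt g = e + tgt f" using src_tgt_shift[OF fg] by blast
  show ?thesis using sg_shift[OF H src_subset[OF fg(1)] o e(1) tgt_X[OF fg(2)]] unfolding e(2,3) by simp
qed

text \<open>Additivity holds because the relations between three generators add up. If \<open>f \<in> U1\<close> then \<open>g \<in> U1\<close>, both
  representatives are special, and \<open>sg_special\<close> applies.\<close>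

lemma rel_coefs_Z1:
  assumes H: "H \<in> Hom2c"
  shows "rel_coefs H \<in> poset_Z1 U U1"
proof (rule poset_Z1I)
  note HA = Hom2c_HA[OF H]
  fix f g assume *: "\<not> (f \<in> U - U1 \<and> g \<in> U \<and> f \<subseteq> g)"
  show "rel_coefs H (f, g) = 0"
  proof (cases "f \<in> U \<and> g \<in> U \<and> f \<subseteq> g")
    case True
    then have fg: "f \<in> U" "g \<in> U" "f \<subseteq> g" "f \<in> U1" using * by auto
    have of: "over (src g) (rep f)" by (rule over_src_mono[OF fg(1-3) rep(1)[OF fg(1)]])
    have g1: "g \<in> U1" by (rule special_U1[OF fg(2) of rep(2)[OF fg(1,4)]])
    show ?thesis
      using sg_special[OF H fg(2) of rep(1)[OF fg(2)] rep(2)[OF fg(1,4)] rep(2)[OF fg(2) g1]]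
      by (simp add: rel_coefs_def)
  qed (auto simp: rel_coefs_def)
next
  note HA = Hom2c_HA[OF H]
  fix f g h assume fgh: "f \<in> U" "g \<in> U" "h \<in> U" "f \<subseteq> g" "g \<subseteq> h"
  have fh: "f \<subseteq> h" using fgh by blast
  have "sg H (src h) (tgt h) (rep f) (rep h) = sg H (src h) (tgt h) (rep f) (rep g) + sg H (src h) (tgt h) (rep g) (rep h)"
    by (rule sg_add[OF HA src_subset[OF fgh(3)] over_src_mono[OF fgh(1,3) fh rep(1)[OF fgh(1)]]
        over_src_mono[OF fgh(2,3,5) rep(1)[OF fgh(2)]] rep(1)[OF fgh(3)] tgt_X[OF fgh(3)]])
  moreover have "sg H (src h) (tgt h) (rep f) (rep g) = sg H (src g) (tgt g) (rep f) (rep g)"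
    by (rule sg_src_mono[OF HA fgh(2,3,5) over_src_mono[OF fgh(1,2,4) rep(1)[OF fgh(1)]] rep(1)[OF fgh(2)]])
  ultimately show "rel_coefs H (f, h) = rel_coefs H (f, g) + rel_coefs H (g, h)"
    using fgh fh by (simp add: rel_coefs_def)
qed

lemma rel_coefs_linear:
  assumes H: "H \<in> HA"
  shows "G \<in> HA \<Longrightarrow> rel_coefs (H \<oplus>\<^bsub>Hom2\<^esub> G) = (\<lambda>p. rel_coefs H p + rel_coefs G p)"
    and "rel_coefs (cl (poly_const z) \<odot>\<^bsub>Hom2\<^esub> H) = (\<lambda>p. z * rel_coefs H p)"
proof -
  have r: "rho (src g) (rep f) (rep g) \<in> Rel" if "f \<in> U" "g \<in> U" "f \<subseteq> g" for f g
    by (rule rho_Rel[OF src_subset[OF that(2)] over_src_mono[OF that rep(1)[OF that(1)]] rep(1)[OF that(2)]])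
  show "rel_coefs (H \<oplus>\<^bsub>Hom2\<^esub> G) = (\<lambda>p. rel_coefs H p + rel_coefs G p)" if G: "G \<in> HA"
  proof
    fix p :: "nat set \<times> nat set"
    obtain f g where p: "p = (f, g)" by fastforce
    show "rel_coefs (H \<oplus>\<^bsub>Hom2\<^esub> G) p = rel_coefs H p + rel_coefs G p"
    proof (cases "f \<in> U \<and> g \<in> U \<and> f \<subseteq> g")
      case True
      then have fg: "f \<in> U" "g \<in> U" "f \<subseteq> g" by auto
      show ?thesis
        using True coef_add[OF eta(1)[OF H r[OF fg]] eta(1)[OF G r[OF fg]] tgt_X[OF fg(2)]]
        by (simp add: p rel_coefs_def sg_def Hom2_ops(1)[OF r[OF fg]])
    qed (auto simp: p rel_coefs_def)
  qed
  show "rel_coefs (cl (poly_const z) \<odot>\<^bsub>Hom2\<^esub> H) = (\<lambda>p. z * rel_coefs H p)"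
  proof
    fix p :: "nat set \<times> nat set"
    obtain f g where p: "p = (f, g)" by fastforce
    show "rel_coefs (cl (poly_const z) \<odot>\<^bsub>Hom2\<^esub> H) p = z * rel_coefs H p"
    proof (cases "f \<in> U \<and> g \<in> U \<and> f \<subseteq> g")
      case True
      then have fg: "f \<in> U" "g \<in> U" "f \<subseteq> g" by auto
      show ?thesis
        using True coef_const_mult[OF eta(1)[OF H r[OF fg]] tgt_X[OF fg(2)]]
        by (simp add: p rel_coefs_def sg_def Hom2_ops(2)[OF r[OF fg]])
    qed (auto simp: p rel_coefs_def)
  qed
qed

lemma Hom2c_closed:
  assumes H: "H \<in> Hom2c"
  shows "G \<in> Hom2c \<Longrightarrow> H \<oplus>\<^bsub>Hom2\<^esub> G \<in> Hom2c" "cl (poly_const z) \<odot>\<^bsub>Hom2\<^esub> H \<in> Hom2c"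
proof -
  note HA = Hom2c_HA[OF H]
  have gr: "G (rc r) \<in> quot_ring_grading n I (\<lambda>i. d i + cdeg i)"
    if "G \<in> Hom2c" "r \<in> Rel \<inter> free_grading n m Deg d" for G r d
    by (rule Hom2c_graded[OF that(1) IntD1[OF that(2)] IntD2[OF that(2)]])
  show "H \<oplus>\<^bsub>Hom2\<^esub> G \<in> Hom2c" if G: "G \<in> Hom2c"
    unfolding Hom2c_iff
  proof (intro conjI allI ballI)
    show "H \<oplus>\<^bsub>Hom2\<^esub> G \<in> HA" by (rule Hom2_closed(1)[OF HA Hom2c_HA[OF G]])
    fix d r assume r: "r \<in> Rel \<inter> free_grading n m Deg d"
    show "(H \<oplus>\<^bsub>Hom2\<^esub> G) (rc r) \<in> quot_ring_grading n I (\<lambda>i. d i + cdeg i)"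
      unfolding Hom2_ops(1)[OF IntD1[OF r]] by (rule quot_ring_grading_closed(1)[OF gr[OF H r] gr[OF G r]])
  qed
  show "cl (poly_const z) \<odot>\<^bsub>Hom2\<^esub> H \<in> Hom2c"
    unfolding Hom2c_iff
  proof (intro conjI allI ballI)
    show "cl (poly_const z) \<odot>\<^bsub>Hom2\<^esub> H \<in> HA" by (rule Hom2_closed(2)[OF HA cl_in_A[OF poly_const_closed]])
    fix d r assume r: "r \<in> Rel \<inter> free_grading n m Deg d"
    show "(cl (poly_const z) \<odot>\<^bsub>Hom2\<^esub> H) (rc r) \<in> quot_ring_grading n I (\<lambda>i. d i + cdeg i)"
      unfolding Hom2_ops(2)[OF IntD1[OF r]] by (rule quot_ring_grading_closed(2)[OF gr[OF H r]])
  qed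
qed

section \<open>Homomorphisms that extend to the free module\<close>

text \<open>If \<open>\<phi>\<close> extends \<open>H\<close> to the free module, then the value of \<open>H\<close> on a basic relation is the difference of the
  values of \<open>\<phi>\<close> on multiples of two basis vectors. The coefficients of these values are constant along
  inclusions of faces, and they vanish for special generators.\<close>

lemma extends_imp_B1:
  assumes H: "H \<in> HA" and N: "H \<in> N2"
  shows "rel_coefs H \<in> poset_B1 U U1"
proof -
  obtain \<phi> where \<phi>: "\<phi> \<in> mod_hom P Fm NA" "\<forall>r\<in>Rel. H (rc r) = \<phi> r" using N N2_iff by blast
  have v: "\<phi> x \<in> carrier A" if "x \<in> carrier Fm" for x using mod_homD(1)[OF \<phi>(1) that] by (simp add: NA_simps)
  have sm: "\<phi> (r \<odot>\<^bsub>Fm\<^esub> x) = cl r \<otimes>\<^bsub>A\<^esub> \<phi> x" if "r \<in> carrier P" "x \<in> carrier Fm" for r x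
    using mod_homD(4)[OF \<phi>(1) that] by (simp add: NA_simps)
  have ad: "\<phi> (x \<oplus>\<^bsub>Fm\<^esub> y) = \<phi> x \<oplus>\<^bsub>A\<^esub> \<phi> y" if "x \<in> carrier Fm" "y \<in> carrier Fm" for x y
    using mod_homD(3)[OF \<phi>(1) that] by (simp add: NA_simps)
  define part where "part d k = single (d - D k) (1 / zc k)" for d k
  define \<omega> where "\<omega> f k = coef (\<phi> (bas k (part (src f) k))) (tgt f)" for f k
  have pc: "part d k \<in> carrier P" if "keys d \<subseteq> {0..n}" for d k
    unfolding part_def using that keys_diff_nat[of d "D k"] by (intro single_closed) blast
  have diff: "sg H (src f) (tgt f) k l = \<omega> f k - \<omega> f l" if f: "f \<in> U" and o: "over (src f) k" "over (src f) l" for f k l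
  proof -
    note s = src_subset[OF f]
    have "bas k (part (src f) k) = rho (src f) k l \<oplus>\<^bsub>Fm\<^esub> bas l (part (src f) l)"
      unfolding Fm_simps(3) unfolding bas_def rho_def part_def by (rule restrict_ext) simp
    then have "\<phi> (bas k (part (src f) k)) = \<phi> (rho (src f) k l) \<oplus>\<^bsub>A\<^esub> \<phi> (bas l (part (src f) l))"
      using ad[OF rho_carrier[OF s] bas_closed[OF pc[OF s]]] by simp
    then have "\<omega> f k = coef (\<phi> (rho (src f) k l)) (tgt f) + \<omega> f l"
      unfolding \<omega>_def using coef_add[OF v[OF rho_carrier[OF s]] v[OF bas_closed[OF pc[OF s]]] tgt_X[OF f]] by simp
    moreover have "H (rc (rho (src f) k l)) = \<phi> (rho (src f) k l)" using \<phi>(2) rho_Rel[OF s o] by blast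
    ultimately show ?thesis by (simp add: sg_def)
  qed
  have mono: "\<omega> g k = \<omega> f k" if fg: "f \<in> U" "g \<in> U" "f \<subseteq> g" and o: "over (src f) k" for f g k
  proof -
    obtain e where e: "keys e \<subseteq> {0..n}" "src g = e + src f" "tgt g = e + tgt f" using src_tgt_shift[OF fg] by blast
    have "src g - D k = e + (src f - D k)" unfolding e(2) by (rule add_diff_below) (use o over_def in blast)
    then have "bas k (part (src g) k) = single e 1 \<odot>\<^bsub>Fm\<^esub> bas k (part (src f) k)"
      by (simp add: smult_bas part_def mult_single)
    then have "\<phi> (bas k (part (src g) k)) = cl (single e 1) \<otimes>\<^bsub>A\<^esub> \<phi> (bas k (part (src f) k))"
      using sm[OF single_closed[OF e(1)] bas_closed[OF pc[OF src_subset[OF fg(1)]]]] by simp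
    then show ?thesis
      unfolding \<omega>_def
      using coef_single_mult[OF e(1) v[OF bas_closed[OF pc[OF src_subset[OF fg(1)]]]] tgt_X[OF fg(2)], of 1]
      unfolding e(3) by simp
  qed
  have special: "\<omega> f k = 0" if f: "f \<in> U" and o: "over (src f) k" and sp: "special k" for f k
  proof -
    obtain w where w: "w \<in> Bs" "lookup (D k) w < b w" using sp special_def by blast
    have "lookup (tgt f) w < lookup (src f - D k) w"
      using w on_Bs[OF w(1)] by (simp add: lookup_minus lookup_src[OF f] lookup_tgt[OF f])
    then have nb: "\<not> below (src f - D k) (tgt f)" unfolding below_def by (meson not_less)
    have ks: "keys (src f - D k) \<subseteq> {0..n}" using src_subset[OF f] keys_diff_nat[of "src f" "D k"] by blast
    have "bas k (part (src f) k) = single (src f - D k) (1 / zc k) \<odot>\<^bsub>Fm\<^esub> bas k 1"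
      by (simp add: smult_bas part_def)
    then have "\<phi> (bas k (part (src f) k)) = cl (single (src f - D k) (1 / zc k)) \<otimes>\<^bsub>A\<^esub> \<phi> (bas k 1)"
      using sm[OF single_closed[OF ks] bas_closed[of 1 k]] by simp
    then show ?thesis
      unfolding \<omega>_def using coef_single_mult[OF ks v[OF bas_closed[of 1 k]] tgt_X[OF f]] nb by simp
  qed
  have "rel_coefs H = poset_delta U (\<lambda>f. if f \<in> U then - \<omega> f (rep f) else 0)"
  proof
    fix p :: "nat set \<times> nat set"
    obtain f g where p: "p = (f, g)" by fastforce
    show "rel_coefs H p = poset_delta U (\<lambda>f. if f \<in> U then - \<omega> f (rep f) else 0) p"
    proof (cases "f \<in> U \<and> g \<in> U \<and> f \<subseteq> g")
      case True
      then have fg: "f \<in> U" "g \<in> U" "f \<subseteq> g" by auto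
      show ?thesis
        using fg diff[OF fg(2) over_src_mono[OF fg rep(1)[OF fg(1)]] rep(1)[OF fg(2)]] mono[OF fg rep(1)[OF fg(1)]]
        by (simp add: p rel_coefs_def poset_delta_def)
    qed (auto simp: p rel_coefs_def poset_delta_def)
  qed
  moreover have "(if f \<in> U then - \<omega> f (rep f) else 0) = 0" if f: "f \<in> U1" for f
    using special[OF _ rep(1) rep(2)[OF _ f]] f by (simp add: U1_iff)
  ultimately show ?thesis unfolding poset_B1_def by blast
qed

text \<open>Every relation is a combination of the basic ones and of basis vectors of zero generators: in a relation each
  other monomial is cancelled by a monomial in another coordinate, and subtracting the corresponding basic relation removes a
  monomial without creating a new one.\<close>

lemma Rel_generated:
  assumes N: "zero Fm \<in> N" "\<And>x y. x \<in> N \<Longrightarrow> y \<in> N \<Longrightarrow> x \<oplus>\<^bsub>Fm\<^esub> y \<in> N"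
      "\<And>p x. p \<in> carrier P \<Longrightarrow> x \<in> N \<Longrightarrow> p \<odot>\<^bsub>Fm\<^esub> x \<in> N"
    and rho: "\<And>d k l. keys d \<subseteq> {0..n} \<Longrightarrow> over d k \<Longrightarrow> over d l \<Longrightarrow> rho d k l \<in> N"
    and bas: "\<And>k. k < m \<Longrightarrow> zc k = 0 \<Longrightarrow> bas k 1 \<in> N"
    and r: "r \<in> Rel"
  shows "r \<in> N"
  using r
proof (induction "card (SIGMA i:{..<m}. keys (r i))" arbitrary: r rule: less_induct)
  case less
  note rR = less.prems
  note rc = Rel_closed(4)[OF rR]
  have step: "r \<in> N" if q: "q \<in> N" "q \<in> Rel" and sub: "\<And>i t. i < m \<Longrightarrow> lookup (r i) t = 0 \<Longrightarrow> lookup (q i) t = 0"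
    and k: "k < m" "s \<in> keys (r k)" "lookup (q k) s = lookup (r k) s" for q k s
  proof -
    let ?r = "r \<oplus>\<^bsub>Fm\<^esub> (poly_const (-1) \<odot>\<^bsub>Fm\<^esub> q)"
    have l: "lookup (?r i) t = lookup (r i) t - lookup (q i) t" if "i < m" for i t
      using that by (simp add: Fm_simps lookup_add lookup_poly_const_mult)
    have R: "?r \<in> Rel" by (intro Rel_closed(1,2) rR q(2) poly_const_closed)
    have "(SIGMA i:{..<m}. keys (?r i)) \<subset> (SIGMA i:{..<m}. keys (r i))"
    proof (rule psubsetI)
      show "(SIGMA i:{..<m}. keys (?r i)) \<subseteq> (SIGMA i:{..<m}. keys (r i))"
      proof (rule Sigma_mono[OF order_refl], rule subsetI)
        fix i t assume i: "i \<in> {..<m}" and t: "t \<in> keys (?r i)"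
        have "lookup (r i) t \<noteq> 0" using t sub[of i t] i l[of i t] by (auto simp: in_keys_iff)
        then show "t \<in> keys (r i)" by (simp add: in_keys_iff)
      qed
      have "(k, s) \<in> (SIGMA i:{..<m}. keys (r i))" using k by simp
      moreover have "(k, s) \<notin> (SIGMA i:{..<m}. keys (?r i))"
        using l[OF k(1), of s] k(3) by (simp add: in_keys_iff)
      ultimately show "(SIGMA i:{..<m}. keys (?r i)) \<noteq> (SIGMA i:{..<m}. keys (r i))" by blast
    qed
    then have "card (SIGMA i:{..<m}. keys (?r i)) < card (SIGMA i:{..<m}. keys (r i))"
      by (intro psubset_card_mono) auto
    from less.hyps[OF this R] have "?r \<oplus>\<^bsub>Fm\<^esub> q \<in> N" by (rule N(2)[OF _ q(1)])
    moreover have "?r \<oplus>\<^bsub>Fm\<^esub> q = r"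
    proof (rule Fm_eqI[OF _ rc])
      show "?r \<oplus>\<^bsub>Fm\<^esub> q \<in> carrier Fm" by (rule Rel_closed(4)[OF Rel_closed(1)[OF R q(2)]])
      fix i assume i: "i < m"
      have "(?r \<oplus>\<^bsub>Fm\<^esub> q) i = ?r i + q i" using i by (simp add: Fm_simps(3))
      also have "\<dots> = r i" by (rule poly_mapping_eqI) (simp add: lookup_add l[OF i])
      finally show "(?r \<oplus>\<^bsub>Fm\<^esub> q) i = r i" .
    qed
    ultimately show ?thesis by simp
  qed
  show ?case
  proof (cases "\<exists>k<m. \<exists>s. s \<in> keys (r k)")
    case False
    have "r = zero Fm"
    proof (rule Fm_eqI[OF rc Fm_closed(3)])
      fix k assume k: "k < m"
      then have "keys (r k) = {}" using False by blast
      then show "r k = zero Fm k" using k by (simp add: Fm_simps)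
    qed
    then show ?thesis using N(1) by simp
  next
    case True
    then obtain k s where k: "k < m" and s: "s \<in> keys (r k)" by blast
    define c where "c = lookup (r k) s"
    have c0: "c \<noteq> 0" using s by (simp add: c_def in_keys_iff)
    have ks: "keys s \<subseteq> {0..n}" using Fm_closed(4)[OF rc k] s unfolding poly_ring_carrier by blast
    show ?thesis
    proof (cases "zc k = 0")
      case z: True
      let ?q = "single s c \<odot>\<^bsub>Fm\<^esub> bas k 1"
      have j0: "j (bas k 1) = 0" using gen_monomial(1)[OF k] z by (simp add: gen_def)
      have q: "?q i = (if i = k then single s c else 0)" if "i < m" for i
        using that unfolding smult_bas by (simp add: bas_def)
      show ?thesis
      proof (rule step[of ?q k s])
        show "?q \<in> N" by (rule N(3)[OF single_closed[OF ks] bas[OF k z]])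
        have "bas k 1 \<in> Rel" using j0 by (simp add: Rel_iff)
        then show "?q \<in> Rel" by (rule Rel_closed(2)[OF single_closed[OF ks]])
        show "lookup (?q i) t = 0" if i: "i < m" and z: "lookup (r i) t = 0" for i t
        proof -
          have "\<not> (i = k \<and> t = s)" using z c0 by (auto simp: c_def)
          then show ?thesis unfolding q[OF i] by (auto simp: lookup_single when_def)
        qed
        show "lookup (?q k) s = lookup (r k) s" unfolding q[OF k] by (simp add: c_def)
      qed (fact k s)+
    next
      case z: False
      let ?d = "s + D k"
      have kd: "keys ?d \<subseteq> {0..n}" using ks gen_monomial(2)[OF k z] by (simp add: keys_add_nat)
      have "lookup (j r) ?d = 0" using rR by (simp add: Rel_iff)
      then have sum0: "(\<Sum>i<m. lookup (gen i * r i) ?d) = 0" unfolding j_eq[OF rc] lookup_sum .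
      have kterm: "lookup (gen k * r k) ?d \<noteq> 0"
        unfolding lookup_gen_mult[OF k] using z c0 by (simp add: c_def)
      have "\<exists>l\<in>{..<m} - {k}. lookup (gen l * r l) ?d \<noteq> 0"
      proof (rule ccontr)
        assume "\<not> ?thesis"
        then have "(\<Sum>i\<in>{..<m} - {k}. lookup (gen i * r i) ?d) = 0" by (intro sum.neutral) blast
        moreover have "(\<Sum>i<m. lookup (gen i * r i) ?d) = lookup (gen k * r k) ?d + (\<Sum>i\<in>{..<m} - {k}. lookup (gen i * r i) ?d)"
          using k by (intro sum.remove) auto
        ultimately show False using sum0 kterm by simp
      qed
      then obtain l where l: "l < m" "l \<noteq> k" "lookup (gen l * r l) ?d \<noteq> 0" by blast
      have ll: "below (D l) ?d" "zc l \<noteq> 0" "lookup (r l) (?d - D l) \<noteq> 0"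
        using l(3) unfolding lookup_gen_mult[OF l(1)] by (auto split: if_splits)
      have o: "over ?d k" "over ?d l" using k z l(1) ll by (simp_all add: over_def)
      let ?q = "poly_const (c * zc k) \<odot>\<^bsub>Fm\<^esub> rho ?d k l"
      have q: "lookup (?q i) t = (if i = k \<and> t = s then c else 0) - (if i = l \<and> t = ?d - D l then c * zc k / zc l else 0)"
        if "i < m" for i t
        using that z by (auto simp: Fm_simps(4) lookup_poly_const_mult rho_def lookup_minus lookup_single when_def)
      show ?thesis
      proof (rule step[of ?q k s])
        show "?q \<in> N" by (rule N(3)[OF poly_const_closed rho[OF kd o]])
        show "?q \<in> Rel" by (rule Rel_closed(2)[OF poly_const_closed rho_Rel[OF kd o]])
        show "lookup (?q i) t = 0" if i: "i < m" and 0: "lookup (r i) t = 0" for i t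
        proof -
          have ne: "(i = k \<and> t = s) = False" "(i = l \<and> t = ?d - D l) = False"
            using 0 c0 ll(3) by (auto simp: c_def)
          show ?thesis unfolding q[OF i] ne by simp
        qed
        show "lookup (?q k) s = lookup (r k) s" unfolding q[OF k] using l(2) by (simp add: c_def)
      qed (fact k s)+
    qed
  qed
qed

text \<open>The homomorphism on the free module that sends the \<open>k\<close>-th basis vector to the class of \<open>p k\<close>.\<close>

definition ext_hom :: "(nat \<Rightarrow> mpoly) \<Rightarrow> (nat \<Rightarrow> mpoly) \<Rightarrow> mpoly set" where
  "ext_hom p = (\<lambda>e\<in>carrier Fm. cl (\<Sum>k<m. e k * p k))"

lemma ext_hom:
  assumes p: "\<And>k. k < m \<Longrightarrow> p k \<in> carrier P"
  shows "e \<in> carrier Fm \<Longrightarrow> (\<Sum>k<m. e k * p k) \<in> carrier P" "ext_hom p \<in> mod_hom P Fm NA"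
proof -
  show c: "(\<Sum>k<m. e k * p k) \<in> carrier P" if e: "e \<in> carrier Fm" for e
    by (intro sum_closed poly_ring_closed) (use p Fm_closed(4)[OF e] in auto)
  show "ext_hom p \<in> mod_hom P Fm NA"
  proof (rule mod_homI)
    show "ext_hom p \<in> extensional (carrier Fm)" unfolding ext_hom_def by (rule restrict_extensional)
    fix x assume x: "x \<in> carrier Fm"
    show "ext_hom p x \<in> carrier NA" using cl_in_A[OF c[OF x]] x by (simp add: ext_hom_def NA_simps)
    show "ext_hom p (x \<oplus>\<^bsub>Fm\<^esub> y) = ext_hom p x \<oplus>\<^bsub>NA\<^esub> ext_hom p y" if y: "y \<in> carrier Fm" for y
    proof -
      have "(\<Sum>k<m. (x \<oplus>\<^bsub>Fm\<^esub> y) k * p k) = (\<Sum>k<m. x k * p k) + (\<Sum>k<m. y k * p k)"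
        unfolding sum.distrib[symmetric] by (rule sum.cong) (simp_all add: Fm_simps(3) distrib_right)
      then show ?thesis
        using x y A_add[OF c[OF x] c[OF y]] Fm_closed(1)[OF x y] by (simp add: ext_hom_def NA_simps)
    qed
    show "ext_hom p (r \<odot>\<^bsub>Fm\<^esub> x) = r \<odot>\<^bsub>NA\<^esub> ext_hom p x" if r: "r \<in> carrier P" for r
    proof -
      have "(\<Sum>k<m. (r \<odot>\<^bsub>Fm\<^esub> x) k * p k) = r * (\<Sum>k<m. x k * p k)"
        unfolding sum_distrib_left by (rule sum.cong) (simp_all add: Fm_simps(4) mult.assoc)
      then show ?thesis
        using x r A_mult[OF r c[OF x]] Fm_closed(2)[OF r x] by (simp add: ext_hom_def NA_simps)
    qed
  qed
qed

text \<open>If the generator is not special then the shifted generator is a monomial of \<open>A\<close>, and it divides \<open>x\<^sup>t\<close>.\<close>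

lemma low_face:
  assumes o: "over d k" and ns: "\<not> special k" and t: "keys t \<in> X" "t + eb = d + ea"
  shows "t = (d - D k) + (D k + ea - eb)" "keys (D k + ea - eb) \<in> X"
    "link_face (D k + ea - eb) \<in> U" "link_face (D k + ea - eb) \<subseteq> link_face t"
proof -
  let ?t = "D k + ea - eb"
  have t0: "?t + eb = D k + ea" using ns below_diff[of eb "D k + ea"] unfolding not_special_below by (simp add: add.commute)
  have "D k + (d - D k) = d" using o below_diff unfolding over_def by blast
  then have "t + eb = ((d - D k) + ?t) + eb" using t(2) t0 by (metis add.assoc add.commute)
  then show eq: "t = (d - D k) + ?t" by (simp only: add_right_cancel)
  have sub: "keys ?t \<subseteq> keys t" unfolding arg_cong[OF eq, of keys] keys_add_nat by blast
  then show X: "keys ?t \<in> X" using face_down[OF t(1)] by blast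
  have "over (D k) k" using o by (simp add: over_def)
  then show "link_face ?t \<in> U" using over_src(1)[OF _ X t0] by blast
  show "link_face ?t \<subseteq> link_face t" using sub unfolding link_face_def by blast
qed

text \<open>If the cocycle of \<open>H\<close> is the coboundary of \<open>u\<close>, correcting by \<open>u\<close> turns the coefficients of \<open>H\<close> on relations
  with the representatives into functions \<open>\<omega>\<close> of a face and one generator, constant along inclusions. They
  prescribe the value on the \<open>k\<close>-th basis vector, in degree \<open>D k + c\<close>; this extends \<open>H\<close> by \<open>Rel_generated\<close>.\<close>

lemma B1_imp_extends:
  assumes H: "H \<in> Hom2c" and B: "rel_coefs H \<in> poset_B1 U U1"
  shows "H \<in> N2"
proof -
  note HA = Hom2c_HA[OF H]
  obtain u where u: "rel_coefs H = poset_delta U u" "\<And>f. f \<in> U1 \<Longrightarrow> u f = 0" using B unfolding poset_B1_def by blast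
  define \<omega> where "\<omega> f k = sg H (src f) (tgt f) k (rep f) - u f" for f k
  have diff: "sg H (src f) (tgt f) k l = \<omega> f k - \<omega> f l" if f: "f \<in> U" and o: "over (src f) k" "over (src f) l" for f k l
    using sg_add[OF HA src_subset[OF f] o rep(1)[OF f] tgt_X[OF f]] by (simp add: \<omega>_def)
  have mono: "\<omega> g k = \<omega> f k" if fg: "f \<in> U" "g \<in> U" "f \<subseteq> g" and o: "over (src f) k" for f g k
  proof -
    have "sg H (src g) (tgt g) k (rep g) = sg H (src g) (tgt g) k (rep f) + sg H (src g) (tgt g) (rep f) (rep g)"
      by (rule sg_add[OF HA src_subset[OF fg(2)] over_src_mono[OF fg o] over_src_mono[OF fg rep(1)[OF fg(1)]] rep(1)[OF fg(2)] tgt_X[OF fg(2)]])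
    moreover have "sg H (src g) (tgt g) k (rep f) = sg H (src f) (tgt f) k (rep f)"
      by (rule sg_src_mono[OF HA fg o rep(1)[OF fg(1)]])
    moreover have "sg H (src g) (tgt g) (rep f) (rep g) = u g - u f"
      using fun_cong[OF u(1), of "(f, g)"] fg by (simp add: rel_coefs_def poset_delta_def)
    ultimately show ?thesis by (simp add: \<omega>_def)
  qed
  have spec0: "\<omega> f k = 0" if f: "f \<in> U" and o: "over (src f) k" and sp: "special k" for f k
  proof -
    have f1: "f \<in> U1" by (rule special_U1[OF f o sp])
    show ?thesis unfolding \<omega>_def using sg_special[OF H f o rep(1)[OF f] sp rep(2)[OF f f1]] u(2)[OF f1] by simp
  qed
  define p where "p k = (if zc k = 0 then SOME p. p \<in> carrier P \<and> H (rc (bas k 1)) = cl p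
      else if \<not> special k \<and> keys (D k + ea - eb) \<in> X
      then single (D k + ea - eb) (zc k * \<omega> (link_face (D k + ea - eb)) k) else 0)" for k
  have bR: "bas k 1 \<in> Rel" if "k < m" "zc k = 0" for k
    using gen_monomial(1)[OF that(1)] that(2) by (simp add: Rel_iff gen_def[symmetric])
  have p0: "p k \<in> carrier P \<and> H (rc (bas k 1)) = cl (p k)" if k: "k < m" "zc k = 0" for k
  proof -
    have "\<exists>p. p \<in> carrier P \<and> H (rc (bas k 1)) = cl p" using eta(1)[OF HA bR[OF k]] A_carrier by blast
    from someI_ex[OF this] show ?thesis using k(2) by (simp add: p_def)
  qed
  have pc: "p k \<in> carrier P" if k: "k < m" for k
  proof (cases "zc k = 0")
    case True
    then show ?thesis using p0[OF k] by blast
  next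
    case False
    then show ?thesis by (auto simp: p_def face_subset intro!: single_closed)
  qed
  have weight: "lookup (single (d - D k) (1 / zc k) * p k) t = (if t + eb = d + ea then \<omega> (link_face t) k else 0)"
    if o: "over d k" and t: "keys t \<in> X" for d k t
  proof -
    have z: "zc k \<noteq> 0" and dk: "D k + (d - D k) = d" using o below_diff unfolding over_def by blast+
    show ?thesis
    proof (cases "t + eb = d + ea")
      case True
      show ?thesis
      proof (cases "special k")
        case sp: True
        have "\<omega> (link_face t) k = 0" by (rule spec0[OF over_src(1,3)[OF o t True] sp])
        then show ?thesis using z sp by (simp add: p_def)
      next
        case ns: False
        note L = low_face[OF o ns t True]
        have "over (D k) k" using o by (simp add: over_def)
        moreover have "(D k + ea - eb) + eb = D k + ea"
          using ns below_diff[of eb "D k + ea"] unfolding not_special_below by (simp add: add.commute)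
        ultimately have ol: "over (src (link_face (D k + ea - eb))) k" using over_src(3)[OF _ L(2)] by blast
        have "\<omega> (link_face t) k = \<omega> (link_face (D k + ea - eb)) k"
          by (rule mono[OF L(3) over_src(1)[OF o t True] L(4) ol])
        then show ?thesis using z ns L(1,2) True by (simp add: p_def mult_single)
      qed
    next
      case False
      have "lookup (single (d - D k) (1 / zc k) * p k) t = 0"
      proof (rule ccontr)
        assume nz: "lookup (single (d - D k) (1 / zc k) * p k) t \<noteq> 0"
        then have ns: "\<not> special k" using z by (auto simp: p_def)
        have "t = (d - D k) + (D k + ea - eb)"
          using nz z by (auto simp: p_def mult_single lookup_single when_def split: if_splits)
        then have "t + eb = (d - D k) + (D k + ea - eb + eb)" by (simp only: add.assoc)
        also have "D k + ea - eb + eb = D k + ea"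
          using ns below_diff[of eb "D k + ea"] unfolding not_special_below by (simp add: add.commute)
        also have "(d - D k) + (D k + ea) = d + ea" using dk by (metis add.assoc add.commute)
        finally show False using False by simp
      qed
      then show ?thesis using False by simp
    qed
  qed
  let ?\<phi> = "ext_hom p"
  note \<phi> = ext_hom(2)[of p, OF pc]
  have v: "?\<phi> x \<in> carrier A" if "x \<in> carrier Fm" for x using mod_homD(1)[OF \<phi> that] by (simp add: NA_simps)
  have sm: "?\<phi> (r \<odot>\<^bsub>Fm\<^esub> x) = cl r \<otimes>\<^bsub>A\<^esub> ?\<phi> x" if "r \<in> carrier P" "x \<in> carrier Fm" for r x
    using mod_homD(4)[OF \<phi> that] by (simp add: NA_simps)
  have ad: "?\<phi> (x \<oplus>\<^bsub>Fm\<^esub> y) = ?\<phi> x \<oplus>\<^bsub>A\<^esub> ?\<phi> y" if "x \<in> carrier Fm" "y \<in> carrier Fm" for x y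
    using mod_homD(3)[OF \<phi> that] by (simp add: NA_simps)
  have on_rho: "H (rc (rho d k l)) = ?\<phi> (rho d k l)" if d: "keys d \<subseteq> {0..n}" and o: "over d k" "over d l" for d k l
  proof (rule A_eqI[OF eta(1)[OF HA rho_Rel[OF d o]] v[OF rho_carrier[OF d]]])
    fix t :: expo assume t: "keys t \<in> X"
    have km: "k < m" "l < m" using o by (simp_all add: over_def)
    have "(\<Sum>i<m. rho d k l i * p i) = (\<Sum>i<m. (if i = k then single (d - D k) (1 / zc k) * p k else 0) -
        (if i = l then single (d - D l) (1 / zc l) * p l else 0))"
      by (rule sum.cong) (auto simp: rho_def left_diff_distrib)
    also have "\<dots> = single (d - D k) (1 / zc k) * p k - single (d - D l) (1 / zc l) * p l"
      using km by (simp add: sum_subtractf)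
    finally have sum_eq: "(\<Sum>i<m. rho d k l i * p i) = single (d - D k) (1 / zc k) * p k - single (d - D l) (1 / zc l) * p l" .
    have "coef (?\<phi> (rho d k l)) t = lookup (\<Sum>i<m. rho d k l i * p i) t"
      using coef_cl[OF ext_hom(1)[of p, OF pc rho_carrier[OF d]] t] rho_carrier[OF d] by (simp add: ext_hom_def)
    also have "\<dots> = lookup (single (d - D k) (1 / zc k) * p k - single (d - D l) (1 / zc l) * p l) t"
      unfolding sum_eq ..
    also have "\<dots> = (if t + eb = d + ea then \<omega> (link_face t) k - \<omega> (link_face t) l else 0)"
      unfolding lookup_minus weight[OF o(1) t] weight[OF o(2) t] by simp
    also have "\<dots> = sg H d t k l"
    proof (cases "t + eb = d + ea")
      case True
      show ?thesis
        using True sg_face[OF HA d o t True] diff[OF over_src(1)[OF o(1) t True] over_src(3)[OF o(1) t True] over_src(3)[OF o(2) t True]]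
        by simp
    next
      case False
      then show ?thesis using sg_degree[OF H d o t] by auto
    qed
    finally show "coef (H (rc (rho d k l))) t = coef (?\<phi> (rho d k l)) t" by (simp add: sg_def)
  qed
  let ?N = "{r \<in> Rel. H (rc r) = ?\<phi> r}"
  have ops: "x \<oplus>\<^bsub>Fm\<^esub> y \<in> ?N" if "x \<in> ?N" "y \<in> ?N" for x y
  proof -
    have xy: "x \<in> Rel" "y \<in> Rel" "H (rc x) = ?\<phi> x" "H (rc y) = ?\<phi> y" using that by auto
    show ?thesis
      using Rel_closed(1)[OF xy(1,2)] eta(2)[OF HA xy(1,2)] ad[OF Rel_closed(4)[OF xy(1)] Rel_closed(4)[OF xy(2)]] xy(3,4)
      by simp
  qed
  have sops: "q \<odot>\<^bsub>Fm\<^esub> x \<in> ?N" if q: "q \<in> carrier P" and "x \<in> ?N" for q x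
  proof -
    have x: "x \<in> Rel" "H (rc x) = ?\<phi> x" using that by auto
    show ?thesis using Rel_closed(2)[OF q x(1)] eta(3)[OF HA q x(1)] sm[OF q Rel_closed(4)[OF x(1)]] x(2) by simp
  qed
  have z: "zero Fm \<in> ?N"
  proof -
    have "?\<phi> (zero Fm) = cl 0" using Fm_closed(3) by (simp add: ext_hom_def) (simp add: Fm_simps)
    then show ?thesis using eta(4)[OF HA Kos_closed(3)] Rel_closed(3) A_zero' by simp
  qed
  have bas: "bas k 1 \<in> ?N" if k: "k < m" "zc k = 0" for k
  proof -
    have "(\<Sum>i<m. bas k 1 i * p i) = (\<Sum>i<m. if i = k then p k else 0)"
      by (rule sum.cong) (auto simp: bas_def)
    also have "\<dots> = p k" using k(1) by simp
    finally have "?\<phi> (bas k 1) = cl (p k)" by (simp add: ext_hom_def)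
    then show ?thesis using p0[OF k] bR[OF k] by simp
  qed
  have "H (rc r) = ?\<phi> r" if r: "r \<in> Rel" for r
  proof -
    have "r \<in> ?N"
      by (rule Rel_generated[OF z ops sops _ bas r]) (use on_rho rho_Rel in blast)+
    then show ?thesis by simp
  qed
  then show ?thesis unfolding N2_iff using HA \<phi> by blast
qed

section \<open>From poset cocycles to homomorphisms\<close>

text \<open>The coefficient at \<open>x\<^sup>t\<close> that is assigned to a monomial multiple of the \<open>k\<close>-th basis vector: the cocycle on the
  pair formed by the face of the shifted generator and the face of \<open>t\<close>.\<close>

definition wt :: "(nat set \<times> nat set \<Rightarrow> complex) \<Rightarrow> nat \<Rightarrow> expo \<Rightarrow> complex" where
  "wt c k t = (if special k then 0 else c (link_face (D k + ea - eb), link_face t))"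

text \<open>The cocycle condition for the face of the generator, the face of \<open>t\<close> and the face of \<open>e + t\<close>. For a special
  generator the face of \<open>t\<close> lies in \<open>U1\<close> and all terms vanish.\<close>

lemma wt_split:
  assumes c: "c \<in> poset_Z1 U U1" and o: "over d k" and t: "keys t \<in> X" "t + eb = d + ea"
    and s: "keys (e + t) \<in> X"
  shows "wt c k (e + t) = wt c k t + c (link_face t, link_face (e + t))"
proof -
  have t': "(e + t) + eb = (e + d) + ea" using t(2) by (simp only: add.assoc)
  have o': "over (e + d) k" by (rule over_mono[OF o below_add(2)])
  note f = over_src(1,3)[OF o t]
  show ?thesis
  proof (cases "special k")
    case True
    have "link_face t \<in> U1" by (rule special_U1[OF f True])
    then show ?thesis using True poset_Z1D(1)[OF c, of "link_face t" "link_face (e + t)"] by (simp add: wt_def)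
  next
    case False
    note L = low_face(3,4)[OF o False t]
    have sub: "link_face t \<subseteq> link_face (e + t)" unfolding link_face_def keys_add_nat by blast
    show ?thesis
      using poset_Z1D(2)[OF c L(1) f(1) over_src(1)[OF o' s t'] L(2) sub] False by (simp add: wt_def)
  qed
qed

definition spread :: "(nat set \<times> nat set \<Rightarrow> complex) \<Rightarrow> (nat \<Rightarrow> mpoly) \<Rightarrow> mpoly" where
  "spread c r = (\<Sum>k<m. shift (wt c k) (gen k * r k))"

lemma lookup_spread: "lookup (spread c r) t =
    (if below ea t then \<Sum>k<m. wt c k t * lookup (gen k * r k) (t - ea + eb) else 0)"
  unfolding spread_def lookup_sum lookup_shift by simp

lemma spread_closed: "r \<in> carrier Fm \<Longrightarrow> spread c r \<in> carrier P"
  unfolding spread_def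
proof (intro sum_closed shift_closed poly_ring_closed)
  show "gen k \<in> carrier P" for k unfolding gen_def by (rule j_props(1)[OF bas_closed]) simp
  show "r k \<in> carrier P" if "r \<in> carrier Fm" "k \<in> {..<m}" for k using Fm_closed(4) that by simp
qed

lemma spread_add: "spread c (x \<oplus>\<^bsub>Fm\<^esub> y) = spread c x + spread c y"
  unfolding spread_def sum.distrib[symmetric]
  by (rule sum.cong) (simp_all add: Fm_simps(3) distrib_left shift_add)

text \<open>Multiplying by \<open>x\<^sup>e\<close> after the shift instead of before it changes all weights by the same amount, by \<open>wt_split\<close>, and
  a common weight gives 0 on a relation. If the shift is possible only after the multiplication, then only
  special generators are involved, and their weight is 0.\<close>

lemma spread_linear:
  assumes c: "c \<in> poset_Z1 U U1" and p: "p \<in> carrier P" and r: "r \<in> Rel"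
  shows "cl (spread c (p \<odot>\<^bsub>Fm\<^esub> r)) = cl p \<otimes>\<^bsub>A\<^esub> cl (spread c r)"
proof -
  note rc = Rel_closed(4)[OF r]
  have "cl (spread c (p \<odot>\<^bsub>Fm\<^esub> r)) = cl (p * spread c r)"
    unfolding cl_eq_iff[OF spread_closed[OF Fm_closed(2)[OF p rc]] poly_ring_closed(5)[OF p spread_closed[OF rc]]]
  proof (intro allI impI)
    fix t :: expo assume t: "keys t \<in> X"
    let ?L = "\<lambda>k s. lookup (gen k * r k) s"
    let ?u = "t - ea + eb"
    have term_eq: "(if below ea t \<and> below e ?u then \<Sum>k<m. wt c k t * ?L k (?u - e) else 0)
        = (if below e t then lookup (spread c r) (t - e) else 0)" for e
    proof (cases "below e t \<and> below ea (t - e)")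
      case True
      then have ix: "below ea t" "below e ?u" "?u - e = t - e - ea + eb" using shift_index by blast+
      let ?u' = "t - e - ea + eb"
      have deg: "(t - e) + eb = ?u' + ea" using True degree_shift_iff by blast
      have X: "keys (t - e) \<in> X" by (rule face_down[OF t keys_diff_nat])
      have t': "e + (t - e) = t" using True below_diff by blast
      let ?c = "c (link_face (t - e), link_face t)"
      have split: "wt c k t * ?L k ?u' = wt c k (t - e) * ?L k ?u' + ?c * ?L k ?u'" if k: "k < m" for k
      proof (cases "?L k ?u' = 0")
        case False
        then have o: "over ?u' k" using k unfolding lookup_gen_mult[OF k] by (auto simp: over_def split: if_splits)
        have "wt c k t = wt c k (t - e) + ?c"
          using wt_split[OF c o X deg, of e] t unfolding t' by blast
        then show ?thesis by (simp only: distrib_right)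
      qed simp
      have "(\<Sum>k<m. wt c k t * ?L k ?u') = (\<Sum>k<m. wt c k (t - e) * ?L k ?u' + ?c * ?L k ?u')"
        by (rule sum.cong[OF refl]) (simp add: split)
      also have "\<dots> = (\<Sum>k<m. wt c k (t - e) * ?L k ?u') + ?c * lookup (j r) ?u'"
        unfolding j_eq[OF rc] lookup_sum by (simp only: sum.distrib sum_distrib_left)
      also have "\<dots> = (\<Sum>k<m. wt c k (t - e) * ?L k ?u')" using r by (simp add: Rel_iff)
      finally show ?thesis using True ix by (simp add: lookup_spread)
    next
      case False
      have "(\<Sum>k<m. wt c k t * ?L k (?u - e)) = 0" if b: "below ea t" "below e ?u"
      proof (rule sum.neutral, rule ballI)
        fix k assume "k \<in> {..<m}"
        then have k: "k < m" by simp
        obtain v where v: "v \<in> Bs" "lookup (?u - e) v < b v" using shift_defect[OF False b] by blast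
        show "wt c k t * ?L k (?u - e) = 0"
        proof (cases "below (D k) (?u - e)")
          case True
          then have "lookup (D k) v \<le> lookup (?u - e) v" unfolding below_def by blast
          then have "lookup (D k) v < b v" using v(2) by (rule le_less_trans)
          then have "special k" using v(1) special_def by blast
          then show ?thesis by (simp add: wt_def)
        qed (simp add: lookup_gen_mult[OF k])
      qed
      then show ?thesis using False by (auto simp: lookup_spread)
    qed
    have "lookup (spread c (p \<odot>\<^bsub>Fm\<^esub> r)) t = (if below ea t then \<Sum>k<m. wt c k t * lookup (p * (gen k * r k)) ?u else 0)"
    proof -
      have "lookup (gen k * (p \<odot>\<^bsub>Fm\<^esub> r) k) ?u = lookup (p * (gen k * r k)) ?u" if "k < m" for k
        using that by (simp add: Fm_simps(4) mult.left_commute)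
      then show ?thesis unfolding lookup_spread by (auto intro!: sum.cong)
    qed
    also have "\<dots> = (\<Sum>e\<in>keys p. lookup p e * (if below ea t \<and> below e ?u then \<Sum>k<m. wt c k t * ?L k (?u - e) else 0))"
    proof (cases "below ea t")
      case True
      have "(\<Sum>k<m. wt c k t * lookup (p * (gen k * r k)) ?u) =
          (\<Sum>k<m. \<Sum>e\<in>keys p. wt c k t * (if below e ?u then lookup p e * ?L k (?u - e) else 0))"
        unfolding lookup_mult_sum[of p] sum_distrib_left ..
      also have "\<dots> = (\<Sum>e\<in>keys p. \<Sum>k<m. wt c k t * (if below e ?u then lookup p e * ?L k (?u - e) else 0))"
        by (rule sum.swap)
      also have "\<dots> = (\<Sum>e\<in>keys p. lookup p e * (if below e ?u then \<Sum>k<m. wt c k t * ?L k (?u - e) else 0))"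
        by (rule sum.cong[OF refl]) (simp add: sum_distrib_left mult.left_commute)
      finally show ?thesis using True by simp
    qed simp
    also have "\<dots> = (\<Sum>e\<in>keys p. lookup p e * (if below e t then lookup (spread c r) (t - e) else 0))"
      by (simp only: term_eq)
    also have "\<dots> = lookup (p * spread c r) t"
      unfolding lookup_mult_sum[of p "spread c r" t] by (rule sum.cong[OF refl]) simp
    finally show "lookup (spread c (p \<odot>\<^bsub>Fm\<^esub> r)) t = lookup (p * spread c r) t" .
  qed
  then show ?thesis unfolding A_mult[OF p spread_closed[OF rc]] .
qed

text \<open>The cofactor has a nonface as support, so it contains a variable \<open>x\<^sub>v\<close> that is missing in \<open>x\<^sup>t\<close>. Then \<open>v\<close> lies in
  \<open>b\<close>, and the generator cannot contain the full power \<open>b v\<close>.\<close>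

lemma ideal_coordinate_special:
  assumes p: "p \<in> I" and k: "k < m" and t: "keys t \<in> X" "below ea t"
    and nz: "lookup (gen k * p) (t - ea + eb) \<noteq> 0"
  shows "special k"
proof -
  let ?u = "t - ea + eb"
  have b: "below (D k) ?u" "lookup p (?u - D k) \<noteq> 0"
    using nz unfolding lookup_gen_mult[OF k] by (auto split: if_splits)
  have "keys (?u - D k) \<notin> X" by (rule I_nonface[OF p b(2)])
  then have "\<not> keys (?u - D k) \<subseteq> keys t" using face_down[OF t(1)] by blast
  then obtain v where v: "v \<in> keys (?u - D k)" "v \<notin> keys t" by blast
  have "lookup t v = 0" using v(2) by (simp add: in_keys_iff)
  then have lt: "lookup (D k) v < lookup eb v" using v(1) by (simp add: in_keys_iff lookup_minus lookup_add)
  then have "v \<in> keys eb" by (simp add: in_keys_iff)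
  then have "v \<in> Bs" using keys_eb by blast
  then show ?thesis using lt on_Bs(2) special_def by auto
qed

text \<open>All coordinates of a Koszul relation lie in the ideal, so only special generators could contribute.\<close>

lemma spread_koszul:
  assumes c: "c \<in> poset_Z1 U U1" and d: "d \<in> Kos"
  shows "cl (spread c d) = I"
proof -
  have rI: "cl p \<otimes>\<^bsub>A\<^esub> I = I" if "p \<in> carrier P" for p using AA.r_null[OF cl_in_A[OF that]] by (simp only: A_zero)
  have II0: "I \<oplus>\<^bsub>A\<^esub> I = I" using AA.l_zero[OF AA.zero_closed] by (simp only: A_zero)
  have "submodule {r \<in> Rel. cl (spread c r) = I} P Fm"
  proof (rule submodule_FmI)
    show "{r \<in> Rel. cl (spread c r) = I} \<subseteq> carrier Fm" using Rel_closed(4) by blast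
    have "spread c (zero Fm) = 0" by (simp add: spread_def Fm_simps(2))
    then show "zero Fm \<in> {r \<in> Rel. cl (spread c r) = I}"
      using Rel_closed(3) II.a_rcos_const[OF I_zero] by simp
    show "x \<oplus>\<^bsub>Fm\<^esub> y \<in> {r \<in> Rel. cl (spread c r) = I}"
      if "x \<in> {r \<in> Rel. cl (spread c r) = I}" "y \<in> {r \<in> Rel. cl (spread c r) = I}" for x y
    proof -
      have xy: "x \<in> Rel" "y \<in> Rel" "cl (spread c x) = I" "cl (spread c y) = I" using that by auto
      have "cl (spread c (x \<oplus>\<^bsub>Fm\<^esub> y)) = cl (spread c x) \<oplus>\<^bsub>A\<^esub> cl (spread c y)"
        unfolding spread_add by (rule A_add[symmetric]) (use xy Rel_closed(4) spread_closed in blast)+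
      then show ?thesis using Rel_closed(1)[OF xy(1,2)] xy(3,4) II0 by simp
    qed
    show "p \<odot>\<^bsub>Fm\<^esub> x \<in> {r \<in> Rel. cl (spread c r) = I}"
      if p: "p \<in> carrier P" and "x \<in> {r \<in> Rel. cl (spread c r) = I}" for p x
    proof -
      have x: "x \<in> Rel" "cl (spread c x) = I" using that by auto
      show ?thesis using Rel_closed(2)[OF p x(1)] spread_linear[OF c p x(1)] x(2) rI[OF p] by simp
    qed
  qed
  moreover have "koszul_gens \<subseteq> {r \<in> Rel. cl (spread c r) = I}"
  proof
    fix x assume x: "x \<in> koszul_gens"
    then have xR: "x \<in> Rel" using koszul_gens_Rel by blast
    obtain e f where ef: "e \<in> carrier Fm" "f \<in> carrier Fm" "x = (\<lambda>k\<in>{..<m}. j f * e k - j e * f k)"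
      using x unfolding koszul_gens_def by blast
    have xI: "x k \<in> I" if k: "k < m" for k
    proof -
      have "e k * j f + (- f k) * j e \<in> I"
        by (intro I_add I_mult j_props(2) ef(1,2) poly_ring_closed Fm_closed(4)[OF ef(1) k] Fm_closed(4)[OF ef(2) k])
      moreover have "x k = e k * j f + (- f k) * j e" using k by (simp add: ef(3) mult.commute)
      ultimately show ?thesis by simp
    qed
    have "spread c x \<in> I"
      unfolding I_iff
    proof (intro conjI allI impI spread_closed[OF Rel_closed(4)[OF xR]])
      fix t :: expo assume t: "keys t \<in> X"
      have "(\<Sum>k<m. wt c k t * lookup (gen k * x k) (t - ea + eb)) = 0" if bt: "below ea t"
      proof (rule sum.neutral, rule ballI)
        fix k assume "k \<in> {..<m}"
        then have k: "k < m" by simp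
        show "wt c k t * lookup (gen k * x k) (t - ea + eb) = 0"
          using ideal_coordinate_special[OF xI[OF k] k t bt] by (auto simp: wt_def)
      qed
      then show "lookup (spread c x) t = 0" by (simp add: lookup_spread)
    qed
    then have "cl (spread c x) = I" by (rule II.a_rcos_const)
    then show "x \<in> {r \<in> Rel. cl (spread c r) = I}" using xR by simp
  qed
  ultimately have "Kos \<subseteq> {r \<in> Rel. cl (spread c r) = I}" by (rule Kos_least)
  then show ?thesis using d by blast
qed

lemma poly_grading_sum: "(\<And>k. k \<in> K \<Longrightarrow> p k \<in> poly_grading n d) \<Longrightarrow> (\<Sum>k\<in>K. p k) \<in> poly_grading n d"
proof (induction K rule: infinite_finite_induct)
  case (insert x F)
  have "p x \<in> poly_grading n d" "sum p F \<in> poly_grading n d" using insert by auto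
  then have "p x + sum p F \<in> poly_grading n d"
    using keys_add[of "p x" "sum p F"] by (auto simp: poly_grading_def)
  then show ?case using insert(1,2) by simp
qed simp_all

lemma spread_grading:
  assumes r: "r \<in> Rel \<inter> free_grading n m Deg d"
  shows "spread c r \<in> poly_grading n (\<lambda>i. d i + cdeg i)"
  unfolding spread_def
proof (intro poly_grading_sum shift_grading)
  fix k assume "k \<in> {..<m}"
  then have k: "k < m" by simp
  have rk: "r k \<in> poly_grading n (\<lambda>i. d i - Deg k i)" using r k unfolding free_grading_def by blast
  then have rc: "r k \<in> carrier P" by (simp add: poly_grading_def)
  have "bas k (r k) \<in> free_grading n m Deg d"
    unfolding free_grading_def mem_Collect_eq
  proof (intro conjI allI impI bas_closed[OF rc])
    fix i assume "i < m"
    then show "bas k (r k) i \<in> poly_grading n (\<lambda>i'. d i' - Deg i i')" using rk by (auto simp: bas_def)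
  qed
  then have "j (bas k (r k)) \<in> poly_grading n d" by (rule j_props(6))
  moreover have "j (bas k (r k)) = gen k * r k"
    using j_props(4)[OF rc bas_closed[of 1 k]] by (simp add: smult_bas gen_def mult.commute)
  ultimately show "gen k * r k \<in> poly_grading n d" by simp
qed

text \<open>The cocycle of the spread homomorphism differs from \<open>c\<close> by the coboundary of the weights of the
  representatives.\<close>

lemma rel_coefs_surj:
  assumes c: "c \<in> poset_Z1 U U1"
  shows "\<exists>H\<in>Hom2c. (\<lambda>p. c p - rel_coefs H p) \<in> poset_B1 U U1"
proof -
  define H where "H = descend (\<lambda>r. cl (spread c r))"
  note sc = spread_closed[OF Rel_closed(4)]
  have H: "H \<in> HA" "\<And>r. r \<in> Rel \<Longrightarrow> H (rc r) = cl (spread c r)"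
  proof -
    note d = descend[of "\<lambda>r. cl (spread c r)"]
    have 1: "cl (spread c r) \<in> carrier A" if "r \<in> Rel" for r by (rule cl_in_A[OF sc[OF that]])
    have 2: "cl (spread c (r \<oplus>\<^bsub>Fm\<^esub> s)) = cl (spread c r) \<oplus>\<^bsub>A\<^esub> cl (spread c s)" if "r \<in> Rel" "s \<in> Rel" for r s
      unfolding spread_add by (rule A_add[OF sc[OF that(1)] sc[OF that(2)], symmetric])
    show "H \<in> HA" unfolding H_def by (rule d(1)[OF 1 2 spread_linear[OF c] spread_koszul[OF c]])
    show "H (rc r) = cl (spread c r)" if "r \<in> Rel" for r
      unfolding H_def by (rule d(2)[OF 1 2 spread_linear[OF c] spread_koszul[OF c] that])
  qed
  have Hc: "H \<in> Hom2c"
    unfolding Hom2c_iff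
  proof (intro conjI allI ballI H(1))
    fix d r assume r: "r \<in> Rel \<inter> free_grading n m Deg d"
    show "H (rc r) \<in> quot_ring_grading n I (\<lambda>i. d i + cdeg i)"
      unfolding H(2)[OF IntD1[OF r]] by (rule quot_ring_gradingI[OF spread_grading[OF r]])
  qed
  define u where "u f = (if f \<in> U then wt c (rep f) (tgt f) else 0)" for f
  have vals: "rel_coefs H (f, g) = u f + c (f, g) - u g" if fg: "f \<in> U" "g \<in> U" "f \<subseteq> g" for f g
  proof -
    note s = src_subset[OF fg(2)]
    have o: "over (src g) (rep f)" "over (src g) (rep g)"
      by (rule over_src_mono[OF fg rep(1)[OF fg(1)]], rule rep(1)[OF fg(2)])
    have km: "rep f < m" "rep g < m" using o by (simp_all add: over_def)
    note rR = rho_Rel[OF s o]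
    have deg: "tgt g + eb = src g + ea" "tgt f + eb = src f + ea" by (simp_all add: source_target)
    have bt: "below ea (tgt g)" "src g = tgt g - ea + eb" using deg(1) degree_shift_iff by blast+
    have gr: "gen k * rho (src g) (rep f) (rep g) k = (if k = rep f then single (src g) 1 else 0) - (if k = rep g then single (src g) 1 else 0)"
      if "k < m" for k
      using that gen_mult_part[OF o(1)] gen_mult_part[OF o(2)] by (auto simp: rho_def right_diff_distrib)
    have "sg H (src g) (tgt g) (rep f) (rep g) = lookup (spread c (rho (src g) (rep f) (rep g))) (tgt g)"
      unfolding sg_def H(2)[OF rR] by (rule coef_cl[OF sc[OF rR] tgt_X[OF fg(2)]])
    also have "\<dots> = (\<Sum>k<m. wt c k (tgt g) * lookup (gen k * rho (src g) (rep f) (rep g) k) (src g))"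
      using bt by (simp add: lookup_spread)
    also have "\<dots> = (\<Sum>k<m. (if k = rep f then wt c k (tgt g) else 0) - (if k = rep g then wt c k (tgt g) else 0))"
      by (rule sum.cong[OF refl]) (auto simp: gr lookup_minus)
    also have "\<dots> = wt c (rep f) (tgt g) - wt c (rep g) (tgt g)" using km by (simp add: sum_subtractf)
    finally have sgv: "sg H (src g) (tgt g) (rep f) (rep g) = wt c (rep f) (tgt g) - wt c (rep g) (tgt g)" .
    obtain e where e: "keys e \<subseteq> {0..n}" "src g = e + src f" "tgt g = e + tgt f" using src_tgt_shift[OF fg] by blast
    have gX: "keys (e + tgt f) \<in> X" using tgt_X[OF fg(2)] unfolding e(3) .
    have "wt c (rep f) (tgt g) = wt c (rep f) (tgt f) + c (link_face (tgt f), link_face (tgt g))"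
      unfolding e(3) by (rule wt_split[OF c rep(1)[OF fg(1)] tgt_X[OF fg(1)] deg(2) gX])
    then show ?thesis
      using sgv fg link_face_target[OF fg(1) Kb_pos] link_face_target[OF fg(2) Kb_pos]
      by (simp add: rel_coefs_def u_def)
  qed
  have "(\<lambda>p. c p - rel_coefs H p) = poset_delta U u"
  proof
    fix p :: "nat set \<times> nat set"
    obtain f g where p: "p = (f, g)" by fastforce
    show "c p - rel_coefs H p = poset_delta U u p"
    proof (cases "f \<in> U \<and> g \<in> U \<and> f \<subseteq> g")
      case True
      then show ?thesis using vals[of f g] by (simp add: p poset_delta_def)
    next
      case False
      then have "c (f, g) = 0" by (intro poset_Z1D(1)[OF c]) blast
      then show ?thesis using False by (auto simp: p rel_coefs_def poset_delta_def)
    qed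
  qed
  moreover have "u f = 0" if f: "f \<in> U1" for f
  proof (cases "f \<in> U")
    case True
    then show ?thesis using rep(2)[OF True f] by (simp add: u_def wt_def)
  qed (simp add: u_def)
  ultimately have "(\<lambda>p. c p - rel_coefs H p) \<in> poset_B1 U U1" unfolding poset_B1_def by blast
  then show ?thesis using Hc by blast
qed

lemma T2_piece_vector_quotient: "vector_quotient (T2_piece n I m Deg j cdeg) (poset_Z1 U U1) (poset_B1 U U1)"
proof (rule vector_quotient_quot[where M = Hom2 and N = N2 and s = "\<lambda>z. cl (poly_const z)"
      and G = Hom2c and F = rel_coefs])
  have carr: "carrier Hom2 = HA" by (simp add: Hom2_eq hom_module_simps)
  have const: "cl (poly_const z) \<in> carrier A" for z by (rule cl_in_A[OF poly_const_closed])
  show "abelian_group Hom2" unfolding Hom2_eq by (rule H2.hom_abelian_group)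
  show "additive_subgroup N2 Hom2" by (rule N2_subgroup)
  show "Hom2c \<subseteq> carrier Hom2" unfolding carr using Hom2c_HA by blast
  show "cl (poly_const z) \<odot>\<^bsub>Hom2\<^esub> (x \<oplus>\<^bsub>Hom2\<^esub> y) = cl (poly_const z) \<odot>\<^bsub>Hom2\<^esub> x \<oplus>\<^bsub>Hom2\<^esub> cl (poly_const z) \<odot>\<^bsub>Hom2\<^esub> y"
    if "x \<in> carrier Hom2" "y \<in> carrier Hom2" for z x y
    using H2.hom_smult_distr[OF that[unfolded carr] const] unfolding Hom2_eq .
  show "cl (poly_const z) \<odot>\<^bsub>Hom2\<^esub> x \<in> carrier Hom2" if "x \<in> carrier Hom2" for z x
    using Hom2_closed(2)[OF _ const] that unfolding carr by blast
  show "cl (poly_const z) \<odot>\<^bsub>Hom2\<^esub> x \<in> N2" if "x \<in> N2" for z x by (rule N2_smult[OF that poly_const_closed])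
  show "carrier (T2_piece n I m Deg j cdeg) = (\<lambda>x. N2 +>\<^bsub>Hom2\<^esub> x) ` Hom2c"
    by (simp add: T2_piece_def quot_grading_def)
  show "add (T2_piece n I m Deg j cdeg) = set_add Hom2"
    by (simp add: T2_piece_def T2_def restrict_scalars_def quot_module_def)
  show "z \<odot>\<^bsub>T2_piece n I m Deg j cdeg\<^esub> x = (\<Union>y\<in>x. N2 +>\<^bsub>Hom2\<^esub> (cl (poly_const z) \<odot>\<^bsub>Hom2\<^esub> y))" for z x
    by (simp add: T2_piece_def T2_def restrict_scalars_def quot_module_def)
  show "rel_coefs x \<in> poset_B1 U U1 \<longleftrightarrow> x \<in> N2" if "x \<in> Hom2c" for x
    using extends_imp_B1[OF Hom2c_HA[OF that]] B1_imp_extends[OF that] by blast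
  show "\<exists>x\<in>Hom2c. (\<lambda>i. v i - rel_coefs x i) \<in> poset_B1 U U1" if "v \<in> poset_Z1 U U1" for v
    by (rule rel_coefs_surj[OF that])
  show "\<ominus>\<^bsub>Hom2\<^esub> x = cl (poly_const (-1)) \<odot>\<^bsub>Hom2\<^esub> x" if "x \<in> Hom2c" for x by (rule Hom2_neg[OF Hom2c_HA[OF that]])
  show "rel_coefs (x \<oplus>\<^bsub>Hom2\<^esub> y) = (\<lambda>i. rel_coefs x i + rel_coefs y i)" if "x \<in> Hom2c" "y \<in> Hom2c" for x y
    by (rule rel_coefs_linear(1)[OF Hom2c_HA[OF that(1)] Hom2c_HA[OF that(2)]])
  show "rel_coefs (cl (poly_const z) \<odot>\<^bsub>Hom2\<^esub> x) = (\<lambda>i. z * rel_coefs x i)" if "x \<in> Hom2c" for z x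
    by (rule rel_coefs_linear(2)[OF Hom2c_HA[OF that]])
qed (assumption | rule Hom2c_closed poset_Z1_closed poset_B1_closed rel_coefs_Z1)+

lemma T2_piece_zero: "\<zero>\<^bsub>T2_piece n I m Deg j cdeg\<^esub> \<in> carrier (T2_piece n I m Deg j cdeg)"
proof -
  interpret H: abelian_group Hom2 unfolding Hom2_eq by (rule H2.hom_abelian_group)
  have z: "\<zero>\<^bsub>Hom2\<^esub> \<in> Hom2c"
    unfolding Hom2c_iff
  proof (intro conjI allI ballI)
    show "\<zero>\<^bsub>Hom2\<^esub> \<in> HA" using H2.hom_zero by (simp add: Hom2_eq hom_module_simps)
    fix d r assume r: "r \<in> Rel \<inter> free_grading n m Deg d"
    have "\<zero>\<^bsub>Hom2\<^esub> (rc r) = I" using IntD1[OF r] by (simp add: Hom2_eq hom_module_simps RQ_carrier RA_simps A_zero)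
    also have "\<dots> = cl 0" by (rule A_zero')
    finally show "\<zero>\<^bsub>Hom2\<^esub> (rc r) \<in> quot_ring_grading n I (\<lambda>i. d i + cdeg i)"
      using quot_ring_gradingI[OF poly_grading_zero] by simp
  qed
  have sub: "N2 \<subseteq> carrier Hom2" using N2_iff by (auto simp: Hom2_eq hom_module_simps)
  have "\<zero>\<^bsub>T2_piece n I m Deg j cdeg\<^esub> = N2"
    by (simp add: T2_piece_def T2_def restrict_scalars_def quot_module_def)
  also have "\<dots> = N2 +>\<^bsub>Hom2\<^esub> \<zero>\<^bsub>Hom2\<^esub>" using H.a_coset_add_zero[OF sub] by simp
  finally show ?thesis using z by (simp add: T2_piece_def quot_grading_def)
qed

end

section \<open>Comparison with the geometric side\<close>

lemma vector_quotient_trivial: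
  assumes "vector_quotient M V N" "V \<subseteq> {\<lambda>_. 0}" "z \<in> carrier M"
  shows "carrier M = {z}"
proof -
  obtain \<pi> where "linear_presentation \<pi> M V N" using assms(1) unfolding vector_quotient_def by blast
  then have "\<pi> ` V = carrier M" by (simp add: linear_presentation_def)
  then have "carrier M \<subseteq> {\<pi> (\<lambda>_. 0)}" using assms(2) by blast
  then show ?thesis using assms(3) by blast
qed

text \<open>Cocycles vanish on \<open>U'\<close>, which here is everything.\<close>

lemma poset_Z_trivial:
  assumes "U \<subseteq> U'"
  shows "poset_Z0 U U' \<subseteq> {\<lambda>_. 0}" "poset_Z1 U U' \<subseteq> {\<lambda>_. 0}"
proof -
  show "poset_Z0 U U' \<subseteq> {\<lambda>_. 0}"
  proof
    fix l assume l: "l \<in> poset_Z0 U U'"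
    have "l f = 0" for f by (rule poset_Z0D(1)[OF l]) (use assms in blast)
    then show "l \<in> {\<lambda>_. 0}" by (simp add: fun_eq_iff)
  qed
  show "poset_Z1 U U' \<subseteq> {\<lambda>_. 0}"
  proof
    fix c assume c: "c \<in> poset_Z1 U U'"
    have "c (f, g) = 0" for f g by (rule poset_Z1D(1)[OF c]) (use assms in blast)
    then show "c \<in> {\<lambda>_. 0}" by (simp add: fun_eq_iff)
  qed
qed

text \<open>The augmentation changes the coboundaries in degree 0 only.\<close>

lemma reduced_cohomology_1: "reduced_cohomology 1 T = rel_cohomology 1 T {}"
  unfolding One_nat_def by (simp add: reduced_cohomology_def rel_cohomology_def reduced_coboundaries_def)

theorem theorem13:
  fixes n m :: nat and X :: "nat set set" and a b :: "nat \<Rightarrow> nat"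
    and Deg :: "nat \<Rightarrow> mdeg" and j :: "(nat \<Rightarrow> mpoly) \<Rightarrow> mpoly"
  assumes "simplicial_complex_on n X"
    and "graded_presentation n (stanley_reisner_ideal n X) m Deg j"
    and "vec_support n a \<inter> vec_support n b = {}"
  shows "let c = (\<lambda>i. int (a i) - int (b i));
             A = vec_support n a; B = vec_support n b;
             T1c = T1_piece n (stanley_reisner_ideal n X) c;
             T2c = T2_piece n (stanley_reisner_ideal n X) m Deg j c;
             Y = link A X;
             U = geom_subset n Y (U_faces B Y);
             U' = geom_subset n Y (U_tilde_faces B Y);
             admissible = (A \<in> X \<and> (\<forall>i\<le>n. b i \<in> {0, 1}) \<and> B \<noteq> {})
         in (\<not> admissible \<longrightarrow> carrier T1c = {\<zero>\<^bsub>T1c\<^esub>} \<and> carrier T2c = {\<zero>\<^bsub>T2c\<^esub>}) \<and>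
            (admissible \<and> card B \<noteq> 1 \<longrightarrow>
               mod_isomorphic complex_field T1c (rel_cohomology 0 (top_of_set U) U') \<and>
               mod_isomorphic complex_field T2c (rel_cohomology 1 (top_of_set U) U')) \<and>
            (admissible \<and> card B = 1 \<longrightarrow>
               mod_isomorphic complex_field T1c (reduced_cohomology 0 (top_of_set U)) \<and>
               mod_isomorphic complex_field T2c (reduced_cohomology 1 (top_of_set U)))"
proof -
  interpret pr: presented n X a b m Deg j
    by unfold_locales (fact assms)+
  let ?I = "stanley_reisner_ideal n X" and ?c = "\<lambda>i. int (a i) - int (b i)"
  let ?A = "vec_support n a" and ?B = "vec_support n b"
  let ?Y = "link ?A X"
  let ?W = "geom_subset n ?Y (U_faces ?B ?Y)" and ?W' = "geom_subset n ?Y (U_tilde_faces ?B ?Y)"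
  let ?adm = "?A \<in> X \<and> (\<forall>i\<le>n. b i \<in> {0, 1}) \<and> ?B \<noteq> {}"
  note T1 = pr.T1_piece_vector_quotient and T2 = pr.T2_piece_vector_quotient
  have U: "pr.U = U_faces ?B ?Y" unfolding pr.U_def pr.Bs_def pr.Y_def pr.As_def ..
  have nonadm: "carrier (T1_piece n ?I ?c) = {\<zero>\<^bsub>T1_piece n ?I ?c\<^esub>} \<and>
      carrier (T2_piece n ?I m Deg j ?c) = {\<zero>\<^bsub>T2_piece n ?I m Deg j ?c\<^esub>}" if na: "\<not> ?adm"
  proof -
    have "pr.U \<subseteq> pr.U1"
    proof
      fix f assume f: "f \<in> pr.U"
      then have fA: "f \<union> ?A \<in> X" "f \<union> ?A \<union> ?B \<notin> X" unfolding pr.U_iff pr.As_def pr.Bs_def by blast+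
      have "?A \<in> X" by (rule pr.face_down[OF fA(1)]) blast
      moreover have "?B \<noteq> {}" using fA by auto
      ultimately obtain i where i: "i \<le> n" "b i \<notin> {0, 1}" using na by blast
      then have "i \<in> pr.Bs" "2 \<le> b i" by (auto simp: pr.Bs_def vec_support_def)
      then show "f \<in> pr.U1" using f unfolding pr.U1_def by blast
    qed
    note triv = poset_Z_trivial[OF this]
    show ?thesis
      using vector_quotient_trivial[OF T1 triv(1) pr.T1_piece_zero] vector_quotient_trivial[OF T2 triv(2) pr.T2_piece_zero]
      by blast
  qed
  have geom: "stratified_space (top_of_set ?W) (carrier_face n) face_point pr.U pr.U1"
      "{x \<in> topspace (top_of_set ?W). carrier_face n x \<in> pr.U1} = ?W'"
      "pr.U1 = U_tilde_faces ?B ?Y" if adm: "?adm"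
  proof -
    have down: "g \<in> ?Y" if "f \<in> ?Y" "g \<subseteq> f" for f g
    proof -
      have f: "f \<inter> ?A = {}" "f \<union> ?A \<in> X" using \<open>f \<in> ?Y\<close> unfolding link_def by blast+
      have "g \<union> ?A \<in> X" "g \<in> X" by (rule pr.face_down[OF f(2)]; use \<open>g \<subseteq> f\<close> in blast)+
      then show ?thesis using f(1) \<open>g \<subseteq> f\<close> unfolding link_def by blast
    qed
    have Yn: "?Y \<subseteq> Pow {0..n}" unfolding link_def using pr.face_subset by blast
    have b1: "\<not> 2 \<le> b v" if "v \<in> ?B" for v
    proof -
      have "v \<le> n" using that by (simp add: vec_support_def)
      then have "b v \<in> {0, 1}" using adm by blast
      then show ?thesis by auto
    qed
    show U1: "pr.U1 = U_tilde_faces ?B ?Y"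
    proof (rule Set.set_eqI)
      fix f
      have "f \<union> ?B \<notin> ?Y" if "f \<union> ?B - {v} \<notin> ?Y" for v
        using down[of "f \<union> ?B" "f \<union> ?B - {v}"] that by blast
      then show "f \<in> pr.U1 \<longleftrightarrow> f \<in> U_tilde_faces ?B ?Y"
        unfolding pr.U1_def pr.Bs_def pr.Y_def pr.As_def U U_faces_def U_tilde_faces_def mem_Collect_eq
        using b1 by blast
    qed
    have U1U: "pr.U1 \<subseteq> pr.U" unfolding pr.U1_def by blast
    have UY: "pr.U \<subseteq> ?Y" unfolding U U_faces_def by blast
    have up: "g \<in> pr.U" if "f \<in> pr.U" "f \<subseteq> g" "g \<in> ?Y" for f g
    proof -
      have "f \<union> ?B \<notin> ?Y" using that(1) unfolding U U_faces_def by blast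
      then have "g \<union> ?B \<notin> ?Y" using down[of "g \<union> ?B" "f \<union> ?B"] that(2) by blast
      then show ?thesis using that(3) unfolding U U_faces_def by blast
    qed
    have up1: "g \<in> pr.U1" if fg: "f \<in> pr.U1" "f \<subseteq> g" "g \<in> ?Y" for f g
    proof -
      obtain v where v: "v \<in> ?B" "f \<union> ?B - {v} \<notin> ?Y" using fg(1) unfolding U1 U_tilde_faces_def by blast
      then have "g \<union> ?B - {v} \<notin> ?Y" using down[of "g \<union> ?B - {v}" "f \<union> ?B - {v}"] fg(2) by blast
      then show ?thesis using v(1) fg(3) unfolding U1 U_tilde_faces_def by blast
    qed
    note G = geom_stratified[OF Yn down UY up U1U up1]
    show "stratified_space (top_of_set ?W) (carrier_face n) face_point pr.U pr.U1" using G(1) unfolding U .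
    show "{x \<in> topspace (top_of_set ?W). carrier_face n x \<in> pr.U1} = ?W'" using G(2) unfolding U[symmetric] U1[symmetric] .
  qed
  have many: "mod_isomorphic complex_field (T1_piece n ?I ?c) (rel_cohomology 0 (top_of_set ?W) ?W') \<and>
      mod_isomorphic complex_field (T2_piece n ?I m Deg j ?c) (rel_cohomology 1 (top_of_set ?W) ?W')"
    if adm: "?adm" and card: "card ?B \<noteq> 1"
  proof -
    interpret st: stratified_space "top_of_set ?W" "carrier_face n" face_point pr.U pr.U1 by (rule geom(1)[OF adm])
    have "eb' \<noteq> single v 1" if "eb' = pr.eb" for v eb'
    proof
      assume "eb' = single v 1"
      then have "keys pr.eb = {v}" using that by simp
      then have "?B = {v}" using pr.keys_eb pr.Bs_def by simp
      then show False using card by simp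
    qed
    then have "pr.trivial_coefs = {\<lambda>_. 0}" unfolding pr.trivial_coefs_def by auto
    then have "vector_quotient (T1_piece n ?I ?c) (poset_Z0 pr.U pr.U1) {\<lambda>_. 0}" using T1 by simp
    then show ?thesis
      using vector_quotient_isomorphic[OF _ st.rel_cohomology_0] vector_quotient_isomorphic[OF T2 st.rel_cohomology_1]
      unfolding geom(2)[OF adm] by blast
  qed
  have one: "mod_isomorphic complex_field (T1_piece n ?I ?c) (reduced_cohomology 0 (top_of_set ?W)) \<and>
      mod_isomorphic complex_field (T2_piece n ?I m Deg j ?c) (reduced_cohomology 1 (top_of_set ?W))"
    if adm: "?adm" and card: "card ?B = 1"
  proof -
    interpret st: stratified_space "top_of_set ?W" "carrier_face n" face_point pr.U pr.U1 by (rule geom(1)[OF adm])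
    obtain v where v: "?B = {v}" using card card_1_singletonE by metis
    have U1: "pr.U1 = {}"
    proof -
      have "f \<union> ?B - {w} \<in> ?Y" if f: "f \<in> ?Y" and w: "w \<in> ?B" for f w
      proof -
        have "w = v" using w unfolding v by simp
        then have sub: "f \<union> ?B - {w} \<subseteq> f" unfolding v by blast
        have fA: "f \<inter> ?A = {}" "f \<union> ?A \<in> X" using f unfolding link_def by blast+
        have "(f \<union> ?B - {w}) \<union> ?A \<in> X" "f \<union> ?B - {w} \<in> X" by (rule pr.face_down[OF fA(2)]; use sub in blast)+
        then show ?thesis using fA(1) sub unfolding link_def by blast
      qed
      then show ?thesis unfolding geom(3)[OF adm] U_tilde_faces_def by blast
    qed
    have eb: "pr.eb = single v 1"
    proof (rule poly_mapping_eqI)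
      fix i
      have vB: "v \<le> n" "b v \<noteq> 0" using v unfolding vec_support_def by blast+
      then have bv: "b v = 1" using adm by auto
      have "b i = 0" if "i \<le> n" "i \<noteq> v" using v that unfolding vec_support_def by blast
      then show "lookup pr.eb i = lookup (single v 1) i"
        using vB(1) bv by (auto simp: pr.lookup_eb lookup_single when_def)
    qed
    then have "pr.trivial_coefs = poset_const pr.U" unfolding pr.trivial_coefs_def by auto
    then have T1': "vector_quotient (T1_piece n ?I ?c) (poset_Z0 pr.U pr.U1) (poset_const pr.U)" using T1 by simp
    have none: "{x \<in> topspace (top_of_set ?W). carrier_face n x \<in> pr.U1} = {}" unfolding U1 by simp
    have rel1: "vector_quotient (reduced_cohomology 1 (top_of_set ?W)) (poset_Z1 pr.U pr.U1) (poset_B1 pr.U pr.U1)"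
      unfolding reduced_cohomology_1 using st.rel_cohomology_1[unfolded none] .
    show ?thesis
      using vector_quotient_isomorphic[OF T1' st.reduced_cohomology_0[OF U1]] vector_quotient_isomorphic[OF T2 rel1] by blast
  qed
  show ?thesis
    unfolding Let_def by (intro conjI impI; (elim conjE)?) (use nonadm many one in blast)+
qed

end
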